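(* Let $(E,\mathcal E)$ be a measurable space such that $\mathcal E$ is countably generated and $\Delta:=\{(x,x):x\in E\}\in\mathcal E\otimes\mathcal E$. Let $P$ be a Markov kernel on $E$ which admits an invariant probability measure $\mu$ (not assumed to be unique). Consider the following conditions. (P$_1$) For every $x\in E$, $P_n(x,\cdot)$ converges to $\mu$ in total variation as $n\to\infty$. (A$_1$) All pairs $(x,y)\in E\times E$ are asymptotically equivalent. (B$_1$) $P$ is aperiodic and Harris. (C$_1$) For all $x,y\in E$ and $m\in\mathbb N$ there exist $k_m\in\mathbb N_0$ and a coupling $\zeta[m]\in C(P_{k_m}(x,\cdot),P_{k_m}(y,\cdot))$ such that $\zeta[m](\Delta)\ge 1-\frac1m$. ($\hat{\mathrm C}_1$) For all $x,y\in E$ there exist couplings $\zeta[m]\in C(P_m(x,\cdot),P_m(y,\cdot))$, $m\in\mathbb N$, such that $\lim_{m\to\infty}\zeta[m](\Delta)=1$. ($\mathring{\mathrm C}_1$) For all $x,y\in E$ there exists a coupling $\xi\in C(\mathbb P_x,\mathbb P_y)$ such that $\lim_{m\to\infty}\xi_m(\Delta)=1$. (C$_1'$) For all $x,y\in E$ there exists a coupling $(X_k)_{k\in\mathbb N_0}$, $(Y_k)_{k\in\mathbb N_0}$ of $\mathbb P_x$ and $\mathbb P_y$ on some probability space $(\Omega,\mathcal F,\mathbb P)$ such that $\lim_{n\to\infty}\mathbb P(X_k=Y_k\text{ for all }k\ge n)=1$. (G$_1$) For each pair $(x,y)\in E\times E$ there exists some $\xi\in\check C(\mathbb P_x,\mathbb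 P_y)$ such that $\lim_{k\to\infty}\xi_k(\Delta)=1$. Then (A$_1$), (B$_1$), (C$_1$), ($\hat{\mathrm C}_1$) and (P$_1$) are equivalent, and (C$_1'$) $\Rightarrow$ ($\mathring{\mathrm C}_1$) $\Rightarrow$ (G$_1$) $\Rightarrow$ (A$_1$). If $(E,\mathcal E)$ is a Borel space, then all eight conditions are equivalent.
   Context: $\mathbb N=\{1,2,\dots\}$, $\mathbb N_0=\mathbb N\cup\{0\}$. $P_n(\cdot,\cdot)$ is the $n$-step transition probability of $P$; $X=(X_n)_{n\in\mathbb N_0}$ is the Markov chain with kernel $P$, and $\mathbb P_x$ is its law on $(E^{\mathbb N_0},\mathcal E^{\otimes\mathbb N_0})$ when started at $x\in E$. The total variation metric is $d(\nu_1,\nu_2)=\sup_{A\in\mathcal E}|\nu_1(A)-\nu_2(A)|$. Asymptotic equivalence: states $x,y\in E$ are asymptotically equivalent if for each $\varepsilon>0$ there exist $n\in\mathbb N$ and $A\in\mathcal E$ such that $P_n(x,A)\ge1-\varepsilon$, $P_n(y,A)\ge1-\varepsilon$, and the measures $P_n(x,\cdot)$ and $P_n(y,\cdot)$ restricted to $A$ are equivalent (mutually absolutely continuous). Aperiodicity (with respect to $\mu$): for an integer $d\ge2$, $P$ is $d$-periodic if there are disjoint sets $E_1,\dots,E_d\in\mathcal E$ with $\mu(E_1)>0$ such that $P(x,E_{i+1})=1$ for all $x\in E_i$, $1\le i\le d$, where $E_{d+1}:=E_1$. $P$ is aperiodic if it is not $d$-periodic for any $d\ge2$. Harris: $P$ is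 Harris if there exists a non-trivial $\sigma$-finite measure $\phi$ on $(E,\mathcal E)$ such that for all $A\in\mathcal E$ with $\phi(A)>0$ and all $x\in E$, $\mathbb P_x(X_n\in A\text{ for infinitely many }n\in\mathbb N)=1$. Couplings: for probability measures $\nu_1,\nu_2$ on a measurable space $(\bar E,\bar{\mathcal E})$, $C(\nu_1,\nu_2)$ is the set of probability measures on $(\bar E\times\bar E,\bar{\mathcal E}\otimes\bar{\mathcal E})$ with first marginal $\nu_1$ and second marginal $\nu_2$; a pair of $\bar E$-valued random variables on a common probability space is a coupling of $\nu_1,\nu_2$ if its joint law is in $C(\nu_1,\nu_2)$. For a probability measure $\xi$ on $\bar E\times\bar E$, $\xi^1,\xi^2$ denote its marginals, and $\check C(\nu_1,\nu_2)$ is the set of probability measures $\xi$ on $\bar E\times\bar E$ with $\xi^1\ll\nu_1$ and $\xi^2\sim\nu_2$ (where $\sim$ denotes mutual absolute continuity). If $\bar E=E^{\mathbb N_0}$ (with product $\sigma$-field), $\xi_k$ denotes the image of $\xi$ on $E\times E$ under the map $((x_j)_j,(y_j)_j)\mapsto(x_k,y_k)$. Borel space: a measurable space isomorphic (as a measurable space) to a Borel subset of $[0,1]$. *)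

theory Defs
  imports "HOL-Probability.Probability"
begin

text \<open>
  A measurable space is the carrier and sigma-algebra of an \<^typ>\<open>'a measure\<close> \<open>M\<close>; the measure
  part of \<open>M\<close> is never used.  A Markov kernel on \<open>M\<close> is an element of
  \<open>M \<rightarrow>\<^sub>M prob_algebra M\<close>, and the diagonal of \<open>M\<close> is \<open>Id_on (space M)\<close>.
\<close>

definition countably_generated :: "'a measure \<Rightarrow> bool" where
  "countably_generated M \<longleftrightarrow>
     (\<exists>G. countable G \<and> G \<subseteq> Pow (space M) \<and> sets M = sigma_sets (space M) G)"

definition borel_space :: "'a measure \<Rightarrow> bool" where
  "borel_space M \<longleftrightarrow>
     (\<exists>(B::real set) f g. B \<in> sets borel \<and> B \<subseteq> {0..1} \<and>
        f \<in> M \<rightarrow>\<^sub>M restrict_space borel B \<and> g \<in> restrict_space borel B \<rightarrow>\<^sub>M M \<and>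
        (\<forall>x\<in>space M. g (f x) = x) \<and> (\<forall>b\<in>B. f (g b) = b))"

definition invariant_prob :: "'a measure \<Rightarrow> ('a \<Rightarrow> 'a measure) \<Rightarrow> 'a measure \<Rightarrow> bool" where
  "invariant_prob M P \<mu> \<longleftrightarrow> prob_space \<mu> \<and> sets \<mu> = sets M \<and> \<mu> \<bind> P = \<mu>"

primrec nstep :: "'a measure \<Rightarrow> ('a \<Rightarrow> 'a measure) \<Rightarrow> nat \<Rightarrow> 'a \<Rightarrow> 'a measure" where
  "nstep M P 0 x = return M x"
| "nstep M P (Suc n) x = nstep M P n x \<bind> P"

text \<open>
  The law of the chain started at \<open>x\<close>, on \<open>\<Pi>\<^sub>M n\<in>UNIV. M\<close>, is the Ionescu-Tulcea limit of the
  conditional laws \<open>step_law M P x n\<close> of \<open>X\<^sub>n\<close> given \<open>(X\<^sub>0, \<dots>, X\<^sub>n\<^sub>-\<^sub>1)\<close>.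
\<close>

definition step_law ::
  "'a measure \<Rightarrow> ('a \<Rightarrow> 'a measure) \<Rightarrow> 'a \<Rightarrow> nat \<Rightarrow> (nat \<Rightarrow> 'a) \<Rightarrow> 'a measure" where
  "step_law M P x n \<omega> = (case n of 0 \<Rightarrow> return M x | Suc k \<Rightarrow> P (\<omega> k))"

definition path_law :: "'a measure \<Rightarrow> ('a \<Rightarrow> 'a measure) \<Rightarrow> 'a \<Rightarrow> (nat \<Rightarrow> 'a) measure" where
  "path_law M P x =
     projective_family.lim UNIV (Ionescu_Tulcea.CI (step_law M P x) (\<lambda>_. M)) (\<lambda>_. M)"

lemma Ionescu_Tulcea_step_law:
  assumes P: "P \<in> M \<rightarrow>\<^sub>M prob_algebra M" and x: "x \<in> space M"
  shows "Ionescu_Tulcea (step_law M P x) (\<lambda>_. M)"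
proof (rule Ionescu_Tulcea.intro)
  have Psub: "P \<in> M \<rightarrow>\<^sub>M subprob_algebra M"
    using P by (rule measurable_prob_algebraD)
  show "step_law M P x i \<in> PiM {0..<i} (\<lambda>_. M) \<rightarrow>\<^sub>M subprob_algebra M" for i
  proof (cases i)
    case 0
    then have "step_law M P x i = (\<lambda>_. return M x)"
      by (simp add: step_law_def fun_eq_iff)
    then show ?thesis
      using x by (simp add: space_subprob_algebra prob_space_return prob_space_imp_subprob_space)
  next
    case (Suc k)
    then have "step_law M P x i = (\<lambda>\<omega>. P (\<omega> k))"
      by (simp add: step_law_def fun_eq_iff)
    moreover have "(\<lambda>\<omega>. \<omega> k) \<in> PiM {0..<i} (\<lambda>_. M) \<rightarrow>\<^sub>M M"
      using Suc by (intro measurable_component_singleton) auto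
    ultimately show ?thesis
      using measurable_compose[OF _ Psub] by auto
  qed
  fix i and \<omega> :: "nat \<Rightarrow> 'a"
  assume that: "\<omega> \<in> space (PiM {0..<i} (\<lambda>_. M))"
  show "prob_space (step_law M P x i \<omega>)"
  proof (cases i)
    case 0
    then show ?thesis using x by (simp add: step_law_def prob_space_return)
  next
    case (Suc k)
    with that have "\<omega> k \<in> space M" by (auto simp: space_PiM PiE_iff)
    then have "P (\<omega> k) \<in> space (prob_algebra M)" using P by (rule measurable_space[rotated])
    then show ?thesis using Suc by (simp add: step_law_def space_prob_algebra)
  qed
qed

definition tv_dist :: "'a measure \<Rightarrow> 'a measure \<Rightarrow> 'a measure \<Rightarrow> real" where
  "tv_dist M \<nu>1 \<nu>2 = (SUP A\<in>sets M. \<bar>measure \<nu>1 A - measure \<nu>2 A\<bar>)"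

definition equivalent_measures :: "'a measure \<Rightarrow> 'a measure \<Rightarrow> bool" where
  "equivalent_measures \<nu>1 \<nu>2 \<longleftrightarrow> absolutely_continuous \<nu>1 \<nu>2 \<and> absolutely_continuous \<nu>2 \<nu>1"

definition asymptotically_equivalent ::
  "'a measure \<Rightarrow> ('a \<Rightarrow> 'a measure) \<Rightarrow> 'a \<Rightarrow> 'a \<Rightarrow> bool" where
  "asymptotically_equivalent M P x y \<longleftrightarrow>
     (\<forall>\<epsilon>::real. \<epsilon> > 0 \<longrightarrow> (\<exists>n\<ge>1. \<exists>A\<in>sets M.
        measure (nstep M P n x) A \<ge> 1 - \<epsilon> \<and> measure (nstep M P n y) A \<ge> 1 - \<epsilon> \<and>
        equivalent_measures (restrict_space (nstep M P n x) A)
                            (restrict_space (nstep M P n y) A)))"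

text \<open>The successor of the index \<open>i \<in> {1..d}\<close> in cyclic order is \<open>Suc (i mod d)\<close>.\<close>

definition periodic :: "'a measure \<Rightarrow> ('a \<Rightarrow> 'a measure) \<Rightarrow> 'a measure \<Rightarrow> nat \<Rightarrow> bool" where
  "periodic M P \<mu> d \<longleftrightarrow>
     (\<exists>E :: nat \<Rightarrow> 'a set.
        (\<forall>i\<in>{1..d}. E i \<in> sets M) \<and> disjoint_family_on E {1..d} \<and> measure \<mu> (E 1) > 0 \<and>
        (\<forall>i\<in>{1..d}. \<forall>x\<in>E i. measure (P x) (E (Suc (i mod d))) = 1))"

definition aperiodic :: "'a measure \<Rightarrow> ('a \<Rightarrow> 'a measure) \<Rightarrow> 'a measure \<Rightarrow> bool" where
  "aperiodic M P \<mu> \<longleftrightarrow> (\<forall>d\<ge>2. \<not> periodic M P \<mu> d)"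

definition Harris :: "'a measure \<Rightarrow> ('a \<Rightarrow> 'a measure) \<Rightarrow> bool" where
  "Harris M P \<longleftrightarrow>
     (\<exists>\<phi>. sigma_finite_measure \<phi> \<and> sets \<phi> = sets M \<and> emeasure \<phi> (space M) \<noteq> 0 \<and>
        (\<forall>A\<in>sets M. emeasure \<phi> A > 0 \<longrightarrow> (\<forall>x\<in>space M.
           measure (path_law M P x)
             {\<omega> \<in> space (path_law M P x). infinite {n. n \<ge> 1 \<and> \<omega> n \<in> A}} = 1)))"

text \<open>
  Below, \<open>distr \<zeta> \<nu>1 fst\<close> is the first marginal of \<open>\<zeta>\<close>, on the sigma-algebra of \<open>\<nu>1\<close>.
  Note that \<^term>\<open>absolutely_continuous \<nu> \<xi>\<close> expresses \<open>\<xi> \<lless> \<nu>\<close>.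
\<close>

definition couplings :: "'b measure \<Rightarrow> 'b measure \<Rightarrow> ('b \<times> 'b) measure set" where
  "couplings \<nu>1 \<nu>2 =
     {\<zeta>. prob_space \<zeta> \<and> sets \<zeta> = sets (\<nu>1 \<Otimes>\<^sub>M \<nu>2) \<and>
          distr \<zeta> \<nu>1 fst = \<nu>1 \<and> distr \<zeta> \<nu>2 snd = \<nu>2}"

definition generalized_couplings :: "'b measure \<Rightarrow> 'b measure \<Rightarrow> ('b \<times> 'b) measure set" where
  "generalized_couplings \<nu>1 \<nu>2 =
     {\<xi>. prob_space \<xi> \<and> sets \<xi> = sets (\<nu>1 \<Otimes>\<^sub>M \<nu>2) \<and>
          absolutely_continuous \<nu>1 (distr \<xi> \<nu>1 fst) \<and>
          equivalent_measures (distr \<xi> \<nu>2 snd) \<nu>2}"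

definition time_marginal ::
  "'a measure \<Rightarrow> ((nat \<Rightarrow> 'a) \<times> (nat \<Rightarrow> 'a)) measure \<Rightarrow> nat \<Rightarrow> ('a \<times> 'a) measure" where
  "time_marginal M \<xi> k = distr \<xi> (M \<Otimes>\<^sub>M M) (\<lambda>(x, y). (x k, y k))"

definition cond_P :: "'a measure \<Rightarrow> ('a \<Rightarrow> 'a measure) \<Rightarrow> 'a measure \<Rightarrow> bool" where
  "cond_P M P \<mu> \<longleftrightarrow> (\<forall>x\<in>space M. (\<lambda>n. tv_dist M (nstep M P n x) \<mu>) \<longlonglongrightarrow> 0)"

definition cond_A :: "'a measure \<Rightarrow> ('a \<Rightarrow> 'a measure) \<Rightarrow> bool" where
  "cond_A M P \<longleftrightarrow> (\<forall>x\<in>space M. \<forall>y\<in>space M. asymptotically_equivalent M P x y)"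

definition cond_B :: "'a measure \<Rightarrow> ('a \<Rightarrow> 'a measure) \<Rightarrow> 'a measure \<Rightarrow> bool" where
  "cond_B M P \<mu> \<longleftrightarrow> aperiodic M P \<mu> \<and> Harris M P"

definition cond_C :: "'a measure \<Rightarrow> ('a \<Rightarrow> 'a measure) \<Rightarrow> bool" where
  "cond_C M P \<longleftrightarrow>
     (\<forall>x\<in>space M. \<forall>y\<in>space M. \<forall>m\<ge>1. \<exists>k. \<exists>\<zeta>\<in>couplings (nstep M P k x) (nstep M P k y).
        measure \<zeta> (Id_on (space M)) \<ge> 1 - 1 / real m)"

definition cond_C_hat :: "'a measure \<Rightarrow> ('a \<Rightarrow> 'a measure) \<Rightarrow> bool" where
  "cond_C_hat M P \<longleftrightarrow>
     (\<forall>x\<in>space M. \<forall>y\<in>space M. \<exists>\<zeta>.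
        (\<forall>m\<ge>1. \<zeta> m \<in> couplings (nstep M P m x) (nstep M P m y)) \<and>
        (\<lambda>m. measure (\<zeta> m) (Id_on (space M))) \<longlonglongrightarrow> 1)"

definition cond_C_ring :: "'a measure \<Rightarrow> ('a \<Rightarrow> 'a measure) \<Rightarrow> bool" where
  "cond_C_ring M P \<longleftrightarrow>
     (\<forall>x\<in>space M. \<forall>y\<in>space M. \<exists>\<xi>\<in>couplings (path_law M P x) (path_law M P y).
        (\<lambda>m. measure (time_marginal M \<xi> m) (Id_on (space M))) \<longlonglongrightarrow> 1)"

text \<open>
  The type argument is the type of the sample points of the probability space \<open>\<Omega>\<close>, since
  types cannot be quantified inside a formula.  As a hypothesis the condition is to be used with
  an arbitrary type \<open>'w\<close>, as a conclusion with a specific one.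
\<close>

definition cond_C' :: "'w itself \<Rightarrow> 'a measure \<Rightarrow> ('a \<Rightarrow> 'a measure) \<Rightarrow> bool" where
  "cond_C' (T :: 'w itself) M P \<longleftrightarrow>
     (\<forall>x\<in>space M. \<forall>y\<in>space M. \<exists>(\<Omega> :: 'w measure) (X :: nat \<Rightarrow> 'w \<Rightarrow> 'a) (Y :: nat \<Rightarrow> 'w \<Rightarrow> 'a).
        prob_space \<Omega> \<and> (\<forall>k. X k \<in> \<Omega> \<rightarrow>\<^sub>M M) \<and> (\<forall>k. Y k \<in> \<Omega> \<rightarrow>\<^sub>M M) \<and>
        distr \<Omega> (PiM UNIV (\<lambda>_. M) \<Otimes>\<^sub>M PiM UNIV (\<lambda>_. M)) (\<lambda>\<omega>. (\<lambda>k. X k \<omega>, \<lambda>k. Y k \<omega>))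
          \<in> couplings (path_law M P x) (path_law M P y) \<and>
        (\<lambda>n. measure \<Omega> {\<omega> \<in> space \<Omega>. \<forall>k\<ge>n. X k \<omega> = Y k \<omega>}) \<longlonglongrightarrow> 1)"

definition cond_G :: "'a measure \<Rightarrow> ('a \<Rightarrow> 'a measure) \<Rightarrow> bool" where
  "cond_G M P \<longleftrightarrow>
     (\<forall>x\<in>space M. \<forall>y\<in>space M. \<exists>\<xi>\<in>generalized_couplings (path_law M P x) (path_law M P y).
        (\<lambda>k. measure (time_marginal M \<xi> k) (Id_on (space M))) \<longlonglongrightarrow> 1)"

end

theory Submission
  imports Defs
begin

text \<open>
  Let \<open>D x y\<close> be the limit of the decreasing sequence \<open>d(P\<^sub>n(x,\<cdot>), P\<^sub>n(y,\<cdot>))\<close>.  It is subharmonic for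
  the product chain, whose invariant probability \<open>\<mu> \<Otimes> \<mu>\<close> forces it to be constant along almost every
  path.  Only the residual parts of \<open>P\<^sub>n(x,\<cdot>)\<close> and \<open>P\<^sub>n(y,\<cdot>)\<close>, of mass \<open>c = d(P\<^sub>n(x,\<cdot>), P\<^sub>n(y,\<cdot>))\<close>,
  contribute to later distances, so \<open>c * D x y \<le> c\<^sup>2 * D x y\<close>; hence \<open>D\<close> is 0 or 1 almost everywhere.
  Asymptotic equivalence gives \<open>D < 1\<close>, hence \<open>D = 0\<close>.  For a Harris chain, a joint density of the
  absolutely continuous parts of \<open>P\<^sub>n(x,\<cdot>)\<close> shows that \<open>D = 1\<close> cannot hold almost everywhere.  The
  classes of the relation \<open>D x y = 0\<close> are then permuted by the chain, a cycle of classes of positive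
  mass has length 1 by aperiodicity, and recurrence drives every starting point into this class.

  Conversely, if \<open>P\<^sub>n(x,\<cdot>)\<close> converges to \<open>\<mu>\<close> then the probability of infinitely many visits to a set
  does not depend on \<open>x\<close>, and it is its own square.  On a Borel space a coalescing coupling is built
  by coupling at each time \<open>n\<close> the common part of the two laws of the path from \<open>n\<close> on, and gluing the
  past by conditional laws.
\<close>

subsection \<open>Common parts of measures and the total variation metric\<close>

text \<open>\<open>D\<close> is controlled only for almost every pair of starting points, while the
  conditions speak of all of them. The routes from asymptotic equivalence and from the Harris
  property therefore end with a transfer: convergence to \<mu> holds from every point of a
  measurable set of full \<mu>-mass, and the distance to \<mu> never increases in time, so from any
  \<open>x\<close> it is enough to reach that set with probability close to 1 at a single time. In
  the first case this is forced by comparison with one typical point; in the second by absorption,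
  where the recurrence measure, given without any relation to \<mu>, must first be related to it.

  Countable generation makes total variation a countable supremum, hence \<open>D\<close>
  measurable, and yields densities that are jointly measurable in both variables.

  The coalescing coupling does not couple states at time \<open>n\<close> but whole tails. Equality
  then persists by construction, and each coupled piece is removed from both laws before the next
  round. This needs conditional laws on path space, which is where the Borel property
  enters.\<close>

definition sum_measure :: "'a measure \<Rightarrow> (nat \<Rightarrow> 'a measure) \<Rightarrow> 'a measure" where
  "sum_measure M c = measure_of (space M) (sets M) (\<lambda>A. \<Sum>n. emeasure (c n) A)"

lemma sets_sum_measure [simp, measurable_cong]: "sets (sum_measure M c) = sets M"
  and space_sum_measure [simp]: "space (sum_measure M c) = space M"
  by (simp_all add: sum_measure_def)

lemma emeasure_sum_measure:
  assumes c: "\<And>n. sets (c n) = sets M" and A: "A \<in> sets M"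
  shows "emeasure (sum_measure M c) A = (\<Sum>n. emeasure (c n) A)"
proof (rule emeasure_measure_of[OF sum_measure_def])
  show "countably_additive (sets (sum_measure M c)) (\<lambda>A. \<Sum>n. emeasure (c n) A)"
  proof (rule countably_additiveI)
    fix A :: "nat \<Rightarrow> _"
    assume "range A \<subseteq> sets (sum_measure M c)" "disjoint_family A"
    moreover from this have "(\<Sum>i. emeasure (c n) (A i)) = emeasure (c n) (\<Union>i. A i)" for n
      using c by (intro suminf_emeasure) auto
    \<comment> \<open>The order of summation is exchanged by Tonelli for two counting
      measures.\<close>
    moreover have "(\<Sum>i. \<Sum>n. emeasure (c n) (A i)) = (\<Sum>n. \<Sum>i. emeasure (c n) (A i))"
      by (simp add: nn_integral_count_space_nat[symmetric])
         (subst pair_sigma_finite.Fubini',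
          auto intro!: pair_sigma_finite.intro sigma_finite_measure_count_space)
    ultimately show "(\<Sum>i. \<Sum>n. emeasure (c n) (A i)) = (\<Sum>n. emeasure (c n) (\<Union> (range A)))"
      by simp
  qed
qed (use assms sets.sets_into_space[of _ M] in \<open>auto simp: positive_def\<close>)

lemma nn_integral_sum_measure:
  assumes c[measurable_cong]: "\<And>n. sets (c n) = sets M" and f: "f \<in> borel_measurable M"
  shows "nn_integral (sum_measure M c) f = (\<Sum>n. nn_integral (c n) f)"
proof -
  have sp: "space (c n) = space M" for n using c sets_eq_imp_space_eq by blast
  show ?thesis using f
  proof induction
    case (cong f g)
    moreover from cong have "nn_integral (c n) f = nn_integral (c n) g" for n
      by (intro nn_integral_cong) (simp add: sp)
    moreover from cong have "nn_integral (sum_measure M c) f = nn_integral (sum_measure M c) g"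
      by (intro nn_integral_cong) simp
    ultimately show ?case using cong by simp
  next
    case (set A)
    then show ?case using c by (simp add: emeasure_sum_measure)
  next
    case (mult u k)
    have "u \<in> borel_measurable (c n)" for n using mult(2) by measurable
    then show ?case using mult by (simp add: nn_integral_cmult)
  next
    case (add u v)
    have "u \<in> borel_measurable (c n)" "v \<in> borel_measurable (c n)" for n
      using add(1,3) by measurable
    then show ?case using add by (simp add: nn_integral_add suminf_add[symmetric])
  next
    case (seq U)
    have [measurable]: "U i \<in> borel_measurable (c n)" for i n using seq(1) by measurable
    have "nn_integral (sum_measure M c) (SUP i. U i) = (SUP i. nn_integral (sum_measure M c) (U i))"
      using seq unfolding SUP_apply by (intro nn_integral_monotone_convergence_SUP) auto
    also have "\<dots> = (SUP i. \<Sum>n. nn_integral (c n) (U i))" by (simp only: seq.IH)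
    also have "\<dots> = (\<Sum>n. SUP i. nn_integral (c n) (U i))"
    proof (intro ennreal_suminf_SUP_eq[symmetric] incseq_SucI nn_integral_mono)
      show "U i x \<le> U (Suc i) x" for i x
        using \<open>incseq U\<close> by (simp add: incseq_Suc_iff le_fun_def)
    qed
    also have "\<dots> = (\<Sum>n. nn_integral (c n) (SUP i. U i))"
      unfolding SUP_apply using seq
      by (intro suminf_cong nn_integral_monotone_convergence_SUP[symmetric]) auto
    finally show ?case .
  qed
qed

lemma emeasure_plus_measure:
  assumes [simp]: "sets a = sets M" "sets b = sets M" and A: "A \<in> sets M"
  shows "emeasure (sum_measure M (case_nat a (\<lambda>n. if n = 0 then b else null_measure M))) A
    = emeasure a A + emeasure b A"
proof -
  have "(\<Sum>n. emeasure (case_nat a (\<lambda>n. if n = 0 then b else null_measure M) n) A)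
     = (\<Sum>n\<in>{0,1}. emeasure (case_nat a (\<lambda>n. if n = 0 then b else null_measure M) n) A)"
    by (rule suminf_finite) (auto split: nat.split)
  then show ?thesis using A by (subst emeasure_sum_measure) (auto split: nat.split)
qed

lemma ex_plus_measure:
  assumes "sets a = sets M" "sets b = sets M"
  shows "\<exists>s. sets s = sets M \<and> (\<forall>A\<in>sets M. emeasure s A = emeasure a A + emeasure b A)"
  using emeasure_plus_measure[OF assms] by (metis sets_sum_measure)

lemma nn_integral_plus_measure:
  assumes [measurable_cong]: "sets a = sets M" "sets b = sets M" "sets s = sets M"
    and s: "\<And>A. A \<in> sets M \<Longrightarrow> emeasure s A = emeasure a A + emeasure b A"
    and f: "f \<in> borel_measurable M"
  shows "nn_integral s f = nn_integral a f + nn_integral b f"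
proof -
  let ?c = "case_nat a (\<lambda>n. if n = 0 then b else null_measure M)"
  have "s = sum_measure M ?c"
    using assms by (intro measure_eqI) (auto simp: emeasure_plus_measure)
  moreover have "nn_integral (sum_measure M ?c) f = (\<Sum>n. nn_integral (?c n) f)"
    using assms by (intro nn_integral_sum_measure) (auto split: nat.split)
  moreover have "\<dots> = (\<Sum>n\<in>{0,1}. nn_integral (?c n) f)"
    using f by (intro suminf_finite) (auto split: nat.split)
  ultimately show ?thesis by simp
qed

lemma finite_measure_le:
  assumes "finite_measure a" "sets r = sets a" "\<And>A. A \<in> sets a \<Longrightarrow> emeasure r A \<le> emeasure a A"
  shows "finite_measure r"
proof (rule finite_measureI)
  have "space r = space a" using assms sets_eq_imp_space_eq by blast
  then show "emeasure r (space r) \<noteq> \<infinity>"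
    using assms(3)[of "space a"] finite_measure.emeasure_finite[OF assms(1), of "space a"]
    by (auto simp: top_unique)
qed

text \<open>The common part \<open>c = a \<and> b\<close> of two measures, with the mutually singular residuals.\<close>

lemma common_part:
  assumes fin: "finite_measure a" "finite_measure b" and sa: "sets a = sets M" and sb: "sets b = sets M"
  obtains c r1 r2 H where "finite_measure c" "finite_measure r1" "finite_measure r2"
    "sets c = sets M" "sets r1 = sets M" "sets r2 = sets M" "H \<in> sets M"
    "\<And>A. A \<in> sets M \<Longrightarrow> emeasure a A = emeasure c A + emeasure r1 A"
    "\<And>A. A \<in> sets M \<Longrightarrow> emeasure b A = emeasure c A + emeasure r2 A"
    "emeasure r1 (space M - H) = 0" "emeasure r2 H = 0"
proof -
  obtain Y where Y: "Y \<in> sets a" and le1: "\<And>X. X \<in> sets a \<Longrightarrow> X \<subseteq> Y \<Longrightarrow> emeasure b X \<le> emeasure a X"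
    and le2: "\<And>X. X \<in> sets a \<Longrightarrow> X \<inter> Y = {} \<Longrightarrow> emeasure a X \<le> emeasure b X"
    using finite_unsigned_Hahn_decomposition[OF fin] sa sb by auto
  define Z where "Z = space M - Y"
  have YM[measurable]: "Y \<in> sets M" "Z \<in> sets M" using Y sa by (auto simp: Z_def)
  have Z_Y: "Z \<inter> A \<inter> Y = {}" for A by (auto simp: Z_def)
  have res: "emeasure (density n (indicator B)) A = emeasure n (B \<inter> A)"
    if "sets n = sets M" "A \<in> sets M" "B \<in> sets M" for n :: "'a measure" and A B
    using that by (simp add: emeasure_restricted)
  \<comment> \<open>On the Hahn set \<open>Y\<close> the measure \<open>a\<close> dominates, so the
    minimum is \<open>b\<close> there and \<open>a\<close> on the complement \<open>Z\<close>. Each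
    residual is the excess of the larger measure, which places \<open>r1\<close> on \<open>Y\<close>
    and \<open>r2\<close> on \<open>Z\<close>.\<close>
  obtain c where c: "sets c = sets M" "\<And>A. A \<in> sets M \<Longrightarrow>
      emeasure c A = emeasure (density b (indicator Y)) A + emeasure (density a (indicator Z)) A"
    using ex_plus_measure[of "density b (indicator Y)" M "density a (indicator Z)"] sa sb by auto
  define r1 where "r1 = diff_measure (density a (indicator Y)) (density b (indicator Y))"
  define r2 where "r2 = diff_measure (density b (indicator Z)) (density a (indicator Z))"
  have finr: "finite_measure (density n (indicator B))"
    if "finite_measure n" "sets n = sets M" "B \<in> sets M" for n :: "'a measure" and B
    using that by (intro finite_measure.finite_measure_restricted) auto
  have [simp]: "space a = space M" "space b = space M"
    using sa sb sets_eq_imp_space_eq by blast+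
  have r1: "emeasure r1 A = emeasure a (Y \<inter> A) - emeasure b (Y \<inter> A)" if "A \<in> sets M" for A
    unfolding r1_def using that sa sb
    by (subst emeasure_diff_measure[OF finr[OF fin(1) sa YM(1)] finr[OF fin(2) sb YM(1)]])
       (simp_all add: res sa sb le1)
  have r2: "emeasure r2 A = emeasure b (Z \<inter> A) - emeasure a (Z \<inter> A)" if "A \<in> sets M" for A
    unfolding r2_def using that sa sb Z_Y
    by (subst emeasure_diff_measure[OF finr[OF fin(2) sb YM(2)] finr[OF fin(1) sa YM(2)]])
       (simp_all add: res sa sb le2)
  have split: "emeasure n A = emeasure n (Y \<inter> A) + emeasure n (Z \<inter> A)"
    if "A \<in> sets M" "sets n = sets M" for n A
  proof -
    have "A = (Y \<inter> A) \<union> (Z \<inter> A)" using that(1) sets.sets_into_space by (auto simp: Z_def)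
    moreover have "emeasure n ((Y \<inter> A) \<union> (Z \<inter> A)) = emeasure n (Y \<inter> A) + emeasure n (Z \<inter> A)"
      using that by (intro plus_emeasure[symmetric]) (auto simp: Z_def)
    ultimately show ?thesis by simp
  qed
  have lea: "emeasure b (Y \<inter> A) \<le> emeasure a (Y \<inter> A)" "emeasure a (Z \<inter> A) \<le> emeasure b (Z \<inter> A)"
    if "A \<in> sets M" for A
    using that YM by (simp_all add: le1 le2 sa Z_Y)
  have cancel: "x + z + (y - x) = y + z" if "x \<le> y" for x y z :: ennreal
  proof -
    have "x + z + (y - x) = (y - x + x) + z" by (simp only: add.commute add.left_commute)
    then show ?thesis using diff_add_cancel_ennreal[OF that] by simp
  qed
  have ea: "emeasure a A = emeasure c A + emeasure r1 A" if "A \<in> sets M" for A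
  proof -
    have "emeasure c A + emeasure r1 A
      = emeasure b (Y \<inter> A) + emeasure a (Z \<inter> A) + (emeasure a (Y \<inter> A) - emeasure b (Y \<inter> A))"
      using that sa sb by (simp add: r1 c res)
    then show ?thesis unfolding cancel[OF lea(1)[OF that]] split[OF that sa] by simp
  qed
  have eb: "emeasure b A = emeasure c A + emeasure r2 A" if "A \<in> sets M" for A
  proof -
    have "emeasure c A + emeasure r2 A
      = emeasure a (Z \<inter> A) + emeasure b (Y \<inter> A) + (emeasure b (Z \<inter> A) - emeasure a (Z \<inter> A))"
      using that sa sb by (simp add: r2 c res add.commute)
    then show ?thesis unfolding cancel[OF lea(2)[OF that]] split[OF that sb] by (simp add: add.commute)
  qed
  have sr: "sets r1 = sets M" "sets r2 = sets M" by (simp_all add: r1_def r2_def sa sb)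
  show ?thesis
  proof (rule that[OF _ _ _ c(1) sr YM(1) ea eb])
    show "finite_measure c" by (rule finite_measure_le[OF fin(1)]) (use c(1) sa ea in auto)
    show "finite_measure r1" by (rule finite_measure_le[OF fin(1)]) (use sr sa ea in auto)
    show "finite_measure r2" by (rule finite_measure_le[OF fin(2)]) (use sr sb eb in auto)
    show "emeasure r1 (space M - Y) = 0" using YM by (subst r1) auto
    have "Z \<inter> Y = {}" by (auto simp: Z_def)
    then show "emeasure r2 Y = 0" using YM by (subst r2) auto
  qed
qed

lemma tv_dist_bound:
  assumes "prob_space a" "prob_space b" "A \<in> sets M"
  shows "\<bar>measure a A - measure b A\<bar> \<le> tv_dist M a b"
  unfolding tv_dist_def
proof (rule cSUP_upper[OF assms(3)])
  have "\<bar>measure a A - measure b A\<bar> \<le> 1" for A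
    using prob_space.prob_le_1[OF assms(1), of A] prob_space.prob_le_1[OF assms(2), of A]
      measure_nonneg[of a A] measure_nonneg[of b A] by linarith
  then show "bdd_above ((\<lambda>A. \<bar>measure a A - measure b A\<bar>) ` sets M)" by (intro bdd_aboveI[of _ 1]) auto
qed

lemma tv_dist_le:
  assumes "\<And>A. A \<in> sets M \<Longrightarrow> \<bar>measure a A - measure b A\<bar> \<le> t"
  shows "tv_dist M a b \<le> t"
  unfolding tv_dist_def by (rule cSUP_least) (use assms in auto)

lemma tv_dist_nonneg: "prob_space a \<Longrightarrow> prob_space b \<Longrightarrow> 0 \<le> tv_dist M a b"
  using tv_dist_bound[of a b "{}" M] by auto

lemma tv_dist_le_1: "prob_space a \<Longrightarrow> prob_space b \<Longrightarrow> tv_dist M a b \<le> 1"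
  by (rule tv_dist_le) (smt (verit) measure_nonneg prob_space.prob_le_1)

lemma tv_dist_commute: "tv_dist M a b = tv_dist M b a"
  by (simp add: tv_dist_def abs_minus_commute)

lemma tv_dist_triangle:
  assumes "prob_space a" "prob_space b" "prob_space c"
  shows "tv_dist M a c \<le> tv_dist M a b + tv_dist M b c"
proof (rule tv_dist_le)
  fix A assume A: "A \<in> sets M"
  show "\<bar>measure a A - measure c A\<bar> \<le> tv_dist M a b + tv_dist M b c"
    using tv_dist_bound[OF assms(1,2) A] tv_dist_bound[OF assms(2,3) A] by linarith
qed

text \<open>It suffices to bound the signed difference, as complements reverse its sign.\<close>

lemma tv_dist_le_signed:
  assumes ps: "prob_space a" "prob_space b" and sets: "sets a = sets M" "sets b = sets M"
    and le: "\<And>A. A \<in> sets M \<Longrightarrow> measure a A - measure b A \<le> t"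
  shows "tv_dist M a b \<le> t"
proof (rule tv_dist_le)
  fix A assume A: "A \<in> sets M"
  have [simp]: "space a = space M" "space b = space M" using sets sets_eq_imp_space_eq by blast+
  have "measure a (space M - A) = 1 - measure a A" "measure b (space M - A) = 1 - measure b A"
    using A sets prob_space.prob_compl[OF ps(1), of A] prob_space.prob_compl[OF ps(2), of A] by auto
  then show "\<bar>measure a A - measure b A\<bar> \<le> t"
    using le[OF A] le[of "space M - A"] A by auto
qed

text \<open>The residuals have equal mass because \<open>a\<close> and \<open>b\<close> have equal
  mass. The set \<open>H\<close> separates them, so the difference of \<open>a\<close> and
  \<open>b\<close> on \<open>H\<close> is the whole mass of \<open>r1\<close>, and no set gives a
  larger difference.\<close>

lemma tv_dist_common_part:
  assumes ps: "prob_space a" "prob_space b" and sa: "sets a = sets M" and sb: "sets b = sets M"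
  obtains c r1 r2 H where "finite_measure c" "finite_measure r1" "finite_measure r2"
    "sets c = sets M" "sets r1 = sets M" "sets r2 = sets M" "H \<in> sets M"
    "\<And>A. A \<in> sets M \<Longrightarrow> emeasure a A = emeasure c A + emeasure r1 A"
    "\<And>A. A \<in> sets M \<Longrightarrow> emeasure b A = emeasure c A + emeasure r2 A"
    "emeasure r1 (space M - H) = 0" "emeasure r2 H = 0"
    "measure r1 (space M) = tv_dist M a b" "measure r2 (space M) = tv_dist M a b"
    "measure c (space M) = 1 - tv_dist M a b"
proof -
  have fin: "finite_measure a" "finite_measure b" using ps prob_space_def by auto
  obtain c r1 r2 H where finc: "finite_measure c" "finite_measure r1" "finite_measure r2"
    and sets: "sets c = sets M" "sets r1 = sets M" "sets r2 = sets M" "H \<in> sets M"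
    and ea: "\<And>A. A \<in> sets M \<Longrightarrow> emeasure a A = emeasure c A + emeasure r1 A"
    and eb: "\<And>A. A \<in> sets M \<Longrightarrow> emeasure b A = emeasure c A + emeasure r2 A"
    and H: "emeasure r1 (space M - H) = 0" "emeasure r2 H = 0"
    using common_part[OF fin sa sb] by metis
  interpret c: finite_measure c by fact
  interpret r1: finite_measure r1 by fact
  interpret r2: finite_measure r2 by fact
  interpret a: prob_space a by fact
  interpret b: prob_space b by fact
  have sp: "space a = space M" "space b = space M" "space c = space M" "space r1 = space M" "space r2 = space M"
    using sa sb sets sets_eq_imp_space_eq by blast+
  have ma: "measure a A = measure c A + measure r1 A" if "A \<in> sets M" for A
    using ea[OF that] by (simp add: a.emeasure_eq_measure c.emeasure_eq_measure r1.emeasure_eq_measure flip: ennreal_plus)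
  have mb: "measure b A = measure c A + measure r2 A" if "A \<in> sets M" for A
    using eb[OF that] by (simp add: b.emeasure_eq_measure c.emeasure_eq_measure r2.emeasure_eq_measure flip: ennreal_plus)
  have tot: "measure r1 (space M) = measure r2 (space M)"
    using ma[of "space M"] mb[of "space M"] a.prob_space b.prob_space sp by auto
  have le: "tv_dist M a b \<le> measure r1 (space M)"
  proof (rule tv_dist_le_signed[OF ps sa sb])
    fix A assume A: "A \<in> sets M"
    have "measure r1 A \<le> measure r1 (space M)" using r1.bounded_measure[of A] sp by simp
    then show "measure a A - measure b A \<le> measure r1 (space M)"
      using ma[OF A] mb[OF A] measure_nonneg[of r2 A] by linarith
  qed
  have "measure r1 (space M) = measure r1 H + measure r1 (space M - H)"
    using sets r1.finite_measure_Diff[of "space M" H] sp sets.sets_into_space[of H M] by auto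
  also have "measure r1 (space M - H) = 0" using H(1) by (simp add: measure_def)
  also have "measure r1 H + 0 = measure a H - measure b H"
    using ma[OF sets(4)] mb[OF sets(4)] H(2) by (simp add: measure_def)
  also have "\<dots> \<le> tv_dist M a b" using tv_dist_bound[OF ps sets(4)] by linarith
  finally have eq: "measure r1 (space M) = tv_dist M a b" using le by linarith
  show ?thesis
  proof (rule that[OF finc sets ea eb H eq])
    show "measure r2 (space M) = tv_dist M a b" using tot eq by simp
    show "measure c (space M) = 1 - tv_dist M a b"
      using eq ma[of "space M"] a.prob_space sp(1) by simp
  qed
qed

subsection \<open>Countably generated algebras and kernels\<close>

text \<open>Codes for Boolean combinations of the generators: there are only countably many of them.\<close>

datatype bexp = Gen nat | Neg bexp | Disj bexp bexp

instance bexp :: countable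
  by countable_datatype

primrec bexp_set :: "'a set \<Rightarrow> (nat \<Rightarrow> 'a set) \<Rightarrow> bexp \<Rightarrow> 'a set" where
  "bexp_set S g (Gen n) = g n"
| "bexp_set S g (Neg e) = S - bexp_set S g e"
| "bexp_set S g (Disj e f) = bexp_set S g e \<union> bexp_set S g f"

lemma countably_generated_algebra:
  assumes "countably_generated M"
  obtains \<A> where "countable \<A>" "algebra (space M) \<A>" "sets M = sigma_sets (space M) \<A>"
proof -
  obtain G where G: "countable G" "G \<subseteq> Pow (space M)" "sets M = sigma_sets (space M) G"
    using assms unfolding countably_generated_def by auto
  define g where "g = from_nat_into (insert {} G)"
  have rg: "range g = insert {} G" unfolding g_def using G(1) by (intro range_from_nat_into) auto
  define \<A> where "\<A> = range (bexp_set (space M) g)"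
  have sub: "bexp_set (space M) g e \<in> sets M" for e
  proof (induction e)
    case (Gen n)
    have "g n \<in> insert {} G" using rg by auto
    then show ?case using G(3) by (auto intro: sigma_sets.intros)
  qed auto
  have alg: "algebra (space M) \<A>"
    unfolding algebra_iff_Un
  proof (intro conjI ballI)
    show "\<A> \<subseteq> Pow (space M)" using sub sets.sets_into_space by (fastforce simp: \<A>_def)
    have "{} \<in> range g" unfolding rg by simp
    then obtain n where "g n = {}" by (metis rangeE)
    then have "{} = bexp_set (space M) g (Gen n)" by simp
    then show "{} \<in> \<A>" unfolding \<A>_def by (rule range_eqI)
    fix a assume "a \<in> \<A>"
    then obtain e where e: "a = bexp_set (space M) g e" unfolding \<A>_def by (rule rangeE)
    then have "space M - a = bexp_set (space M) g (Neg e)" by simp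
    then show "space M - a \<in> \<A>" unfolding \<A>_def by (rule range_eqI)
    fix b assume "b \<in> \<A>"
    then obtain f where "b = bexp_set (space M) g f" unfolding \<A>_def by (rule rangeE)
    with e have "a \<union> b = bexp_set (space M) g (Disj e f)" by simp
    then show "a \<union> b \<in> \<A>" unfolding \<A>_def by (rule range_eqI)
  qed
  have "G \<subseteq> \<A>"
  proof
    fix a assume "a \<in> G"
    then have "a \<in> range g" unfolding rg by simp
    then obtain n where "g n = a" by (metis rangeE)
    then have "a = bexp_set (space M) g (Gen n)" by simp
    then show "a \<in> \<A>" unfolding \<A>_def by (rule range_eqI)
  qed
  then have "sets M \<subseteq> sigma_sets (space M) \<A>" using G(3) sigma_sets_mono' by metis
  moreover have "sigma_sets (space M) \<A> \<subseteq> sets M"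
    using sub by (intro sets.sigma_sets_subset) (auto simp: \<A>_def)
  ultimately show ?thesis using that[of \<A>] alg unfolding \<A>_def by auto
qed

lemma algebra_approx:
  assumes "finite_measure a" and alg: "algebra \<Omega> \<A>" and sets: "sets a = sigma_sets \<Omega> \<A>"
    and "A \<in> sets a" "0 < (e::real)"
  shows "\<exists>B\<in>\<A>. measure a ((A - B) \<union> (B - A)) < e"
proof -
  interpret a: finite_measure a by fact
  interpret \<A>: algebra \<Omega> \<A> by fact
  have sub: "B \<in> sets a" if "B \<in> \<A>" for B using that sets by auto
  have spa: "space a = \<Omega>" using sets \<A>.space_closed
    by (metis sigma_sets_into_sp sets.sets_into_space sets.top sigma_sets_top subset_antisym sets sigma_sets.Empty \<A>.top sub)
  have "A \<in> sigma_sets \<Omega> \<A>" using assms by simp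
  then show ?thesis using \<open>0 < e\<close>
  proof (induction arbitrary: e)
    case (Basic B)
    then show ?case by (auto intro!: bexI[of _ B])
  next
    case Empty
    then show ?case by (auto intro!: bexI[of _ "{}"])
  next
    case (Compl A)
    then obtain B where B: "B \<in> \<A>" "measure a ((A - B) \<union> (B - A)) < e" by auto
    have "A \<subseteq> \<Omega>" using Compl.hyps sigma_sets_into_sp[OF \<A>.space_closed] by auto
    moreover have "B \<subseteq> \<Omega>" using B(1) \<A>.space_closed by auto
    ultimately have "(\<Omega> - A - (\<Omega> - B)) \<union> (\<Omega> - B - (\<Omega> - A)) = (A - B) \<union> (B - A)" by auto
    then show ?case using B by (intro bexI[of _ "\<Omega> - B"]) auto
  next
    case (Union A)
    have A[measurable]: "A i \<in> sets a" for i using Union.hyps sets by auto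
    have "(\<lambda>n. measure a (\<Union>i. A i) - measure a (\<Union>i\<in>{..<n}. A i)) \<longlonglongrightarrow> measure a (\<Union>i. A i) - measure a (\<Union>n. \<Union>i\<in>{..<n}. A i)"
    proof (intro tendsto_intros a.finite_Lim_measure_incseq)
      show "incseq (\<lambda>n. \<Union>i\<in>{..<n}. A i)" by (intro incseq_SucI UN_mono) auto
    qed auto
    moreover have "(\<Union>n. \<Union>i\<in>{..<n}. A i) = (\<Union>i. A i)" by auto
    ultimately have "(\<lambda>n. measure a (\<Union>i. A i) - measure a (\<Union>i\<in>{..<n}. A i)) \<longlonglongrightarrow> 0" by simp
    then obtain n where n: "measure a (\<Union>i. A i) - measure a (\<Union>i\<in>{..<n}. A i) < e/2"
      using eventually_happens'[OF sequentially_bot order_tendstoD(2)[of _ 0 _ "e/2"]] Union.prems by force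
    \<comment> \<open>The \<open>n\<close> approximation errors add up to at most
      \<open>e / 2\<close>, the other half paying for the truncation of the union. The
      \<open>+ 1\<close> keeps the denominator positive when \<open>n = 0\<close>.\<close>
    have "\<exists>B. B \<in> \<A> \<and> measure a ((A i - B) \<union> (B - A i)) < e / (2 * (real n + 1))" for i
      using Union.IH[of "e / (2 * (real n + 1))" i] Union.prems by auto
    then obtain B where B: "\<And>i. B i \<in> \<A>" "\<And>i. measure a ((A i - B i) \<union> (B i - A i)) < e / (2 * (real n + 1))"
      by metis
    define C where "C = (\<Union>i\<in>{..<n}. B i)"
    have C: "C \<in> \<A>" unfolding C_def using B(1) by (intro \<A>.finite_UN) auto
    have [measurable]: "B i \<in> sets a" for i using B(1) sub by auto
    have "((\<Union>i. A i) - C) \<union> (C - (\<Union>i. A i)) \<subseteq> ((\<Union>i. A i) - (\<Union>i\<in>{..<n}. A i)) \<union> (\<Union>i\<in>{..<n}. (A i - B i) \<union> (B i - A i))"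
      unfolding C_def by blast
    then have "measure a (((\<Union>i. A i) - C) \<union> (C - (\<Union>i. A i)))
      \<le> measure a (((\<Union>i. A i) - (\<Union>i\<in>{..<n}. A i)) \<union> (\<Union>i\<in>{..<n}. (A i - B i) \<union> (B i - A i)))"
      by (rule a.finite_measure_mono) measurable
    also have "\<dots> \<le> measure a ((\<Union>i. A i) - (\<Union>i\<in>{..<n}. A i)) + measure a (\<Union>i\<in>{..<n}. (A i - B i) \<union> (B i - A i))"
      by (rule measure_Un_le) auto
    also have "measure a ((\<Union>i. A i) - (\<Union>i\<in>{..<n}. A i)) = measure a (\<Union>i. A i) - measure a (\<Union>i\<in>{..<n}. A i)"
      by (rule a.finite_measure_Diff) auto
    also have "\<dots> < e/2" by (rule n)
    also have "measure a (\<Union>i\<in>{..<n}. (A i - B i) \<union> (B i - A i)) \<le> (\<Sum>i\<in>{..<n}. measure a ((A i - B i) \<union> (B i - A i)))"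
      by (rule a.finite_measure_subadditive_finite) auto
    also have "\<dots> \<le> (\<Sum>i\<in>{..<n}. e / (2 * (real n + 1)))"
      using B(2) by (intro sum_mono) (simp add: less_imp_le)
    also have "\<dots> \<le> e/2" using Union.prems by (simp add: field_simps)
    finally show ?case using C by (intro bexI[of _ C]) auto
  qed
qed

text \<open>Approximating with respect to the sum of \<open>a\<close> and \<open>b\<close> yields
  one set of the algebra that is close to \<open>A\<close> for both measures at once.\<close>

lemma tv_dist_le_algebra:
  assumes ps: "prob_space a" "prob_space b" and sets: "sets a = sets M" "sets b = sets M"
    and alg: "algebra (space M) \<A>" "sets M = sigma_sets (space M) \<A>"
    and le: "\<And>A. A \<in> \<A> \<Longrightarrow> \<bar>measure a A - measure b A\<bar> \<le> t"
  shows "tv_dist M a b \<le> t"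
proof (rule tv_dist_le, rule field_le_epsilon)
  fix A and e :: real assume A: "A \<in> sets M" and e: "0 < e"
  interpret a: prob_space a by fact
  interpret b: prob_space b by fact
  obtain s where s: "sets s = sets M" "\<And>A. A \<in> sets M \<Longrightarrow> emeasure s A = emeasure a A + emeasure b A"
    using ex_plus_measure[OF sets] by auto
  have "space s = space M" using s(1) sets_eq_imp_space_eq by blast
  then have fin: "finite_measure s" using s(2)[of "space M"] by (intro finite_measureI) auto
  interpret s: finite_measure s by fact
  have ms: "measure s X = measure a X + measure b X" if "X \<in> sets M" for X
    using s(2)[OF that] by (simp add: a.emeasure_eq_measure b.emeasure_eq_measure s.emeasure_eq_measure flip: ennreal_plus)
  obtain B where B: "B \<in> \<A>" "measure s ((A - B) \<union> (B - A)) < e"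
    using algebra_approx[OF fin alg(1), of A e] alg(2) s(1) A e by auto
  have BM: "B \<in> sets M" using B alg by auto
  have *: "\<bar>measure n A - measure n B\<bar> \<le> measure n ((A - B) \<union> (B - A))"
    if "prob_space n" "sets n = sets M" for n :: "'a measure"
  proof -
    interpret n: prob_space n by fact
    have "measure n A \<le> measure n (B \<union> ((A - B) \<union> (B - A)))"
      using A BM that by (intro n.finite_measure_mono) auto
    also have "\<dots> \<le> measure n B + measure n ((A - B) \<union> (B - A))"
      using A BM that by (intro measure_Un_le) auto
    finally have 1: "measure n A \<le> measure n B + measure n ((A - B) \<union> (B - A))" .
    have "measure n B \<le> measure n (A \<union> ((A - B) \<union> (B - A)))"
      using A BM that by (intro n.finite_measure_mono) auto
    also have "\<dots> \<le> measure n A + measure n ((A - B) \<union> (B - A))"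
      using A BM that by (intro measure_Un_le) auto
    finally show ?thesis using 1 by linarith
  qed
  have "(A - B) \<union> (B - A) \<in> sets M" using A BM by auto
  then show "\<bar>measure a A - measure b A\<bar> \<le> t + e"
    using *[OF ps(1) sets(1)] *[OF ps(2) sets(2)] le[OF B(1)] B(2) ms by fastforce
qed

text \<open>The supremum over all measurable sets equals the supremum over a countable generating
  algebra. This is one of two uses of countable generation; the other is the choice of densities in
  \<open>singular_of_pairwise_singular\<close>.\<close>

lemma measurable_tv_dist:
  assumes cg: "countably_generated M"
    and k[measurable]: "k1 \<in> N \<rightarrow>\<^sub>M prob_algebra M" "k2 \<in> N \<rightarrow>\<^sub>M prob_algebra M"
  shows "(\<lambda>x. tv_dist M (k1 x) (k2 x)) \<in> borel_measurable N"
proof -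
  obtain \<A> where \<A>: "countable \<A>" "algebra (space M) \<A>" "sets M = sigma_sets (space M) \<A>"
    using countably_generated_algebra[OF cg] by metis
  interpret \<A>: algebra "space M" \<A> by fact
  have sub[measurable]: "A \<in> sets M" if "A \<in> \<A>" for A using that \<A>(3) by auto
  have kp: "prob_space (k1 x)" "prob_space (k2 x)" "sets (k1 x) = sets M" "sets (k2 x) = sets M"
    if "x \<in> space N" for x
    using measurable_space[OF k(1) that] measurable_space[OF k(2) that] by (auto simp: space_prob_algebra)
  have eq: "tv_dist M (k1 x) (k2 x) = (SUP A\<in>\<A>. \<bar>measure (k1 x) A - measure (k2 x) A\<bar>)"
    and bdd: "bdd_above ((\<lambda>A. \<bar>measure (k1 x) A - measure (k2 x) A\<bar>) ` \<A>)" if "x \<in> space N" for x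
  proof -
    note kp = kp[OF that]
    show bdd: "bdd_above ((\<lambda>A. \<bar>measure (k1 x) A - measure (k2 x) A\<bar>) ` \<A>)"
      using tv_dist_bound[OF kp(1,2)] sub by (intro bdd_aboveI[of _ "tv_dist M (k1 x) (k2 x)"]) auto
    show "tv_dist M (k1 x) (k2 x) = (SUP A\<in>\<A>. \<bar>measure (k1 x) A - measure (k2 x) A\<bar>)"
    proof (rule antisym)
      show "tv_dist M (k1 x) (k2 x) \<le> (SUP A\<in>\<A>. \<bar>measure (k1 x) A - measure (k2 x) A\<bar>)"
        by (rule tv_dist_le_algebra[OF kp \<A>(2,3)]) (intro cSUP_upper bdd)
      show "(SUP A\<in>\<A>. \<bar>measure (k1 x) A - measure (k2 x) A\<bar>) \<le> tv_dist M (k1 x) (k2 x)"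
        by (rule cSUP_least) (use tv_dist_bound[OF kp(1,2)] sub \<A>.empty_sets in auto)
    qed
  qed
  have "(\<lambda>x. SUP A\<in>\<A>. \<bar>measure (k1 x) A - measure (k2 x) A\<bar>) \<in> borel_measurable N"
    using measurable_compose[OF k(1) measurable_measure_prob_algebra[OF sub]]
      measurable_compose[OF k(2) measurable_measure_prob_algebra[OF sub]]
    by (intro borel_measurable_cSUP[OF \<A>(1) _ bdd] borel_measurable_abs borel_measurable_diff) auto
  then show ?thesis by (subst measurable_cong[OF eq])
qed

lemma measure_bind_kernel:
  assumes "prob_space m" and [measurable_cong]: "sets m = sets N"
    and k: "k \<in> N \<rightarrow>\<^sub>M prob_algebra M" and A: "A \<in> sets M"
  shows "measure (m \<bind> k) A = (\<integral>z. measure (k z) A \<partial>m)"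
proof -
  interpret prob_space m by fact
  have "k \<in> m \<rightarrow>\<^sub>M subprob_algebra M" using measurable_prob_algebraD[OF k] by measurable
  then show ?thesis by (rule measure_bind[OF _ A])
qed

lemma kernel_props:
  assumes "k \<in> N \<rightarrow>\<^sub>M prob_algebra M" "x \<in> space N"
  shows "prob_space (k x)" "sets (k x) = sets M" "space (k x) = space M"
  using measurable_space[OF assms] by (auto simp: space_prob_algebra dest: sets_eq_imp_space_eq)

lemma bind_props:
  assumes "prob_space m" "sets m = sets N" "k \<in> N \<rightarrow>\<^sub>M prob_algebra M"
  shows "prob_space (m \<bind> k)" "sets (m \<bind> k) = sets M"
  using prob_space_bind'[of m N k M] sets_bind'[of m N k M] assms by (auto simp: space_prob_algebra)

lemma bounded_integrable:
  fixes f :: "'a \<Rightarrow> real"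
  assumes "finite_measure m" "f \<in> borel_measurable m" "\<And>x. x \<in> space m \<Longrightarrow> \<bar>f x\<bar> \<le> B"
  shows "integrable m f"
  using assms by (intro finite_measure.integrable_const_bound[of m f B]) auto

text \<open>Convexity of the metric: a mixture is no farther from \<nu> than its components are on
  average.\<close>

lemma tv_dist_bind_le:
  assumes cg: "countably_generated M" and m: "prob_space m" and [measurable_cong]: "sets m = sets N"
    and k[measurable]: "k \<in> N \<rightarrow>\<^sub>M prob_algebra M" and \<nu>: "prob_space \<nu>" "sets \<nu> = sets M"
  shows "tv_dist M (m \<bind> k) \<nu> \<le> (\<integral>z. tv_dist M (k z) \<nu> \<partial>m)"
proof (rule tv_dist_le)
  interpret m: prob_space m by fact
  have \<nu>k[measurable]: "(\<lambda>_. \<nu>) \<in> N \<rightarrow>\<^sub>M prob_algebra M" using \<nu> by (simp add: space_prob_algebra)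
  have spN: "space m = space N" by (rule sets_eq_imp_space_eq) fact
  have [measurable]: "(\<lambda>z. tv_dist M (k z) \<nu>) \<in> borel_measurable m"
    using measurable_tv_dist[OF cg k \<nu>k] by measurable
  fix A assume A[measurable]: "A \<in> sets M"
  have fin: "finite_measure m" by unfold_locales
  have i1: "integrable m (\<lambda>z. measure (k z) A)"
    using prob_space.prob_le_1[OF kernel_props(1)[OF k]] spN
    by (intro bounded_integrable[OF fin, of _ 1]) auto
  have "\<bar>measure (m \<bind> k) A - measure \<nu> A\<bar> = \<bar>\<integral>z. measure (k z) A - measure \<nu> A \<partial>m\<bar>"
    using i1 by (simp add: measure_bind_kernel[OF m \<open>sets m = sets N\<close> k A] m.prob_space)
  also have "\<dots> \<le> (\<integral>z. \<bar>measure (k z) A - measure \<nu> A\<bar> \<partial>m)" by (rule integral_abs_bound)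
  also have "\<dots> \<le> (\<integral>z. tv_dist M (k z) \<nu> \<partial>m)"
  proof (rule integral_mono)
    show "integrable m (\<lambda>z. \<bar>measure (k z) A - measure \<nu> A\<bar>)" using i1 by auto
    show "integrable m (\<lambda>z. tv_dist M (k z) \<nu>)"
      using tv_dist_nonneg[OF kernel_props(1)[OF k] \<nu>(1)] tv_dist_le_1[OF kernel_props(1)[OF k] \<nu>(1)] spN
      by (intro bounded_integrable[OF fin, of _ 1]) auto
    show "\<bar>measure (k z) A - measure \<nu> A\<bar> \<le> tv_dist M (k z) \<nu>" if "z \<in> space m" for z
      using that spN kernel_props[OF k] \<nu> by (intro tv_dist_bound) auto
  qed
  finally show "\<bar>measure (m \<bind> k) A - measure \<nu> A\<bar> \<le> (\<integral>z. tv_dist M (k z) \<nu> \<partial>m)" .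
qed

lemma integral_plus_measure:
  fixes h :: "'a \<Rightarrow> real"
  assumes fin: "finite_measure a" "finite_measure c" "finite_measure r"
    and sets[measurable_cong]: "sets a = sets M" "sets c = sets M" "sets r = sets M"
    and eq: "\<And>A. A \<in> sets M \<Longrightarrow> emeasure a A = emeasure c A + emeasure r A"
    and h[measurable]: "h \<in> borel_measurable M" "\<And>x. x \<in> space M \<Longrightarrow> 0 \<le> h x" "\<And>x. x \<in> space M \<Longrightarrow> h x \<le> B"
  shows "(\<integral>x. h x \<partial>a) = (\<integral>x. h x \<partial>c) + (\<integral>x. h x \<partial>r)"
proof -
  have sp: "space a = space M" "space c = space M" "space r = space M"
    using sets sets_eq_imp_space_eq by blast+
  have int: "integrable n h" if "finite_measure n" "sets n = sets M" for n
    using that h sets_eq_imp_space_eq[OF that(2)] by (intro bounded_integrable[OF that(1), of _ B]) auto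
  have nn: "ennreal (\<integral>x. h x \<partial>n) = (\<integral>\<^sup>+x. h x \<partial>n)" "0 \<le> (\<integral>x. h x \<partial>n)" if "finite_measure n" "sets n = sets M" for n
    using int[OF that] h sets_eq_imp_space_eq[OF that(2)]
    by (auto intro!: nn_integral_eq_integral[symmetric] integral_nonneg_AE)
  have "(\<integral>\<^sup>+x. h x \<partial>a) = (\<integral>\<^sup>+x. h x \<partial>c) + (\<integral>\<^sup>+x. h x \<partial>r)"
    by (rule nn_integral_plus_measure[OF sets(2,3,1) eq]) auto
  then show ?thesis
    using nn[OF fin(1) sets(1)] nn[OF fin(2) sets(2)] nn[OF fin(3) sets(3)]
    by (metis ennreal_inj ennreal_plus add_nonneg_nonneg)
qed

text \<open>The common part of \<open>m1\<close> and \<open>m2\<close> contributes equally to both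
  mixtures and cancels. The rest of the difference is at most the integral over \<open>r1\<close> of
  a function bounded by 1, hence at most the mass of \<open>r1\<close>.\<close>

lemma tv_dist_bind_contract:
  assumes m: "prob_space m1" "prob_space m2" and sm: "sets m1 = sets N" "sets m2 = sets N"
    and k[measurable]: "k \<in> N \<rightarrow>\<^sub>M prob_algebra M"
  shows "tv_dist M (m1 \<bind> k) (m2 \<bind> k) \<le> tv_dist N m1 m2"
proof (rule tv_dist_le_signed)
  show "prob_space (m1 \<bind> k)" "prob_space (m2 \<bind> k)" "sets (m1 \<bind> k) = sets M" "sets (m2 \<bind> k) = sets M"
    using bind_props m sm k by blast+
  obtain c r1 r2 H where fin: "finite_measure c" "finite_measure r1" "finite_measure r2"
    and sets: "sets c = sets N" "sets r1 = sets N" "sets r2 = sets N" "H \<in> sets N"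
    and e: "\<And>A. A \<in> sets N \<Longrightarrow> emeasure m1 A = emeasure c A + emeasure r1 A"
     "\<And>A. A \<in> sets N \<Longrightarrow> emeasure m2 A = emeasure c A + emeasure r2 A"
    and tv: "measure r1 (space N) = tv_dist N m1 m2"
    using tv_dist_common_part[OF m sm] by metis
  fix A assume A[measurable]: "A \<in> sets M"
  let ?h = "\<lambda>z. measure (k z) A"
  have h: "?h \<in> borel_measurable N" "\<And>z. z \<in> space N \<Longrightarrow> 0 \<le> ?h z" "\<And>z. z \<in> space N \<Longrightarrow> ?h z \<le> 1"
    using prob_space.prob_le_1[OF kernel_props(1)[OF k]] by auto
  have fm: "finite_measure m1" "finite_measure m2" using m prob_space_def by auto
  have "measure (m1 \<bind> k) A - measure (m2 \<bind> k) A = (\<integral>z. ?h z \<partial>r1) - (\<integral>z. ?h z \<partial>r2)"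
    using integral_plus_measure[OF fm(1) fin(1,2) sm(1) sets(1,2) e(1) h]
      integral_plus_measure[OF fm(2) fin(1,3) sm(2) sets(1,3) e(2) h]
    by (simp add: measure_bind_kernel[OF m(1) sm(1) k A] measure_bind_kernel[OF m(2) sm(2) k A])
  also have "\<dots> \<le> (\<integral>z. ?h z \<partial>r1)" proof -
    have "0 \<le> (\<integral>z. ?h z \<partial>r2)" by (rule integral_nonneg_AE) simp
    then show ?thesis by simp
  qed
  also have "\<dots> \<le> (\<integral>z. 1 \<partial>r1)"
  proof -
    interpret r1: finite_measure r1 by fact
    have "space r1 = space N" using sets sets_eq_imp_space_eq by blast
    then show ?thesis using h sets
      by (intro integral_mono bounded_integrable[of r1 ?h 1]) (auto simp: fin cong: measurable_cong_sets)
  qed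
  also have "\<dots> = tv_dist N m1 m2"
    using tv sets_eq_imp_space_eq[OF sets(2)] by simp
  finally show "measure (m1 \<bind> k) A - measure (m2 \<bind> k) A \<le> tv_dist N m1 m2" .
qed

text \<open>Both sides are multiplied by the common mass \<open>t\<close> of \<open>r1\<close> and \<open>r2\<close>, so that no normalization
  of the residual measures is needed.\<close>

lemma residual_bound:
  assumes cg: "countably_generated M"
    and fin: "finite_measure r1" "finite_measure r2" and [measurable_cong]: "sets r1 = sets N" "sets r2 = sets N"
    and mass: "measure r1 (space N) = t" "measure r2 (space N) = t"
    and k[measurable]: "k \<in> N \<rightarrow>\<^sub>M prob_algebra M" and A[measurable]: "A \<in> sets M"
  shows "t * ((\<integral>z. measure (k z) A \<partial>r1) - (\<integral>z. measure (k z) A \<partial>r2))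
     \<le> (\<integral>p. tv_dist M (k (fst p)) (k (snd p)) \<partial>(r1 \<Otimes>\<^sub>M r2))"
proof -
  interpret r1: finite_measure r1 by fact
  interpret r2: finite_measure r2 by fact
  interpret p: pair_sigma_finite r1 r2 by unfold_locales
  interpret pf: finite_measure "r1 \<Otimes>\<^sub>M r2" by (intro finite_measure_pair_measure fin)
  have sp: "space r1 = space N" "space r2 = space N" by (rule sets_eq_imp_space_eq, fact)+
  let ?h = "\<lambda>z. measure (k z) A"
  have hb: "\<bar>?h z\<bar> \<le> 1" if "z \<in> space N" for z
    using that prob_space.prob_le_1[OF kernel_props(1)[OF k that]] by auto
  have i1: "integrable (r1 \<Otimes>\<^sub>M r2) (\<lambda>p. ?h (fst p))" and i2: "integrable (r1 \<Otimes>\<^sub>M r2) (\<lambda>p. ?h (snd p))"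
    using hb by (intro bounded_integrable[of _ _ 1]; force simp: pf.finite_measure_axioms space_pair_measure sp)+
  have "(\<integral>p. ?h (fst p) \<partial>(r1 \<Otimes>\<^sub>M r2)) = (\<integral>x. \<integral>y. ?h x \<partial>r2 \<partial>r1)"
    by (subst p.integral_fst'[symmetric, OF i1]) simp
  then have e1: "(\<integral>p. ?h (fst p) \<partial>(r1 \<Otimes>\<^sub>M r2)) = t * (\<integral>z. ?h z \<partial>r1)"
    using mass sp by simp
  have "(\<integral>p. ?h (snd p) \<partial>(r1 \<Otimes>\<^sub>M r2)) = (\<integral>x. \<integral>y. ?h y \<partial>r2 \<partial>r1)"
    by (subst p.integral_fst'[symmetric, OF i2]) simp
  then have e2: "(\<integral>p. ?h (snd p) \<partial>(r1 \<Otimes>\<^sub>M r2)) = t * (\<integral>z. ?h z \<partial>r2)"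
    using mass sp by simp
  have "t * ((\<integral>z. ?h z \<partial>r1) - (\<integral>z. ?h z \<partial>r2)) = (\<integral>p. ?h (fst p) - ?h (snd p) \<partial>(r1 \<Otimes>\<^sub>M r2))"
    using i1 i2 e1 e2 by (simp add: algebra_simps)
  also have "\<dots> \<le> (\<integral>p. tv_dist M (k (fst p)) (k (snd p)) \<partial>(r1 \<Otimes>\<^sub>M r2))"
  proof (rule integral_mono)
    show "integrable (r1 \<Otimes>\<^sub>M r2) (\<lambda>p. ?h (fst p) - ?h (snd p))" using i1 i2 by auto
    have ps: "prob_space (k (fst p))" "prob_space (k (snd p))" if "p \<in> space (r1 \<Otimes>\<^sub>M r2)" for p
      using that kernel_props(1)[OF k] by (auto simp: space_pair_measure sp)
    have "(\<lambda>p. tv_dist M (k (fst p)) (k (snd p))) \<in> borel_measurable (N \<Otimes>\<^sub>M N)"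
      by (rule measurable_tv_dist[OF cg]) measurable
    then have "(\<lambda>p. tv_dist M (k (fst p)) (k (snd p))) \<in> borel_measurable (r1 \<Otimes>\<^sub>M r2)" by measurable
    then show "integrable (r1 \<Otimes>\<^sub>M r2) (\<lambda>p. tv_dist M (k (fst p)) (k (snd p)))"
      using tv_dist_nonneg[OF ps] tv_dist_le_1[OF ps]
      by (intro bounded_integrable[of _ _ 1] pf.finite_measure_axioms) auto
    show "?h (fst p) - ?h (snd p) \<le> tv_dist M (k (fst p)) (k (snd p))" if "p \<in> space (r1 \<Otimes>\<^sub>M r2)" for p
      using tv_dist_bound[OF ps[OF that] A] by linarith
  qed
  finally show ?thesis .
qed

subsection \<open>Total variation along the chain\<close>

lemma bounded_convergence:
  fixes f :: "'a \<Rightarrow> real"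
  assumes "finite_measure m" and [measurable]: "\<And>i. s i \<in> borel_measurable m" "f \<in> borel_measurable m"
    and le: "\<And>i x. x \<in> space m \<Longrightarrow> \<bar>s i x\<bar> \<le> B" and lim: "AE x in m. (\<lambda>i. s i x) \<longlonglongrightarrow> f x"
  shows "(\<lambda>i. \<integral>x. s i x \<partial>m) \<longlonglongrightarrow> (\<integral>x. f x \<partial>m)"
proof (rule integral_dominated_convergence[where w="\<lambda>_. B"])
  show "integrable m (\<lambda>_. B)" using assms(1) by (rule finite_measure.integrable_const)
qed (use lim le in auto)

lemma AE_le_measure:
  assumes "sets r = sets a" "\<And>A. A \<in> sets a \<Longrightarrow> emeasure r A \<le> emeasure a A" "AE x in a. Q x"
  shows "AE x in r. Q x"
proof -
  have "absolutely_continuous a r"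
    unfolding absolutely_continuous_def
  proof
    fix N assume "N \<in> null_sets a"
    then show "N \<in> null_sets r" using assms(1) assms(2)[of N] by (simp add: null_sets_def)
  qed
  then show ?thesis using absolutely_continuous_AE[OF assms(1)] assms(3) by blast
qed

lemma integral_bind_kernel:
  fixes f :: "'b \<Rightarrow> real"
  assumes m: "prob_space m" and [measurable_cong]: "sets m = sets N" and k: "k \<in> N \<rightarrow>\<^sub>M prob_algebra K"
    and f[measurable]: "f \<in> borel_measurable K" and le: "\<And>x. x \<in> space K \<Longrightarrow> \<bar>f x\<bar> \<le> B"
  shows "(\<integral>x. f x \<partial>(m \<bind> k)) = (\<integral>z. \<integral>x. f x \<partial>(k z) \<partial>m)"
proof (rule integral_bind[where K=K and B=B and B'=1])
  have spN: "space m = space N" by (rule sets_eq_imp_space_eq) fact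
  show "k \<in> m \<rightarrow>\<^sub>M subprob_algebra K" using measurable_prob_algebraD[OF k] by measurable
  show "finite_measure m" using m prob_space_def by auto
  show "AE x in m. emeasure (k x) (space (k x)) \<le> ennreal 1"
    using kernel_props(1)[OF k] spN by (intro AE_I2) (simp add: prob_space.emeasure_space_1)
qed (use le in auto)

text \<open>A bounded subharmonic function for a stationary chain is almost surely constant along the
  chain: it has equality in Jensen's inequality for the square.\<close>

lemma subharmonic_constant:
  fixes f :: "'a \<Rightarrow> real"
  assumes m: "prob_space m" and sm[measurable_cong]: "sets m = sets Z"
    and Q[measurable]: "Q \<in> Z \<rightarrow>\<^sub>M prob_algebra Z"
    and inv: "m \<bind> Q = m" and f[measurable]: "f \<in> borel_measurable Z"
    and f0: "\<And>z. z \<in> space Z \<Longrightarrow> 0 \<le> f z" and f1: "\<And>z. z \<in> space Z \<Longrightarrow> f z \<le> 1"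
    and sub: "\<And>z. z \<in> space Z \<Longrightarrow> f z \<le> (\<integral>w. f w \<partial>Q z)"
  shows "AE z in m. AE w in Q z. f w = f z"
proof -
  interpret m: prob_space m by fact
  have fm: "finite_measure m" by unfold_locales
  have spm: "space m = space Z" by (rule sets_eq_imp_space_eq) fact
  have [measurable]: "Q \<in> Z \<rightarrow>\<^sub>M subprob_algebra Z" by (rule measurable_prob_algebraD) fact
  define g where "g z = (\<integral>w. f w \<partial>Q z)" for z
  define g2 where "g2 z = (\<integral>w. (f w)\<^sup>2 \<partial>Q z)" for z
  have [measurable]: "g \<in> borel_measurable Z" "g2 \<in> borel_measurable Z"
    unfolding g_def g2_def by measurable
  have fb: "\<bar>f z\<bar> \<le> 1" "\<bar>(f z)\<^sup>2\<bar> \<le> 1" if "z \<in> space Z" for z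
    using f0[OF that] f1[OF that] by (auto simp: power_le_one)
  have ints: "integrable (Q z) f" "integrable (Q z) (\<lambda>w. (f w)\<^sup>2)" if "z \<in> space Z" for z
  proof -
    have [measurable]: "f \<in> borel_measurable (Q z)"
      using f kernel_props(2)[OF Q that] by (simp cong: measurable_cong_sets)
    have "finite_measure (Q z)" using kernel_props(1)[OF Q that] prob_space_def by auto
    then show "integrable (Q z) f" "integrable (Q z) (\<lambda>w. (f w)\<^sup>2)"
      using fb kernel_props(3)[OF Q that] by (auto intro!: bounded_integrable[of _ _ 1])
  qed
  have gb: "0 \<le> g z" "g z \<le> 1" "0 \<le> g2 z" "g2 z \<le> 1" if "z \<in> space Z" for z
  proof -
    interpret Qz: prob_space "Q z" using kernel_props(1)[OF Q that] .
    show "0 \<le> g z" "0 \<le> g2 z" unfolding g_def g2_def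
      using f0 kernel_props(3)[OF Q that] by (auto intro!: integral_nonneg_AE)
    show "g z \<le> 1" "g2 z \<le> 1" unfolding g_def g2_def
      using ints[OF that] fb kernel_props(3)[OF Q that] by (auto intro!: Qz.integral_le_const AE_I2 simp: abs_le_iff)
  qed
  have im: "integrable m f" "integrable m (\<lambda>w. (f w)\<^sup>2)" "integrable m g" "integrable m g2"
    using fb gb spm by (auto intro!: bounded_integrable[OF fm, of _ 1])
  \<comment> \<open>Used twice: with \<open>c = g z\<close> its nonnegativity is Jensen's
    inequality, and with \<open>c = f z\<close> it vanishes as soon as \<open>g z = f z\<close> and
    \<open>g2 z = (f z)\<^sup>2\<close>.\<close>
  have dev: "(\<integral>w. (f w - c)\<^sup>2 \<partial>Q z) = g2 z - 2 * c * g z + c\<^sup>2" if "z \<in> space Z" for z c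
  proof -
    interpret Qz: prob_space "Q z" using kernel_props(1)[OF Q that] .
    have "(\<integral>w. (f w - c)\<^sup>2 \<partial>Q z) = (\<integral>w. (f w)\<^sup>2 - 2 * c * f w + c\<^sup>2 \<partial>Q z)"
      by (intro Bochner_Integration.integral_cong) (auto simp: power2_eq_square algebra_simps)
    also have "\<dots> = g2 z - 2 * c * g z + c\<^sup>2"
      using ints[OF that] by (simp add: g_def g2_def Qz.prob_space)
    finally show ?thesis .
  qed
  have jensen: "(g z)\<^sup>2 \<le> g2 z" if "z \<in> space Z" for z
  proof -
    have "0 \<le> (\<integral>w. (f w - g z)\<^sup>2 \<partial>Q z)" by (rule integral_nonneg_AE) simp
    then show ?thesis unfolding dev[OF that] by (simp add: power2_eq_square)
  qed
  have AEeq: "AE z in m. u z = v z"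
    if "integrable m u" "integrable m v" "\<And>z. z \<in> space Z \<Longrightarrow> u z \<le> v z" "(\<integral>z. v z \<partial>m) = (\<integral>z. u z \<partial>m)"
    for u v :: "'a \<Rightarrow> real"
  proof -
    have "(\<integral>z. v z - u z \<partial>m) = 0" using that by simp
    then have "AE z in m. v z - u z = 0"
      using that spm by (subst integral_nonneg_eq_0_iff_AE[symmetric]) auto
    then show ?thesis by auto
  qed
  \<comment> \<open>Invariance gives \<open>f\<close> and \<open>g\<close> the same integral, so the
    pointwise inequality is an equality almost everywhere. The same argument then applies to
    \<open>(f z)\<^sup>2\<close> and \<open>g2 z\<close>.\<close>
  have "(\<integral>z. g z \<partial>m) = (\<integral>z. f z \<partial>m)"
    using integral_bind_kernel[OF m sm Q f fb(1)] inv unfolding g_def by simp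
  then have 1: "AE z in m. f z = g z"
    using sub by (intro AEeq im) (auto simp: g_def)
  have "(\<integral>z. g2 z \<partial>m) = (\<integral>z. (f z)\<^sup>2 \<partial>m)"
    using integral_bind_kernel[OF m sm Q _ fb(2)] inv unfolding g2_def by simp
  moreover have "(f z)\<^sup>2 \<le> g2 z" if "z \<in> space Z" for z
    by (rule order.trans[OF power_mono[OF sub[OF that] f0[OF that]] jensen[OF that, unfolded g_def]])
  ultimately have 2: "AE z in m. (f z)\<^sup>2 = g2 z" by (intro AEeq im) auto
  show ?thesis using 1 2 AE_space
  proof eventually_elim
    case (elim z)
    then have z: "z \<in> space Z" using spm by simp
    have [measurable]: "f \<in> borel_measurable (Q z)"
      using f kernel_props(2)[OF Q z] by (simp cong: measurable_cong_sets)
    have fin: "finite_measure (Q z)" using kernel_props(1)[OF Q z] prob_space_def by auto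
    have "\<bar>(f w - f z)\<^sup>2\<bar> \<le> 1" if "w \<in> space Z" for w
      using f0[OF that] f1[OF that] f0[OF z] f1[OF z] by (auto simp: abs_square_le_1 abs_le_iff)
    then have "integrable (Q z) (\<lambda>w. (f w - f z)\<^sup>2)"
      using kernel_props(3)[OF Q z] by (intro bounded_integrable[OF fin, of _ 1]) auto
    moreover have "(\<integral>w. (f w - f z)\<^sup>2 \<partial>Q z) = 0"
      unfolding dev[OF z] using elim by (simp add: power2_eq_square)
    ultimately have "AE w in Q z. (f w - f z)\<^sup>2 = 0"
      by (subst integral_nonneg_eq_0_iff_AE[symmetric]) auto
    then show ?case by auto
  qed
qed

locale markov_kernel =
  fixes M :: "'a measure" and P :: "'a \<Rightarrow> 'a measure"
  assumes P[measurable]: "P \<in> M \<rightarrow>\<^sub>M prob_algebra M"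
begin

lemma P_sub[measurable]: "P \<in> M \<rightarrow>\<^sub>M subprob_algebra M"
  using P by (rule measurable_prob_algebraD)

lemma measurable_nstep[measurable]: "nstep M P n \<in> M \<rightarrow>\<^sub>M prob_algebra M"
proof (induction n)
  case 0
  have "nstep M P 0 = return M" by (simp add: fun_eq_iff)
  then show ?case by simp
next
  case (Suc n)
  have "nstep M P (Suc n) = (\<lambda>x. nstep M P n x \<bind> P)" by (simp add: fun_eq_iff)
  then show ?case using measurable_bind_prob_space[OF Suc P] by simp
qed

lemma measurable_nstep_sub[measurable]: "nstep M P n \<in> M \<rightarrow>\<^sub>M subprob_algebra M"
  using measurable_nstep by (rule measurable_prob_algebraD)

lemmas nstep_props = kernel_props[OF measurable_nstep]

lemma finite_nstep: "x \<in> space M \<Longrightarrow> finite_measure (nstep M P n x)"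
  using nstep_props(1) prob_space_def by auto

lemma nstep_sub: "x \<in> space M \<Longrightarrow> k \<in> M \<rightarrow>\<^sub>M subprob_algebra N \<Longrightarrow> k \<in> nstep M P n x \<rightarrow>\<^sub>M subprob_algebra N"
  using nstep_props(2)[of x n] by (simp cong: measurable_cong_sets)

lemma nstep_add:
  assumes x: "x \<in> space M"
  shows "nstep M P (n + m) x = nstep M P n x \<bind> nstep M P m"
proof (induction m)
  case 0
  have "nstep M P 0 = return M" by (simp add: fun_eq_iff)
  then show ?case using nstep_props(2)[OF x] by (simp add: bind_return'')
next
  case (Suc m)
  have "nstep M P (n + Suc m) x = (nstep M P n x \<bind> nstep M P m) \<bind> P" using Suc by simp
  also have "\<dots> = nstep M P n x \<bind> (\<lambda>y. nstep M P m y \<bind> P)"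
    by (rule bind_assoc[OF nstep_sub[OF x measurable_nstep_sub] P_sub])
  also have "(\<lambda>y. nstep M P m y \<bind> P) = nstep M P (Suc m)" by (simp add: fun_eq_iff)
  finally show ?case .
qed

lemma measure_nstep_add:
  assumes "x \<in> space M" "A \<in> sets M"
  shows "measure (nstep M P (n + m) x) A = (\<integral>z. measure (nstep M P m z) A \<partial>nstep M P n x)"
  unfolding nstep_add[OF assms(1)]
  by (rule measure_bind_kernel[OF nstep_props(1,2)[OF assms(1)] measurable_nstep assms(2)])

abbreviation "dn n x y \<equiv> tv_dist M (nstep M P n x) (nstep M P n y)"

definition "D x y = lim (\<lambda>n. dn n x y)"

lemma dn_mono: "x \<in> space M \<Longrightarrow> y \<in> space M \<Longrightarrow> dn (n + m) x y \<le> dn n x y"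
  unfolding nstep_add
  by (intro tv_dist_bind_contract) (auto simp: nstep_props)

lemma dn_bounds: "x \<in> space M \<Longrightarrow> y \<in> space M \<Longrightarrow> 0 \<le> dn n x y" "x \<in> space M \<Longrightarrow> y \<in> space M \<Longrightarrow> dn n x y \<le> 1"
  by (simp_all add: tv_dist_nonneg tv_dist_le_1 nstep_props)

lemma
  assumes "x \<in> space M" "y \<in> space M"
  shows dn_tendsto: "(\<lambda>n. dn n x y) \<longlonglongrightarrow> D x y" and D_le: "D x y \<le> dn n x y"
proof -
  have dec: "decseq (\<lambda>n. dn n x y)" using dn_mono[OF assms, of _ 1] by (simp add: decseq_Suc_iff)
  then obtain L where L: "(\<lambda>n. dn n x y) \<longlonglongrightarrow> L" "\<And>n. L \<le> dn n x y"
    using decseq_convergent[OF dec, of 0] dn_bounds(1)[OF assms] by auto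
  then show "(\<lambda>n. dn n x y) \<longlonglongrightarrow> D x y" "D x y \<le> dn n x y" by (simp_all add: D_def limI)
qed

lemma D_bounds: "x \<in> space M \<Longrightarrow> y \<in> space M \<Longrightarrow> 0 \<le> D x y" "x \<in> space M \<Longrightarrow> y \<in> space M \<Longrightarrow> D x y \<le> 1"
  using dn_bounds D_le[of x y 0] LIMSEQ_le_const[OF dn_tendsto, of x y 0] by (force, meson order.trans)

lemma D_commute: "D x y = D y x"
  by (simp add: D_def tv_dist_commute)

lemma D_triangle:
  assumes "x \<in> space M" "y \<in> space M" "z \<in> space M"
  shows "D x z \<le> D x y + D y z"
  using assms
  by (intro LIMSEQ_le[OF dn_tendsto tendsto_add[OF dn_tendsto dn_tendsto]])
     (auto intro!: exI[of _ 0] tv_dist_triangle simp: nstep_props)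

end

locale cg_markov_kernel = markov_kernel +
  assumes cg: "countably_generated M"
begin

lemma measurable_dn[measurable]: "(\<lambda>p. dn n (fst p) (snd p)) \<in> borel_measurable (M \<Otimes>\<^sub>M M)"
  by (intro measurable_tv_dist[OF cg] measurable_compose[OF measurable_fst measurable_nstep]
      measurable_compose[OF measurable_snd measurable_nstep])

lemma measurable_D[measurable]: "(\<lambda>p. D (fst p) (snd p)) \<in> borel_measurable (M \<Otimes>\<^sub>M M)"
  by (rule borel_measurable_LIMSEQ_real[OF dn_tendsto measurable_dn]) (auto simp: space_pair_measure)

lemma measurable_D1: "x \<in> space M \<Longrightarrow> (\<lambda>y. D x y) \<in> borel_measurable M"
  using measurable_compose[OF measurable_Pair1' measurable_D, of x] by simp

text \<open>Passing from \<open>n\<close> to \<open>n + m\<close> steps only transports the residual measures of time \<open>n\<close>.\<close>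

lemma residual_D_bound:
  assumes x: "x \<in> space M" and y: "y \<in> space M"
    and fin: "finite_measure c" "finite_measure r1" "finite_measure r2"
    and sets: "sets c = sets M" "sets r1 = sets M" "sets r2 = sets M"
    and e1: "\<And>A. A \<in> sets M \<Longrightarrow> emeasure (nstep M P n x) A = emeasure c A + emeasure r1 A"
    and e2: "\<And>A. A \<in> sets M \<Longrightarrow> emeasure (nstep M P n y) A = emeasure c A + emeasure r2 A"
    and mass: "measure r1 (space M) = t" "measure r2 (space M) = t"
  shows "t * D x y \<le> (\<integral>p. D (fst p) (snd p) \<partial>(r1 \<Otimes>\<^sub>M r2))"
proof -
  note [measurable_cong] = sets
  interpret pf: finite_measure "r1 \<Otimes>\<^sub>M r2" by (intro finite_measure_pair_measure fin)
  have sp: "space (r1 \<Otimes>\<^sub>M r2) = space M \<times> space M"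
    using sets sets_eq_imp_space_eq[of r1 M] sets_eq_imp_space_eq[of r2 M] by (simp add: space_pair_measure)
  have t0: "0 \<le> t" using mass by auto
  have le: "t * D x y \<le> (\<integral>p. dn m (fst p) (snd p) \<partial>(r1 \<Otimes>\<^sub>M r2))" for m
  proof (cases "t = 0")
    case True
    then show ?thesis using dn_bounds(1) sp by (auto intro!: integral_nonneg_AE AE_I2)
  next
    case False
    then have t: "0 < t" using t0 by simp
    \<comment> \<open>Subtracting the two laws cancels the common part, so that
      \<open>residual_bound\<close> applies. The case \<open>t = 0\<close> is split off because of
      the division.\<close>
    have "dn (n + m) x y \<le> (\<integral>p. dn m (fst p) (snd p) \<partial>(r1 \<Otimes>\<^sub>M r2)) / t"
    proof (rule tv_dist_le_signed)
      fix A assume A: "A \<in> sets M"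
      let ?h = "\<lambda>z. measure (nstep M P m z) A"
      have h: "?h \<in> borel_measurable M" "\<And>z. z \<in> space M \<Longrightarrow> 0 \<le> ?h z" "\<And>z. z \<in> space M \<Longrightarrow> ?h z \<le> 1"
        using prob_space.prob_le_1[OF nstep_props(1)] A by auto
      have "measure (nstep M P (n + m) x) A - measure (nstep M P (n + m) y) A = (\<integral>z. ?h z \<partial>r1) - (\<integral>z. ?h z \<partial>r2)"
        using integral_plus_measure[OF finite_nstep[OF x] fin(1,2) nstep_props(2)[OF x] sets(1,2) e1 h]
          integral_plus_measure[OF finite_nstep[OF y] fin(1,3) nstep_props(2)[OF y] sets(1,3) e2 h]
        by (simp add: measure_nstep_add x y A)
      then show "measure (nstep M P (n + m) x) A - measure (nstep M P (n + m) y) A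
          \<le> (\<integral>p. dn m (fst p) (snd p) \<partial>(r1 \<Otimes>\<^sub>M r2)) / t"
        using residual_bound[OF cg fin(2,3) sets(2,3) mass measurable_nstep A, of m] t
        by (simp only: pos_le_divide_eq) (simp add: mult.commute)
    qed (use x y in \<open>auto simp: nstep_props\<close>)
    then show ?thesis using D_le[OF x y, of "n + m"] t by (simp add: field_simps) (smt (verit) mult_left_mono)
  qed
  have "(\<lambda>m. \<integral>p. dn m (fst p) (snd p) \<partial>(r1 \<Otimes>\<^sub>M r2)) \<longlonglongrightarrow> (\<integral>p. D (fst p) (snd p) \<partial>(r1 \<Otimes>\<^sub>M r2))"
    using dn_bounds sp dn_tendsto
    by (intro bounded_convergence[where B=1] pf.finite_measure_axioms) auto
  then show ?thesis using le by (intro LIMSEQ_le_const) auto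
qed

text \<open>The case of an empty common part: the two laws themselves serve as residuals, of mass
  1.\<close>

lemma D_subharmonic:
  assumes x: "x \<in> space M" and y: "y \<in> space M"
  shows "D x y \<le> (\<integral>p. D (fst p) (snd p) \<partial>(nstep M P n x \<Otimes>\<^sub>M nstep M P n y))"
proof -
  have "finite_measure (null_measure M)" by (intro finite_measureI) simp
  from residual_D_bound[OF x y this finite_nstep[OF x] finite_nstep[OF y], where n=n and t=1]
  show ?thesis using x y nstep_props prob_space.prob_space[OF nstep_props(1)] by simp
qed

end

locale stationary_kernel = cg_markov_kernel +
  fixes \<mu> :: "'a measure"
  assumes \<mu>_prob: "prob_space \<mu>" and sets_\<mu>[measurable_cong]: "sets \<mu> = sets M" and \<mu>_inv: "\<mu> \<bind> P = \<mu>"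
begin

lemma space_\<mu>: "space \<mu> = space M" by (rule sets_eq_imp_space_eq) (rule sets_\<mu>)

lemma \<mu>_nstep: "\<mu> \<bind> nstep M P n = \<mu>"
proof (induction n)
  case 0
  have "nstep M P 0 = return M" by (simp add: fun_eq_iff)
  then show ?case using sets_\<mu> by (simp add: bind_return'')
next
  case (Suc n)
  have "nstep M P (Suc n) = (\<lambda>x. nstep M P n x \<bind> P)" by (simp add: fun_eq_iff)
  moreover have "\<mu> \<bind> (\<lambda>x. nstep M P n x \<bind> P) = (\<mu> \<bind> nstep M P n) \<bind> P"
    by (rule bind_assoc[symmetric, OF _ P_sub]) (rule measurable_nstep_sub[unfolded measurable_cong_sets[OF sets_\<mu>[symmetric] refl]])
  ultimately show ?case using Suc \<mu>_inv by simp
qed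

definition "Q n p = nstep M P n (fst p) \<Otimes>\<^sub>M nstep M P n (snd p)"

lemma measurable_Q[measurable]: "Q n \<in> M \<Otimes>\<^sub>M M \<rightarrow>\<^sub>M prob_algebra (M \<Otimes>\<^sub>M M)"
  unfolding Q_def by measurable

lemma \<mu>2_inv: "(\<mu> \<Otimes>\<^sub>M \<mu>) \<bind> Q n = \<mu> \<Otimes>\<^sub>M \<mu>"
proof (rule pair_measure_eqI[symmetric])
  interpret \<mu>: prob_space \<mu> by (rule \<mu>_prob)
  interpret pp: pair_prob_space \<mu> \<mu> ..
  show "sigma_finite_measure \<mu>" "sigma_finite_measure \<mu>" by unfold_locales
  have sp2: "prob_space (\<mu> \<Otimes>\<^sub>M \<mu>)" by unfold_locales
  have s2: "sets (\<mu> \<Otimes>\<^sub>M \<mu>) = sets (M \<Otimes>\<^sub>M M)" by (intro sets_pair_measure_cong sets_\<mu>)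
  then show "sets (\<mu> \<Otimes>\<^sub>M \<mu>) = sets ((\<mu> \<Otimes>\<^sub>M \<mu>) \<bind> Q n)" using bind_props(2)[OF sp2 s2 measurable_Q] by simp
  fix A B assume "A \<in> sets \<mu>" "B \<in> sets \<mu>"
  then have A[measurable]: "A \<in> sets M" and B[measurable]: "B \<in> sets M" using sets_\<mu> by auto
  have Qm: "Q n \<in> \<mu> \<Otimes>\<^sub>M \<mu> \<rightarrow>\<^sub>M subprob_algebra (M \<Otimes>\<^sub>M M)"
    using measurable_prob_algebraD[OF measurable_Q] by measurable
  have em: "emeasure \<mu> X = (\<integral>\<^sup>+x. emeasure (nstep M P n x) X \<partial>\<mu>)" if "X \<in> sets M" for X
  proof -
    have "emeasure (\<mu> \<bind> nstep M P n) X = (\<integral>\<^sup>+x. emeasure (nstep M P n x) X \<partial>\<mu>)"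
      by (rule emeasure_bind[OF \<mu>.not_empty _ that]) measurable
    then show ?thesis by (simp add: \<mu>_nstep)
  qed
  have "emeasure ((\<mu> \<Otimes>\<^sub>M \<mu>) \<bind> Q n) (A \<times> B) = (\<integral>\<^sup>+p. emeasure (Q n p) (A \<times> B) \<partial>(\<mu> \<Otimes>\<^sub>M \<mu>))"
    by (rule emeasure_bind[OF pp.P.not_empty Qm]) auto
  also have "\<dots> = (\<integral>\<^sup>+p. emeasure (nstep M P n (fst p)) A * emeasure (nstep M P n (snd p)) B \<partial>(\<mu> \<Otimes>\<^sub>M \<mu>))"
  proof (rule nn_integral_cong)
    fix p assume "p \<in> space (\<mu> \<Otimes>\<^sub>M \<mu>)"
    then have p: "fst p \<in> space M" "snd p \<in> space M" by (auto simp: space_pair_measure space_\<mu>)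
    interpret b: prob_space "nstep M P n (snd p)" using p by (simp add: nstep_props)
    show "emeasure (Q n p) (A \<times> B) = emeasure (nstep M P n (fst p)) A * emeasure (nstep M P n (snd p)) B"
      unfolding Q_def using A B p by (intro b.emeasure_pair_measure_Times) (auto simp: nstep_props)
  qed
  also have "\<dots> = (\<integral>\<^sup>+x. \<integral>\<^sup>+y. emeasure (nstep M P n x) A * emeasure (nstep M P n y) B \<partial>\<mu> \<partial>\<mu>)"
    by (subst \<mu>.nn_integral_fst[symmetric]) (auto intro!: measurable_compose[OF measurable_fst] measurable_compose[OF measurable_snd])
  also have "\<dots> = emeasure \<mu> A * emeasure \<mu> B"
    by (simp add: nn_integral_cmult nn_integral_multc em[OF A, symmetric] em[OF B, symmetric])
  finally show "emeasure \<mu> A * emeasure \<mu> B = emeasure ((\<mu> \<Otimes>\<^sub>M \<mu>) \<bind> Q n) (A \<times> B)" by simp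
qed

lemma D_invariant:
  "AE p in \<mu> \<Otimes>\<^sub>M \<mu>. AE q in nstep M P n (fst p) \<Otimes>\<^sub>M nstep M P n (snd p). D (fst q) (snd q) = D (fst p) (snd p)"
proof -
  interpret \<mu>: prob_space \<mu> by (rule \<mu>_prob)
  interpret pp: pair_prob_space \<mu> \<mu> ..
  have "AE p in \<mu> \<Otimes>\<^sub>M \<mu>. AE q in Q n p. D (fst q) (snd q) = D (fst p) (snd p)"
  proof (rule subharmonic_constant[OF _ _ measurable_Q \<mu>2_inv measurable_D])
    show "prob_space (\<mu> \<Otimes>\<^sub>M \<mu>)" by unfold_locales
    show "sets (\<mu> \<Otimes>\<^sub>M \<mu>) = sets (M \<Otimes>\<^sub>M M)" by (intro sets_pair_measure_cong sets_\<mu>)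
  qed (auto simp: space_pair_measure D_bounds Q_def D_subharmonic)
  then show ?thesis unfolding Q_def .
qed

lemma D_zero_one: "AE p in \<mu> \<Otimes>\<^sub>M \<mu>. D (fst p) (snd p) = 0 \<or> D (fst p) (snd p) = 1"
proof -
  have "AE p in \<mu> \<Otimes>\<^sub>M \<mu>. \<forall>n. AE q in nstep M P n (fst p) \<Otimes>\<^sub>M nstep M P n (snd p). D (fst q) (snd q) = D (fst p) (snd p)"
    using D_invariant by (simp add: AE_all_countable)
  with AE_space show ?thesis
  proof eventually_elim
    case (elim p)
    define x y where "x = fst p" and "y = snd p"
    have x: "x \<in> space M" and y: "y \<in> space M"
      using elim(1) by (auto simp: x_def y_def space_pair_measure space_\<mu>)
    have const: "AE q in nstep M P n x \<Otimes>\<^sub>M nstep M P n y. D (fst q) (snd q) = D x y" for n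
      using elim(2) unfolding x_def y_def by blast
    have "1 \<le> dn n x y" if pos: "0 < D x y" for n
    proof -
      obtain c r1 r2 where fin: "finite_measure c" "finite_measure r1" "finite_measure r2"
        and sets: "sets c = sets M" "sets r1 = sets M" "sets r2 = sets M"
        and e1: "\<And>A. A \<in> sets M \<Longrightarrow> emeasure (nstep M P n x) A = emeasure c A + emeasure r1 A"
        and e2: "\<And>A. A \<in> sets M \<Longrightarrow> emeasure (nstep M P n y) A = emeasure c A + emeasure r2 A"
        and mass: "measure r1 (space M) = dn n x y" "measure r2 (space M) = dn n x y"
        using tv_dist_common_part[OF nstep_props(1)[OF x] nstep_props(1)[OF y] nstep_props(2)[OF x] nstep_props(2)[OF y]]
        by metis
      note [measurable_cong] = sets
      interpret a: prob_space "nstep M P n x" using nstep_props(1)[OF x] .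
      interpret b: prob_space "nstep M P n y" using nstep_props(1)[OF y] .
      interpret ab: pair_prob_space "nstep M P n x" "nstep M P n y" ..
      interpret r1: finite_measure r1 by fact
      interpret r2: finite_measure r2 by fact
      interpret r: pair_sigma_finite r1 r2 ..
      interpret pf: finite_measure "r1 \<Otimes>\<^sub>M r2" by (intro finite_measure_pair_measure fin)
      \<comment> \<open>Both residuals are dominated by the laws they come from, so the almost sure
        constancy of \<open>D\<close> passes to them. The right-hand side of
        \<open>residual_D_bound\<close> can then be evaluated: it is \<open>D x y\<close> times the
        squared residual mass.\<close>
      have "AE u in nstep M P n x. AE v in nstep M P n y. D (fst (u,v)) (snd (u,v)) = D x y"
        by (rule ab.AE_pair[OF const])
      then have "AE u in r1. AE v in nstep M P n y. D (fst (u,v)) (snd (u,v)) = D x y"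
        by (rule AE_le_measure[rotated 2]) (use sets nstep_props(2)[OF x] e1 in auto)
      then have "AE u in r1. AE v in r2. D (fst (u,v)) (snd (u,v)) = D x y"
      proof eventually_elim
        case (elim u)
        then show ?case by (rule AE_le_measure[rotated 2]) (use sets nstep_props(2)[OF y] e2 in auto)
      qed
      then have "AE q in r1 \<Otimes>\<^sub>M r2. D (fst q) (snd q) = D x y"
        by (intro r.AE_pair_measure) auto
      then have "(\<integral>q. D (fst q) (snd q) \<partial>(r1 \<Otimes>\<^sub>M r2)) = (\<integral>q. D x y \<partial>(r1 \<Otimes>\<^sub>M r2))"
        by (intro integral_cong_AE) auto
      also have "\<dots> = D x y * (dn n x y * dn n x y)"
      proof -
        have sp: "space r1 = space M" "space r2 = space M" using sets sets_eq_imp_space_eq by blast+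
        have "measure (r1 \<Otimes>\<^sub>M r2) (space r1 \<times> space r2) = dn n x y * dn n x y"
          unfolding measure_def r2.emeasure_pair_measure_Times[OF sets.top sets.top] enn2real_mult
          using mass by (simp add: measure_def sp)
        then show ?thesis by (simp add: space_pair_measure)
      qed
      finally have "dn n x y * D x y \<le> D x y * (dn n x y * dn n x y)"
        using residual_D_bound[OF x y fin sets e1 e2 mass] by (rule ord_le_eq_trans[rotated])
      moreover have "0 < dn n x y" using pos D_le[OF x y, of n] by linarith
      ultimately show ?thesis using pos by simp
    qed
    then have "D x y = 1" if "0 < D x y"
      using that D_bounds(2)[OF x y] LIMSEQ_le_const[OF dn_tendsto[OF x y], of 1] by force
    then show ?case using D_bounds(1)[OF x y] unfolding x_def y_def by fastforce
  qed
qed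

lemma tv_\<mu>_le: "x \<in> space M \<Longrightarrow> tv_dist M (nstep M P (n + m) x) \<mu> \<le> tv_dist M (nstep M P n x) \<mu>"
  using tv_dist_bind_contract[OF nstep_props(1) \<mu>_prob nstep_props(2) sets_\<mu> measurable_nstep, of x n m]
  by (simp add: nstep_add \<mu>_nstep)

lemma measurable_tv_\<mu>[measurable]: "(\<lambda>z. tv_dist M (nstep M P m z) \<mu>) \<in> borel_measurable M"
  by (intro measurable_tv_dist[OF cg] measurable_nstep) (simp add: space_prob_algebra \<mu>_prob sets_\<mu>)

text \<open>By invariance \<mu> is the \<mu>-average of the laws of time \<open>n\<close>, so
  convexity bounds its distance from the law started at \<open>x\<close> by the average of
  \<open>dn n x y\<close> over \<open>y\<close>, which vanishes by bounded convergence.\<close>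

lemma tv_\<mu>_tendsto_0:
  assumes x: "x \<in> space M" and ae: "AE y in \<mu>. D x y = 0"
  shows "(\<lambda>n. tv_dist M (nstep M P n x) \<mu>) \<longlonglongrightarrow> 0"
proof (rule tendsto_sandwich[OF _ _ tendsto_const])
  interpret \<mu>: prob_space \<mu> by (rule \<mu>_prob)
  have meas: "(\<lambda>y. dn n x y) \<in> borel_measurable M" for n
    using measurable_compose[OF measurable_Pair1' measurable_dn, of x] x by simp
  have "(\<lambda>n. \<integral>y. dn n x y \<partial>\<mu>) \<longlonglongrightarrow> (\<integral>y. 0 \<partial>\<mu>)"
  proof (rule bounded_convergence[where B=1])
    show "AE y in \<mu>. (\<lambda>n. dn n x y) \<longlonglongrightarrow> 0" using ae AE_space
    proof eventually_elim
      case (elim y)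
      then show ?case using dn_tendsto[OF x, of y] by (simp add: space_\<mu>)
    qed
  qed (use dn_bounds x space_\<mu> meas in \<open>auto cong: measurable_cong_sets intro: \<mu>.finite_measure_axioms\<close>)
  then show "(\<lambda>n. \<integral>y. dn n x y \<partial>\<mu>) \<longlonglongrightarrow> 0" by simp
  have "tv_dist M (nstep M P n x) \<mu> \<le> (\<integral>y. dn n x y \<partial>\<mu>)" for n
    using tv_dist_bind_le[OF cg \<mu>_prob sets_\<mu> measurable_nstep nstep_props(1,2)[OF x], of n n]
    by (simp add: \<mu>_nstep tv_dist_commute)
  then show "\<forall>\<^sub>F n in sequentially. tv_dist M (nstep M P n x) \<mu> \<le> (\<integral>y. dn n x y \<partial>\<mu>)" by simp
  show "\<forall>\<^sub>F n in sequentially. 0 \<le> tv_dist M (nstep M P n x) \<mu>"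
    using x by (simp add: tv_dist_nonneg nstep_props \<mu>_prob)
qed

text \<open>The probability of being in \<open>G\<close> need not tend to 1: one time at which it is
  close to 1 suffices, since the distance to \<mu> does not increase afterwards.\<close>

lemma tv_\<mu>_tendsto_0_entering:
  assumes x: "x \<in> space M" and G[measurable]: "G \<in> sets M"
    and lim: "\<And>z. z \<in> G \<Longrightarrow> (\<lambda>n. tv_dist M (nstep M P n z) \<mu>) \<longlonglongrightarrow> 0"
    and enter: "\<And>\<epsilon>. \<epsilon> > 0 \<Longrightarrow> \<exists>n. measure (nstep M P n x) G \<ge> 1 - \<epsilon>"
  shows "(\<lambda>n. tv_dist M (nstep M P n x) \<mu>) \<longlonglongrightarrow> 0"
proof (rule LIMSEQ_I)
  fix \<epsilon> :: real assume \<epsilon>: "0 < \<epsilon>"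
  obtain n where n: "measure (nstep M P n x) G \<ge> 1 - \<epsilon>/2" using enter[of "\<epsilon>/2"] \<epsilon> by auto
  interpret a: prob_space "nstep M P n x" using nstep_props(1)[OF x] .
  note [measurable_cong] = nstep_props(2)[OF x, of n]
  have sp: "space (nstep M P n x) = space M" using nstep_props(3)[OF x] .
  have b: "0 \<le> tv_dist M (nstep M P m z) \<mu>" "tv_dist M (nstep M P m z) \<mu> \<le> 1" if "z \<in> space M" for m z
    using that by (simp_all add: tv_dist_nonneg tv_dist_le_1 nstep_props \<mu>_prob)
  let ?g = "\<lambda>m z. indicator G z * tv_dist M (nstep M P m z) \<mu>"
  have gb: "\<bar>?g m z\<bar> \<le> 1" if "z \<in> space M" for m z using b[OF that] by (auto simp: indicator_def)
  have "(\<lambda>m. \<integral>z. ?g m z \<partial>nstep M P n x) \<longlonglongrightarrow> (\<integral>z. 0 \<partial>nstep M P n x)"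
  proof (rule bounded_convergence[where B=1])
    show "AE z in nstep M P n x. (\<lambda>m. ?g m z) \<longlonglongrightarrow> 0"
      by (rule AE_I2) (use lim in \<open>auto simp: indicator_def\<close>)
  qed (use gb sp in \<open>auto intro: a.finite_measure_axioms\<close>)
  then obtain m where m: "(\<integral>z. ?g m z \<partial>nstep M P n x) < \<epsilon>/2"
    using eventually_happens'[OF sequentially_bot order_tendstoD(2)[of _ 0 _ "\<epsilon>/2"]] \<epsilon> by force
  have integral_1_minus: "(\<integral>z. 1 - indicator G z \<partial>nstep M P n x) = 1 - measure (nstep M P n x) G"
    using sp G sets.sets_into_space[OF G]
    by (subst Bochner_Integration.integral_diff)
       (auto intro!: bounded_integrable[OF a.finite_measure_axioms, of _ 1] simp: a.prob_space[unfolded sp] Int_absorb1 Int_absorb2)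
  have "tv_dist M (nstep M P (n + m) x) \<mu> \<le> (\<integral>z. tv_dist M (nstep M P m z) \<mu> \<partial>nstep M P n x)"
    unfolding nstep_add[OF x]
    by (rule tv_dist_bind_le[OF cg nstep_props(1,2)[OF x] measurable_nstep \<mu>_prob sets_\<mu>])
  \<comment> \<open>Outside \<open>G\<close> the distance is replaced by its trivial bound 1, which
    costs at most \<open>\<epsilon>/2\<close>; inside \<open>G\<close> bounded convergence has made
    the integral smaller than \<open>\<epsilon>/2\<close>.\<close>
  also have "\<dots> \<le> (\<integral>z. ?g m z + (1 - indicator G z) \<partial>nstep M P n x)"
    using b gb sp by (intro integral_mono bounded_integrable[OF a.finite_measure_axioms, of _ 1]
        Bochner_Integration.integrable_add Bochner_Integration.integrable_diff) (auto simp: indicator_def)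
  also have "\<dots> = (\<integral>z. ?g m z \<partial>nstep M P n x) + (1 - measure (nstep M P n x) G)"
    using gb sp G sets.sets_into_space[OF G]
    by (subst Bochner_Integration.integral_add)
       (auto intro!: bounded_integrable[OF a.finite_measure_axioms, of _ 1]
             simp: a.prob_space Int_absorb1 Int_absorb2 integral_1_minus)
  finally have small: "tv_dist M (nstep M P (n + m) x) \<mu> < \<epsilon>" using m n by linarith
  show "\<exists>no. \<forall>k\<ge>no. norm (tv_dist M (nstep M P k x) \<mu> - 0) < \<epsilon>"
  proof (intro exI[of _ "n + m"] allI impI)
    fix k assume "n + m \<le> k"
    then obtain l where "k = n + m + l" using le_Suc_ex by blast
    then show "norm (tv_dist M (nstep M P k x) \<mu> - 0) < \<epsilon>"
      using tv_\<mu>_le[OF x, of "n + m" l] small b(1)[OF x, of k] by simp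
  qed
qed

end

subsection \<open>Couplings and asymptotic equivalence\<close>

text \<open>The coupling inequality: if the first coordinate lies in \<open>A\<close> and the second
  does not, then the pair is off the diagonal.\<close>

lemma coupling_tv_dist_le:
  assumes \<zeta>: "\<zeta> \<in> couplings a b" and sa: "sets a = sets M" and sb: "sets b = sets M"
    and diag: "Id_on (space M) \<in> sets (M \<Otimes>\<^sub>M M)"
  shows "tv_dist M a b \<le> 1 - measure \<zeta> (Id_on (space M))"
proof -
  have z: "prob_space \<zeta>" "sets \<zeta> = sets (M \<Otimes>\<^sub>M M)" "distr \<zeta> a fst = a" "distr \<zeta> b snd = b"
    using \<zeta> sets_pair_measure_cong[OF sa sb] by (auto simp: couplings_def)
  note [measurable_cong] = z(2) sa sb
  interpret \<zeta>: prob_space \<zeta> by fact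
  have spz: "space \<zeta> = space M \<times> space M"
    using sets_eq_imp_space_eq[OF z(2)] by (simp add: space_pair_measure)
  have ps: "prob_space a" "prob_space b"
    using \<zeta>.prob_space_distr[of fst a] \<zeta>.prob_space_distr[of snd b] z(3,4) by simp_all
  show ?thesis
  proof (rule tv_dist_le_signed[OF ps sa sb])
    fix A assume A[measurable]: "A \<in> sets M"
    have "measure a A = measure (distr \<zeta> a fst) A" "measure b A = measure (distr \<zeta> b snd) A"
      unfolding z(3,4) by auto
    then have "measure a A = measure \<zeta> (fst -` A \<inter> space \<zeta>)" "measure b A = measure \<zeta> (snd -` A \<inter> space \<zeta>)"
      using A sa sb by (simp_all add: measure_distr)
    moreover have "measure \<zeta> (fst -` A \<inter> space \<zeta>)
        \<le> measure \<zeta> ((snd -` A \<inter> space \<zeta>) \<union> (space \<zeta> - Id_on (space M)))"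
    proof (rule \<zeta>.finite_measure_mono)
      show "fst -` A \<inter> space \<zeta> \<subseteq> (snd -` A \<inter> space \<zeta>) \<union> (space \<zeta> - Id_on (space M))" by auto
      show "(snd -` A \<inter> space \<zeta>) \<union> (space \<zeta> - Id_on (space M)) \<in> sets \<zeta>"
        using diag z(2) by (intro sets.Un sets.compl_sets measurable_sets[of snd \<zeta> M]) auto
    qed
    moreover have "\<dots> \<le> measure \<zeta> (snd -` A \<inter> space \<zeta>) + measure \<zeta> (space \<zeta> - Id_on (space M))"
      using diag z(2) by (intro measure_Un_le sets.compl_sets measurable_sets[of snd \<zeta> M]) auto
    moreover have "measure \<zeta> (space \<zeta> - Id_on (space M)) = 1 - measure \<zeta> (Id_on (space M))"
      using diag z(2) by (intro \<zeta>.prob_compl) auto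
    ultimately show "measure a A - measure b A \<le> 1 - measure \<zeta> (Id_on (space M))" by linarith
  qed
qed

text \<open>The common part is coupled on the diagonal; the residuals, of common mass \<open>t\<close>, are coupled
  independently.  For \<open>t = 0\<close> the factor \<open>1 / t = 0\<close> does no harm, as the residuals vanish.\<close>

lemma maximal_coupling:
  assumes ps: "prob_space a" "prob_space b" and sa: "sets a = sets M" and sb: "sets b = sets M"
    and diag: "Id_on (space M) \<in> sets (M \<Otimes>\<^sub>M M)"
  shows "\<exists>\<zeta>\<in>couplings a b. 1 - tv_dist M a b \<le> measure \<zeta> (Id_on (space M))"
proof -
  define t where "t = tv_dist M a b"
  obtain c r1 r2 where fin: "finite_measure c" "finite_measure r1" "finite_measure r2"
    and sets: "sets c = sets M" "sets r1 = sets M" "sets r2 = sets M"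
    and e1: "\<And>A. A \<in> sets M \<Longrightarrow> emeasure a A = emeasure c A + emeasure r1 A"
    and e2: "\<And>A. A \<in> sets M \<Longrightarrow> emeasure b A = emeasure c A + emeasure r2 A"
    and mass: "measure r1 (space M) = t" "measure r2 (space M) = t" "measure c (space M) = 1 - t"
    using tv_dist_common_part[OF ps sa sb] unfolding t_def by metis
  note [measurable_cong] = sets sa sb
  interpret a: prob_space a by fact
  interpret b: prob_space b by fact
  interpret c: finite_measure c by fact
  interpret r1: finite_measure r1 by fact
  interpret r2: finite_measure r2 by fact
  have t0: "0 \<le> t" using mass by auto
  have sp: "space a = space M" "space b = space M" "space c = space M" "space r1 = space M" "space r2 = space M"
    using sa sb sets sets_eq_imp_space_eq by blast+
  define R where "R = scale_measure (ennreal (1 / t)) (r1 \<Otimes>\<^sub>M r2)"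
  have sR: "sets R = sets (M \<Otimes>\<^sub>M M)" unfolding R_def using sets by (simp cong: sets_pair_measure_cong)
  have eR: "emeasure R (A \<times> B) = ennreal (1 / t) * (emeasure r1 A * emeasure r2 B)"
    if "A \<in> sets M" "B \<in> sets M" for A B
    using that sets by (simp add: R_def r2.emeasure_pair_measure_Times)
  have cancel: "ennreal (1 / t) * (ennreal u * ennreal t) = ennreal u" if "0 \<le> u" "u \<le> t" for u
    using that by (cases "t = 0") (auto simp: ennreal_mult'[symmetric] simp flip: ennreal_mult)
  have R1: "emeasure R (A \<times> space M) = emeasure r1 A" if "A \<in> sets M" for A
  proof -
    have "measure r1 A \<le> t" using r1.bounded_measure[of A] mass sp by simp
    then show ?thesis using cancel[of "measure r1 A"] mass that
      by (simp add: eR r1.emeasure_eq_measure r2.emeasure_eq_measure)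
  qed
  have R2: "emeasure R (space M \<times> A) = emeasure r2 A" if "A \<in> sets M" for A
  proof -
    have "measure r2 A \<le> t" using r2.bounded_measure[of A] mass sp by simp
    then show ?thesis using cancel[of "measure r2 A"] mass that
      by (simp add: eR r1.emeasure_eq_measure r2.emeasure_eq_measure mult.commute)
  qed
  define dc where "dc = distr c (M \<Otimes>\<^sub>M M) (\<lambda>x. (x, x))"
  obtain \<zeta> where s\<zeta>: "sets \<zeta> = sets (M \<Otimes>\<^sub>M M)"
    and e\<zeta>: "\<And>A. A \<in> sets (M \<Otimes>\<^sub>M M) \<Longrightarrow> emeasure \<zeta> A = emeasure dc A + emeasure R A"
    using ex_plus_measure[of dc "M \<Otimes>\<^sub>M M" R] sR by (auto simp: dc_def)
  have sp\<zeta>: "space \<zeta> = space M \<times> space M" using sets_eq_imp_space_eq[OF s\<zeta>] by (simp add: space_pair_measure)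
  have d1: "emeasure dc (A \<times> space M) = emeasure c A" "emeasure dc (space M \<times> A) = emeasure c A"
    if "A \<in> sets M" for A
    using that sets.sets_into_space[OF that]
    by (auto simp: dc_def emeasure_distr sp intro!: arg_cong[where f="emeasure c"])
  have m1: "emeasure \<zeta> (A \<times> space M) = emeasure a A" "emeasure \<zeta> (space M \<times> A) = emeasure b A" if "A \<in> sets M" for A
    using that by (simp_all add: e\<zeta> d1 R1 R2 e1 e2)
  have p\<zeta>: "prob_space \<zeta>"
    using m1(1)[of "space M"] a.emeasure_space_1 by (intro prob_spaceI) (simp add: sp\<zeta> sp)
  note [measurable_cong] = s\<zeta>
  have f1: "distr \<zeta> a fst = a"
  proof (rule measure_eqI)
    fix A assume "A \<in> sets (distr \<zeta> a fst)"
    then have A: "A \<in> sets M" using sa by simp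
    then have "fst -` A \<inter> space \<zeta> = A \<times> space M" using sets.sets_into_space[OF A] by (auto simp: sp\<zeta>)
    then show "emeasure (distr \<zeta> a fst) A = emeasure a A" using A sa by (simp add: emeasure_distr m1)
  qed simp
  have f2: "distr \<zeta> b snd = b"
  proof (rule measure_eqI)
    fix A assume "A \<in> sets (distr \<zeta> b snd)"
    then have A: "A \<in> sets M" using sb by simp
    then have "snd -` A \<inter> space \<zeta> = space M \<times> A" using sets.sets_into_space[OF A] by (auto simp: sp\<zeta>)
    then show "emeasure (distr \<zeta> b snd) A = emeasure b A" using A sb by (simp add: emeasure_distr m1)
  qed simp
  have "emeasure dc (Id_on (space M)) = emeasure c (space M)"
    using diag by (auto simp: dc_def emeasure_distr sp intro!: arg_cong[where f="emeasure c"])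
  then have "ennreal (1 - t) \<le> emeasure \<zeta> (Id_on (space M))"
    using mass by (simp add: e\<zeta>[OF diag] c.emeasure_eq_measure)
  then have "1 - t \<le> measure \<zeta> (Id_on (space M))"
    using p\<zeta> by (simp add: finite_measure.emeasure_eq_measure[OF prob_space.finite_measure])
  moreover have "\<zeta> \<in> couplings a b"
    using p\<zeta> s\<zeta> f1 f2 sets_pair_measure_cong[OF sa sb] by (simp add: couplings_def)
  ultimately show ?thesis unfolding t_def by blast
qed

text \<open>\<open>N1\<close> and \<open>N2\<close> are the zero sets of the densities with respect to \<open>a + b\<close>.\<close>

lemma equivalence_off_null_sets:
  assumes fin: "finite_measure a" "finite_measure b" and sa: "sets a = sets M" and sb: "sets b = sets M"
  obtains N1 N2 where "N1 \<in> null_sets a" "N2 \<in> null_sets b"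
    "\<And>X. X \<in> sets M \<Longrightarrow> X \<inter> N1 = {} \<Longrightarrow> X \<inter> N2 = {} \<Longrightarrow> emeasure a X = 0 \<longleftrightarrow> emeasure b X = 0"
proof -
  obtain s where s: "sets s = sets M" "\<And>A. A \<in> sets M \<Longrightarrow> emeasure s A = emeasure a A + emeasure b A"
    using ex_plus_measure[OF sa sb] by auto
  note [measurable_cong] = s(1) sa sb
  have sp: "space s = space M" using s(1) sets_eq_imp_space_eq by blast
  have "finite_measure s" using s(2)[of "space M"] fin
    by (intro finite_measureI) (simp add: sp finite_measure.emeasure_finite)
  then interpret s: finite_measure s .
  have ac: "absolutely_continuous s a" "absolutely_continuous s b"
    using s sa sb by (auto simp: absolutely_continuous_def null_sets_def)
  obtain f where f[measurable]: "f \<in> borel_measurable s" "density s f = a"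
    using s.Radon_Nikodym[OF ac(1)] sa s(1) by auto
  obtain g where g[measurable]: "g \<in> borel_measurable s" "density s g = b"
    using s.Radon_Nikodym[OF ac(2)] sb s(1) by auto
  have null: "emeasure (density s h) X = 0 \<longleftrightarrow> (AE x in s. x \<in> X \<longrightarrow> h x = 0)"
    if "X \<in> sets M" "h \<in> borel_measurable s" for X h
    using that null_sets_density_iff[of h s X] s(1) by (simp add: null_sets_def)
  define N1 where "N1 = {x\<in>space M. f x = 0}"
  define N2 where "N2 = {x\<in>space M. g x = 0}"
  have N: "N1 \<in> sets M" "N2 \<in> sets M" unfolding N1_def N2_def by measurable
  show ?thesis
  proof (rule that[of N1 N2])
    have "emeasure (density s f) N1 = 0" "emeasure (density s g) N2 = 0"
      unfolding null[OF N(1) f(1)] null[OF N(2) g(1)] by (simp_all add: N1_def N2_def)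
    then show "N1 \<in> null_sets a" "N2 \<in> null_sets b"
      using N unfolding f(2) g(2) null_sets_def by (simp_all add: sa sb)
    fix X assume X: "X \<in> sets M" "X \<inter> N1 = {}" "X \<inter> N2 = {}"
    then have "x \<in> X \<Longrightarrow> f x \<noteq> 0" "x \<in> X \<Longrightarrow> g x \<noteq> 0" for x
      using sets.sets_into_space[OF X(1)] by (auto simp: N1_def N2_def)
    then have "(AE x in s. x \<in> X \<longrightarrow> f x = 0) \<longleftrightarrow> (AE x in s. x \<in> X \<longrightarrow> g x = 0)"
      by (intro AE_cong) blast
    then show "emeasure a X = 0 \<longleftrightarrow> emeasure b X = 0"
      using null[OF X(1) f(1)] null[OF X(1) g(1)] unfolding f(2) g(2) by blast
  qed
qed

lemma equivalent_measures_restrict_iff: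
  assumes "sets a = sets M" "sets b = sets M" "A \<in> sets M"
  shows "equivalent_measures (restrict_space a A) (restrict_space b A) \<longleftrightarrow>
    (\<forall>X\<in>sets M. X \<subseteq> A \<longrightarrow> emeasure a X = 0 \<longleftrightarrow> emeasure b X = 0)"
proof -
  have "N \<in> null_sets (restrict_space m A) \<longleftrightarrow> N \<subseteq> A \<and> N \<in> sets M \<and> emeasure m N = 0"
    if "sets m = sets M" for m N
    unfolding null_sets_restrict_space[of A m N, unfolded that, OF assms(3)] using that by (simp add: null_sets_def)
  from this[OF assms(1)] this[OF assms(2)] show ?thesis
    unfolding equivalent_measures_def absolutely_continuous_def subset_iff[of "null_sets _"] by metis
qed

context markov_kernel
begin

text \<open>Removing the zero sets of both densities leaves a set on which the two laws are
  equivalent. Each removed set is null for one law, so the hypothesis makes it small for the other;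
  no exact mass has to be computed.\<close>

lemma asymptotically_equivalentI:
  assumes x: "x \<in> space M" and y: "y \<in> space M"
    and ex: "\<And>\<epsilon>. 0 < \<epsilon> \<Longrightarrow> \<exists>n\<ge>1. \<forall>N\<in>sets M.
      (emeasure (nstep M P n x) N = 0 \<longrightarrow> measure (nstep M P n y) N \<le> \<epsilon>) \<and>
      (emeasure (nstep M P n y) N = 0 \<longrightarrow> measure (nstep M P n x) N \<le> \<epsilon>)"
  shows "asymptotically_equivalent M P x y"
  unfolding asymptotically_equivalent_def
proof (intro allI impI)
  fix \<epsilon> :: real assume "0 < \<epsilon>"
  then obtain n where n: "n \<ge> 1" "\<And>N. N \<in> sets M \<Longrightarrow> emeasure (nstep M P n x) N = 0 \<Longrightarrow> measure (nstep M P n y) N \<le> \<epsilon>"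
      "\<And>N. N \<in> sets M \<Longrightarrow> emeasure (nstep M P n y) N = 0 \<Longrightarrow> measure (nstep M P n x) N \<le> \<epsilon>"
    using ex by metis
  let ?a = "nstep M P n x" and ?b = "nstep M P n y"
  note s = nstep_props(2)[OF x, of n] nstep_props(2)[OF y, of n]
  interpret a: prob_space ?a by (rule nstep_props(1)[OF x])
  interpret b: prob_space ?b by (rule nstep_props(1)[OF y])
  obtain N1 N2 where N: "N1 \<in> null_sets ?a" "N2 \<in> null_sets ?b"
    and eq: "\<And>X. X \<in> sets M \<Longrightarrow> X \<inter> N1 = {} \<Longrightarrow> X \<inter> N2 = {} \<Longrightarrow> emeasure ?a X = 0 \<longleftrightarrow> emeasure ?b X = 0"
    using equivalence_off_null_sets[OF finite_nstep[OF x] finite_nstep[OF y] s] by metis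
  have N': "N1 \<in> sets M" "N2 \<in> sets M" using N s by auto
  define A where "A = space M - (N1 \<union> N2)"
  have A: "A \<in> sets M" using N' by (auto simp: A_def)
  have large: "1 - \<epsilon> \<le> measure m A" if "prob_space m" "sets m = sets M" "measure m N1 + measure m N2 \<le> \<epsilon>" for m
  proof -
    interpret m: prob_space m by fact
    have "space m = space M" using that(2) sets_eq_imp_space_eq by blast
    then have "measure m A = 1 - measure m (N1 \<union> N2)"
      unfolding A_def using m.prob_compl[of "N1 \<union> N2"] N' that(2) by auto
    moreover have "measure m (N1 \<union> N2) \<le> measure m N1 + measure m N2"
      using N' that(2) by (intro measure_Un_le) auto
    ultimately show ?thesis using that(3) by linarith
  qed
  have ea: "emeasure ?a N1 = 0" "emeasure ?b N2 = 0" using N by auto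
  then have z: "measure ?a N1 = 0" "measure ?b N2 = 0" by (simp_all add: measure_def)
  show "\<exists>n\<ge>1. \<exists>A\<in>sets M. 1 - \<epsilon> \<le> measure (nstep M P n x) A \<and> 1 - \<epsilon> \<le> measure (nstep M P n y) A \<and>
      equivalent_measures (restrict_space (nstep M P n x) A) (restrict_space (nstep M P n y) A)"
  proof (intro exI[of _ n] conjI bexI[OF _ A] n(1))
    show "1 - \<epsilon> \<le> measure ?a A"
      by (rule large[OF a.prob_space_axioms s(1)]) (use z n(3)[OF N'(2)] ea in simp)
    show "1 - \<epsilon> \<le> measure ?b A"
      by (rule large[OF b.prob_space_axioms s(2)]) (use z n(2)[OF N'(1)] ea in simp)
    show "equivalent_measures (restrict_space ?a A) (restrict_space ?b A)"
      unfolding equivalent_measures_restrict_iff[OF s A]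
      by (intro ballI impI eq) (auto simp: A_def)
  qed
qed

text \<open>Distance 1 would mean that some \<open>H\<close> separates the two laws. By equivalence
  on \<open>A\<close>, both \<open>A \<inter> H\<close> and \<open>A - H\<close> would then be null
  for the law from \<open>x\<close>, although \<open>A\<close> has positive mass; the constant 1/2
  only ensures this positivity.\<close>

lemma asymptotically_equivalent_D_less_1:
  assumes x: "x \<in> space M" and y: "y \<in> space M" and eq: "asymptotically_equivalent M P x y"
  shows "D x y < 1"
proof -
  obtain n A where A: "A \<in> sets M" "measure (nstep M P n x) A \<ge> 1/2"
    "equivalent_measures (restrict_space (nstep M P n x) A) (restrict_space (nstep M P n y) A)"
    using eq[unfolded asymptotically_equivalent_def, rule_format, of "1/2"] by auto
  note s = nstep_props(2)[OF x, of n] nstep_props(2)[OF y, of n]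
  have equiv: "emeasure (nstep M P n x) X = 0 \<longleftrightarrow> emeasure (nstep M P n y) X = 0" if "X \<in> sets M" "X \<subseteq> A" for X
    using A(3) that unfolding equivalent_measures_restrict_iff[OF s A(1)] by blast
  obtain c r1 r2 H where fin: "finite_measure c" "finite_measure r1" "finite_measure r2"
    and sets: "sets c = sets M" "sets r1 = sets M" "sets r2 = sets M" "H \<in> sets M"
    and e: "\<And>A. A \<in> sets M \<Longrightarrow> emeasure (nstep M P n x) A = emeasure c A + emeasure r1 A"
      "\<And>A. A \<in> sets M \<Longrightarrow> emeasure (nstep M P n y) A = emeasure c A + emeasure r2 A"
    and H: "emeasure r1 (space M - H) = 0" "emeasure r2 H = 0"
    and mass: "measure c (space M) = 1 - dn n x y"
    using tv_dist_common_part[OF nstep_props(1)[OF x] nstep_props(1)[OF y] s] by metis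
  have "dn n x y \<noteq> 1"
  proof
    assume "dn n x y = 1"
    then have "emeasure c (space M) = 0"
      using mass fin(1) by (simp add: finite_measure.emeasure_eq_measure)
    then have c0: "emeasure c X = 0" if "X \<in> sets M" for X
      using emeasure_mono[of X "space M" c] sets that sets.sets_into_space[OF that] by auto
    have "emeasure r2 (A \<inter> H) \<le> emeasure r2 H" using sets A by (intro emeasure_mono) auto
    then have "emeasure (nstep M P n y) (A \<inter> H) = 0" using c0 e(2) H sets A by simp
    then have 1: "emeasure (nstep M P n x) (A \<inter> H) = 0" using equiv[of "A \<inter> H"] A sets by auto
    have "emeasure r1 (A - H) \<le> emeasure r1 (space M - H)"
      using sets A sets.sets_into_space[OF A(1)] by (intro emeasure_mono) auto
    then have 2: "emeasure (nstep M P n x) (A - H) = 0" using c0 e(1) H sets A by simp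
    have "emeasure (nstep M P n x) A = emeasure (nstep M P n x) (A \<inter> H) + emeasure (nstep M P n x) (A - H)"
      using A sets s by (subst plus_emeasure) (auto intro!: arg_cong[where f="emeasure _"])
    then show False using 1 2 A(2) by (simp add: measure_def)
  qed
  then show ?thesis using dn_bounds(2)[OF x y, of n] D_le[OF x y, of n] by linarith
qed

lemma cond_C_D_zero:
  assumes diag: "Id_on (space M) \<in> sets (M \<Otimes>\<^sub>M M)" and C: "cond_C M P" and x: "x \<in> space M" and y: "y \<in> space M"
  shows "D x y = 0"
proof -
  have "D x y \<le> 1 / real m" if "m \<ge> 1" for m
  proof -
    obtain k \<zeta> where \<zeta>: "\<zeta> \<in> couplings (nstep M P k x) (nstep M P k y)" "measure \<zeta> (Id_on (space M)) \<ge> 1 - 1 / real m"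
      using C x y \<open>m \<ge> 1\<close> unfolding cond_C_def by blast
    show ?thesis using coupling_tv_dist_le[OF \<zeta>(1) nstep_props(2)[OF x] nstep_props(2)[OF y] diag] \<zeta>(2) D_le[OF x y, of k]
      by linarith
  qed
  then have "D x y \<le> 0" by (intro LIMSEQ_le_const[OF lim_1_over_n]) (auto intro!: exI[of _ 1])
  then show ?thesis using D_bounds(1)[OF x y] by linarith
qed

lemma cond_C_hat_imp_C:
  assumes "cond_C_hat M P"
  shows "cond_C M P"
  unfolding cond_C_def
proof (intro ballI allI impI)
  fix x y and m :: nat assume xy: "x \<in> space M" "y \<in> space M" and m: "1 \<le> m"
  obtain \<zeta> where \<zeta>: "\<And>m. m \<ge> 1 \<Longrightarrow> \<zeta> m \<in> couplings (nstep M P m x) (nstep M P m y)"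
    "(\<lambda>m. measure (\<zeta> m) (Id_on (space M))) \<longlonglongrightarrow> 1"
    using assms xy unfolding cond_C_hat_def by blast
  have "\<forall>\<^sub>F k in sequentially. 1 - 1 / real m < measure (\<zeta> k) (Id_on (space M)) \<and> 1 \<le> k"
    using order_tendstoD(1)[OF \<zeta>(2), of "1 - 1 / real m"] m eventually_ge_at_top[of 1]
    by (intro eventually_conj) auto
  then obtain k where "1 - 1 / real m < measure (\<zeta> k) (Id_on (space M))" "1 \<le> k"
    using eventually_happens'[OF sequentially_bot] by blast
  then show "\<exists>k. \<exists>\<zeta>\<in>couplings (nstep M P k x) (nstep M P k y). 1 - 1 / real m \<le> measure \<zeta> (Id_on (space M))"
    using \<zeta>(1) by (intro exI[of _ k] bexI[of _ "\<zeta> k"]) auto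
qed

end

section \<open>Convergence in total variation, couplings and asymptotic equivalence\<close>

context stationary_kernel
begin

lemma cond_C_imp_P:
  assumes "Id_on (space M) \<in> sets (M \<Otimes>\<^sub>M M)" "cond_C M P"
  shows "cond_P M P \<mu>"
  unfolding cond_P_def
proof
  fix x assume x: "x \<in> space M"
  show "(\<lambda>n. tv_dist M (nstep M P n x) \<mu>) \<longlonglongrightarrow> 0"
    by (rule tv_\<mu>_tendsto_0[OF x AE_I2]) (simp add: space_\<mu> cond_C_D_zero[OF assms x])
qed

lemma cond_P_D_zero:
  assumes P: "cond_P M P \<mu>" and x: "x \<in> space M" and y: "y \<in> space M"
  shows "D x y = 0"
proof -
  have "(\<lambda>n. tv_dist M (nstep M P n x) \<mu> + tv_dist M (nstep M P n y) \<mu>) \<longlonglongrightarrow> 0 + 0"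
    using P x y unfolding cond_P_def by (intro tendsto_add) auto
  then have "D x y \<le> 0 + 0"
    by (rule LIMSEQ_le[OF dn_tendsto[OF x y]])
       (use tv_dist_triangle[OF nstep_props(1)[OF x] \<mu>_prob nstep_props(1)[OF y], of M] in
         \<open>auto simp: tv_dist_commute[of M \<mu>]\<close>)
  then show ?thesis using D_bounds(1)[OF x y] by linarith
qed

lemma cond_P_imp_C_hat:
  assumes diag: "Id_on (space M) \<in> sets (M \<Otimes>\<^sub>M M)" and P: "cond_P M P \<mu>"
  shows "cond_C_hat M P"
  unfolding cond_C_hat_def
proof (intro ballI)
  fix x y assume x: "x \<in> space M" and y: "y \<in> space M"
  have "\<forall>m. \<exists>\<zeta>. \<zeta> \<in> couplings (nstep M P m x) (nstep M P m y) \<and> 1 - dn m x y \<le> measure \<zeta> (Id_on (space M))"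
    using maximal_coupling[OF nstep_props(1)[OF x] nstep_props(1)[OF y] nstep_props(2)[OF x] nstep_props(2)[OF y] diag]
    by blast
  then obtain \<zeta> where \<zeta>: "\<And>m. \<zeta> m \<in> couplings (nstep M P m x) (nstep M P m y)"
    "\<And>m. 1 - dn m x y \<le> measure (\<zeta> m) (Id_on (space M))" by metis
  have "measure (\<zeta> m) (Id_on (space M)) \<le> 1" for m
    using \<zeta>(1)[of m] by (intro prob_space.prob_le_1) (simp add: couplings_def)
  moreover have "(\<lambda>m. 1 - dn m x y) \<longlonglongrightarrow> 1 - 0"
    using dn_tendsto[OF x y] cond_P_D_zero[OF P x y] by (intro tendsto_intros) simp
  ultimately have "(\<lambda>m. measure (\<zeta> m) (Id_on (space M))) \<longlonglongrightarrow> 1"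
    by (intro tendsto_sandwich[OF always_eventually[OF allI[OF \<zeta>(2)]] _ _ tendsto_const])
       (simp_all only: diff_zero always_eventually simp_thms)
  then show "\<exists>\<zeta>. (\<forall>m\<ge>1. \<zeta> m \<in> couplings (nstep M P m x) (nstep M P m y)) \<and>
            (\<lambda>m. measure (\<zeta> m) (Id_on (space M))) \<longlonglongrightarrow> 1"
    using \<zeta>(1) by blast
qed

lemma cond_P_imp_A:
  assumes P: "cond_P M P \<mu>"
  shows "cond_A M P"
  unfolding cond_A_def
proof (intro ballI asymptotically_equivalentI)
  fix x y and \<epsilon> :: real assume x: "x \<in> space M" and y: "y \<in> space M" and "0 < \<epsilon>"
  have "\<forall>\<^sub>F n in sequentially. dn n x y < \<epsilon> \<and> 1 \<le> n"
    using order_tendstoD(2)[OF dn_tendsto[OF x y], of \<epsilon>] \<open>0 < \<epsilon>\<close> cond_P_D_zero[OF P x y] eventually_ge_at_top[of 1]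
    by (intro eventually_conj) auto
  then obtain n where n: "dn n x y < \<epsilon>" "1 \<le> n" using eventually_happens'[OF sequentially_bot] by blast
  show "\<exists>n\<ge>1. \<forall>N\<in>sets M.
      (emeasure (nstep M P n x) N = 0 \<longrightarrow> measure (nstep M P n y) N \<le> \<epsilon>) \<and>
      (emeasure (nstep M P n y) N = 0 \<longrightarrow> measure (nstep M P n x) N \<le> \<epsilon>)"
  proof (intro exI[of _ n] conjI ballI n impI)
    fix N assume "N \<in> sets M"
    then have "\<bar>measure (nstep M P n x) N - measure (nstep M P n y) N\<bar> < \<epsilon>"
      using tv_dist_bound[OF nstep_props(1)[OF x] nstep_props(1)[OF y], of N M n n] n by simp
    then show "emeasure (nstep M P n x) N = 0 \<Longrightarrow> measure (nstep M P n y) N \<le> \<epsilon>"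
      "emeasure (nstep M P n y) N = 0 \<Longrightarrow> measure (nstep M P n x) N \<le> \<epsilon>"
      by (auto simp: measure_def)
  qed
qed

lemma tv_\<mu>_tendsto_0_of_class:
  assumes z0: "z0 \<in> space M" and ae: "AE y in \<mu>. D z0 y = 0" and z: "z \<in> space M" "D z0 z = 0"
  shows "(\<lambda>n. tv_dist M (nstep M P n z) \<mu>) \<longlonglongrightarrow> 0"
proof (rule tv_\<mu>_tendsto_0[OF z(1)])
  show "AE y in \<mu>. D z y = 0" using ae AE_space
  proof eventually_elim
    case (elim y)
    then have y: "y \<in> space M" by (simp add: space_\<mu>)
    show ?case using D_triangle[OF z(1) z0 y] D_bounds(1)[OF z(1) y] elim z(2) by (simp add: D_commute[of z z0])
  qed
qed

text \<open>The zero-one property covers only almost every pair. To reach an arbitrary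
  \<open>x\<close>, it is compared with a typical \<open>y0\<close> whose laws at all times live on
  the class \<open>G\<close> of a good point: where the law from \<open>x\<close> is equivalent to
  the law from \<open>y0\<close>, it cannot charge the complement of \<open>G\<close>.\<close>

lemma cond_A_imp_P:
  assumes A: "cond_A M P"
  shows "cond_P M P \<mu>"
proof -
  interpret \<mu>: prob_space \<mu> by (rule \<mu>_prob)
  interpret pp: pair_prob_space \<mu> \<mu> ..
  have "AE p in \<mu> \<Otimes>\<^sub>M \<mu>. D (fst p) (snd p) = 0" using D_zero_one AE_space
  proof eventually_elim
    case (elim p)
    then have "fst p \<in> space M" "snd p \<in> space M" by (auto simp: space_pair_measure space_\<mu>)
    then have "D (fst p) (snd p) < 1"
      using A unfolding cond_A_def by (intro asymptotically_equivalent_D_less_1) blast+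
    then show ?case using elim(1) by linarith
  qed
  from pp.AE_pair[OF this] have "AE x in \<mu>. AE y in \<mu>. D x y = 0" by simp
  with AE_space have "AE x in \<mu>. x \<in> space M \<and> (AE y in \<mu>. D x y = 0)"
    by eventually_elim (simp add: space_\<mu>)
  then obtain z0 where z0: "z0 \<in> space M" "AE y in \<mu>. D z0 y = 0"
    using eventually_happens'[OF \<mu>.ae_filter_bot] by blast
  note [measurable] = measurable_D1[OF z0(1)]
  define G where "G = {y\<in>space M. D z0 y = 0}"
  have G[measurable]: "G \<in> sets M" unfolding G_def by measurable
  have "AE y in \<mu>. y \<in> G" using z0(2) AE_space by eventually_elim (simp add: G_def space_\<mu>)
  then have "AE y in \<mu> \<bind> nstep M P n. y \<in> G" for n unfolding \<mu>_nstep .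
  moreover have "nstep M P n \<in> \<mu> \<rightarrow>\<^sub>M subprob_algebra M" for n by measurable
  ultimately have "AE x in \<mu>. AE y in nstep M P n x. y \<in> G" for n
    by (subst (asm) AE_bind[where B=M]) auto
  then have "AE x in \<mu>. \<forall>n. AE y in nstep M P n x. y \<in> G" by (simp add: AE_all_countable)
  with AE_space have "AE x in \<mu>. x \<in> space M \<and> (\<forall>n. AE y in nstep M P n x. y \<in> G)"
    by eventually_elim (simp add: space_\<mu>)
  then obtain y0 where y0: "y0 \<in> space M" "\<And>n. AE y in nstep M P n y0. y \<in> G"
    using eventually_happens'[OF \<mu>.ae_filter_bot] by blast
  show ?thesis
    unfolding cond_P_def
  proof
    fix x assume x: "x \<in> space M"
    show "(\<lambda>n. tv_dist M (nstep M P n x) \<mu>) \<longlonglongrightarrow> 0"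
    proof (rule tv_\<mu>_tendsto_0_entering[OF x G])
      show "(\<lambda>n. tv_dist M (nstep M P n z) \<mu>) \<longlonglongrightarrow> 0" if "z \<in> G" for z
        using tv_\<mu>_tendsto_0_of_class[OF z0] that by (simp add: G_def)
      fix \<epsilon> :: real assume "0 < \<epsilon>"
      then obtain n B where B: "B \<in> sets M" "measure (nstep M P n x) B \<ge> 1 - \<epsilon>"
        "equivalent_measures (restrict_space (nstep M P n x) B) (restrict_space (nstep M P n y0) B)"
        using A x y0(1) unfolding cond_A_def asymptotically_equivalent_def by meson
      interpret a: prob_space "nstep M P n x" by (rule nstep_props(1)[OF x])
      note s = nstep_props(2)[OF x, of n] nstep_props(2)[OF y0(1), of n]
      have sp: "space (nstep M P n y0) = space M" by (rule nstep_props(3)[OF y0(1)])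
      have "emeasure (nstep M P n y0) (B - G) = 0"
        using y0(2)[of n] B(1) s(2) sets.sets_into_space[OF B(1)]
        by (subst AE_iff_measurable[symmetric, where P="\<lambda>y. y \<notin> B - G"]) (auto simp: sp)
      then have "emeasure (nstep M P n x) (B - G) = 0"
        using B(3) B(1) unfolding equivalent_measures_restrict_iff[OF s B(1)] by auto
      then have "measure (nstep M P n x) (B - G) = 0" by (simp add: measure_def)
      moreover have "measure (nstep M P n x) B \<le> measure (nstep M P n x) (G \<union> (B - G))"
        using B(1) s by (intro a.finite_measure_mono) auto
      moreover have "\<dots> \<le> measure (nstep M P n x) G + measure (nstep M P n x) (B - G)"
        using B(1) s by (intro measure_Un_le) auto
      ultimately show "\<exists>n. measure (nstep M P n x) G \<ge> 1 - \<epsilon>" using B(2) by (intro exI[of _ n]) linarith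
    qed
  qed
qed

end

subsection \<open>The law of the chain\<close>

text \<open>For a Markov kernel and a nonempty list \<open>[f0, ..., fn]\<close> this is the
  expectation of the product of the \<open>fi\<close> evaluated at the \<open>i\<close>-th state,
  for the chain started at \<open>x\<close>. The recursion conditions on the first step.\<close>

primrec cylinder_integral :: "('a \<Rightarrow> 'a measure) \<Rightarrow> ('a \<Rightarrow> ennreal) list \<Rightarrow> 'a \<Rightarrow> ennreal" where
  "cylinder_integral P [] x = 1"
| "cylinder_integral P (f # fs) x = f x * (\<integral>\<^sup>+y. cylinder_integral P fs y \<partial>P x)"

definition cylinder :: "'a measure \<Rightarrow> nat \<Rightarrow> (nat \<Rightarrow> 'a set) \<Rightarrow> (nat \<Rightarrow> 'a) set" where
  "cylinder M n A = {\<omega> \<in> space (PiM UNIV (\<lambda>_. M)). \<forall>i<n. \<omega> i \<in> A i}"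

definition cylinders :: "'a measure \<Rightarrow> (nat \<Rightarrow> 'a) set set" where
  "cylinders M = {cylinder M n A | n A. \<forall>i. A i \<in> sets M}"

lemma cylinder_sets:
  assumes [measurable]: "\<And>i. A i \<in> sets M"
  shows "cylinder M n A \<in> sets (PiM UNIV (\<lambda>_. M))"
  unfolding cylinder_def by measurable

lemma sets_PiM_cylinders:
  "sets (PiM UNIV (\<lambda>_::nat. M)) = sigma_sets (space (PiM UNIV (\<lambda>_. M))) (cylinders M)"
proof (rule antisym)
  have "prod_algebra UNIV (\<lambda>_. M) \<subseteq> cylinders M"
  proof
    fix X assume "X \<in> prod_algebra UNIV (\<lambda>_::nat. M)"
    then obtain J E where J: "finite J" and E: "\<And>i. i \<in> J \<Longrightarrow> E i \<in> sets M"
      and X: "X = prod_emb UNIV (\<lambda>_. M) J (\<Pi>\<^sub>E j\<in>J. E j)"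
      by (rule prod_algebraE) auto
    obtain n where n: "J \<subseteq> {..<n}" using finite_nat_iff_bounded J by auto
    have "X = cylinder M n (\<lambda>i. if i \<in> J then E i else space M)"
      unfolding X cylinder_def prod_emb_def using n by (auto simp: space_PiM PiE_iff) fastforce
    then show "X \<in> cylinders M" unfolding cylinders_def using E by fastforce
  qed
  then show "sets (PiM UNIV (\<lambda>_::nat. M)) \<subseteq> sigma_sets (space (PiM UNIV (\<lambda>_. M))) (cylinders M)"
    unfolding sets_PiM space_PiM by (rule sigma_sets_mono')
  show "sigma_sets (space (PiM UNIV (\<lambda>_. M))) (cylinders M) \<subseteq> sets (PiM UNIV (\<lambda>_::nat. M))"
    by (rule sets.sigma_sets_subset) (auto simp: cylinders_def intro!: cylinder_sets)
qed

lemma cylinders_Pow: "cylinders M \<subseteq> Pow (space (PiM UNIV (\<lambda>_. M)))"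
  by (auto simp: cylinders_def cylinder_def)

lemma Int_stable_cylinders: "Int_stable (cylinders M)"
proof (rule Int_stableI)
  fix a b assume "a \<in> cylinders M" "b \<in> cylinders M"
  then obtain n A m B where a: "a = cylinder M n A" "\<And>i. A i \<in> sets M" and b: "b = cylinder M m B" "\<And>i. B i \<in> sets M"
    unfolding cylinders_def by blast
  have "a \<inter> b = cylinder M (max n m) (\<lambda>i. (if i < n then A i else space M) \<inter> (if i < m then B i else space M))"
    unfolding a b cylinder_def by (auto simp: space_PiM PiE_iff)
  moreover have "(if i < n then A i else space M) \<inter> (if i < m then B i else space M) \<in> sets M" for i
    using a b by auto
  ultimately show "a \<inter> b \<in> cylinders M" unfolding cylinders_def by blast
qed

lemma space_cylinder: "space (PiM UNIV (\<lambda>_. M)) = cylinder M 0 (\<lambda>_. space M)"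
  by (simp add: cylinder_def)

lemma path_measure_eqI:
  assumes "finite_measure a" and s: "sets a = sets (PiM UNIV (\<lambda>_. M))" "sets b = sets (PiM UNIV (\<lambda>_. M))"
    and eq: "\<And>n A. (\<And>i. A i \<in> sets M) \<Longrightarrow> emeasure a (cylinder M n A) = emeasure b (cylinder M n A)"
  shows "a = b"
proof (rule measure_eqI_generator_eq[OF Int_stable_cylinders cylinders_Pow])
  interpret a: finite_measure a by fact
  show "range (\<lambda>_::nat. space (PiM UNIV (\<lambda>_. M))) \<subseteq> cylinders M"
    unfolding cylinders_def space_cylinder by blast
  show "sets a = sigma_sets (space (Pi\<^sub>M UNIV (\<lambda>_. M))) (cylinders M)"
    "sets b = sigma_sets (space (Pi\<^sub>M UNIV (\<lambda>_. M))) (cylinders M)"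
    unfolding s sets_PiM_cylinders by simp_all
qed (use eq assms(1) in \<open>auto simp: cylinders_def finite_measure.emeasure_finite\<close>)

context markov_kernel
begin

abbreviation "S \<equiv> PiM UNIV (\<lambda>_::nat. M)"

lemma measurable_cylinder_integral:
  "(\<And>f. f \<in> set fs \<Longrightarrow> f \<in> borel_measurable M) \<Longrightarrow> cylinder_integral P fs \<in> borel_measurable M"
proof (induction fs)
  case Nil
  then show ?case by (simp add: cylinder_integral_def)
next
  case (Cons f fs)
  have [measurable]: "cylinder_integral P fs \<in> borel_measurable M" "f \<in> borel_measurable M" using Cons by auto
  have "(\<lambda>x. f x * (\<integral>\<^sup>+y. cylinder_integral P fs y \<partial>P x)) \<in> borel_measurable M" by measurable
  then show ?case by simp
qed

text \<open>The Ionescu-Tulcea construction adds coordinates at the end of a path, whereas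
  \<open>cylinder_integral\<close> peels them off at the front. Integrating out the last coordinate
  mediates between the two.\<close>

lemma cylinder_integral_snoc:
  assumes "\<And>f. f \<in> set fs \<Longrightarrow> f \<in> borel_measurable M" "x \<in> space M"
  shows "cylinder_integral P (fs @ [f, g]) x = cylinder_integral P (fs @ [\<lambda>y. f y * (\<integral>\<^sup>+z. g z \<partial>P y)]) x"
  using assms
proof (induction fs arbitrary: x)
  case Nil
  have one: "(\<integral>\<^sup>+z. 1 \<partial>P y) = 1" if "y \<in> space M" for y
    using prob_space.emeasure_space_1[OF kernel_props(1)[OF P that]] by simp
  have "(\<integral>\<^sup>+y. g y * (\<integral>\<^sup>+z. 1 \<partial>P y) \<partial>P x) = (\<integral>\<^sup>+y. g y \<partial>P x)"
    using Nil one kernel_props(3)[OF P Nil(2)] by (intro nn_integral_cong) auto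
  then show ?case using one[OF Nil(2)] by simp
next
  case (Cons h fs)
  have "(\<integral>\<^sup>+y. cylinder_integral P (fs @ [f, g]) y \<partial>P x)
      = (\<integral>\<^sup>+y. cylinder_integral P (fs @ [\<lambda>y. f y * (\<integral>\<^sup>+z. g z \<partial>P y)]) y \<partial>P x)"
    using Cons kernel_props(3)[OF P Cons(3)] by (intro nn_integral_cong) auto
  then show ?case by simp
qed

text \<open>Induction on the number of steps: the last coordinate is integrated out, and the outcome
  is absorbed into the preceding test function, called \<open>k\<close> below.\<close>

lemma nn_integral_Ionescu_Tulcea_C:
  assumes x: "x \<in> space M" and "\<And>f. f \<in> set fs \<Longrightarrow> f \<in> borel_measurable M" "length fs = Suc n"
  shows "(\<integral>\<^sup>+\<omega>. (\<Prod>i<Suc n. (fs ! i) (\<omega> i)) \<partial>Ionescu_Tulcea.C (step_law M P x) (\<lambda>_. M) 0 (Suc n) (\<lambda>_. undefined))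
    = cylinder_integral P fs x"
proof -
  interpret IT: Ionescu_Tulcea "step_law M P x" "\<lambda>_. M"
    by (rule Ionescu_Tulcea_step_law[OF P x])
  \<comment> \<open>The history before time 0 is the empty tuple, whose only representative is
    \<open>\<lambda>_. undefined\<close>.\<close>
  have u[simp]: "(\<lambda>_::nat. undefined) \<in> space (PiM {0..<0} (\<lambda>_. M))"
    by (auto simp: space_PiM PiE_iff extensional_def)
  have step: "(\<integral>\<^sup>+\<omega>. F \<omega> \<partial>IT.C 0 (Suc n) (\<lambda>_. undefined))
      = (\<integral>\<^sup>+\<omega>. \<integral>\<^sup>+y. F (fun_upd \<omega> n y) \<partial>step_law M P x n \<omega> \<partial>IT.C 0 n (\<lambda>_. undefined))"
    if "F \<in> borel_measurable (PiM {0..<Suc n} (\<lambda>_. M))" for n F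
  proof -
    have "(\<integral>\<^sup>+\<omega>. F \<omega> \<partial>IT.C 0 (Suc n) (\<lambda>_. undefined))
        = (\<integral>\<^sup>+\<omega>. \<integral>\<^sup>+v. F v \<partial>IT.eP n \<omega> \<partial>IT.C 0 n (\<lambda>_. undefined))"
      unfolding IT.C.simps add_0
      by (rule nn_integral_bind[where B="PiM {0..<Suc n} (\<lambda>_. M)"])
         (use that IT.sets_C[OF u, of n] IT.measurable_eP[of n] in \<open>auto cong: measurable_cong_sets\<close>)
    also have "\<dots> = (\<integral>\<^sup>+\<omega>. \<integral>\<^sup>+y. F (fun_upd \<omega> n y) \<partial>step_law M P x n \<omega> \<partial>IT.C 0 n (\<lambda>_. undefined))"
      using IT.space_C[OF u, of n] by (intro nn_integral_cong IT.nn_integral_eP that) auto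
    finally show ?thesis .
  qed
  have meas: "(\<lambda>\<omega>. \<Prod>i<k. (gs ! i) (\<omega> i)) \<in> borel_measurable (PiM {0..<m} (\<lambda>_. M))"
    if "\<And>f. f \<in> set gs \<Longrightarrow> f \<in> borel_measurable M" "k \<le> length gs" "k \<le> m" for gs :: "('a \<Rightarrow> ennreal) list" and k m
  proof (rule borel_measurable_prod_ennreal)
    fix i assume "i \<in> {..<k}"
    then have [measurable]: "gs ! i \<in> borel_measurable M" "(\<lambda>\<omega>. \<omega> i) \<in> PiM {0..<m} (\<lambda>_. M) \<rightarrow>\<^sub>M M"
      using that by (auto intro!: measurable_component_singleton)
    show "(\<lambda>\<omega>. (gs ! i) (\<omega> i)) \<in> borel_measurable (PiM {0..<m} (\<lambda>_. M))" by measurable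
  qed
  show ?thesis using assms(2,3)
  proof (induction n arbitrary: fs)
    case 0
    then obtain f where fs: "fs = [f]" by (cases fs) auto
    have f[measurable]: "f \<in> borel_measurable M" using 0 fs by auto
    have "(\<lambda>\<omega>. f (\<omega> 0)) \<in> borel_measurable (PiM {0..<Suc 0} (\<lambda>_. M))"
      using meas[of fs 1 1, OF 0(1)] fs by simp
    moreover have "emeasure (return (PiM {} (\<lambda>_::nat. M)) (\<lambda>_. undefined)) {\<lambda>_. undefined} = 1"
      by (subst emeasure_return) (auto simp: sets_PiM_empty)
    ultimately have "(\<integral>\<^sup>+\<omega>. f (\<omega> 0) \<partial>IT.C 0 (Suc 0) (\<lambda>_. undefined)) = (\<integral>\<^sup>+y. f y \<partial>return M x)"
      by (subst step) (auto simp: nn_integral_return space_PiM step_law_def intro!: measurable_const)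
    moreover have "(\<integral>\<^sup>+y. 1 \<partial>P x) = 1" using prob_space.emeasure_space_1[OF kernel_props(1)[OF P x]] by simp
    ultimately show ?case using x by (simp add: fs nn_integral_return)
  next
    case (Suc n)
    obtain gs g where fs1: "fs = gs @ [g]" using Suc(3) by (cases fs rule: rev_cases) auto
    obtain hs h where gs: "gs = hs @ [h]" using Suc(3) fs1 by (cases gs rule: rev_cases) auto
    have len: "length hs = n" using Suc(3) fs1 gs by simp
    have [measurable]: "g \<in> borel_measurable M" "h \<in> borel_measurable M"
      and hs: "\<And>f. f \<in> set hs \<Longrightarrow> f \<in> borel_measurable M" using Suc(2) fs1 gs by auto
    define k where "k y = h y * (\<integral>\<^sup>+z. g z \<partial>P y)" for y
    have [measurable]: "k \<in> borel_measurable M" unfolding k_def by measurable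
    have "(\<integral>\<^sup>+\<omega>. (\<Prod>i<Suc (Suc n). (fs ! i) (\<omega> i)) \<partial>IT.C 0 (Suc (Suc n)) (\<lambda>_. undefined))
        = (\<integral>\<^sup>+\<omega>. \<integral>\<^sup>+y. (\<Prod>i<Suc (Suc n). (fs ! i) ((fun_upd \<omega> (Suc n) y) i)) \<partial>step_law M P x (Suc n) \<omega> \<partial>IT.C 0 (Suc n) (\<lambda>_. undefined))"
      using Suc(2,3) by (intro step meas) auto
    also have "\<dots> = (\<integral>\<^sup>+\<omega>. (\<Prod>i<Suc n. ((hs @ [k]) ! i) (\<omega> i)) \<partial>IT.C 0 (Suc n) (\<lambda>_. undefined))"
    proof (rule nn_integral_cong)
      fix \<omega> assume "\<omega> \<in> space (IT.C 0 (Suc n) (\<lambda>_. undefined))"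
      then have w: "\<omega> n \<in> space M" using IT.space_C[OF u, of "Suc n"] by (auto simp: space_PiM PiE_iff simp del: IT.C.simps)
      have "(\<Prod>i<Suc (Suc n). (fs ! i) ((fun_upd \<omega> (Suc n) y) i)) = (\<Prod>i<n. (hs ! i) (\<omega> i)) * h (\<omega> n) * g y" for y
        using len by (simp add: fs1 gs nth_append)
      then have "(\<integral>\<^sup>+y. (\<Prod>i<Suc (Suc n). (fs ! i) ((fun_upd \<omega> (Suc n) y) i)) \<partial>step_law M P x (Suc n) \<omega>)
          = (\<integral>\<^sup>+y. (\<Prod>i<n. (hs ! i) (\<omega> i)) * h (\<omega> n) * g y \<partial>P (\<omega> n))" by (simp add: step_law_def)
      also have "\<dots> = (\<Prod>i<n. (hs ! i) (\<omega> i)) * h (\<omega> n) * (\<integral>\<^sup>+y. g y \<partial>P (\<omega> n))"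
        using kernel_props(2)[OF P w] by (intro nn_integral_cmult) (simp cong: measurable_cong_sets)
      also have "\<dots> = (\<Prod>i<Suc n. ((hs @ [k]) ! i) (\<omega> i))"
        using len by (simp add: nth_append k_def mult.assoc)
      finally show "(\<integral>\<^sup>+y. (\<Prod>i<Suc (Suc n). (fs ! i) ((fun_upd \<omega> (Suc n) y) i)) \<partial>step_law M P x (Suc n) \<omega>)
          = (\<Prod>i<Suc n. ((hs @ [k]) ! i) (\<omega> i))" .
    qed
    also have "\<dots> = cylinder_integral P (hs @ [k]) x"
      using hs len by (intro Suc.IH) auto
    also have "\<dots> = cylinder_integral P fs x"
      using cylinder_integral_snoc[where fs=hs and f=h and g=g, OF hs x] by (simp add: fs1 gs k_def[abs_def])
    finally show ?case .
  qed
qed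

lemma path_law_props:
  assumes x: "x \<in> space M"
  shows "prob_space (path_law M P x)" "sets (path_law M P x) = sets S" "space (path_law M P x) = space S"
proof -
  interpret IT: Ionescu_Tulcea "step_law M P x" "\<lambda>_. M"
    by (rule Ionescu_Tulcea_step_law[OF P x])
  show s: "sets (path_law M P x) = sets S" by (simp add: path_law_def)
  then show sp: "space (path_law M P x) = space S" by (rule sets_eq_imp_space_eq)
  \<comment> \<open>The total mass is read off from the cylinder over the empty set of
    times.\<close>
  have "emeasure IT.PF.lim (IT.PF.emb UNIV {} (space (PiM {} (\<lambda>_. M)))) = 1"
    using IT.lim[of "{}" "space (PiM {} (\<lambda>_. M))"] IT.PF.prob_space_P[of "{}"] prob_space.emeasure_space_1
    by (metis IT.PF.space_P finite.emptyI sets.top empty_subsetI)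
  moreover have "IT.PF.emb UNIV {} (space (PiM {} (\<lambda>_. M))) = space S"
    by (auto simp: prod_emb_def space_PiM)
  ultimately show "prob_space (path_law M P x)"
    using sp by (intro prob_spaceI) (simp add: path_law_def)
qed

lemma emeasure_path_law_cylinder:
  assumes x: "x \<in> space M" and A: "\<And>i. A i \<in> sets M"
  shows "emeasure (path_law M P x) (cylinder M n A) = cylinder_integral P (map (\<lambda>i. indicator (A i)) [0..<n]) x"
proof (cases n)
  case 0
  then have "cylinder M n A = space (path_law M P x)" using path_law_props(3)[OF x] by (simp add: cylinder_def)
  then show ?thesis using prob_space.emeasure_space_1[OF path_law_props(1)[OF x]] 0 by simp
next
  case (Suc m)
  interpret IT: Ionescu_Tulcea "step_law M P x" "\<lambda>_. M"
    by (rule Ionescu_Tulcea_step_law[OF P x])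
  have u[simp]: "(\<lambda>_::nat. undefined) \<in> space (PiM {0..<0} (\<lambda>_. M))"
    by (auto simp: space_PiM PiE_iff extensional_def)
  define X where "X = (\<Pi>\<^sub>E i\<in>{0..<n}. A i)"
  have X: "X \<in> sets (PiM {0..<n} (\<lambda>_. M))" unfolding X_def using A by (intro sets_PiM_I_finite) auto
  have "cylinder M n A = IT.PF.emb UNIV {0..<n} X"
    by (auto simp: cylinder_def prod_emb_def X_def space_PiM PiE_iff)
  then have "emeasure (path_law M P x) (cylinder M n A) = emeasure (IT.CI {0..<n}) X"
    using IT.lim[OF _ X] by (simp add: path_law_def)
  also have "\<dots> = emeasure (IT.C 0 n (\<lambda>_. undefined)) (IT.PF.emb {0..<n} {0..<n} X)"
    by (rule IT.emeasure_CI[OF order.refl X])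
  also have "IT.PF.emb {0..<n} {0..<n} X = X"
    using sets.sets_into_space[OF X] by (intro prod_emb_id) (auto simp: space_PiM)
  also have "emeasure (IT.C 0 n (\<lambda>_. undefined)) X = (\<integral>\<^sup>+\<omega>. indicator X \<omega> \<partial>IT.C 0 n (\<lambda>_. undefined))"
    using X IT.sets_C[OF u, of n] by simp
  also have "\<dots> = (\<integral>\<^sup>+\<omega>. (\<Prod>i<Suc m. ((map (\<lambda>i. indicator (A i)) [0..<n]) ! i) (\<omega> i)) \<partial>IT.C 0 n (\<lambda>_. undefined))"
  proof (rule nn_integral_cong)
    fix \<omega> assume "\<omega> \<in> space (IT.C 0 n (\<lambda>_. undefined))"
    then have ext: "\<omega> \<in> extensional {0..<n}" using IT.space_C[OF u, of n] by (auto simp: space_PiM PiE_iff)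
    have "(\<Prod>i<Suc m. ((map (\<lambda>i. indicator (A i)) [0..<n]) ! i) (\<omega> i)) = (\<Prod>i<n. indicator (A i) (\<omega> i) :: ennreal)"
      unfolding Suc[symmetric] by (intro prod.cong) auto
    also have "\<dots> = indicator X \<omega>"
    proof (cases "\<omega> \<in> X")
      case True
      then show ?thesis by (auto simp: X_def PiE_iff intro!: prod.neutral)
    next
      case False
      then obtain i where "i < n" "\<omega> i \<notin> A i" using ext by (auto simp: X_def PiE_iff)
      then show ?thesis using False by (auto simp: indicator_def intro!: prod_zero)
    qed
    finally show "indicator X \<omega> = (\<Prod>i<Suc m. ((map (\<lambda>i. indicator (A i)) [0..<n]) ! i) (\<omega> i) :: ennreal)" by simp
  qed
  also have "\<dots> = cylinder_integral P (map (\<lambda>i. indicator (A i)) [0..<n]) x"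
    unfolding Suc by (rule nn_integral_Ionescu_Tulcea_C[OF x]) (use A in auto)
  finally show ?thesis .
qed

lemma measurable_path_law[measurable]: "path_law M P \<in> M \<rightarrow>\<^sub>M prob_algebra S"
proof (rule measurable_prob_algebra_generated[OF sets_PiM_cylinders Int_stable_cylinders cylinders_Pow])
  fix X assume "X \<in> cylinders M"
  then obtain n A where X: "X = cylinder M n A" "\<And>i. A i \<in> sets M" unfolding cylinders_def by blast
  have "cylinder_integral P (map (\<lambda>i. indicator (A i)) [0..<n]) \<in> borel_measurable M"
    using X by (intro measurable_cylinder_integral) auto
  then show "(\<lambda>x. emeasure (path_law M P x) X) \<in> borel_measurable M"
    unfolding X(1) by (subst measurable_cong[OF emeasure_path_law_cylinder[OF _ X(2)]])
qed (auto simp: path_law_props)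

lemma measurable_path_law_sub[measurable]: "path_law M P \<in> M \<rightarrow>\<^sub>M subprob_algebra S"
  using measurable_path_law by (rule measurable_prob_algebraD)

lemma measurable_case_nat[measurable]: "(\<lambda>(x, \<omega>). case_nat x \<omega>) \<in> M \<Otimes>\<^sub>M S \<rightarrow>\<^sub>M S"
proof (rule measurable_PiM_single')
  fix i :: nat
  show "(\<lambda>p. (case p of (x, \<omega>) \<Rightarrow> case_nat x \<omega>) i) \<in> M \<Otimes>\<^sub>M S \<rightarrow>\<^sub>M M"
    by (cases i) (simp_all add: case_prod_beta)
qed (auto simp: space_pair_measure space_PiM PiE_iff split: nat.split)

lemma measurable_case_nat1: "x \<in> space M \<Longrightarrow> case_nat x \<in> S \<rightarrow>\<^sub>M S"
  using measurable_compose[OF measurable_Pair1' measurable_case_nat, of x] by simp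

lemma measurable_shift[measurable]: "(\<lambda>\<omega> i. \<omega> (i + n)) \<in> S \<rightarrow>\<^sub>M S"
  by (rule measurable_PiM_single') (auto simp: space_PiM)

lemma measurable_shift_Suc[measurable]: "(\<lambda>\<omega> i. \<omega> (Suc i)) \<in> S \<rightarrow>\<^sub>M S"
  using measurable_shift[of 1] by simp

lemma bind_P_measurable:
  assumes "x \<in> space M" "k \<in> M \<rightarrow>\<^sub>M subprob_algebra N"
  shows "k \<in> P x \<rightarrow>\<^sub>M subprob_algebra N"
  using assms kernel_props(2)[OF P] by (simp cong: measurable_cong_sets)

lemma space_P_not_empty: "x \<in> space M \<Longrightarrow> space (P x) \<noteq> {}"
  using kernel_props(3)[OF P] by auto

text \<open>The Markov property at time 1: the path is \<open>x\<close> followed by a path started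
  at the next state. On cylinders this is the recursion of \<open>cylinder_integral\<close>, and
  cylinders determine the law.\<close>

lemma emeasure_path_law_first_step:
  assumes x: "x \<in> space M" and B: "B \<in> sets S"
  shows "emeasure (path_law M P x) B = (\<integral>\<^sup>+y. emeasure (path_law M P y) (case_nat x -` B \<inter> space S) \<partial>P x)"
proof -
  define K where "K y = distr (path_law M P y) S (case_nat x)" for y
  have K: "K \<in> M \<rightarrow>\<^sub>M subprob_algebra S"
    unfolding K_def using measurable_distr[OF measurable_case_nat1[OF x]] measurable_compose[OF measurable_path_law_sub] by blast
  have KP: "K \<in> P x \<rightarrow>\<^sub>M subprob_algebra S" by (rule bind_P_measurable[OF x K])
  have eK: "emeasure (K y) X = emeasure (path_law M P y) (case_nat x -` X \<inter> space S)" if "y \<in> space M" "X \<in> sets S" for y X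
  proof -
    have "case_nat x \<in> path_law M P y \<rightarrow>\<^sub>M S"
      using measurable_case_nat1[OF x] unfolding measurable_cong_sets[OF path_law_props(2)[OF that(1)] refl] .
    then show ?thesis unfolding K_def path_law_props(3)[OF that(1), symmetric] by (rule emeasure_distr) (rule that(2))
  qed
  have eb: "emeasure (P x \<bind> K) X = (\<integral>\<^sup>+y. emeasure (path_law M P y) (case_nat x -` X \<inter> space S) \<partial>P x)" if "X \<in> sets S" for X
    using that kernel_props(3)[OF P x]
    by (subst emeasure_bind[OF space_P_not_empty[OF x] KP that]) (auto intro!: nn_integral_cong eK)
  have "path_law M P x = P x \<bind> K"
  proof (rule path_measure_eqI)
    show "finite_measure (path_law M P x)" using path_law_props(1)[OF x] prob_space_def by auto
    show "sets (path_law M P x) = sets S" by (rule path_law_props(2)[OF x])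
    show "sets (P x \<bind> K) = sets S" by (rule sets_bind_measurable[OF KP space_P_not_empty[OF x]])
    fix n and A :: "nat \<Rightarrow> 'a set" assume A: "\<And>i. A i \<in> sets M"
    have spP: "space (P x) = space M" by (rule kernel_props(3)[OF P x])
    show "emeasure (path_law M P x) (cylinder M n A) = emeasure (P x \<bind> K) (cylinder M n A)"
    proof (cases n)
      case 0
      have "case_nat x -` cylinder M n A \<inter> space S = space S"
        using x 0 by (auto simp: cylinder_def space_PiM PiE_iff split: nat.split)
      then have "emeasure (P x \<bind> K) (cylinder M n A) = (\<integral>\<^sup>+y. 1 \<partial>P x)"
        using path_law_props prob_space.emeasure_space_1[OF path_law_props(1)]
        by (subst eb[OF cylinder_sets[OF A]], intro nn_integral_cong) (simp add: spP)
      then show ?thesis using prob_space.emeasure_space_1[OF kernel_props(1)[OF P x]] 0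
        by (simp add: emeasure_path_law_cylinder[OF x A])
    next
      case (Suc m)
      have "case_nat x -` cylinder M n A \<inter> space S = (if x \<in> A 0 then cylinder M m (\<lambda>i. A (Suc i)) else {})"
        using x Suc by (auto simp: cylinder_def space_PiM PiE_iff less_Suc_eq_0_disj split: nat.split)
      then have "emeasure (path_law M P y) (case_nat x -` cylinder M n A \<inter> space S)
          = indicator (A 0) x * cylinder_integral P (map (\<lambda>i. indicator (A (Suc i))) [0..<m]) y"
        if "y \<in> space M" for y
        using emeasure_path_law_cylinder[OF that, of "\<lambda>i. A (Suc i)" m] A by simp
      then have "emeasure (P x \<bind> K) (cylinder M n A)
          = (\<integral>\<^sup>+y. indicator (A 0) x * cylinder_integral P (map (\<lambda>i. indicator (A (Suc i))) [0..<m]) y \<partial>P x)"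
        by (subst eb[OF cylinder_sets[OF A]]) (auto intro!: nn_integral_cong simp: spP)
      also have "\<dots> = indicator (A 0) x * (\<integral>\<^sup>+y. cylinder_integral P (map (\<lambda>i. indicator (A (Suc i))) [0..<m]) y \<partial>P x)"
      proof (rule nn_integral_cmult)
        have "cylinder_integral P (map (\<lambda>i. indicator (A (Suc i))) [0..<m]) \<in> borel_measurable M"
          using A by (intro measurable_cylinder_integral) auto
        then show "cylinder_integral P (map (\<lambda>i. indicator (A (Suc i))) [0..<m]) \<in> borel_measurable (P x)"
          using kernel_props(2)[OF P x] by (simp cong: measurable_cong_sets)
      qed
      also have "\<dots> = emeasure (path_law M P x) (cylinder M n A)"
        using upt_conv_Cons[of 0 n] Suc
        by (simp add: emeasure_path_law_cylinder[OF x A] map_Suc_upt[symmetric] comp_def del: upt_Suc)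
      finally show ?thesis by simp
    qed
  qed
  then show ?thesis using eb[OF B] by simp
qed

lemma path_law_shift_1:
  assumes x: "x \<in> space M"
  shows "distr (path_law M P x) S (\<lambda>\<omega> i. \<omega> (i + 1)) = P x \<bind> path_law M P"
proof (rule measure_eqI)
  note [measurable_cong] = path_law_props(2)[OF x]
  show "sets (distr (path_law M P x) S (\<lambda>\<omega> i. \<omega> (i + 1))) = sets (P x \<bind> path_law M P)"
    by (simp add: sets_bind_measurable[OF bind_P_measurable[OF x measurable_path_law_sub] space_P_not_empty[OF x]])
  fix B assume "B \<in> sets (distr (path_law M P x) S (\<lambda>\<omega> i. \<omega> (i + 1)))"
  then have B: "B \<in> sets S" by simp
  let ?C = "(\<lambda>\<omega> i. \<omega> (i + 1)) -` B \<inter> space S"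
  have C: "?C \<in> sets S" by (rule measurable_sets[OF measurable_shift B])
  have "emeasure (distr (path_law M P x) S (\<lambda>\<omega> i. \<omega> (i + 1))) B = emeasure (path_law M P x) ?C"
    using B path_law_props(3)[OF x] by (subst emeasure_distr) auto
  also have "\<dots> = (\<integral>\<^sup>+y. emeasure (path_law M P y) (case_nat x -` ?C \<inter> space S) \<partial>P x)"
    by (rule emeasure_path_law_first_step[OF x C])
  also have "case_nat x -` ?C \<inter> space S = B"
    using sets.sets_into_space[OF B] measurable_space[OF measurable_case_nat1[OF x]] by auto
  also have "(\<integral>\<^sup>+y. emeasure (path_law M P y) B \<partial>P x) = emeasure (P x \<bind> path_law M P) B"
    by (rule emeasure_bind[OF space_P_not_empty[OF x] bind_P_measurable[OF x measurable_path_law_sub] B, symmetric])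
  finally show "emeasure (distr (path_law M P x) S (\<lambda>\<omega> i. \<omega> (i + 1))) B = emeasure (P x \<bind> path_law M P) B" .
qed

lemma nstep_not_empty: "x \<in> space M \<Longrightarrow> space (nstep M P n x) \<noteq> {}"
  using nstep_props(3) by auto

text \<open>The Markov property at time \<open>n\<close>, by shifting \<open>n\<close> times by one
  step.\<close>

lemma path_law_shift:
  assumes x: "x \<in> space M"
  shows "distr (path_law M P x) S (\<lambda>\<omega> i. \<omega> (i + n)) = nstep M P n x \<bind> path_law M P"
proof (induction n)
  case 0
  show ?case
    using path_law_props(2)[OF x] by (simp add: bind_return[OF measurable_path_law_sub x] distr_id2)
next
  case (Suc n)
  note [measurable_cong] = path_law_props(2)[OF x]
  have "distr (path_law M P x) S (\<lambda>\<omega> i. \<omega> (i + Suc n))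
      = distr (distr (path_law M P x) S (\<lambda>\<omega> i. \<omega> (i + n))) S (\<lambda>\<omega> i. \<omega> (i + 1))"
    by (subst distr_distr) (auto simp: comp_def)
  also have "\<dots> = nstep M P n x \<bind> (\<lambda>y. distr (path_law M P y) S (\<lambda>\<omega> i. \<omega> (i + 1)))"
    unfolding Suc by (rule distr_bind[OF nstep_sub[OF x measurable_path_law_sub] nstep_not_empty[OF x] measurable_shift])
  also have "\<dots> = nstep M P n x \<bind> (\<lambda>y. P y \<bind> path_law M P)"
    using nstep_props(3)[OF x] by (intro bind_cong refl path_law_shift_1) auto
  also have "\<dots> = nstep M P (Suc n) x \<bind> path_law M P"
    by (simp add: bind_assoc[OF nstep_sub[OF x P_sub] measurable_path_law_sub])
  finally show ?case .
qed

lemma measurable_path_component: "x \<in> space M \<Longrightarrow> (\<lambda>\<omega>. \<omega> n) \<in> path_law M P x \<rightarrow>\<^sub>M M"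
  unfolding measurable_cong_sets[OF path_law_props(2) refl] by (rule measurable_component_singleton) simp

text \<open>Shifting reduces time \<open>n\<close> to time 0, where the marginal is the point mass
  at the start.\<close>

lemma path_law_marginal:
  assumes x: "x \<in> space M"
  shows "distr (path_law M P x) M (\<lambda>\<omega>. \<omega> n) = nstep M P n x"
proof -
  have 0: "distr (path_law M P y) M (\<lambda>\<omega>. \<omega> 0) = return M y" if y: "y \<in> space M" for y
  proof (rule measure_eqI)
    note [measurable_cong] = path_law_props(2)[OF y]
    fix A assume "A \<in> sets (distr (path_law M P y) M (\<lambda>\<omega>. \<omega> 0))"
    then have A: "A \<in> sets M" by simp
    have "(\<lambda>\<omega>. \<omega> 0) -` A \<inter> space (path_law M P y) = cylinder M 1 (\<lambda>_. A)"
      using path_law_props(3)[OF y] by (auto simp: cylinder_def)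
    then have "emeasure (distr (path_law M P y) M (\<lambda>\<omega>. \<omega> 0)) A = emeasure (path_law M P y) (cylinder M 1 (\<lambda>_. A))"
      using emeasure_distr[OF measurable_path_component[OF y, of 0] A] by simp
    also have "\<dots> = indicator A y * (\<integral>\<^sup>+z. 1 \<partial>P y)"
      by (subst emeasure_path_law_cylinder[OF y A]) simp
    also have "(\<integral>\<^sup>+z. 1 \<partial>P y) = 1" using prob_space.emeasure_space_1[OF kernel_props(1)[OF P y]] by simp
    finally show "emeasure (distr (path_law M P y) M (\<lambda>\<omega>. \<omega> 0)) A = emeasure (return M y) A"
      using A by simp
  qed simp
  note [measurable_cong] = path_law_props(2)[OF x]
  have "distr (path_law M P x) M (\<lambda>\<omega>. \<omega> n) = distr (distr (path_law M P x) S (\<lambda>\<omega> i. \<omega> (i + n))) M (\<lambda>\<omega>. \<omega> 0)"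
    by (subst distr_distr) (auto simp: comp_def)
  also have "\<dots> = nstep M P n x \<bind> (\<lambda>y. distr (path_law M P y) M (\<lambda>\<omega>. \<omega> 0))"
    unfolding path_law_shift[OF x]
    by (rule distr_bind[OF nstep_sub[OF x measurable_path_law_sub] nstep_not_empty[OF x]]) measurable
  also have "\<dots> = nstep M P n x \<bind> return M"
    using nstep_props(3)[OF x] by (intro bind_cong refl 0) auto
  also have "\<dots> = nstep M P n x" by (rule bind_return''[OF nstep_props(2)[OF x]])
  finally show ?thesis .
qed

lemma measure_path_law_marginal:
  assumes x: "x \<in> space M" and A: "A \<in> sets M"
  shows "emeasure (path_law M P x) {\<omega> \<in> space S. \<omega> n \<in> A} = emeasure (nstep M P n x) A"
    "measure (path_law M P x) {\<omega> \<in> space S. \<omega> n \<in> A} = measure (nstep M P n x) A"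
proof -
  note [measurable_cong] = path_law_props(2)[OF x]
  have "(\<lambda>\<omega>. \<omega> n) -` A \<inter> space (path_law M P x) = {\<omega> \<in> space S. \<omega> n \<in> A}"
    using path_law_props(3)[OF x] by auto
  then show "emeasure (path_law M P x) {\<omega> \<in> space S. \<omega> n \<in> A} = emeasure (nstep M P n x) A"
    unfolding path_law_marginal[OF x, symmetric] emeasure_distr[OF measurable_path_component[OF x] A] by simp
  then show "measure (path_law M P x) {\<omega> \<in> space S. \<omega> n \<in> A} = measure (nstep M P n x) A"
    by (simp add: measure_def)
qed

end

subsection \<open>Generalized couplings, Harris recurrence and aperiodicity\<close>

text \<open>If this failed, there would be sets \<open>C n\<close> of \<open>b\<close>-mass below
  \<open>(1/2)^n\<close> and \<open>a\<close>-mass at least \<open>e\<close>. By Borel-Cantelli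
  their upper limit is null for \<open>b\<close>, but its \<open>a\<close>-mass is still at least
  \<open>e\<close>, which contradicts absolute continuity.\<close>

lemma absolutely_continuous_uniform:
  assumes "finite_measure a" "finite_measure b" and s: "sets b = sets a" and ac: "absolutely_continuous b a"
    and e: "0 < (e::real)"
  shows "\<exists>d>0. \<forall>C\<in>sets a. measure b C < d \<longrightarrow> measure a C < e"
proof (rule ccontr)
  interpret a: finite_measure a by fact
  interpret b: finite_measure b by fact
  assume "\<not> ?thesis"
  then have "\<exists>C\<in>sets a. measure b C < d \<and> e \<le> measure a C" if "0 < d" for d
    using that by (meson not_le)
  then have "\<forall>n. \<exists>C. C \<in> sets a \<and> measure b C < (1/2)^n \<and> e \<le> measure a C"
    by (meson zero_less_power half_gt_zero zero_less_one)
  then obtain C where C: "\<And>n. C n \<in> sets a" "\<And>n. measure b (C n) < (1/2)^n" "\<And>n. e \<le> measure a (C n)"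
    by metis
  define U where "U m = (\<Union>n. C (n + m))" for m
  have U[measurable]: "U m \<in> sets a" "U m \<in> sets b" for m unfolding U_def using C s by auto
  have geo: "(\<lambda>n. (1/2::real)^(n + m)) sums (2 * (1/2)^m)" for m
    using sums_mult2[OF power_half_series[THEN sums_mult, of 2], of "(1/2)^m"] by (simp add: power_add)
  have sm: "summable (\<lambda>n. measure b (C (n + m)))" for m
    using C(2) by (intro summable_comparison_test'[OF sums_summable[OF geo[of m]]]) (auto simp: less_imp_le)
  have bU: "measure b (U m) \<le> 2 * (1/2)^m" for m
  proof -
    have "measure b (U m) \<le> (\<Sum>n. measure b (C (n + m)))"
      unfolding U_def using C s sm by (intro b.finite_measure_subadditive_countably) auto
    also have "\<dots> \<le> (\<Sum>n. (1/2)^(n + m))"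
      using C(2) sums_summable[OF geo[of m]] by (intro suminf_le sm) (auto simp: less_imp_le)
    finally show ?thesis using sums_unique[OF geo[of m]] by simp
  qed
  have "measure b (\<Inter>m. U m) \<le> 2 * (1/2)^m" for m
  proof -
    have "measure b (\<Inter>m. U m) \<le> measure b (U m)" by (rule b.finite_measure_mono) auto
    also note bU[of m]
    finally show ?thesis .
  qed
  moreover have "(\<lambda>m. 2 * (1/2::real)^m) \<longlonglongrightarrow> 2 * 0"
    by (intro tendsto_intros LIMSEQ_realpow_zero) auto
  ultimately have "measure b (\<Inter>m. U m) \<le> 2 * 0" by (intro LIMSEQ_le_const[of "\<lambda>m. 2 * (1/2)^m"]) blast+
  then have "emeasure b (\<Inter>m. U m) = 0" by (simp add: b.emeasure_eq_measure measure_le_0_iff)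
  then have "(\<Inter>m. U m) \<in> null_sets b" by (intro null_setsI sets.countable_INT' U(2)) auto
  then have "(\<Inter>m. U m) \<in> null_sets a" using ac unfolding absolutely_continuous_def by blast
  then have "emeasure a (\<Inter>m. U m) = 0" by (rule null_setsD1)
  then have "measure a (\<Inter>m. U m) = 0" by (simp add: measure_def)
  moreover have "(\<lambda>m. measure a (U m)) \<longlonglongrightarrow> measure a (\<Inter>m. U m)"
  proof (rule a.finite_Lim_measure_decseq)
    have "C (n + Suc m) \<subseteq> U m" for n m
      using UN_upper[of "Suc n" UNIV "\<lambda>n. C (n + m)"] unfolding U_def by simp
    then have "U (Suc m) \<subseteq> U m" for m unfolding U_def[of "Suc m"] by (intro UN_least)
    then show "decseq U" unfolding decseq_Suc_iff by blast
  qed auto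
  moreover have "e \<le> measure a (U m)" for m
  proof -
    have "C m \<subseteq> U m" using UN_upper[of 0 UNIV "\<lambda>n. C (n + m)"] unfolding U_def by simp
    then have "measure a (C m) \<le> measure a (U m)" by (rule a.finite_measure_mono) (rule U)
    then show ?thesis using C(3)[of m] by linarith
  qed
  ultimately show False using e LIMSEQ_le_const[of "\<lambda>m. measure a (U m)" 0 e] by force
qed

context markov_kernel
begin

text \<open>If the law from \<open>x\<close> at time \<open>k\<close> does not charge
  \<open>N\<close>, then almost surely under \<xi> the first path is outside \<open>N\<close> at
  that time, so the second can be inside only off the diagonal. The threshold \<delta> comes from
  absolute continuity on the whole path space and hence does not depend on \<open>k\<close>.\<close>

lemma generalized_coupling_abs_cont:
  assumes diag: "Id_on (space M) \<in> sets (M \<Otimes>\<^sub>M M)" and x: "x \<in> space M" and y: "y \<in> space M"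
    and \<xi>: "\<xi> \<in> generalized_couplings (path_law M P x) (path_law M P y)"
    and lim: "(\<lambda>k. measure (time_marginal M \<xi> k) (Id_on (space M))) \<longlonglongrightarrow> 1" and \<epsilon>: "0 < \<epsilon>"
  shows "\<forall>\<^sub>F k in sequentially. \<forall>N\<in>sets M. emeasure (nstep M P k x) N = 0 \<longrightarrow> measure (nstep M P k y) N \<le> \<epsilon>"
proof -
  let ?Px = "path_law M P x" and ?Py = "path_law M P y"
  note sx = path_law_props(2)[OF x] and sy = path_law_props(2)[OF y]
  have z: "prob_space \<xi>" "sets \<xi> = sets (S \<Otimes>\<^sub>M S)" "absolutely_continuous ?Px (distr \<xi> ?Px fst)"
      "absolutely_continuous (distr \<xi> ?Py snd) ?Py"
    using \<xi> sets_pair_measure_cong[OF sx sy] by (auto simp: generalized_couplings_def equivalent_measures_def)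
  note [measurable_cong] = z(2) sx sy
  interpret \<xi>: prob_space \<xi> by fact
  have sp: "space \<xi> = space S \<times> space S" using sets_eq_imp_space_eq[OF z(2)] by (simp add: space_pair_measure)
  have fm: "fst \<in> \<xi> \<rightarrow>\<^sub>M ?Px" "snd \<in> \<xi> \<rightarrow>\<^sub>M ?Py" by measurable
  interpret \<xi>2: prob_space "distr \<xi> ?Py snd" by (rule \<xi>.prob_space_distr) fact
  interpret Py: prob_space ?Py by (rule path_law_props(1)[OF y])
  obtain \<delta> where \<delta>: "0 < \<delta>" and small: "\<And>C. C \<in> sets ?Py \<Longrightarrow> measure (distr \<xi> ?Py snd) C < \<delta> \<Longrightarrow> measure ?Py C < \<epsilon>"
    using absolutely_continuous_uniform[OF Py.finite_measure_axioms \<xi>2.finite_measure_axioms _ z(4) \<epsilon>] by auto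
  have "\<forall>\<^sub>F k in sequentially. 1 - \<delta> < measure (time_marginal M \<xi> k) (Id_on (space M))"
    using \<delta> by (intro order_tendstoD(1)[OF lim]) simp
  then show ?thesis
  proof eventually_elim
    case (elim k)
    show ?case
    proof (intro ballI impI)
      fix N assume N: "N \<in> sets M" and 0: "emeasure (nstep M P k x) N = 0"
      let ?C = "{\<omega> \<in> space S. \<omega> k \<in> N}"
      have C: "?C \<in> sets S" using N by measurable
      have comp: "(\<lambda>p. (fst p k, snd p k)) \<in> \<xi> \<rightarrow>\<^sub>M M \<Otimes>\<^sub>M M" by measurable
      define Dk where "Dk = (\<lambda>p. (fst p k, snd p k)) -` Id_on (space M) \<inter> space \<xi>"
      have Dk: "Dk \<in> sets \<xi>" unfolding Dk_def by (rule measurable_sets[OF comp diag])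
      have "measure (time_marginal M \<xi> k) (Id_on (space M)) = measure \<xi> Dk"
        unfolding time_marginal_def Dk_def case_prod_beta by (rule measure_distr[OF comp diag])
      then have "measure \<xi> (space \<xi> - Dk) < \<delta>" using elim \<xi>.prob_compl[OF Dk] by linarith
      moreover have "measure \<xi> (fst -` ?C \<inter> space \<xi>) = 0"
      proof -
        have "?C \<in> null_sets ?Px"
          using 0 C sx by (simp add: null_sets_def measure_path_law_marginal(1)[OF x N])
        then have "?C \<in> null_sets (distr \<xi> ?Px fst)" using z(3) unfolding absolutely_continuous_def by blast
        then have "emeasure (distr \<xi> ?Px fst) ?C = 0" by (rule null_setsD1)
        then show ?thesis using C sx emeasure_distr[OF fm(1), of ?C] by (simp add: measure_def)
      qed
      moreover have "measure \<xi> (snd -` ?C \<inter> space \<xi>) \<le> measure \<xi> ((fst -` ?C \<inter> space \<xi>) \<union> (space \<xi> - Dk))"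
      proof (rule \<xi>.finite_measure_mono)
        show "snd -` ?C \<inter> space \<xi> \<subseteq> (fst -` ?C \<inter> space \<xi>) \<union> (space \<xi> - Dk)"
          by (auto simp: Dk_def sp)
        show "(fst -` ?C \<inter> space \<xi>) \<union> (space \<xi> - Dk) \<in> sets \<xi>"
          using Dk measurable_sets[OF fm(1), of ?C] C sx by (intro sets.Un sets.compl_sets) simp_all
      qed
      moreover have "\<dots> \<le> measure \<xi> (fst -` ?C \<inter> space \<xi>) + measure \<xi> (space \<xi> - Dk)"
        using Dk measurable_sets[OF fm(1), of ?C] C sx by (intro measure_Un_le sets.compl_sets) simp_all
      moreover have "measure (distr \<xi> ?Py snd) ?C = measure \<xi> (snd -` ?C \<inter> space \<xi>)"
        using C sy by (intro measure_distr[OF fm(2)]) simp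
      ultimately have "measure (distr \<xi> ?Py snd) ?C < \<delta>" by linarith
      then have "measure ?Py ?C < \<epsilon>" using C sy by (intro small) simp_all
      then show "measure (nstep M P k y) N \<le> \<epsilon>" by (simp add: measure_path_law_marginal(2)[OF y N])
    qed
  qed
qed

text \<open>A generalized coupling yields smallness of null sets in one direction only. Using the
  condition for \<open>(x, y)\<close> and for \<open>(y, x)\<close>, together with the fact that
  each bound holds for all large times, gives a common time for both directions.\<close>

lemma cond_G_imp_A:
  assumes diag: "Id_on (space M) \<in> sets (M \<Otimes>\<^sub>M M)" and G: "cond_G M P"
  shows "cond_A M P"
  unfolding cond_A_def
proof (intro ballI asymptotically_equivalentI)
  fix x y and \<epsilon> :: real assume x: "x \<in> space M" and y: "y \<in> space M" and \<epsilon>: "0 < \<epsilon>"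
  have "\<forall>\<^sub>F k in sequentially. (\<forall>N\<in>sets M. emeasure (nstep M P k x) N = 0 \<longrightarrow> measure (nstep M P k y) N \<le> \<epsilon>) \<and>
     (\<forall>N\<in>sets M. emeasure (nstep M P k y) N = 0 \<longrightarrow> measure (nstep M P k x) N \<le> \<epsilon>) \<and> 1 \<le> k"
    using G x y generalized_coupling_abs_cont[OF diag x y _ _ \<epsilon>] generalized_coupling_abs_cont[OF diag y x _ _ \<epsilon>]
      eventually_ge_at_top[of 1] unfolding cond_G_def
    by (intro eventually_conj) blast+
  then show "\<exists>n\<ge>1. \<forall>N\<in>sets M.
      (emeasure (nstep M P n x) N = 0 \<longrightarrow> measure (nstep M P n y) N \<le> \<epsilon>) \<and>
      (emeasure (nstep M P n y) N = 0 \<longrightarrow> measure (nstep M P n x) N \<le> \<epsilon>)"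
    using eventually_happens'[OF sequentially_bot] by blast
qed

lemma cond_C_ring_imp_G: "cond_C_ring M P \<Longrightarrow> cond_G M P"
proof -
  have "\<xi> \<in> generalized_couplings a b" if "\<xi> \<in> couplings a b" for \<xi> and a b :: "(nat \<Rightarrow> 'a) measure"
    using that unfolding couplings_def generalized_couplings_def equivalent_measures_def absolutely_continuous_def by simp
  then show "cond_C_ring M P \<Longrightarrow> cond_G M P" unfolding cond_C_ring_def cond_G_def by meson
qed

lemma cond_C'_imp_C_ring:
  assumes diag: "Id_on (space M) \<in> sets (M \<Otimes>\<^sub>M M)" and C': "cond_C' TYPE('w) M P"
  shows "cond_C_ring M P"
  unfolding cond_C_ring_def
proof (intro ballI)
  fix x y assume xy: "x \<in> space M" "y \<in> space M"
  obtain \<Omega> :: "'w measure" and X Y where ps: "prob_space \<Omega>" and XY': "\<forall>k. X k \<in> \<Omega> \<rightarrow>\<^sub>M M" "\<forall>k. Y k \<in> \<Omega> \<rightarrow>\<^sub>M M"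
    and coup: "distr \<Omega> (S \<Otimes>\<^sub>M S) (\<lambda>\<omega>. (\<lambda>k. X k \<omega>, \<lambda>k. Y k \<omega>)) \<in> couplings (path_law M P x) (path_law M P y)"
    and lim: "(\<lambda>n. measure \<Omega> {\<omega> \<in> space \<Omega>. \<forall>k\<ge>n. X k \<omega> = Y k \<omega>}) \<longlonglongrightarrow> 1"
    using bspec[OF bspec[OF C'[unfolded cond_C'_def] xy(1)] xy(2)] by (elim exE conjE) (rule that)
  have XY[measurable]: "\<And>k. X k \<in> \<Omega> \<rightarrow>\<^sub>M M" "\<And>k. Y k \<in> \<Omega> \<rightarrow>\<^sub>M M" by (rule spec[OF XY'(1)], rule spec[OF XY'(2)])
  interpret \<Omega>: prob_space \<Omega> by fact
  let ?F = "\<lambda>\<omega>. (\<lambda>k. X k \<omega>, \<lambda>k. Y k \<omega>)"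
  let ?\<xi> = "distr \<Omega> (S \<Otimes>\<^sub>M S) ?F"
  have F: "?F \<in> \<Omega> \<rightarrow>\<^sub>M S \<Otimes>\<^sub>M S"
    using measurable_space[OF XY(1)] measurable_space[OF XY(2)]
    by (intro measurable_Pair measurable_PiM_single' XY) (simp_all add: PiE_UNIV_domain Pi_iff)
  have eq: "{\<omega> \<in> space \<Omega>. X m \<omega> = Y m \<omega>} = (\<lambda>\<omega>. (X m \<omega>, Y m \<omega>)) -` Id_on (space M) \<inter> space \<Omega>" for m
    using measurable_space[OF XY(1)] measurable_space[OF XY(2)] by (auto simp: Id_on_iff)
  have tm: "measure (time_marginal M ?\<xi> m) (Id_on (space M)) = measure \<Omega> {\<omega> \<in> space \<Omega>. X m \<omega> = Y m \<omega>}" for m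
  proof -
    have g: "(\<lambda>(x, y). (x m, y m)) \<in> S \<Otimes>\<^sub>M S \<rightarrow>\<^sub>M M \<Otimes>\<^sub>M M"
      unfolding case_prod_beta
      by (intro measurable_Pair measurable_compose[OF measurable_fst] measurable_compose[OF measurable_snd]
          measurable_component_singleton) simp_all
    have tm: "time_marginal M ?\<xi> m = distr \<Omega> (M \<Otimes>\<^sub>M M) (\<lambda>\<omega>. (X m \<omega>, Y m \<omega>))"
      unfolding time_marginal_def distr_distr[OF g F] by (simp only: comp_def case_prod_conv)
    have "(\<lambda>\<omega>. (X m \<omega>, Y m \<omega>)) \<in> \<Omega> \<rightarrow>\<^sub>M M \<Otimes>\<^sub>M M" by (intro measurable_Pair XY)
    then show ?thesis unfolding eq tm by (rule measure_distr[OF _ diag])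
  qed
  have meas: "{\<omega> \<in> space \<Omega>. X m \<omega> = Y m \<omega>} \<in> sets \<Omega>" for m
    unfolding eq by (rule measurable_sets[OF measurable_Pair[OF XY] diag])
  have "measure \<Omega> {\<omega> \<in> space \<Omega>. \<forall>k\<ge>m. X k \<omega> = Y k \<omega>} \<le> measure (time_marginal M ?\<xi> m) (Id_on (space M))" for m
    unfolding tm by (intro \<Omega>.finite_measure_mono meas) auto
  moreover have "measure (time_marginal M ?\<xi> m) (Id_on (space M)) \<le> 1" for m
    unfolding tm by (rule \<Omega>.prob_le_1)
  ultimately have "(\<lambda>m. measure (time_marginal M ?\<xi> m) (Id_on (space M))) \<longlonglongrightarrow> 1"
    by (intro tendsto_sandwich[OF _ _ lim tendsto_const]) auto
  then show "\<exists>\<xi>\<in>couplings (path_law M P x) (path_law M P y).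
      (\<lambda>m. measure (time_marginal M \<xi> m) (Id_on (space M))) \<longlonglongrightarrow> 1"
    using coup by blast
qed

section \<open>Recurrence events and a zero-one law\<close>

definition infinitely_often :: "'a set \<Rightarrow> (nat \<Rightarrow> 'a) set" where
  "infinitely_often A = {\<omega> \<in> space S. infinite {n. n \<ge> 1 \<and> \<omega> n \<in> A}}"

lemma infinite_visits_iff: "infinite {n::nat. n \<ge> 1 \<and> Q n} \<longleftrightarrow> (\<forall>m. \<exists>n>m. Q n)"
  unfolding infinite_nat_iff_unbounded by (auto intro: less_trans) (metis Suc_le_eq gr_implies_not0 not_gr_zero)

lemma infinitely_often_alt: "infinitely_often A = {\<omega> \<in> space S. \<forall>m. \<exists>n>m. \<omega> n \<in> A}"
  by (simp only: infinitely_often_def infinite_visits_iff)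

lemma infinitely_often_sets:
  assumes [measurable]: "A \<in> sets M"
  shows "infinitely_often A \<in> sets S"
  unfolding infinitely_often_alt by measurable

lemma infinitely_often_case_nat: "case_nat x \<omega> \<in> infinitely_often A \<longleftrightarrow> \<omega> \<in> infinitely_often A"
  if x: "x \<in> space M" and w: "\<omega> \<in> space S"
proof -
  have "case_nat x \<omega> \<in> space S" using measurable_space[OF measurable_case_nat1[OF x] w] .
  moreover have "(\<forall>m. \<exists>n>m. case_nat x \<omega> n \<in> A) \<longleftrightarrow> (\<forall>m. \<exists>n>m. \<omega> n \<in> A)"
  proof safe
    fix m assume "\<forall>m. \<exists>n>m. case_nat x \<omega> n \<in> A"
    then obtain n where "n > Suc m" "case_nat x \<omega> n \<in> A" by blast
    then show "\<exists>n>m. \<omega> n \<in> A" by (cases n) auto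
  next
    fix m assume "\<forall>m. \<exists>n>m. \<omega> n \<in> A"
    then obtain n where "n > m" "\<omega> n \<in> A" by blast
    then show "\<exists>n>m. case_nat x \<omega> n \<in> A" by (intro exI[of _ "Suc n"]) auto
  qed
  ultimately show ?thesis using w by (simp add: infinitely_often_alt)
qed

text \<open>Since \<open>B\<close> ignores the first state and has the same probability from every
  start, the Markov property makes it independent of every cylinder. So the law restricted to
  \<open>B\<close> and \<open>c\<close> times the law agree on cylinders, hence also on
  \<open>B\<close> itself.\<close>

lemma invariant_event_independent:
  assumes B: "B \<in> sets S" and inv: "\<And>x \<omega>. x \<in> space M \<Longrightarrow> \<omega> \<in> space S \<Longrightarrow> case_nat x \<omega> \<in> B \<longleftrightarrow> \<omega> \<in> B"
    and c: "\<And>x. x \<in> space M \<Longrightarrow> emeasure (path_law M P x) B = c" and x: "x \<in> space M"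
  shows "c = c * c"
proof -
  have cyl: "emeasure (path_law M P x) (cylinder M n A \<inter> B) = emeasure (path_law M P x) (cylinder M n A) * c"
    if "\<And>i. A i \<in> sets M" "x \<in> space M" for n A x
    using that
  proof (induction n arbitrary: A x)
    case 0
    have "cylinder M 0 A = space (path_law M P x)" using path_law_props(3)[OF 0(2)] by (simp add: cylinder_def)
    moreover have "space (path_law M P x) \<inter> B = B"
      using sets.sets_into_space[OF B] path_law_props(3)[OF 0(2)] by auto
    ultimately show ?case using c[OF 0(2)] prob_space.emeasure_space_1[OF path_law_props(1)[OF 0(2)]] by simp
  next
    case (Suc n)
    note x = Suc(3)
    have spP: "space (P x) = space M" by (rule kernel_props(3)[OF P x])
    have cs: "cylinder M (Suc n) A \<in> sets S" "cylinder M n (\<lambda>i. A (Suc i)) \<in> sets S"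
      using Suc(2) by (auto intro: cylinder_sets)
    have 1: "case_nat x -` cylinder M (Suc n) A \<inter> space S = (if x \<in> A 0 then cylinder M n (\<lambda>i. A (Suc i)) else {})"
      using x by (auto simp: cylinder_def space_PiM PiE_iff less_Suc_eq_0_disj split: nat.split)
    have "case_nat x -` (cylinder M (Suc n) A \<inter> B) \<inter> space S = (case_nat x -` cylinder M (Suc n) A \<inter> space S) \<inter> B"
      using inv[OF x] sets.sets_into_space[OF B] by auto
    then have 2: "case_nat x -` (cylinder M (Suc n) A \<inter> B) \<inter> space S = (if x \<in> A 0 then cylinder M n (\<lambda>i. A (Suc i)) \<inter> B else {})"
      unfolding 1 by auto
    have "emeasure (path_law M P x) (cylinder M (Suc n) A \<inter> B) =
      (\<integral>\<^sup>+y. (if x \<in> A 0 then emeasure (path_law M P y) (cylinder M n (\<lambda>i. A (Suc i)) \<inter> B) else 0) \<partial>P x)"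
      unfolding emeasure_path_law_first_step[OF x sets.Int[OF cs(1) B]] 2 by (intro nn_integral_cong) simp
    also have "\<dots> = (\<integral>\<^sup>+y. (if x \<in> A 0 then emeasure (path_law M P y) (cylinder M n (\<lambda>i. A (Suc i))) else 0) * c \<partial>P x)"
      using Suc.IH[of "\<lambda>i. A (Suc i)"] Suc(2) by (intro nn_integral_cong) (auto simp: spP)
    also have "\<dots> = (\<integral>\<^sup>+y. (if x \<in> A 0 then emeasure (path_law M P y) (cylinder M n (\<lambda>i. A (Suc i))) else 0) \<partial>P x) * c"
    proof (rule nn_integral_multc)
      have "(\<lambda>y. emeasure (path_law M P y) (cylinder M n (\<lambda>i. A (Suc i)))) \<in> borel_measurable M"
        by (rule measurable_compose[OF measurable_path_law_sub measurable_emeasure_subprob_algebra]) (rule cs)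
      then show "(\<lambda>y. if x \<in> A 0 then emeasure (path_law M P y) (cylinder M n (\<lambda>i. A (Suc i))) else 0) \<in> borel_measurable (P x)"
        unfolding measurable_cong_sets[OF kernel_props(2)[OF P x] refl] by (cases "x \<in> A 0") (simp_all only: if_True if_False borel_measurable_const)
    qed
    also have "(\<integral>\<^sup>+y. (if x \<in> A 0 then emeasure (path_law M P y) (cylinder M n (\<lambda>i. A (Suc i))) else 0) \<partial>P x)
      = emeasure (path_law M P x) (cylinder M (Suc n) A)"
      unfolding emeasure_path_law_first_step[OF x cs(1)] 1 by (intro nn_integral_cong) simp
    finally show ?case .
  qed
  interpret Px: prob_space "path_law M P x" by (rule path_law_props(1)[OF x])
  note sx = path_law_props(2)[OF x]
  have c1: "c \<le> 1" using c[OF x] Px.emeasure_le_1[of B] by simp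
  then have cfin: "c < \<top>" by (meson ennreal_one_less_top le_less_trans)
  have "scale_measure c (path_law M P x) = density (path_law M P x) (indicator B)"
  proof (rule path_measure_eqI)
    show "finite_measure (scale_measure c (path_law M P x))"
      using cfin by (intro finite_measureI) (simp add: space_scale_measure ennreal_mult_eq_top_iff)
    fix n and A :: "nat \<Rightarrow> 'a set" assume A: "\<And>i. A i \<in> sets M"
    show "emeasure (scale_measure c (path_law M P x)) (cylinder M n A) = emeasure (density (path_law M P x) (indicator B)) (cylinder M n A)"
      using cyl[OF A x, of n] cylinder_sets[OF A, of n] B sx by (simp add: emeasure_restricted Int_commute mult.commute)
  qed (simp_all add: sx)
  then have "emeasure (scale_measure c (path_law M P x)) B = emeasure (density (path_law M P x) (indicator B)) B" by simp
  then show ?thesis using B sx c[OF x] by (simp add: emeasure_restricted)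
qed

end

section \<open>Convergence implies Harris recurrence and aperiodicity\<close>

context stationary_kernel
begin

lemma cond_P_measure_tendsto:
  assumes P': "cond_P M P \<mu>" and x: "x \<in> space M" and A: "A \<in> sets M"
  shows "(\<lambda>n. measure (nstep M P n x) A) \<longlonglongrightarrow> measure \<mu> A"
proof (rule Lim_null[THEN iffD2], rule tendsto_rabs_zero_cancel, rule tendsto_sandwich[OF _ _ tendsto_const])
  show "(\<lambda>n. tv_dist M (nstep M P n x) \<mu>) \<longlonglongrightarrow> 0" using P' x by (simp add: cond_P_def)
  show "\<forall>\<^sub>F n in sequentially. \<bar>measure (nstep M P n x) A - measure \<mu> A\<bar> \<le> tv_dist M (nstep M P n x) \<mu>"
    using tv_dist_bound[OF nstep_props(1)[OF x] \<mu>_prob A] by simp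
qed simp

text \<open>The recurrence measure is \<mu>. The event of infinitely many visits is shift invariant,
  so its probabilities from two starts differ by at most \<open>dn n y x\<close> for every
  \<open>n\<close>. The zero-one law then leaves only the values 0 and 1.\<close>

lemma cond_P_imp_Harris:
  assumes P': "cond_P M P \<mu>"
  shows "Harris M P"
  unfolding Harris_def
proof (intro exI[of _ \<mu>] conjI ballI impI)
  interpret \<mu>: prob_space \<mu> by (rule \<mu>_prob)
  show "sigma_finite_measure \<mu>" by unfold_locales
  show "sets \<mu> = sets M" by (rule sets_\<mu>)
  show "emeasure \<mu> (space M) \<noteq> 0" using \<mu>.emeasure_space_1 by (simp add: space_\<mu>)
  fix A x assume A: "A \<in> sets M" and pos: "0 < emeasure \<mu> A" and x: "x \<in> space M"
  let ?B = "infinitely_often A"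
  let ?h = "\<lambda>x. measure (path_law M P x) ?B"
  note B = infinitely_often_sets[OF A]
  have h_shift: "?h y = measure (nstep M P n y \<bind> path_law M P) ?B" if y: "y \<in> space M" for y n
  proof -
    have "(\<forall>m. \<exists>k>m. \<omega> (k + n) \<in> A) \<longleftrightarrow> (\<forall>m. \<exists>k>m. \<omega> k \<in> A)" for \<omega>
    proof safe
      fix m assume "\<forall>m. \<exists>k>m. \<omega> (k + n) \<in> A"
      then show "\<exists>k>m. \<omega> k \<in> A" by (meson trans_less_add1)
    next
      fix m assume "\<forall>m. \<exists>k>m. \<omega> k \<in> A"
      then obtain k where "k > m + n" "\<omega> k \<in> A" by blast
      then show "\<exists>k>m. \<omega> (k + n) \<in> A" by (intro exI[of _ "k - n"]) auto
    qed
    then have "(\<lambda>\<omega> i. \<omega> (i + n)) -` ?B \<inter> space (path_law M P y) = ?B"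
      using measurable_space[OF measurable_shift] path_law_props(3)[OF y] by (auto simp: infinitely_often_alt)
    moreover have "(\<lambda>\<omega> i. \<omega> (i + n)) \<in> path_law M P y \<rightarrow>\<^sub>M S"
      unfolding measurable_cong_sets[OF path_law_props(2)[OF y] refl] by (rule measurable_shift)
    ultimately show ?thesis
      unfolding path_law_shift[OF y, symmetric] by (simp add: measure_distr[OF _ B])
  qed
  have h_const: "?h y = ?h x" if y: "y \<in> space M" for y
  proof -
    have "\<bar>?h y - ?h x\<bar> \<le> dn n y x" for n
    proof -
      have "\<bar>?h y - ?h x\<bar> \<le> tv_dist S (nstep M P n y \<bind> path_law M P) (nstep M P n x \<bind> path_law M P)"
        unfolding h_shift[OF y, of n] h_shift[OF x, of n]
        using bind_props(1)[OF nstep_props(1,2)[OF y] measurable_path_law] bind_props(1)[OF nstep_props(1,2)[OF x] measurable_path_law]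
        by (intro tv_dist_bound B)
      also have "\<dots> \<le> dn n y x"
        by (rule tv_dist_bind_contract[OF nstep_props(1)[OF y] nstep_props(1)[OF x] nstep_props(2)[OF y] nstep_props(2)[OF x] measurable_path_law])
      finally show ?thesis .
    qed
    then have "\<bar>?h y - ?h x\<bar> \<le> 0"
      using dn_tendsto[OF y x] unfolding cond_P_D_zero[OF P' y x] by (intro LIMSEQ_le_const) auto
    then show ?thesis by simp
  qed
  interpret Px: prob_space "path_law M P x" by (rule path_law_props(1)[OF x])
  have "emeasure (path_law M P y) ?B = emeasure (path_law M P x) ?B" if "y \<in> space M" for y
    using h_const[OF that] prob_space.finite_measure[OF path_law_props(1)[OF that]]
    by (simp add: Px.emeasure_eq_measure finite_measure.emeasure_eq_measure)
  from invariant_event_independent[OF B infinitely_often_case_nat this x]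
  have "emeasure (path_law M P x) ?B = emeasure (path_law M P x) ?B * emeasure (path_law M P x) ?B" by blast
  then have "?h x = ?h x * ?h x" by (simp add: Px.emeasure_eq_measure flip: ennreal_mult)
  then have "?h x = 0 \<or> ?h x = 1" by simp
  \<comment> \<open>The value 0 is excluded here: the event is the decreasing limit of the events
    \<open>U m\<close>, and \<open>U m\<close> contains a visit at time \<open>Suc m\<close>, whose
    probability tends to the \<mu>-mass of \<open>A\<close>.\<close>
  moreover have "measure \<mu> A \<le> ?h x"
  proof -
    define U where "U m = {\<omega> \<in> space S. \<exists>n>m. \<omega> n \<in> A}" for m
    have U: "U m \<in> sets (path_law M P x)" for m unfolding U_def path_law_props(2)[OF x] using A by measurable
    have "?B = (\<Inter>m. U m)" by (auto simp: infinitely_often_alt U_def)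
    moreover have "(\<lambda>m. measure (path_law M P x) (U m)) \<longlonglongrightarrow> measure (path_law M P x) (\<Inter>m. U m)"
    proof (rule Px.finite_Lim_measure_decseq)
      show "decseq U" unfolding decseq_Suc_iff U_def by (auto intro: Suc_lessD)
    qed (use U in auto)
    moreover have "(\<lambda>m. measure (nstep M P (Suc m) x) A) \<longlonglongrightarrow> measure \<mu> A"
      by (rule LIMSEQ_Suc) (rule cond_P_measure_tendsto[OF P' x A])
    moreover have "measure (nstep M P (Suc m) x) A \<le> measure (path_law M P x) (U m)" for m
      unfolding measure_path_law_marginal(2)[OF x A, symmetric]
      by (rule Px.finite_measure_mono[OF _ U]) (auto simp: U_def)
    ultimately show ?thesis by (intro LIMSEQ_le) auto
  qed
  moreover have "0 < measure \<mu> A" using pos by (simp add: \<mu>.emeasure_eq_measure)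
  ultimately have "?h x = 1" by linarith
  then show "measure (path_law M P x) {\<omega> \<in> space (path_law M P x). infinite {n. n \<ge> 1 \<and> \<omega> n \<in> A}} = 1"
    unfolding infinitely_often_def path_law_props(3)[OF x] .
qed

lemma prob_1_of_AE_bind:
  assumes "prob_space m" and sm: "sets m = sets N" and k: "k \<in> N \<rightarrow>\<^sub>M prob_algebra M" and A: "A \<in> sets M"
  shows "measure (m \<bind> k) A = 1 \<longleftrightarrow> (AE z in m. measure (k z) A = 1)"
proof -
  interpret prob_space m by fact
  have sp: "space m = space N" using sm sets_eq_imp_space_eq by blast
  have k': "k \<in> m \<rightarrow>\<^sub>M subprob_algebra M" using measurable_prob_algebraD[OF k] sm by (simp cong: measurable_cong_sets)
  have b: "prob_space (m \<bind> k)" "sets (m \<bind> k) = sets M" using bind_props[OF assms(1) sm k] .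
  have "measure (m \<bind> k) A = 1 \<longleftrightarrow> (AE x in m \<bind> k. x \<in> A)"
    using prob_space.prob_eq_1[OF b(1), of A] A b(2) by simp
  also have "\<dots> \<longleftrightarrow> (AE z in m. AE x in k z. x \<in> A)"
    using A by (intro AE_bind[OF k']) simp
  also have "\<dots> \<longleftrightarrow> (AE z in m. measure (k z) A = 1)"
    using kernel_props(1,2)[OF k] A sp by (intro AE_cong) (simp add: prob_space.prob_eq_1)
  finally show ?thesis .
qed

text \<open>From a point of \<open>E 1\<close> the chain is surely in \<open>E 1\<close> at
  multiples of \<open>d\<close> and surely in \<open>E 2\<close> one step later. Convergence along
  these two subsequences would give two disjoint sets \<mu>-mass 1 each.\<close>

lemma cond_P_imp_aperiodic:
  assumes P': "cond_P M P \<mu>"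
  shows "aperiodic M P \<mu>"
  unfolding aperiodic_def periodic_def
proof (intro allI impI notI, elim exE conjE)
  fix d :: nat and E assume d: "2 \<le> d" and E: "\<forall>i\<in>{1..d}. E i \<in> sets M" "disjoint_family_on E {1..d}" "0 < measure \<mu> (E 1)"
    and step: "\<forall>i\<in>{1..d}. \<forall>x\<in>E i. measure (P x) (E (Suc (i mod d))) = 1"
  have "E 1 \<noteq> {}" using E(3) by auto
  then obtain x where xE: "x \<in> E 1" by auto
  have E1: "E 1 \<in> sets M" "E 2 \<in> sets M" using E(1) d by auto
  then have x: "x \<in> space M" using xE sets.sets_into_space by blast
  \<comment> \<open>Classes are numbered from 1, so time \<open>n\<close> corresponds to the index
    \<open>Suc (n mod d)\<close>.\<close>
  have ind: "Suc (n mod d) \<in> {1..d}" for n using d mod_less_divisor[of d n] by (auto simp: Suc_le_eq)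
  have 1: "measure (nstep M P n x) (E (Suc (n mod d))) = 1" for n
  proof (induction n)
    case 0
    then show ?case using xE E1 by (simp add: measure_return)
  next
    case (Suc n)
    interpret a: prob_space "nstep M P n x" by (rule nstep_props(1)[OF x])
    have "AE z in nstep M P n x. z \<in> E (Suc (n mod d))"
      using Suc E(1) ind[of n] nstep_props(2)[OF x, of n] by (subst a.prob_eq_1[symmetric]) auto
    then have "AE z in nstep M P n x. measure (P z) (E (Suc (Suc (n mod d) mod d))) = 1"
      by eventually_elim (use step ind[of n] in blast)
    then have "measure (nstep M P n x \<bind> P) (E (Suc (Suc n mod d))) = 1"
      using E(1) ind[of "Suc n"] by (subst prob_1_of_AE_bind[OF nstep_props(1,2)[OF x] P]) (auto simp: mod_Suc_eq)
    then show ?case by simp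
  qed
  have "(\<lambda>k. measure (nstep M P (k * d) x) (E 1)) \<longlonglongrightarrow> measure \<mu> (E 1)"
    by (rule filterlim_compose[OF cond_P_measure_tendsto[OF P' x E1(1)]])
       (use d in \<open>auto intro!: filterlim_subseq strict_monoI\<close>)
  moreover have "measure (nstep M P (k * d) x) (E 1) = 1" for k using 1[of "k * d"] by simp
  ultimately have m1: "measure \<mu> (E 1) = 1" by (simp add: LIMSEQ_const_iff)
  have "(\<lambda>k. measure (nstep M P (Suc (k * d)) x) (E 2)) \<longlonglongrightarrow> measure \<mu> (E 2)"
    by (rule filterlim_compose[OF cond_P_measure_tendsto[OF P' x E1(2)]])
       (use d in \<open>auto intro!: filterlim_subseq strict_monoI\<close>)
  moreover have "measure (nstep M P (Suc (k * d)) x) (E 2) = 1" for k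
  proof -
    have "Suc (k * d) mod d = 1" using d by (metis One_nat_def Suc_eq_plus1 Suc_le_lessD add.commute mod_less mod_mult_self3 numeral_2_eq_2)
    then show ?thesis using 1[of "Suc (k * d)"] by (simp add: numeral_2_eq_2)
  qed
  ultimately have m2: "measure \<mu> (E 2) = 1" by (simp add: LIMSEQ_const_iff del: nstep.simps)
  interpret \<mu>: prob_space \<mu> by (rule \<mu>_prob)
  have "E 1 \<inter> E 2 = {}" using E(2) d by (auto simp: disjoint_family_on_def)
  then have "measure \<mu> (E 1 \<union> E 2) = 2"
    using m1 m2 E1 sets_\<mu> by (subst \<mu>.finite_measure_Union) auto
  then show False using \<mu>.prob_le_1[of "E 1 \<union> E 2"] by simp
qed

end

subsection \<open>Singularity and Harris recurrence\<close>

text \<open>\<open>N\<close> is the zero set of the density of \<open>b\<close> with respect to the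
  sum of both measures. It is null for \<open>b\<close>, carries the singular part of
  \<open>a\<close>, and off \<open>N\<close> every null set of \<open>b\<close> is null for
  \<open>a\<close>.\<close>

lemma lebesgue_decomposition:
  assumes fin: "finite_measure a" "finite_measure b" and sa: "sets a = sets M" and sb: "sets b = sets M"
  obtains N p where "N \<in> null_sets b" "p \<in> borel_measurable b" "density a (indicator (space M - N)) = density b p"
proof -
  interpret b: finite_measure b by fact
  obtain N1 N2 where N: "N1 \<in> null_sets a" "N2 \<in> null_sets b"
    and eq: "\<And>X. X \<in> sets M \<Longrightarrow> X \<inter> N1 = {} \<Longrightarrow> X \<inter> N2 = {} \<Longrightarrow> emeasure a X = 0 \<longleftrightarrow> emeasure b X = 0"
    using equivalence_off_null_sets[OF fin sa sb] by metis
  have N': "N1 \<in> sets M" "N2 \<in> sets M" using N sa sb by auto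
  let ?a = "density a (indicator (space M - N2))"
  have "absolutely_continuous b ?a"
    unfolding absolutely_continuous_def
  proof
    fix X assume X: "X \<in> null_sets b"
    then have XM: "X \<in> sets M" using sb by auto
    define Y where "Y = X - N1 - N2"
    have YM: "Y \<in> sets M" using XM N' by (auto simp: Y_def)
    have "emeasure b Y \<le> emeasure b X" using XM sb by (intro emeasure_mono) (auto simp: Y_def)
    then have "emeasure b Y = 0" using X by (simp add: null_setsD1)
    then have aY: "emeasure a Y = 0" using eq[OF YM] by (auto simp: Y_def)
    have "emeasure ?a X = emeasure a ((space M - N2) \<inter> X)"
      using XM N' sa by (intro emeasure_restricted) auto
    also have "\<dots> \<le> emeasure a (N1 \<union> Y)"
      using YM N' sa by (intro emeasure_mono) (auto simp: Y_def)
    also have "\<dots> \<le> emeasure a N1 + emeasure a Y"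
      using YM N' sa by (intro emeasure_subadditive) auto
    finally have "emeasure ?a X = 0" using aY N(1) by (simp add: null_setsD1)
    then show "X \<in> null_sets ?a" using XM sa by (intro null_setsI) auto
  qed
  then obtain p where "p \<in> borel_measurable b" "density b p = ?a"
    using b.Radon_Nikodym[of ?a] sa sb by auto
  then show ?thesis using that[OF N(2)] by simp
qed

context stationary_kernel
begin

lemma measurable_\<mu>: "f \<in> M \<rightarrow>\<^sub>M N \<Longrightarrow> f \<in> \<mu> \<rightarrow>\<^sub>M N"
  unfolding measurable_cong_sets[OF sets_\<mu> refl] .

text \<open>The absolutely continuous parts of the laws \<open>K x\<close> have a jointly measurable density \<open>p\<close>.
  If \<open>K x\<close> and \<open>K y\<close> are almost always mutually singular then \<open>p x z * p y z = 0\<close> almost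
  everywhere; integrating over \<open>x\<close> and \<open>y\<close> first gives a square.\<close>

lemma singular_of_pairwise_singular:
  assumes K[measurable]: "K \<in> M \<rightarrow>\<^sub>M prob_algebra M"
    and sing: "AE x in \<mu>. AE y in \<mu>. tv_dist M (K x) (K y) = 1"
  shows "AE x in \<mu>. \<exists>N\<in>sets M. emeasure \<mu> N = 0 \<and> emeasure (K x) (space M - N) = 0"
proof -
  interpret \<mu>: prob_space \<mu> by (rule \<mu>_prob)
  interpret pp: pair_prob_space \<mu> \<mu> ..
  have Ks[measurable]: "K \<in> M \<rightarrow>\<^sub>M subprob_algebra M" by (rule measurable_prob_algebraD[OF K])
  have s2: "sets (\<mu> \<Otimes>\<^sub>M \<mu>) = sets (M \<Otimes>\<^sub>M M)" by (intro sets_pair_measure_cong sets_\<mu>)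
  \<comment> \<open>\<open>\<Psi>\<close> is the joint law of a point \<open>x\<close> drawn from
    \<mu> and a point \<open>z\<close> drawn from \<open>K x\<close>. Decomposing this single
    measure with respect to the product of \<mu> with itself yields one jointly measurable
    \<open>p\<close>, instead of unrelated densities for each \<open>x\<close>.\<close>
  define L where "L x = distr (K x) (M \<Otimes>\<^sub>M M) (Pair x)" for x
  have L: "L \<in> M \<rightarrow>\<^sub>M prob_algebra (M \<Otimes>\<^sub>M M)" unfolding L_def by (intro measurable_distr_prob_space2[OF K]) simp
  define \<Psi> where "\<Psi> = \<mu> \<bind> L"
  have \<Psi>: "prob_space \<Psi>" "sets \<Psi> = sets (M \<Otimes>\<^sub>M M)"
    unfolding \<Psi>_def using bind_props[OF \<mu>_prob sets_\<mu> L] by auto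
  have L': "L \<in> \<mu> \<rightarrow>\<^sub>M subprob_algebra (M \<Otimes>\<^sub>M M)"
    unfolding measurable_cong_sets[OF sets_\<mu> refl] by (rule measurable_prob_algebraD[OF L])
  have e\<Psi>: "emeasure \<Psi> X = (\<integral>\<^sup>+x. emeasure (K x) (Pair x -` X) \<partial>\<mu>)" if X: "X \<in> sets (M \<Otimes>\<^sub>M M)" for X
  proof -
    have "emeasure (L x) X = emeasure (K x) (Pair x -` X)" if x: "x \<in> space M" for x
    proof -
      have "Pair x \<in> K x \<rightarrow>\<^sub>M M \<Otimes>\<^sub>M M"
        unfolding measurable_cong_sets[OF kernel_props(2)[OF K x] refl] by (rule measurable_Pair1'[OF x])
      then have "emeasure (L x) X = emeasure (K x) (Pair x -` X \<inter> space (K x))"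
        unfolding L_def by (rule emeasure_distr[OF _ X])
      also have "Pair x -` X \<inter> space (K x) = Pair x -` X"
        using sets.sets_into_space[OF X] kernel_props(3)[OF K x] by (auto simp: space_pair_measure)
      finally show ?thesis .
    qed
    then show ?thesis
      unfolding \<Psi>_def emeasure_bind[OF \<mu>.not_empty L' X] by (intro nn_integral_cong) (simp add: space_\<mu>)
  qed
  obtain N p where N: "N \<in> null_sets (\<mu> \<Otimes>\<^sub>M \<mu>)" and p0: "p \<in> borel_measurable (\<mu> \<Otimes>\<^sub>M \<mu>)"
    and dens: "density \<Psi> (indicator (space (M \<Otimes>\<^sub>M M) - N)) = density (\<mu> \<Otimes>\<^sub>M \<mu>) p"
    using lebesgue_decomposition[OF prob_space.finite_measure[OF \<Psi>(1)] pp.P.finite_measure_axioms \<Psi>(2) s2] by metis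
  have p[measurable]: "p \<in> borel_measurable (M \<Otimes>\<^sub>M M)" using p0 unfolding measurable_cong_sets[OF s2 refl] .
  have NM[measurable]: "N \<in> sets (M \<Otimes>\<^sub>M M)" using N s2 by auto
  define Nx where "Nx x = Pair x -` N" for x
  have Nx[measurable]: "Nx x \<in> sets M" for x unfolding Nx_def by (rule sets_Pair1[OF NM])
  have "AE q in \<mu> \<Otimes>\<^sub>M \<mu>. q \<notin> N" by (rule AE_not_in[OF N])
  then have "AE x in \<mu>. AE z in \<mu>. (x, z) \<notin> N" by (rule pp.AE_pair)
  then have Nnull: "AE x in \<mu>. emeasure \<mu> (Nx x) = 0"
  proof eventually_elim
    case (elim x)
    have "{z \<in> space \<mu>. \<not> (x, z) \<notin> N} = Nx x"
      using sets.sets_into_space[OF Nx, of x] by (auto simp: Nx_def space_\<mu>)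
    then show ?case using elim AE_iff_measurable[of "Nx x" \<mu> "\<lambda>z. (x, z) \<notin> N"] Nx sets_\<mu> by auto
  qed
  have sect: "AE x in \<mu>. emeasure (K x) (B - Nx x) = (\<integral>\<^sup>+z. p (x, z) * indicator B z \<partial>\<mu>)" if B[measurable]: "B \<in> sets M" for B
  proof -
    have set1: "space M \<times> B - N \<in> sets (M \<Otimes>\<^sub>M M)" by measurable
    have sig: "(SIGMA x:space M. B - Nx x) = space M \<times> B - N" by (auto simp: Nx_def)
    have u: "(\<lambda>x. emeasure (K x) (B - Nx x)) \<in> borel_measurable M"
      by (rule emeasure_measurable_subprob_algebra2[OF _ Ks]) (simp only: sig set1)
    have u': "(\<lambda>x. emeasure (K x) (B - Nx x)) \<in> borel_measurable \<mu>" by (rule measurable_\<mu>[OF u])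
    have v': "(\<lambda>x. \<integral>\<^sup>+z. p (x, z) * indicator B z \<partial>\<mu>) \<in> borel_measurable \<mu>"
      by (rule measurable_\<mu>) measurable
    have "(\<integral>\<^sup>+x. emeasure (K x) (B - Nx x) \<partial>\<mu>) \<le> (\<integral>\<^sup>+x. 1 \<partial>\<mu>)"
      by (intro nn_integral_mono) (simp add: space_\<mu> prob_space.emeasure_le_1 kernel_props[OF K])
    then have fin: "(\<integral>\<^sup>+x. emeasure (K x) (B - Nx x) \<partial>\<mu>) \<noteq> \<infinity>"
      using \<mu>.emeasure_space_1 by (auto simp: top_unique)
    have "density \<mu> (\<lambda>x. emeasure (K x) (B - Nx x)) = density \<mu> (\<lambda>x. \<integral>\<^sup>+z. p (x, z) * indicator B z \<partial>\<mu>)"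
    proof (rule measure_eqI)
      fix A assume "A \<in> sets (density \<mu> (\<lambda>x. emeasure (K x) (B - Nx x)))"
      then have A[measurable]: "A \<in> sets M" using sets_\<mu> by simp
      have AM: "A \<in> sets \<mu>" using A sets_\<mu> by simp
      have AB: "A \<times> B - N \<in> sets (M \<Otimes>\<^sub>M M)" by measurable
      have AB': "A \<times> B \<in> sets (M \<Otimes>\<^sub>M M)" by measurable
      have "emeasure (density \<mu> (\<lambda>x. emeasure (K x) (B - Nx x))) A = (\<integral>\<^sup>+x. emeasure (K x) (B - Nx x) * indicator A x \<partial>\<mu>)"
        by (rule emeasure_density[OF u' AM])
      also have "\<dots> = (\<integral>\<^sup>+x. emeasure (K x) (Pair x -` (A \<times> B - N)) \<partial>\<mu>)"
        by (intro nn_integral_cong) (auto simp: Nx_def indicator_def vimage_Diff intro!: arg_cong[where f="emeasure _"])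
      also have "\<dots> = emeasure \<Psi> (A \<times> B - N)" by (rule e\<Psi>[OF AB, symmetric])
      also have "\<dots> = emeasure \<Psi> ((space (M \<Otimes>\<^sub>M M) - N) \<inter> (A \<times> B))"
        using sets.sets_into_space[OF AB'] by (intro arg_cong[where f="emeasure \<Psi>"]) auto
      also have "\<dots> = emeasure (density \<Psi> (indicator (space (M \<Otimes>\<^sub>M M) - N))) (A \<times> B)"
        using \<Psi>(2) AB' NM by (intro emeasure_restricted[symmetric]) auto
      also have "\<dots> = (\<integral>\<^sup>+q. p q * indicator (A \<times> B) q \<partial>(\<mu> \<Otimes>\<^sub>M \<mu>))"
        unfolding dens using AB' s2 by (intro emeasure_density[OF p0]) simp
      also have "\<dots> = (\<integral>\<^sup>+x. \<integral>\<^sup>+z. p (x, z) * indicator (A \<times> B) (x, z) \<partial>\<mu> \<partial>\<mu>)"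
        by (rule \<mu>.nn_integral_fst[symmetric]) measurable
      also have "\<dots> = (\<integral>\<^sup>+x. (\<integral>\<^sup>+z. p (x, z) * indicator B z \<partial>\<mu>) * indicator A x \<partial>\<mu>)"
        by (intro nn_integral_cong) (auto simp: indicator_def)
      also have "\<dots> = emeasure (density \<mu> (\<lambda>x. \<integral>\<^sup>+z. p (x, z) * indicator B z \<partial>\<mu>)) A"
        by (rule emeasure_density[OF v' AM, symmetric])
      finally show "emeasure (density \<mu> (\<lambda>x. emeasure (K x) (B - Nx x))) A = emeasure (density \<mu> (\<lambda>x. \<integral>\<^sup>+z. p (x, z) * indicator B z \<partial>\<mu>)) A" .
    qed simp
    then show ?thesis using finite_density_unique[OF u' v' AE_I2 AE_I2 fin] by simp
  qed
  \<comment> \<open>The exceptional null set of \<open>sect\<close> depends on \<open>B\<close>. A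
    countable generating algebra gives one null set for all of its members, and uniqueness of
    measures extends the identity to all measurable \<open>B\<close>.\<close>
  obtain \<A> where \<A>: "countable \<A>" "algebra (space M) \<A>" "sets M = sigma_sets (space M) \<A>"
    using countably_generated_algebra[OF cg] by metis
  interpret \<A>: algebra "space M" \<A> by fact
  have "AE x in \<mu>. \<forall>B\<in>\<A>. emeasure (K x) (B - Nx x) = (\<integral>\<^sup>+z. p (x, z) * indicator B z \<partial>\<mu>)"
    using \<A> by (subst AE_ball_countable[OF \<A>(1)]) (auto intro!: sect)
  with AE_space have ac: "AE x in \<mu>. \<forall>B\<in>sets M. emeasure (K x) (B - Nx x) = (\<integral>\<^sup>+z. p (x, z) * indicator B z \<partial>\<mu>)"
  proof eventually_elim
    case (elim x)
    then have x: "x \<in> space M" by (simp add: space_\<mu>)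
    note sK = kernel_props(2)[OF K x]
    interpret Kx: prob_space "K x" by (rule kernel_props(1)[OF K x])
    have px: "(\<lambda>z. p (x, z)) \<in> borel_measurable \<mu>"
      by (rule measurable_\<mu>[OF measurable_compose[OF measurable_Pair1'[OF x] p]])
    have d1: "emeasure (density (K x) (indicator (space M - Nx x))) B = emeasure (K x) (B - Nx x)" if B: "B \<in> sets M" for B
    proof -
      have "emeasure (density (K x) (indicator (space M - Nx x))) B = emeasure (K x) ((space M - Nx x) \<inter> B)"
        using B sK Nx by (intro emeasure_restricted) auto
      also have "(space M - Nx x) \<inter> B = B - Nx x" using sets.sets_into_space[OF B] by auto
      finally show ?thesis .
    qed
    have d2: "emeasure (density \<mu> (\<lambda>z. p (x, z))) B = (\<integral>\<^sup>+z. p (x, z) * indicator B z \<partial>\<mu>)" if "B \<in> sets M" for B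
      using that sets_\<mu> by (intro emeasure_density[OF px]) simp
    have "density (K x) (indicator (space M - Nx x)) = density \<mu> (\<lambda>z. p (x, z))"
    proof (rule measure_eqI_generator_eq[where A="\<lambda>_. space M" and E=\<A> and \<Omega>="space M"])
      show "Int_stable \<A>" by (auto simp: Int_stable_def)
      show "\<A> \<subseteq> Pow (space M)" by (rule \<A>.space_closed)
      show "range (\<lambda>_::nat. space M) \<subseteq> \<A>" by auto
      show "sets (density (K x) (indicator (space M - Nx x))) = sigma_sets (space M) \<A>"
        "sets (density \<mu> (\<lambda>z. p (x, z))) = sigma_sets (space M) \<A>"
        unfolding \<A>(3)[symmetric] by (simp_all add: sK sets_\<mu>)
      show "emeasure (density (K x) (indicator (space M - Nx x))) (space M) \<noteq> \<infinity>" by (simp add: d1)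
      fix B assume "B \<in> \<A>"
      then have "B \<in> sets M" using \<A>(3) by auto
      then show "emeasure (density (K x) (indicator (space M - Nx x))) B = emeasure (density \<mu> (\<lambda>z. p (x, z))) B"
        using elim(2) \<open>B \<in> \<A>\<close> by (simp add: d1 d2)
    qed auto
    then show ?case using d1 d2 by metis
  qed
  have px: "(\<lambda>z. p (x, z)) \<in> borel_measurable M" if "x \<in> space M" for x
    by (rule measurable_compose[OF measurable_Pair1'[OF that] p])
  have py: "(\<lambda>x. p (x, z)) \<in> borel_measurable M" if "z \<in> space M" for z
    by (rule measurable_compose[OF measurable_Pair2'[OF that] p])
  define q where "q z = (\<integral>\<^sup>+y. p (y, z) \<partial>\<mu>)" for z
  have p': "(\<lambda>(z, y). p (y, z)) \<in> borel_measurable (M \<Otimes>\<^sub>M \<mu>)" by measurable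
  have q[measurable]: "q \<in> borel_measurable M" unfolding q_def
    by (rule \<mu>.borel_measurable_nn_integral[OF p'])
  have zero: "AE x in \<mu>. AE y in \<mu>. (\<integral>\<^sup>+z. p (x, z) * p (y, z) \<partial>\<mu>) = 0"
    using sing ac AE_space
  proof eventually_elim
    case (elim x)
    note x = elim(1,2)
    have xM: "x \<in> space M" using elim(3) by (simp add: space_\<mu>)
    show ?case using elim(1) ac AE_space
    proof eventually_elim
      case (elim y)
      have yM: "y \<in> space M" using elim(3) by (simp add: space_\<mu>)
      obtain c r1 r2 H where fin: "finite_measure c"
        and sets: "sets c = sets M" "H \<in> sets M"
        and e: "\<And>A. A \<in> sets M \<Longrightarrow> emeasure (K x) A = emeasure c A + emeasure r1 A"
          "\<And>A. A \<in> sets M \<Longrightarrow> emeasure (K y) A = emeasure c A + emeasure r2 A"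
        and H: "emeasure r1 (space M - H) = 0" "emeasure r2 H = 0"
        and mass: "measure c (space M) = 1 - tv_dist M (K x) (K y)"
        using tv_dist_common_part[OF kernel_props(1)[OF K xM] kernel_props(1)[OF K yM] kernel_props(2)[OF K xM] kernel_props(2)[OF K yM]]
        by metis
      \<comment> \<open>Distance 1 leaves no common part, so \<open>K x\<close> lives on
        \<open>H\<close> and \<open>K y\<close> on its complement; each density vanishes where its
        law has no mass.\<close>
      have "emeasure c (space M) = 0"
        using mass fin elim(1) by (simp add: finite_measure.emeasure_eq_measure)
      then have c0: "emeasure c X = 0" if "X \<in> sets M" for X
        using emeasure_mono[of X "space M" c] sets that sets.sets_into_space[OF that] by auto
      have AEz: "AE z in \<mu>. z \<in> B \<longrightarrow> p (w, z) = 0"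
        if w: "w \<in> space M" and eqw: "\<forall>B\<in>sets M. emeasure (K w) (B - Nx w) = (\<integral>\<^sup>+z. p (w, z) * indicator B z \<partial>\<mu>)"
        and B: "B \<in> sets M" "emeasure (K w) B = 0" for w B
      proof -
        have "emeasure (K w) (B - Nx w) \<le> emeasure (K w) B"
          using B kernel_props(2)[OF K w] by (intro emeasure_mono) auto
        then have i0: "(\<integral>\<^sup>+z. p (w, z) * indicator B z \<partial>\<mu>) = 0" using bspec[OF eqw B(1)] B(2) by simp
        have "(\<lambda>z. p (w, z) * indicator B z) \<in> borel_measurable \<mu>"
          by (rule measurable_\<mu>[OF borel_measurable_times_ennreal[OF px borel_measurable_indicator]]) (rule w, rule B)
        from i0[unfolded nn_integral_0_iff_AE[OF this]] have "AE z in \<mu>. p (w, z) * indicator B z = 0" .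
        then show ?thesis by eventually_elim (auto simp: indicator_def)
      qed
      have "emeasure (K x) (space M - H) = 0" using c0 e(1) H sets by simp
      from AEz[OF xM x(2) _ this] have "AE z in \<mu>. z \<in> space M - H \<longrightarrow> p (x, z) = 0"
        using sets.compl_sets[OF sets(2)] by blast
      moreover have "emeasure (K y) H = 0" using c0 e(2) H sets by simp
      from AEz[OF yM elim(2) sets(2) this] have "AE z in \<mu>. z \<in> H \<longrightarrow> p (y, z) = 0" .
      ultimately have "AE z in \<mu>. p (x, z) * p (y, z) = 0" using AE_space
        by eventually_elim (auto simp: space_\<mu>)
      then show ?case using nn_integral_cong_AE[of "\<lambda>z. p (x, z) * p (y, z)" "\<lambda>_. 0" \<mu>] by simp
    qed
  qed
  have swap: "(\<integral>\<^sup>+x. \<integral>\<^sup>+z. F x z \<partial>\<mu> \<partial>\<mu>) = (\<integral>\<^sup>+z. \<integral>\<^sup>+x. F x z \<partial>\<mu> \<partial>\<mu>)"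
    if "(\<lambda>(x, z). F x z) \<in> borel_measurable (M \<Otimes>\<^sub>M M)" for F :: "'a \<Rightarrow> 'a \<Rightarrow> ennreal"
    by (rule pp.Fubini'[symmetric]) (use that in \<open>simp only: measurable_cong_sets[OF s2 refl]\<close>)
  have "(\<integral>\<^sup>+z. q z * q z \<partial>\<mu>) = (\<integral>\<^sup>+z. \<integral>\<^sup>+x. p (x, z) * q z \<partial>\<mu> \<partial>\<mu>)"
  proof (rule nn_integral_cong)
    fix z assume "z \<in> space \<mu>"
    then have z: "z \<in> space M" by (simp only: space_\<mu>)
    show "q z * q z = (\<integral>\<^sup>+x. p (x, z) * q z \<partial>\<mu>)"
      unfolding q_def by (rule nn_integral_multc[symmetric, OF measurable_\<mu>[OF py[OF z]]])
  qed
  also have "\<dots> = (\<integral>\<^sup>+x. \<integral>\<^sup>+z. p (x, z) * q z \<partial>\<mu> \<partial>\<mu>)"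
    by (rule swap[symmetric]) measurable
  also have "\<dots> = (\<integral>\<^sup>+x. \<integral>\<^sup>+z. \<integral>\<^sup>+y. p (x, z) * p (y, z) \<partial>\<mu> \<partial>\<mu> \<partial>\<mu>)"
  proof (intro nn_integral_cong)
    fix x z assume "z \<in> space \<mu>"
    then have z: "z \<in> space M" by (simp only: space_\<mu>)
    show "p (x, z) * q z = (\<integral>\<^sup>+y. p (x, z) * p (y, z) \<partial>\<mu>)"
      unfolding q_def by (rule nn_integral_cmult[symmetric, OF measurable_\<mu>[OF py[OF z]]])
  qed
  also have "\<dots> = (\<integral>\<^sup>+x. \<integral>\<^sup>+y. \<integral>\<^sup>+z. p (x, z) * p (y, z) \<partial>\<mu> \<partial>\<mu> \<partial>\<mu>)"
  proof (rule nn_integral_cong, rule swap)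
    fix x assume "x \<in> space \<mu>"
    then have x: "x \<in> space M" by (simp only: space_\<mu>)
    show "(\<lambda>(z, y). p (x, z) * p (y, z)) \<in> borel_measurable (M \<Otimes>\<^sub>M M)"
      unfolding case_prod_beta
      by (rule borel_measurable_times_ennreal[OF measurable_compose[OF measurable_fst px[OF x]]
            measurable_compose[OF measurable_Pair[OF measurable_snd measurable_fst] p]])
  qed
  also have "\<dots> = (\<integral>\<^sup>+x. 0 \<partial>\<mu>)"
  proof (rule nn_integral_cong_AE)
    show "AE x in \<mu>. (\<integral>\<^sup>+y. \<integral>\<^sup>+z. p (x, z) * p (y, z) \<partial>\<mu> \<partial>\<mu>) = 0" using zero
    proof eventually_elim
      case (elim x)
      from nn_integral_cong_AE[OF elim] show ?case by simp
    qed
  qed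
  finally have i0: "(\<integral>\<^sup>+z. q z * q z \<partial>\<mu>) = 0" by simp
  have "(\<lambda>z. q z * q z) \<in> borel_measurable \<mu>" by (rule measurable_\<mu>[OF borel_measurable_times_ennreal[OF q q]])
  from i0[unfolded nn_integral_0_iff_AE[OF this]] have "AE z in \<mu>. q z = 0" by eventually_elim simp
  from nn_integral_cong_AE[OF this] have q0: "(\<integral>\<^sup>+z. q z \<partial>\<mu>) = 0" by simp
  have "(\<integral>\<^sup>+x. \<integral>\<^sup>+z. p (x, z) \<partial>\<mu> \<partial>\<mu>) = (\<integral>\<^sup>+z. q z \<partial>\<mu>)"
    unfolding q_def by (rule swap) measurable
  then have p0: "(\<integral>\<^sup>+x. \<integral>\<^sup>+z. p (x, z) \<partial>\<mu> \<partial>\<mu>) = 0" unfolding q0 .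
  have pm: "p \<in> borel_measurable (M \<Otimes>\<^sub>M \<mu>)" by measurable
  have "(\<lambda>x. \<integral>\<^sup>+z. p (x, z) \<partial>\<mu>) \<in> borel_measurable \<mu>" by (rule measurable_\<mu>[OF \<mu>.borel_measurable_nn_integral_fst[OF pm]])
  from p0[unfolded nn_integral_0_iff_AE[OF this]] have "AE x in \<mu>. (\<integral>\<^sup>+z. p (x, z) \<partial>\<mu>) = 0" .
  \<comment> \<open>With a vanishing density \<open>K x\<close> has no mass outside the section
    \<open>Nx x\<close>, which is null for \<mu>.\<close>
  then show ?thesis using Nnull ac AE_space
  proof eventually_elim
    case (elim x)
    have "(\<integral>\<^sup>+z. p (x, z) * indicator (space M) z \<partial>\<mu>) = (\<integral>\<^sup>+z. p (x, z) \<partial>\<mu>)"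
      by (intro nn_integral_cong) (simp add: space_\<mu>)
    then have "emeasure (K x) (space M - Nx x) = 0" using bspec[OF elim(3) sets.top] elim(1) by simp
    then show ?case using elim(2) Nx by blast
  qed
qed

lemma Harris_visit:
  assumes io: "measure (path_law M P x) {\<omega> \<in> space (path_law M P x). infinite {n. n \<ge> 1 \<and> \<omega> n \<in> A}} = 1"
    and x: "x \<in> space M" and A: "A \<in> sets M"
  shows "\<exists>n. emeasure (nstep M P n x) A \<noteq> 0"
proof (rule ccontr)
  assume "\<not> ?thesis"
  then have 0: "emeasure (nstep M P n x) A = 0" for n by simp
  interpret Px: prob_space "path_law M P x" by (rule path_law_props(1)[OF x])
  note sx = path_law_props(2)[OF x]
  have m: "{\<omega> \<in> space S. \<omega> n \<in> A} \<in> sets S" for n using A by measurable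
  then have "(\<Union>n. {\<omega> \<in> space S. \<omega> n \<in> A}) \<in> null_sets (path_law M P x)"
    by (intro null_sets_UN null_setsI) (simp_all add: sx measure_path_law_marginal(1)[OF x A] 0)
  moreover have "infinitely_often A \<subseteq> (\<Union>n. {\<omega> \<in> space S. \<omega> n \<in> A})" by (auto simp: infinitely_often_alt)
  moreover have "infinitely_often A \<in> sets (path_law M P x)" using infinitely_often_sets[OF A] by (simp add: sx)
  ultimately have "infinitely_often A \<in> null_sets (path_law M P x)" by (meson null_sets_subset)
  then have "measure (path_law M P x) (infinitely_often A) = 0" by (simp add: measure_def null_setsD1)
  then show False using io by (simp add: infinitely_often_def path_law_props(3)[OF x])
qed

lemma \<mu>_null_nstep:
  assumes A: "A \<in> sets M" and 0: "emeasure \<mu> A = 0"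
  shows "AE x in \<mu>. \<forall>n. emeasure (nstep M P n x) A = 0"
  unfolding AE_all_countable
proof
  fix n
  interpret \<mu>: prob_space \<mu> by (rule \<mu>_prob)
  have k: "nstep M P n \<in> \<mu> \<rightarrow>\<^sub>M subprob_algebra M"
    unfolding measurable_cong_sets[OF sets_\<mu> refl] by (rule measurable_nstep_sub)
  have "(\<integral>\<^sup>+x. emeasure (nstep M P n x) A \<partial>\<mu>) = 0"
    using emeasure_bind[OF \<mu>.not_empty k A] unfolding \<mu>_nstep 0 by (rule sym)
  moreover have "(\<lambda>x. emeasure (nstep M P n x) A) \<in> borel_measurable \<mu>"
    unfolding measurable_cong_sets[OF sets_\<mu> refl]
    by (rule measurable_compose[OF measurable_nstep_sub measurable_emeasure_subprob_algebra[OF A]])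
  ultimately show "AE x in \<mu>. emeasure (nstep M P n x) A = 0" by (simp only: nn_integral_0_iff_AE)
qed

text \<open>Otherwise \<open>D\<close> is 1 almost everywhere, and then from some \<open>x\<close>
  the laws of all times live on \<mu>-null sets. Their union is null for \<phi> as well, so its
  complement is charged by \<phi> and has to be visited from \<open>x\<close>, but no law from
  \<open>x\<close> charges it.\<close>

lemma Harris_D_zero:
  assumes H: "Harris M P"
  shows "\<not> (AE x in \<mu>. AE y in \<mu>. D x y \<noteq> 0)"
proof
  interpret \<mu>: prob_space \<mu> by (rule \<mu>_prob)
  interpret pp: pair_prob_space \<mu> \<mu> ..
  obtain \<phi> where s\<phi>: "sets \<phi> = sets M" and \<phi>0: "emeasure \<phi> (space M) \<noteq> 0"
    and io: "\<forall>A\<in>sets M. emeasure \<phi> A > 0 \<longrightarrow> (\<forall>x\<in>space M. measure (path_law M P x)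
             {\<omega> \<in> space (path_law M P x). infinite {n. n \<ge> 1 \<and> \<omega> n \<in> A}} = 1)"
    using H unfolding Harris_def by (elim exE conjE) (rule that)
  have visit: "\<exists>n. emeasure (nstep M P n x) A \<noteq> 0" if "A \<in> sets M" "emeasure \<phi> A > 0" "x \<in> space M" for A x
    by (rule Harris_visit[OF bspec[OF mp[OF bspec[OF io that(1)] that(2)] that(3)] that(3,1)])
  \<comment> \<open>By invariance almost every start gives a \<mu>-null set probability 0 at all
    times, whereas a set charged by \<phi> is visited from every start.\<close>
  have ac: "emeasure \<phi> A = 0" if A: "A \<in> sets M" "emeasure \<mu> A = 0" for A
  proof (rule ccontr)
    assume "emeasure \<phi> A \<noteq> 0"
    then have v: "\<forall>x\<in>space M. \<exists>n. emeasure (nstep M P n x) A \<noteq> 0" using visit[OF A(1)] by (simp add: zero_less_iff_neq_zero)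
    have "AE x in \<mu>. False" using \<mu>_null_nstep[OF A] AE_space by eventually_elim (use v in \<open>auto simp: space_\<mu>\<close>)
    then show False by (simp add: \<mu>.AE_False)
  qed
  assume "AE x in \<mu>. AE y in \<mu>. D x y \<noteq> 0"
  moreover have "AE x in \<mu>. AE y in \<mu>. D x y = 0 \<or> D x y = 1" using pp.AE_pair[OF D_zero_one] by simp
  ultimately have D1: "AE x in \<mu>. AE y in \<mu>. D x y = 1"
  proof eventually_elim
    case (elim x)
    show ?case using elim by eventually_elim auto
  qed
  have "AE x in \<mu>. \<exists>N\<in>sets M. emeasure \<mu> N = 0 \<and> emeasure (nstep M P n x) (space M - N) = 0" for n
  proof (rule singular_of_pairwise_singular[OF measurable_nstep])
    show "AE x in \<mu>. AE y in \<mu>. dn n x y = 1" using D1 AE_space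
    proof eventually_elim
      case (elim x)
      show ?case using elim(1) AE_space
      proof eventually_elim
        case (elim y)
        then show ?case using D_le[of x y n] dn_bounds(2)[of x y n] \<open>x \<in> space \<mu>\<close> by (simp add: space_\<mu>)
      qed
    qed
  qed
  then have "AE x in \<mu>. \<forall>n. \<exists>N\<in>sets M. emeasure \<mu> N = 0 \<and> emeasure (nstep M P n x) (space M - N) = 0"
    by (simp add: AE_all_countable)
  with AE_space have "AE x in \<mu>. x \<in> space M \<and> (\<forall>n. \<exists>N\<in>sets M. emeasure \<mu> N = 0 \<and> emeasure (nstep M P n x) (space M - N) = 0)"
    by eventually_elim (simp add: space_\<mu>)
  then obtain x where x: "x \<in> space M" and "\<forall>n. \<exists>N\<in>sets M. emeasure \<mu> N = 0 \<and> emeasure (nstep M P n x) (space M - N) = 0"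
    using eventually_happens'[OF \<mu>.ae_filter_bot] by blast
  then obtain N where N: "\<And>n. N n \<in> sets M" "\<And>n. emeasure \<mu> (N n) = 0" "\<And>n. emeasure (nstep M P n x) (space M - N n) = 0"
    by metis
  have "(\<Union>n. N n) \<in> null_sets \<mu>" using N sets_\<mu> by (intro null_sets_UN null_setsI) auto
  then have UN: "(\<Union>n. N n) \<in> sets M" "emeasure \<phi> (\<Union>n. N n) = 0" using ac sets_\<mu> by auto
  have "emeasure \<phi> (space M) \<le> emeasure \<phi> ((\<Union>n. N n) \<union> (space M - (\<Union>n. N n)))"
    using UN s\<phi> by (intro emeasure_mono) auto
  also have "\<dots> \<le> emeasure \<phi> (\<Union>n. N n) + emeasure \<phi> (space M - (\<Union>n. N n))"
    using UN s\<phi> by (intro emeasure_subadditive) auto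
  finally have "0 < emeasure \<phi> (space M - (\<Union>n. N n))" using \<phi>0 UN(2) by (auto simp: zero_less_iff_neq_zero)
  then obtain n where "emeasure (nstep M P n x) (space M - (\<Union>n. N n)) \<noteq> 0" using visit[OF _ _ x] UN(1) by blast
  moreover have "emeasure (nstep M P n x) (space M - (\<Union>n. N n)) \<le> emeasure (nstep M P n x) (space M - N n)"
    using N(1) nstep_props(2)[OF x] by (intro emeasure_mono) auto
  ultimately show False using N(3)[of n] by simp
qed

end

subsection \<open>Cyclic classes\<close>

context stationary_kernel
begin

definition "class_of x = {y \<in> space M. D x y = 0}"

lemma class_of_sets: "x \<in> space M \<Longrightarrow> class_of x \<in> sets M"
  unfolding class_of_def using measurable_D1[of x] by simp

lemma class_of_eq:
  assumes x: "x \<in> space M" and y: "y \<in> space M" and D: "D x y = 0"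
  shows "class_of x = class_of y"
proof -
  have "D x z = D y z" if z: "z \<in> space M" for z
    using D_triangle[OF x y z] D_triangle[OF y x z] D by (simp add: D_commute[of y x])
  then show ?thesis by (auto simp: class_of_def)
qed

lemma class_of_disjoint:
  assumes x: "x \<in> space M" and y: "y \<in> space M" and D: "D x y \<noteq> 0"
  shows "class_of x \<inter> class_of y = {}"
proof -
  have False if z: "z \<in> space M" "D x z = 0" "D y z = 0" for z
    using D_triangle[OF x z(1) y] D_bounds(1)[OF x y] D z by (simp add: D_commute[of z y])
  then show ?thesis by (auto simp: class_of_def)
qed

lemma D_invariant_iterated:
  "AE x in \<mu>. AE y in \<mu>. AE u in P x. AE v in P y. D u v = D x y"
proof -
  interpret \<mu>: prob_space \<mu> by (rule \<mu>_prob)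
  interpret pp: pair_prob_space \<mu> \<mu> ..
  have P1: "nstep M P 1 x = P x" if "x \<in> space M" for x
    using bind_return[OF P_sub that] by simp
  have "AE x in \<mu>. AE y in \<mu>. AE q in nstep M P 1 x \<Otimes>\<^sub>M nstep M P 1 y. D (fst q) (snd q) = D x y"
    using pp.AE_pair[OF D_invariant[of 1]] by (simp only: fst_conv snd_conv)
  with AE_space show ?thesis
  proof eventually_elim
    case (elim x)
    then have x: "x \<in> space M" by (simp only: space_\<mu>)
    show ?case using AE_space elim(2)
    proof eventually_elim
      case (elim y)
      then have y: "y \<in> space M" by (simp only: space_\<mu>)
      interpret Px: prob_space "P x" by (rule kernel_props(1)[OF P x])
      interpret Py: prob_space "P y" by (rule kernel_props(1)[OF P y])
      interpret xy: pair_prob_space "P x" "P y" ..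
      show ?case using xy.AE_pair[OF elim(2)[unfolded P1[OF x] P1[OF y]]] by (simp only: fst_conv snd_conv)
    qed
  qed
qed

text \<open>Constancy of \<open>D\<close> along the product chain makes almost all points of one
  class jump into one common class. The bound \<open>c\<close> is carried along so that the step can
  be iterated without the masses tending to 0.\<close>

lemma class_of_step:
  assumes x: "x \<in> space M" and R: "AE y in \<mu>. AE u in P x. AE v in P y. D u v = D x y"
    and c: "0 < c" "c \<le> measure \<mu> (class_of x)"
  shows "\<exists>x'\<in>space M. c \<le> measure \<mu> (class_of x') \<and> (AE y in \<mu>. y \<in> class_of x \<longrightarrow> measure (P y) (class_of x') = 1)"
proof -
  interpret \<mu>: prob_space \<mu> by (rule \<mu>_prob)
  note Cx = class_of_sets[OF x]
  interpret Px: prob_space "P x" by (rule kernel_props(1)[OF P x])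
  have spx: "space (P x) = space M" by (rule kernel_props(3)[OF P x])
  have R0: "AE y in \<mu>. y \<in> space M \<and> (y \<in> class_of x \<longrightarrow> (AE u in P x. AE v in P y. D u v = 0))"
    using R AE_space
  proof eventually_elim
    case (elim y)
    have "AE u in P x. AE v in P y. D u v = 0" if "y \<in> class_of x"
    proof -
      have "D x y = 0" using that by (simp add: class_of_def)
      show ?thesis using elim(1) unfolding \<open>D x y = 0\<close> .
    qed
    then show ?case using elim(2) by (simp add: space_\<mu>)
  qed
  have "\<exists>y. y \<in> class_of x \<and> (AE u in P x. AE v in P y. D u v = 0)"
  proof (rule ccontr)
    assume no: "\<not> ?thesis"
    have "AE y in \<mu>. y \<notin> class_of x" using R0 by eventually_elim (use no in blast)
    then have "measure \<mu> (class_of x) = 0"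
      using Cx sets_\<mu> sets.sets_into_space[OF Cx]
      by (subst \<mu>.prob_eq_0) auto
    then show False using c by simp
  qed
  then obtain y0 where y0: "y0 \<in> space M" "AE u in P x. AE v in P y0. D u v = 0"
    by (auto simp: class_of_def)
  interpret Py0: prob_space "P y0" by (rule kernel_props(1)[OF P y0(1)])
  have spy0: "space (P y0) = space M" by (rule kernel_props(3)[OF P y0(1)])
  have "AE u in P x. u \<in> space M \<and> (AE v in P y0. D u v = 0)"
    using y0(2) AE_space by eventually_elim (simp add: spx)
  then obtain x' where x': "x' \<in> space M" "AE v in P y0. D x' v = 0"
    using eventually_happens'[OF Px.ae_filter_bot] by blast
  \<comment> \<open>A typical point \<open>u\<close> under \<open>P x\<close> and the chosen
    \<open>x'\<close> are both at \<open>D\<close>-distance 0 from almost every point under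
    \<open>P y0\<close>. Any common such point places \<open>u\<close> in the class of
    \<open>x'\<close>.\<close>
  have inC: "AE u in P x. u \<in> class_of x'"
    using y0(2) AE_space
  proof eventually_elim
    case (elim u)
    then have u: "u \<in> space M" by (simp only: spx)
    have "AE v in P y0. v \<in> space M \<and> D u v = 0 \<and> D x' v = 0"
      using elim(1) x'(2) AE_space by eventually_elim (simp add: spy0)
    then obtain v where v: "v \<in> space M" "D u v = 0" "D x' v = 0"
      using eventually_happens'[OF Py0.ae_filter_bot] by blast
    have "D x' u = 0"
      using D_triangle[OF x'(1) v(1) u] D_bounds(1)[OF x'(1) u] v by (simp add: D_commute[of v u])
    then show ?case using u by (simp add: class_of_def)
  qed
  note Cx' = class_of_sets[OF x'(1)]
  have one: "measure (P y) (class_of x') = 1"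
    if y: "y \<in> space M" and ae: "AE u in P x. AE v in P y. D u v = 0" for y
  proof -
    interpret Py: prob_space "P y" by (rule kernel_props(1)[OF P y])
    have spy: "space (P y) = space M" by (rule kernel_props(3)[OF P y])
    have "AE u in P x. u \<in> class_of x' \<and> (AE v in P y. D u v = 0)"
      using ae inC by eventually_elim simp
    then obtain u where u: "u \<in> class_of x'" "AE v in P y. D u v = 0"
      using eventually_happens'[OF Px.ae_filter_bot] by blast
    then have "u \<in> space M" "D x' u = 0" by (auto simp: class_of_def)
    then have "class_of x' = class_of u" by (intro class_of_eq x')
    moreover have "AE v in P y. v \<in> class_of u" using u(2) AE_space by eventually_elim (simp add: class_of_def spy)
    ultimately show ?thesis using Cx' kernel_props(2)[OF P y] by (subst Py.prob_eq_1) auto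
  qed
  have step: "AE y in \<mu>. y \<in> class_of x \<longrightarrow> measure (P y) (class_of x') = 1"
    using R0 by eventually_elim (use one in blast)
  \<comment> \<open>By invariance the mass of the new class is the mean probability of jumping into
    it, and this probability is 1 from almost all of the old class.\<close>
  have "measure \<mu> (class_of x) = (\<integral>y. indicator (class_of x) y \<partial>\<mu>)"
    using Cx sets_\<mu> sets.sets_into_space[OF Cx] by (simp add: space_\<mu> Int_absorb2)
  also have "\<dots> \<le> (\<integral>y. measure (P y) (class_of x') \<partial>\<mu>)"
  proof (rule integral_mono_AE)
    show "AE y in \<mu>. indicator (class_of x) y \<le> measure (P y) (class_of x')"
      using step by eventually_elim (auto simp: indicator_def)
    show "integrable \<mu> (indicator (class_of x) :: 'a \<Rightarrow> real)"
      using Cx sets_\<mu> by (intro integrable_real_indicator) (auto simp: \<mu>.emeasure_finite less_top[symmetric])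
    have "(\<lambda>y. measure (P y) (class_of x')) \<in> borel_measurable \<mu>"
      by (rule measurable_\<mu>[OF measurable_compose[OF P_sub measurable_measure_subprob_algebra[OF Cx']]])
    then show "integrable \<mu> (\<lambda>y. measure (P y) (class_of x'))"
      by (rule bounded_integrable[OF \<mu>.finite_measure_axioms, of _ 1])
         (simp add: space_\<mu> prob_space.prob_le_1 kernel_props(1)[OF P])
  qed
  also have "\<dots> = measure \<mu> (class_of x')"
    using measure_bind_kernel[OF \<mu>_prob sets_\<mu> P Cx'] by (simp only: \<mu>_inv)
  finally show ?thesis using step x' c by (intro bexI[of _ x'] conjI) auto
qed

text \<open>Iterating \<open>class_of_step\<close> yields classes of mass at least \<open>c\<close>.
  A finite measure has no room for infinitely many disjoint ones, so a class recurs, and the minimal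
  recurrence time is a candidate period.\<close>

lemma cond_B_absorbing_class:
  assumes H: "Harris M P" and ap: "aperiodic M P \<mu>"
  shows "\<exists>x\<in>space M. \<exists>E\<in>sets M. E \<subseteq> class_of x \<and> 0 < measure \<mu> E \<and> (\<forall>y\<in>E. measure (P y) E = 1)"
proof -
  interpret \<mu>: prob_space \<mu> by (rule \<mu>_prob)
  define R where "R x \<longleftrightarrow> (AE y in \<mu>. AE u in P x. AE v in P y. D u v = D x y)" for x
  have AR: "AE x in \<mu>. R x" unfolding R_def by (rule D_invariant_iterated)
  have "\<exists>x. x \<in> space M \<and> R x \<and> \<not> (AE y in \<mu>. D x y \<noteq> 0)"
  proof (rule ccontr)
    assume no: "\<not> ?thesis"
    have "AE x in \<mu>. AE y in \<mu>. D x y \<noteq> 0"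
      using AR AE_space by eventually_elim (use no in \<open>auto simp: space_\<mu>\<close>)
    then show False using Harris_D_zero[OF H] by blast
  qed
  then obtain x0 where x0: "x0 \<in> space M" "R x0" "\<not> (AE y in \<mu>. D x0 y \<noteq> 0)" by blast
  have pos: "measure \<mu> (class_of x0) \<noteq> 0"
  proof
    assume "measure \<mu> (class_of x0) = 0"
    then have "AE y in \<mu>. y \<notin> class_of x0" using class_of_sets[OF x0(1)] sets_\<mu> by (subst (asm) \<mu>.prob_eq_0) auto
    then have "AE y in \<mu>. D x0 y \<noteq> 0" using AE_space by eventually_elim (auto simp: class_of_def space_\<mu>)
    then show False using x0(3) by blast
  qed
  define c where "c = measure \<mu> (class_of x0)"
  have c: "0 < c" using pos by (simp add: c_def zero_less_measure_iff)
  have "\<exists>xs. \<forall>n. (xs n \<in> space M \<and> R (xs n) \<and> c \<le> measure \<mu> (class_of (xs n))) \<and>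
    (AE y in \<mu>. y \<in> class_of (xs n) \<longrightarrow> measure (P y) (class_of (xs (Suc n))) = 1)"
  proof (rule dependent_nat_choice)
    show "\<exists>x. x \<in> space M \<and> R x \<and> c \<le> measure \<mu> (class_of x)" using x0 c_def by auto
    fix x n assume "x \<in> space M \<and> R x \<and> c \<le> measure \<mu> (class_of x)"
    then obtain x' where x': "x' \<in> space M" "c \<le> measure \<mu> (class_of x')"
      "AE y in \<mu>. y \<in> class_of x \<longrightarrow> measure (P y) (class_of x') = 1"
      using class_of_step[of x c] c unfolding R_def by blast
    \<comment> \<open>The step needs a representative satisfying \<open>R\<close>, which holds only
      almost everywhere. As the new class has positive mass, it contains such a point
      \<open>z\<close>, and the class is renamed after it.\<close>
    have "\<exists>z. z \<in> class_of x' \<and> R z"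
    proof (rule ccontr)
      assume no: "\<not> ?thesis"
      have "AE y in \<mu>. y \<notin> class_of x'" using AR by eventually_elim (use no in blast)
      then have "measure \<mu> (class_of x') = 0"
        using class_of_sets[OF x'(1)] sets_\<mu> by (subst \<mu>.prob_eq_0) auto
      then show False using x' c by simp
    qed
    then obtain z where z: "z \<in> class_of x'" "R z" by blast
    then have "z \<in> space M" "class_of x' = class_of z" using class_of_eq[OF x'(1)] by (auto simp: class_of_def)
    then show "\<exists>y. (y \<in> space M \<and> R y \<and> c \<le> measure \<mu> (class_of y)) \<and>
        (AE w in \<mu>. w \<in> class_of x \<longrightarrow> measure (P w) (class_of y) = 1)"
      using x' z by (intro exI[of _ z]) simp
  qed
  then obtain xs where xs: "\<And>n. xs n \<in> space M" "\<And>n. c \<le> measure \<mu> (class_of (xs n))"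
    and step: "\<And>n. AE y in \<mu>. y \<in> class_of (xs n) \<longrightarrow> measure (P y) (class_of (xs (Suc n))) = 1" by blast
  \<comment> \<open>Without a recurrence the classes would be disjoint, so their masses would be
    summable and tend to 0, below \<open>c\<close>.\<close>
  have "\<exists>d\<ge>1. \<exists>i. D (xs i) (xs (i + d)) = 0"
  proof (rule ccontr)
    assume "\<not> ?thesis"
    then have ne: "D (xs i) (xs (i + d)) \<noteq> 0" if "d \<ge> 1" for i d using that by blast
    have "class_of (xs i) \<inter> class_of (xs j) = {}" if "i < j" for i j
      using ne[of "j - i" i] that by (intro class_of_disjoint xs) auto
    then have "disjoint_family (\<lambda>n. class_of (xs n))"
      unfolding disjoint_family_on_def by (metis inf_commute nat_neq_iff)
    then have "(\<lambda>n. measure \<mu> (class_of (xs n))) sums measure \<mu> (\<Union>n. class_of (xs n))"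
      using class_of_sets[OF xs(1)] sets_\<mu> by (intro \<mu>.finite_measure_UNION) auto
    then have "(\<lambda>n. measure \<mu> (class_of (xs n))) \<longlonglongrightarrow> 0" by (intro summable_LIMSEQ_zero) (rule sums_summable)
    then have "c \<le> 0" using xs(2) by (intro LIMSEQ_le_const) auto
    then show False using c by simp
  qed
  \<comment> \<open>Minimality is taken over all starting indices \<open>i\<close> at once; this
    makes the \<open>d\<close> classes from index \<open>i\<close> on pairwise disjoint.\<close>
  define d where "d = (LEAST d. d \<ge> 1 \<and> (\<exists>i. D (xs i) (xs (i + d)) = 0))"
  have d: "d \<ge> 1 \<and> (\<exists>i. D (xs i) (xs (i + d)) = 0)"
    unfolding d_def by (rule LeastI_ex) (use \<open>\<exists>d\<ge>1. \<exists>i. D (xs i) (xs (i + d)) = 0\<close> in blast)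
  have dmin: "D (xs i) (xs (i + e)) \<noteq> 0" if "1 \<le> e" "e < d" for i e
    using not_less_Least[of e "\<lambda>d. d \<ge> 1 \<and> (\<exists>i. D (xs i) (xs (i + d)) = 0)"] that unfolding d_def[symmetric] by blast
  obtain i where i: "D (xs i) (xs (i + d)) = 0" using d by blast
  define K where "K r = class_of (xs (i + r mod d))" for r
  have KM: "K r \<in> sets M" for r unfolding K_def by (rule class_of_sets[OF xs(1)])
  have Kstep: "AE y in \<mu>. y \<in> K r \<longrightarrow> measure (P y) (K (Suc r)) = 1" for r
  proof (cases "Suc (r mod d) = d")
    case True
    then have e: "Suc (i + r mod d) = i + d" by linarith
    have "class_of (xs (Suc (i + r mod d))) = class_of (xs i)"
      unfolding e by (rule class_of_eq[OF xs(1) xs(1) i, symmetric])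
    also have "\<dots> = K (Suc r)" using True by (simp add: K_def mod_Suc)
    finally have "class_of (xs (Suc (i + r mod d))) = K (Suc r)" .
    then show ?thesis using step[of "i + r mod d"] by (simp add: K_def)
  next
    case False
    then show ?thesis using step[of "i + r mod d"] by (simp add: K_def mod_Suc)
  qed
  have Kmod: "K (r mod d + n) = K (r + n)" for r n by (simp add: K_def mod_add_left_eq)
  \<comment> \<open>The classes \<open>K r\<close> follow the cycle only up to null sets, but
    periodicity asks for every point. \<open>E r\<close> keeps the points from which the whole
    future follows the cycle with probability 1; this loses no mass, and one step leads from
    \<open>E r\<close> surely into \<open>E (Suc r)\<close>.\<close>
  define E where "E r = {y \<in> K r. \<forall>n. measure (nstep M P n y) (K (r + n)) = 1}" for r
  have Em: "(\<lambda>y. measure (nstep M P n y) (K r)) \<in> borel_measurable M" for n r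
    by (rule measurable_compose[OF measurable_nstep_sub measurable_measure_subprob_algebra[OF KM]])
  have EM: "E r \<in> sets M" for r
  proof -
    have "E r = K r \<inter> {y \<in> space M. \<forall>n. measure (nstep M P n y) (K (r + n)) = 1}"
      using sets.sets_into_space[OF KM] by (auto simp: E_def)
    moreover have "{y \<in> space M. \<forall>n. measure (nstep M P n y) (K (r + n)) = 1} \<in> sets M"
      by (intro sets.sets_Collect_countable_All borel_measurable_eq Em) simp
    ultimately show ?thesis using KM by auto
  qed
  have KE: "AE y in \<mu>. y \<in> K r \<longrightarrow> measure (nstep M P n y) (K (r + n)) = 1" for r n
  proof (induction n)
    case 0
    have "AE y in \<mu>. y \<in> K r \<longrightarrow> measure (return M y) (K r) = 1"
      by (rule AE_I2) (simp add: measure_return[OF KM])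
    then show ?case by simp
  next
    case (Suc n)
    let ?Q = "\<lambda>z. z \<in> K (r + n) \<longrightarrow> measure (P z) (K (Suc (r + n))) = 1"
    have Qm: "Measurable.pred M ?Q"
      using measurable_compose[OF P_sub measurable_measure_subprob_algebra[OF KM]] KM[of "r + n"] by measurable
    have "AE z in \<mu> \<bind> nstep M P n. ?Q z" unfolding \<mu>_nstep by (rule Kstep)
    then have "AE y in \<mu>. AE z in nstep M P n y. ?Q z"
      unfolding AE_bind[OF measurable_\<mu>[OF measurable_nstep_sub] Qm] .
    with Suc AE_space show ?case
    proof eventually_elim
      case (elim y)
      then have y: "y \<in> space M" by (simp only: space_\<mu>)
      interpret a: prob_space "nstep M P n y" by (rule nstep_props(1)[OF y])
      show ?case
      proof
        assume "y \<in> K r"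
        then have "AE z in nstep M P n y. z \<in> K (r + n)"
          using elim(1) KM nstep_props(2)[OF y, of n] by (subst a.prob_eq_1[symmetric]) auto
        then have "AE z in nstep M P n y. measure (P z) (K (Suc (r + n))) = 1"
          using elim(3) by eventually_elim blast
        then have "measure (nstep M P n y \<bind> P) (K (Suc (r + n))) = 1"
          by (simp only: prob_1_of_AE_bind[OF nstep_props(1,2)[OF y] P KM])
        then show "measure (nstep M P (Suc n) y) (K (r + Suc n)) = 1" by simp
      qed
    qed
  qed
  have "AE y in \<mu>. \<forall>n. y \<in> K r \<longrightarrow> measure (nstep M P n y) (K (r + n)) = 1" for r
    unfolding AE_all_countable using KE by blast
  then have AEE: "AE y in \<mu>. y \<in> K r \<longrightarrow> y \<in> E r" for r
    by (rule eventually_mono) (auto simp: E_def)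
  have Estep: "measure (P y) (E (Suc r)) = 1" if yE: "y \<in> E r" for y r
  proof -
    have y: "y \<in> space M" using yE EM sets.sets_into_space by blast
    interpret Py: prob_space "P y" by (rule kernel_props(1)[OF P y])
    note sPy = kernel_props(2)[OF P y]
    have P1: "nstep M P 1 y = P y" using bind_return[OF P_sub y] by simp
    have "AE z in P y. measure (nstep M P n z) (K (Suc r + n)) = 1" for n
    proof -
      have "measure (nstep M P (1 + n) y) (K (r + (1 + n))) = 1" using yE unfolding E_def by blast
      then have "measure (P y \<bind> nstep M P n) (K (Suc r + n)) = 1"
        unfolding nstep_add[OF y] P1 by simp
      then show ?thesis unfolding prob_1_of_AE_bind[OF Py.prob_space_axioms sPy measurable_nstep KM] .
    qed
    then have 1: "AE z in P y. \<forall>n. measure (nstep M P n z) (K (Suc r + n)) = 1" unfolding AE_all_countable by blast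
    have "measure (P y) (K (Suc r)) = 1"
    proof -
      have "measure (nstep M P 1 y) (K (r + 1)) = 1" using yE unfolding E_def by blast
      then show ?thesis unfolding P1 by simp
    qed
    then have "AE z in P y. z \<in> K (Suc r)" using KM sPy by (subst Py.prob_eq_1[symmetric]) auto
    with 1 have "AE z in P y. z \<in> E (Suc r)" by eventually_elim (simp add: E_def)
    then show ?thesis using EM sPy by (subst Py.prob_eq_1) auto
  qed
  have Emod: "E (r mod d) = E r" for r using Kmod[of r] Kmod[of r 0] by (simp add: E_def)
  have Epos: "0 < measure \<mu> (E 0)"
  proof -
    have "c \<le> measure \<mu> (K 0)" unfolding K_def by (rule xs(2))
    also have "\<dots> \<le> measure \<mu> (E 0)"
      using AEE[of 0] EM KM sets_\<mu> by (intro \<mu>.finite_measure_mono_AE) auto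
    finally show ?thesis using c by simp
  qed
  have "d = 1"
  proof (rule ccontr)
    assume "d \<noteq> 1"
    then have d2: "2 \<le> d" using d by simp
    have dis: "K r \<inter> K s = {}" if "r < s" "s < d" for r s
      using dmin[of "s - r" "i + r"] that unfolding K_def by (intro class_of_disjoint xs(1)) (simp_all add: add.assoc)
    \<comment> \<open>The definition of periodicity numbers the classes from 1, the sets
      \<open>E\<close> from 0; hence the shift by one.\<close>
    have "periodic M P \<mu> d"
      unfolding periodic_def
    proof (intro exI[of _ "\<lambda>j. E (j - 1)"] conjI ballI)
      show "E (j - 1) \<in> sets M" for j by (rule EM)
      show "disjoint_family_on (\<lambda>j. E (j - 1)) {1..d}"
        unfolding disjoint_family_on_def
      proof (intro ballI impI)
        fix j k assume jk: "j \<in> {1..d}" "k \<in> {1..d}" "j \<noteq> k"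
        have EK: "E r \<subseteq> K r" for r by (auto simp: E_def)
        have "K (j - 1) \<inter> K (k - 1) = {}"
        proof (cases "j < k")
          case True
          then show ?thesis using jk by (intro dis) auto
        next
          case False
          then have "K (k - 1) \<inter> K (j - 1) = {}" using jk by (intro dis) auto
          then show ?thesis by blast
        qed
        then show "E (j - 1) \<inter> E (k - 1) = {}" using EK by blast
      qed
      show "0 < measure \<mu> (E (1 - 1))" using Epos by simp
      fix j y assume j: "j \<in> {1..d}" and y: "y \<in> E (j - 1)"
      have "measure (P y) (E (Suc (j - 1))) = 1" by (rule Estep[OF y])
      then show "measure (P y) (E (Suc (j mod d) - 1)) = 1" using j by (simp add: Emod)
    qed
    then show False using ap d2 unfolding aperiodic_def by blast
  qed
  then have E1: "E (Suc 0) = E 0" using Emod[of "Suc 0"] by simp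
  have "\<forall>y\<in>E 0. measure (P y) (E 0) = 1"
  proof
    fix y assume "y \<in> E 0"
    from Estep[OF this] show "measure (P y) (E 0) = 1" by (simp only: E1)
  qed
  moreover have "E 0 \<subseteq> class_of (xs i)" by (auto simp: E_def K_def \<open>d = 1\<close>)
  ultimately show ?thesis using xs(1)[of i] EM[of 0] Epos by blast
qed

section \<open>Absorption of Harris chains\<close>

lemma path_law_stays:
  assumes z: "z \<in> space M" and E: "E \<in> sets M" and abs: "\<And>y. y \<in> E \<Longrightarrow> measure (P y) E = 1"
  shows "AE \<omega> in path_law M P z. \<forall>k. \<omega> k \<in> E \<longrightarrow> \<omega> (Suc k) \<in> E"
  unfolding AE_all_countable
proof
  fix k
  \<comment> \<open>The cylinder \<open>C\<close> below says that the path is in \<open>E\<close> at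
    time 0 and outside \<open>E\<close> at time 1. It is null from every start, and its shift by
    \<open>k\<close> is the event of leaving \<open>E\<close> right after time
    \<open>k\<close>.\<close>
  define A where "A i = (if i = (0::nat) then E else space M - E)" for i
  have A: "A i \<in> sets M" for i using E by (simp add: A_def sets.compl_sets)
  define C where "C = cylinder M 2 A"
  have C: "C \<in> sets S" unfolding C_def by (rule cylinder_sets[OF A])
  have C0: "emeasure (path_law M P y) C = 0" if y: "y \<in> space M" for y
  proof (cases "y \<in> E")
    case True
    interpret Py: prob_space "P y" by (rule kernel_props(1)[OF P y])
    note sP = kernel_props(2)[OF P y]
    have "measure (P y) (space M - E) = 0"
      using abs[OF True] E sP kernel_props(3)[OF P y] Py.prob_compl[of E] by simp
    then have e0: "emeasure (P y) (space M - E) = 0" by (simp add: Py.emeasure_eq_measure)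
    have "(\<integral>\<^sup>+u. indicator (space M - E) u * (\<integral>\<^sup>+v. 1 \<partial>P u) \<partial>P y) = (\<integral>\<^sup>+u. indicator (space M - E) u \<partial>P y)"
      using prob_space.emeasure_space_1[OF kernel_props(1)[OF P]] kernel_props(3)[OF P y]
      by (intro nn_integral_cong) simp
    also have "\<dots> = 0" using e0 E sP by (simp add: sets.compl_sets)
    finally show ?thesis
      unfolding C_def emeasure_path_law_cylinder[OF y A] by (simp add: A_def numeral_2_eq_2)
  next
    case False
    then show ?thesis
      unfolding C_def emeasure_path_law_cylinder[OF y A] by (simp add: A_def numeral_2_eq_2)
  qed
  have "emeasure (nstep M P k z \<bind> path_law M P) C = (\<integral>\<^sup>+y. emeasure (path_law M P y) C \<partial>nstep M P k z)"
    by (rule emeasure_bind[OF nstep_not_empty[OF z] nstep_sub[OF z measurable_path_law_sub] C])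
  also have "\<dots> = (\<integral>\<^sup>+y. 0 \<partial>nstep M P k z)"
    using C0 nstep_props(3)[OF z] by (intro nn_integral_cong) auto
  finally have 0: "emeasure (nstep M P k z \<bind> path_law M P) C = 0" by simp
  have sh: "(\<lambda>\<omega> i. \<omega> (i + k)) \<in> path_law M P z \<rightarrow>\<^sub>M S"
    unfolding measurable_cong_sets[OF path_law_props(2)[OF z] refl] by (rule measurable_shift)
  define X where "X = (\<lambda>\<omega> i. \<omega> (i + k)) -` C \<inter> space (path_law M P z)"
  have X: "X \<in> null_sets (path_law M P z)"
    using 0 measurable_sets[OF sh C] unfolding path_law_shift[OF z, symmetric] emeasure_distr[OF sh C] X_def
    by (rule null_setsI)
  show "AE \<omega> in path_law M P z. \<omega> k \<in> E \<longrightarrow> \<omega> (Suc k) \<in> E"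
  proof (rule AE_I'[OF X], rule subsetI)
    fix \<omega> assume w: "\<omega> \<in> {\<omega> \<in> space (path_law M P z). \<not> (\<omega> k \<in> E \<longrightarrow> \<omega> (Suc k) \<in> E)}"
    then have wS: "\<omega> \<in> space S" using path_law_props(3)[OF z] by simp
    have "(\<lambda>i. \<omega> (i + k)) \<in> space S" by (rule measurable_space[OF measurable_shift wS])
    moreover have "\<omega> (Suc k) \<in> space M" using wS by (auto simp: space_PiM PiE_iff)
    ultimately show "\<omega> \<in> X" using w by (auto simp: X_def C_def cylinder_def A_def less_2_cases_iff)
  qed
qed

text \<open>Since \<open>E\<close> is absorbing, a single visit means that the path stays in
  \<open>E\<close> from then on. The events \<open>V n\<close> therefore increase to an event of
  probability 1.\<close>

lemma measure_nstep_tendsto_1: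
  assumes z: "z \<in> space M" and E: "E \<in> sets M" and abs: "\<And>y. y \<in> E \<Longrightarrow> measure (P y) E = 1"
    and io: "measure (path_law M P z) (infinitely_often E) = 1"
  shows "(\<lambda>n. measure (nstep M P n z) E) \<longlonglongrightarrow> 1"
proof -
  interpret Pz: prob_space "path_law M P z" by (rule path_law_props(1)[OF z])
  note sz = path_law_props(2)[OF z]
  define V where "V n = {\<omega> \<in> space S. \<forall>m\<ge>n. \<omega> m \<in> E}" for n
  have V: "V n \<in> sets (path_law M P z)" for n unfolding V_def sz using E by measurable
  have lim: "(\<lambda>n. measure (path_law M P z) (V n)) \<longlonglongrightarrow> measure (path_law M P z) (\<Union>n. V n)"
  proof (rule Pz.finite_Lim_measure_incseq)
    show "range V \<subseteq> sets (path_law M P z)" using V by blast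
    show "incseq V" by (rule incseq_SucI) (auto simp: V_def)
  qed
  have UV: "(\<Union>n. V n) \<in> sets (path_law M P z)" using V by (rule sets.countable_UN[OF image_subsetI])
  have "AE \<omega> in path_law M P z. \<omega> \<in> infinitely_often E"
    using io infinitely_often_sets[OF E] sz by (subst Pz.prob_eq_1[symmetric]) auto
  moreover have "AE \<omega> in path_law M P z. \<forall>k. \<omega> k \<in> E \<longrightarrow> \<omega> (Suc k) \<in> E"
    by (rule path_law_stays[OF z E abs])
  ultimately have "AE \<omega> in path_law M P z. \<omega> \<in> (\<Union>n. V n)"
  proof eventually_elim
    case (elim \<omega>)
    then obtain n where n: "\<omega> n \<in> E" "\<omega> \<in> space S" by (auto simp: infinitely_often_alt)
    have "\<omega> m \<in> E" if "n \<le> m" for m using that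
      by (induction m rule: dec_induct) (use n elim(2) in auto)
    then show ?case using n by (auto simp: V_def)
  qed
  then have "measure (path_law M P z) (\<Union>n. V n) = 1" using UV by (simp add: Pz.prob_eq_1)
  then have lim1: "(\<lambda>n. measure (path_law M P z) (V n)) \<longlonglongrightarrow> 1" using lim by simp
  show ?thesis
  proof (rule tendsto_sandwich[OF _ _ lim1 tendsto_const])
    have "measure (path_law M P z) (V n) \<le> measure (nstep M P n z) E" for n
    proof -
      have "{\<omega> \<in> space S. \<omega> n \<in> E} \<in> sets (path_law M P z)" unfolding sz using E by measurable
      then have "measure (path_law M P z) (V n) \<le> measure (path_law M P z) {\<omega> \<in> space S. \<omega> n \<in> E}"
        by (intro Pz.finite_measure_mono) (auto simp: V_def)
      then show ?thesis by (simp only: measure_path_law_marginal(2)[OF z E])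
    qed
    then show "\<forall>\<^sub>F n in sequentially. measure (path_law M P z) (V n) \<le> measure (nstep M P n z) E" by simp
    show "\<forall>\<^sub>F n in sequentially. measure (nstep M P n z) E \<le> 1"
      using prob_space.prob_le_1[OF nstep_props(1)[OF z]] by simp
  qed
qed

text \<open>Once the absorbing set \<open>E\<close> is known to be charged by \<phi>, recurrence
  drives every path into it. Then \<open>E\<close> has full \<mu>-mass, and as it lies within one
  class, convergence holds from all of its points.\<close>

lemma cond_B_imp_P:
  assumes B: "cond_B M P \<mu>"
  shows "cond_P M P \<mu>"
proof -
  interpret \<mu>: prob_space \<mu> by (rule \<mu>_prob)
  have H: "Harris M P" and ap: "aperiodic M P \<mu>" using B by (auto simp: cond_B_def)
  obtain x0 E where x0: "x0 \<in> space M" and E: "E \<in> sets M" "E \<subseteq> class_of x0" "0 < measure \<mu> E"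
    and abs: "\<And>y. y \<in> E \<Longrightarrow> measure (P y) E = 1"
    using cond_B_absorbing_class[OF H ap] by blast
  obtain \<phi> where s\<phi>: "sets \<phi> = sets M" and \<phi>0: "emeasure \<phi> (space M) \<noteq> 0"
    and io: "\<forall>A\<in>sets M. emeasure \<phi> A > 0 \<longrightarrow> (\<forall>x\<in>space M. measure (path_law M P x)
             {\<omega> \<in> space (path_law M P x). infinite {n. n \<ge> 1 \<and> \<omega> n \<in> A}} = 1)"
    using H unfolding Harris_def by (elim exE conjE) (rule that)
  have stay: "measure (nstep M P n y) E = 1" if yE: "y \<in> E" for y n
  proof (induction n)
    case 0
    show ?case using yE by (simp add: measure_return[OF E(1)])
  next
    case (Suc n)
    have y: "y \<in> space M" using yE sets.sets_into_space[OF E(1)] by blast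
    interpret a: prob_space "nstep M P n y" by (rule nstep_props(1)[OF y])
    have "AE u in nstep M P n y. u \<in> E"
      using Suc E(1) nstep_props(2)[OF y, of n] by (subst a.prob_eq_1[symmetric]) auto
    then have "AE u in nstep M P n y. measure (P u) E = 1" by eventually_elim (rule abs)
    then have "measure (nstep M P n y \<bind> P) E = 1"
      by (simp only: prob_1_of_AE_bind[OF nstep_props(1,2)[OF y] P E(1)])
    then show ?case by simp
  qed
  \<comment> \<open>Otherwise the complement of \<open>E\<close> would be charged by \<phi> and
    hence visited from points of \<open>E\<close>, which the chain never leaves.\<close>
  have "emeasure \<phi> E \<noteq> 0"
  proof
    assume 0: "emeasure \<phi> E = 0"
    have cE: "space M - E \<in> sets M" using E(1) by auto
    have "emeasure \<phi> (space M) \<le> emeasure \<phi> (E \<union> (space M - E))"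
      using E(1) s\<phi> by (intro emeasure_mono) auto
    also have "\<dots> \<le> emeasure \<phi> E + emeasure \<phi> (space M - E)"
      using E(1) s\<phi> by (intro emeasure_subadditive) auto
    finally have pos: "0 < emeasure \<phi> (space M - E)" using \<phi>0 0 by (auto simp: zero_less_iff_neq_zero)
    have "E \<noteq> {}" using E(3) by auto
    then obtain y where yE: "y \<in> E" by auto
    then have y: "y \<in> space M" using sets.sets_into_space[OF E(1)] by blast
    obtain n where n: "emeasure (nstep M P n y) (space M - E) \<noteq> 0"
      using Harris_visit[OF bspec[OF mp[OF bspec[OF io cE] pos] y] y cE] by blast
    interpret a: prob_space "nstep M P n y" by (rule nstep_props(1)[OF y])
    have "measure (nstep M P n y) (space M - E) = 0"
      using stay[OF yE, of n] E(1) nstep_props(2,3)[OF y] a.prob_compl[of E] by simp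
    then show False using n by (simp add: a.emeasure_eq_measure)
  qed
  then have pos: "0 < emeasure \<phi> E" by (simp add: zero_less_iff_neq_zero)
  have lim1: "(\<lambda>n. measure (nstep M P n z) E) \<longlonglongrightarrow> 1" if z: "z \<in> space M" for z
  proof (rule measure_nstep_tendsto_1[OF z E(1) abs])
    show "measure (path_law M P z) (infinitely_often E) = 1"
      using bspec[OF mp[OF bspec[OF io E(1)] pos] z]
      unfolding infinitely_often_def path_law_props(3)[OF z] .
  qed
  \<comment> \<open>The probabilities of \<open>E\<close> tend to 1 from every start, while their
    \<mu>-averages all equal the \<mu>-mass of \<open>E\<close> by invariance.\<close>
  have "measure \<mu> E = 1"
  proof (rule LIMSEQ_unique)
    have meas: "(\<lambda>z. measure (nstep M P n z) E) \<in> borel_measurable \<mu>" for n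
      by (rule measurable_\<mu>[OF measurable_compose[OF measurable_nstep_sub measurable_measure_subprob_algebra[OF E(1)]]])
    have "(\<lambda>n. \<integral>z. measure (nstep M P n z) E \<partial>\<mu>) \<longlonglongrightarrow> (\<integral>z. 1 \<partial>\<mu>)"
    proof (rule bounded_convergence[OF \<mu>.finite_measure_axioms meas, where B=1])
      show "AE z in \<mu>. (\<lambda>n. measure (nstep M P n z) E) \<longlonglongrightarrow> 1"
        by (rule AE_I2) (simp add: space_\<mu> lim1)
      show "\<bar>measure (nstep M P n z) E\<bar> \<le> 1" if "z \<in> space \<mu>" for n z
        using prob_space.prob_le_1[OF nstep_props(1)] that by (simp add: space_\<mu>)
    qed simp
    then show "(\<lambda>n. \<integral>z. measure (nstep M P n z) E \<partial>\<mu>) \<longlonglongrightarrow> 1" by (simp add: \<mu>.prob_space)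
    have "(\<integral>z. measure (nstep M P n z) E \<partial>\<mu>) = measure \<mu> E" for n
      using measure_bind_kernel[OF \<mu>_prob sets_\<mu> measurable_nstep E(1)] by (simp only: \<mu>_nstep)
    then show "(\<lambda>n. \<integral>z. measure (nstep M P n z) E \<partial>\<mu>) \<longlonglongrightarrow> measure \<mu> E" by simp
  qed
  then have "AE y in \<mu>. y \<in> E" using E(1) sets_\<mu> by (subst \<mu>.prob_eq_1[symmetric]) auto
  then have AE0: "AE y in \<mu>. D x0 y = 0" by eventually_elim (use E(2) in \<open>auto simp: class_of_def\<close>)
  show ?thesis
    unfolding cond_P_def
  proof
    fix x assume x: "x \<in> space M"
    show "(\<lambda>n. tv_dist M (nstep M P n x) \<mu>) \<longlonglongrightarrow> 0"
    proof (rule tv_\<mu>_tendsto_0_entering[OF x E(1)])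
      show "(\<lambda>n. tv_dist M (nstep M P n z) \<mu>) \<longlonglongrightarrow> 0" if "z \<in> E" for z
        using tv_\<mu>_tendsto_0_of_class[OF x0 AE0] that E(2) by (auto simp: class_of_def)
      fix \<epsilon> :: real assume "0 < \<epsilon>"
      then obtain n where "1 - \<epsilon> < measure (nstep M P n x) E"
        using eventually_happens'[OF sequentially_bot order_tendstoD(1)[OF lim1[OF x], of "1 - \<epsilon>"]] by auto
      then show "\<exists>n. measure (nstep M P n x) E \<ge> 1 - \<epsilon>" by (intro exI[of _ n]) simp
    qed
  qed
qed

end

subsection \<open>Disintegration and gluing\<close>

text \<open>The hypothesis is tested on the set where \<open>g x < f x\<close>; finiteness of the
  integral of \<open>f\<close> permits the subtraction there.\<close>

lemma (in finite_measure) AE_le_of_integrals_le: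
  assumes f[measurable]: "f \<in> borel_measurable M" and g[measurable]: "g \<in> borel_measurable M"
    and fin: "(\<integral>\<^sup>+x. f x \<partial>M) < \<infinity>"
    and le: "\<And>A. A \<in> sets M \<Longrightarrow> (\<integral>\<^sup>+x. f x * indicator A x \<partial>M) \<le> (\<integral>\<^sup>+x. g x * indicator A x \<partial>M)"
  shows "AE x in M. f x \<le> (g x :: ennreal)"
proof -
  define A where "A = {x \<in> space M. g x < f x}"
  have A[measurable]: "A \<in> sets M" unfolding A_def by measurable
  have gf: "g x * indicator A x \<le> f x * indicator A x" for x by (auto simp: A_def indicator_def)
  have "(\<integral>\<^sup>+x. g x * indicator A x \<partial>M) \<le> (\<integral>\<^sup>+x. f x \<partial>M)"
    by (intro nn_integral_mono) (auto simp: A_def indicator_def)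
  then have gfin: "(\<integral>\<^sup>+x. g x * indicator A x \<partial>M) \<noteq> \<infinity>" using fin by (auto simp: top_unique)
  have "(\<integral>\<^sup>+x. f x * indicator A x - g x * indicator A x \<partial>M)
      = (\<integral>\<^sup>+x. f x * indicator A x \<partial>M) - (\<integral>\<^sup>+x. g x * indicator A x \<partial>M)"
    by (rule nn_integral_diff[OF _ _ gfin]) (use gf in auto)
  also have "\<dots> = 0"
  proof (rule diff_eq_0_ennreal[OF _ le[OF A]])
    have "(\<integral>\<^sup>+x. f x * indicator A x \<partial>M) \<le> (\<integral>\<^sup>+x. f x \<partial>M)"
      by (intro nn_integral_mono) (auto simp: indicator_def)
    then show "(\<integral>\<^sup>+x. f x * indicator A x \<partial>M) < \<top>" using fin by simp
  qed
  finally have "(\<integral>\<^sup>+x. f x * indicator A x - g x * indicator A x \<partial>M) = 0" .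
  then have "AE x in M. f x * indicator A x - g x * indicator A x = 0"
    by (subst (asm) nn_integral_0_iff_AE) auto
  with AE_space show ?thesis
  proof eventually_elim
    case (elim x)
    show ?case
    proof (rule ccontr)
      assume "\<not> f x \<le> g x"
      then have lt: "g x < f x" by simp
      then have "x \<in> A" using elim(1) by (simp add: A_def)
      then have "f x - g x = 0" using elim(2) by simp
      then show False using lt by (metis diff_gr0_ennreal less_irrefl)
    qed
  qed
qed

text \<open>The kernel is obtained from its distribution functions, which are the right limits of the
  Radon--Nikodym derivatives \<open>f t\<close> along the rationals.\<close>

lemma disintegration_unit_interval:
  assumes fin: "finite_measure \<rho>" and s\<rho>: "sets \<rho> = sets (N \<Otimes>\<^sub>M borel)"
    and unit: "AE p in \<rho>. 0 \<le> snd p \<and> snd p \<le> (1::real)"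
  shows "\<exists>\<kappa>\<in>N \<rightarrow>\<^sub>M prob_algebra borel. \<forall>C\<in>sets (N \<Otimes>\<^sub>M borel).
    emeasure \<rho> C = (\<integral>\<^sup>+s. emeasure (\<kappa> s) (Pair s -` C) \<partial>distr \<rho> N fst)"
proof -
  interpret \<rho>: finite_measure \<rho> by fact
  have sp\<rho>: "space \<rho> = space N \<times> UNIV" using sets_eq_imp_space_eq[OF s\<rho>] by (simp add: space_pair_measure)
  have fm: "fst \<in> \<rho> \<rightarrow>\<^sub>M N" unfolding measurable_cong_sets[OF s\<rho> refl] by (rule measurable_fst)
  have sm: "snd \<in> \<rho> \<rightarrow>\<^sub>M borel" unfolding measurable_cong_sets[OF s\<rho> refl] by (rule measurable_snd)
  define \<gamma> where "\<gamma> = distr \<rho> N fst"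
  interpret \<gamma>: finite_measure \<gamma> unfolding \<gamma>_def by (rule \<rho>.finite_measure_distr[OF fm])
  have s\<gamma>: "sets \<gamma> = sets N" "space \<gamma> = space N" by (simp_all add: \<gamma>_def)
  have e\<gamma>: "emeasure \<gamma> A = emeasure \<rho> (A \<times> UNIV)" if A: "A \<in> sets N" for A
    unfolding \<gamma>_def emeasure_distr[OF fm A] using sets.sets_into_space[OF A]
    by (intro arg_cong[where f="emeasure \<rho>"]) (auto simp: sp\<rho>)
  have rect: "A \<times> B \<in> sets \<rho>" if "A \<in> sets N" "B \<in> sets borel" for A B
    unfolding s\<rho> using that by (rule pair_measureI)
  \<comment> \<open>\<open>R t\<close> maps \<open>A\<close> to the mass of
    \<open>A \<times> {..t}\<close>, so its derivative \<open>f t\<close> with respect to \<gamma>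
    is the conditional probability that the second coordinate is at most \<open>t\<close>.\<close>
  define R where "R t = distr (density \<rho> (indicator (space N \<times> {..t}))) N fst" for t :: real
  have fmd: "fst \<in> density \<rho> g \<rightarrow>\<^sub>M N" for g using fm by simp
  have eR: "emeasure (R t) A = emeasure \<rho> (A \<times> {..t})" if A: "A \<in> sets N" for A t
  proof -
    have "emeasure (R t) A = emeasure (density \<rho> (indicator (space N \<times> {..t}))) (fst -` A \<inter> space \<rho>)"
      unfolding R_def emeasure_distr[OF fmd A] by simp
    also have "\<dots> = emeasure \<rho> ((space N \<times> {..t}) \<inter> (fst -` A \<inter> space \<rho>))"
      by (rule emeasure_restricted[OF rect measurable_sets[OF fm A]]) auto
    also have "(space N \<times> {..t}) \<inter> (fst -` A \<inter> space \<rho>) = A \<times> {..t}"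
      using sets.sets_into_space[OF A] by (auto simp: sp\<rho>)
    finally show ?thesis .
  qed
  have Rle: "emeasure (R t) A \<le> emeasure \<gamma> A" if A: "A \<in> sets N" for A t
    unfolding eR[OF A] e\<gamma>[OF A] by (intro emeasure_mono rect A) auto
  have sR: "sets (R t) = sets \<gamma>" for t by (simp add: R_def s\<gamma>)
  have acR: "absolutely_continuous \<gamma> (R t)" for t
    unfolding absolutely_continuous_def
  proof
    fix X assume X: "X \<in> null_sets \<gamma>"
    then have "X \<in> sets N" using s\<gamma> by auto
    then have "emeasure (R t) X \<le> 0" using Rle[of X t] null_setsD1[OF X] by simp
    then show "X \<in> null_sets (R t)" using X sR[of t] by (intro null_setsI) auto
  qed
  define f where "f t = RN_deriv \<gamma> (R t)" for t
  have fmeas: "f t \<in> borel_measurable N" for t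
    using borel_measurable_RN_deriv[of \<gamma> "R t"] unfolding f_def measurable_cong_sets[OF s\<gamma>(1) refl] .
  have fmeas': "f t \<in> borel_measurable \<gamma>" for t
    unfolding measurable_cong_sets[OF s\<gamma>(1) refl] by (rule fmeas)
  have densf: "density \<gamma> (f t) = R t" for t
    unfolding f_def by (rule \<gamma>.density_RN_deriv[OF acR sR])
  have intf: "(\<integral>\<^sup>+s. f t s * indicator A s \<partial>\<gamma>) = emeasure \<rho> (A \<times> {..t})" if A: "A \<in> sets N" for A t
    using emeasure_density[OF fmeas', of A t] A s\<gamma>(1) unfolding densf eR[OF A] by simp
  have f_mono: "AE s in \<gamma>. f t s \<le> f r s" if "t \<le> r" for t r
  proof (rule \<gamma>.AE_le_of_integrals_le[OF fmeas' fmeas'])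
    have "(\<integral>\<^sup>+s. f t s \<partial>\<gamma>) = (\<integral>\<^sup>+s. f t s * indicator (space N) s \<partial>\<gamma>)"
      by (intro nn_integral_cong) (simp add: s\<gamma>)
    then show "(\<integral>\<^sup>+s. f t s \<partial>\<gamma>) < \<infinity>"
      using intf[of "space N" t] \<rho>.emeasure_finite by (simp add: less_top[symmetric])
    fix A assume "A \<in> sets \<gamma>"
    then have A: "A \<in> sets N" using s\<gamma> by simp
    show "(\<integral>\<^sup>+s. f t s * indicator A s \<partial>\<gamma>) \<le> (\<integral>\<^sup>+s. f r s * indicator A s \<partial>\<gamma>)"
      unfolding intf[OF A] using that by (intro emeasure_mono rect A) auto
  qed
  have f_1: "AE s in \<gamma>. f t s = 1" if "1 \<le> t" for t
  proof -
    have "density \<gamma> (f t) = density \<gamma> (\<lambda>_. 1)"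
      unfolding densf density_1
    proof (rule measure_eqI)
      fix A assume "A \<in> sets (R t)"
      then have A: "A \<in> sets N" using sR s\<gamma> by simp
      have "emeasure \<rho> (A \<times> {..t}) = emeasure \<rho> (A \<times> UNIV)"
      proof (rule emeasure_eq_AE)
        show "AE p in \<rho>. p \<in> A \<times> {..t} \<longleftrightarrow> p \<in> A \<times> UNIV"
          using unit by eventually_elim (use that in \<open>auto simp: mem_Times_iff\<close>)
      qed (auto intro: rect A)
      then show "emeasure (R t) A = emeasure \<gamma> A" by (simp add: eR e\<gamma> A)
    qed (rule sR)
    then show ?thesis
      using \<gamma>.density_unique_iff[OF fmeas', of "\<lambda>_. 1"] by simp
  qed
  have f_0: "AE s in \<gamma>. f t s = 0" if "t < 0" for t
  proof -
    have "emeasure \<rho> (space N \<times> {..t}) = emeasure \<rho> {}"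
    proof (rule emeasure_eq_AE)
      show "AE p in \<rho>. p \<in> space N \<times> {..t} \<longleftrightarrow> p \<in> {}"
        using unit by eventually_elim (use that in \<open>auto simp: mem_Times_iff\<close>)
    qed (auto intro: rect)
    then have "(\<integral>\<^sup>+s. f t s * indicator (space N) s \<partial>\<gamma>) = 0" using intf[of "space N" t] by simp
    moreover have "(\<integral>\<^sup>+s. f t s * indicator (space N) s \<partial>\<gamma>) = (\<integral>\<^sup>+s. f t s \<partial>\<gamma>)"
      by (intro nn_integral_cong) (simp add: s\<gamma>)
    ultimately show ?thesis using nn_integral_0_iff_AE[OF fmeas'] by simp
  qed
  \<comment> \<open>The desired properties hold almost everywhere for each pair of parameters.
    Restricting the parameters to rationals makes the exceptional set a countable union of null
    sets.\<close>
  define good where "good s \<longleftrightarrow> (\<forall>q r::rat. (q \<le> r \<longrightarrow> f (of_rat q) s \<le> f (of_rat r) s) \<and>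
      (of_rat q < (0::real) \<longrightarrow> f (of_rat q) s = 0) \<and> ((1::real) \<le> of_rat q \<longrightarrow> f (of_rat q) s = 1))" for s
  define G where "G = {s \<in> space N. good s}"
  have G: "G \<in> sets N"
    unfolding G_def good_def using fmeas by measurable
  have AEgood: "AE s in \<gamma>. s \<in> G"
  proof -
    have "AE s in \<gamma>. \<forall>q r::rat. (q \<le> r \<longrightarrow> f (of_rat q) s \<le> f (of_rat r) s) \<and>
      (of_rat q < (0::real) \<longrightarrow> f (of_rat q) s = 0) \<and> ((1::real) \<le> of_rat q \<longrightarrow> f (of_rat q) s = 1)"
      unfolding AE_all_countable
    proof (intro allI AE_conjI)
      fix q r :: rat
      show "AE s in \<gamma>. q \<le> r \<longrightarrow> f (of_rat q) s \<le> f (of_rat r) s"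
        using f_mono[of "of_rat q" "of_rat r"] by (cases "q \<le> r") (auto simp: of_rat_less_eq)
      show "AE s in \<gamma>. of_rat q < (0::real) \<longrightarrow> f (of_rat q) s = 0"
        using f_0[of "of_rat q"] by (cases "of_rat q < (0::real)") auto
      show "AE s in \<gamma>. (1::real) \<le> of_rat q \<longrightarrow> f (of_rat q) s = 1"
        using f_1[of "of_rat q"] by (cases "(1::real) \<le> of_rat q") auto
    qed
    with AE_space show ?thesis by eventually_elim (simp add: G_def good_def s\<gamma>)
  qed
  define F where "F q s = enn2real (f (of_rat q) s)" for q :: rat and s
  define H where "H s t = (INF q\<in>{q. t < of_rat q}. F q s)" for s and t :: real
  have Fm: "F q \<in> borel_measurable N" for q unfolding F_def using fmeas by measurable
  have Hm: "(\<lambda>s. H s t) \<in> borel_measurable N" for t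
    unfolding H_def by (rule borel_measurable_cINF_real) (auto intro: Fm)
  have gF: "F q s \<le> F r s" "of_rat q < (0::real) \<Longrightarrow> F q s = 0" "(1::real) \<le> of_rat q \<Longrightarrow> F q s = 1"
    "0 \<le> F q s" "ennreal (F q s) = f (of_rat q) s" if s: "s \<in> G" and qr: "q \<le> r" for s q r
  proof -
    have g: "good s" using s by (simp add: G_def)
    have top: "f (of_rat r) s < \<top>" for r
    proof -
      have "r \<le> max r 1" by simp
      then have "f (of_rat r) s \<le> f (of_rat (max r 1)) s" using g unfolding good_def by blast
      also have "(1::real) \<le> of_rat (max r 1)" by simp
      then have "f (of_rat (max r 1)) s = 1" using g unfolding good_def by blast
      finally show ?thesis by (meson ennreal_one_less_top le_less_trans)
    qed
    show "F q s \<le> F r s" unfolding F_def using g qr top by (intro enn2real_mono) (auto simp: good_def)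
    show "of_rat q < (0::real) \<Longrightarrow> F q s = 0" "(1::real) \<le> of_rat q \<Longrightarrow> F q s = 1"
      using g unfolding F_def good_def by auto
    show "0 \<le> F q s" by (simp add: F_def)
    show "ennreal (F q s) = f (of_rat q) s" unfolding F_def using top[of q] by simp
  qed
  have bdd: "bdd_below ((\<lambda>q. F q s) ` X)" for s X by (rule bdd_belowI[of _ 0]) (auto simp: F_def)
  have ne: "{q. t < of_rat q} \<noteq> {}" for t :: real using of_rat_dense[of t "t + 1"] by auto
  have H_le: "H s t \<le> F q s" if "t < of_rat q" for s t q
    unfolding H_def by (rule cINF_lower[OF bdd]) (use that in simp)
  have H_ge: "x \<le> H s t" if "\<And>q. t < of_rat q \<Longrightarrow> x \<le> F q s" for s t x
    unfolding H_def by (rule cINF_greatest[OF ne]) (use that in simp)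
  have H_mono: "H s t \<le> H s r" if "t \<le> r" for s t r
    by (rule H_ge, rule H_le) (use that in linarith)
  have H0: "H s t = 0" if s: "s \<in> G" and "t < 0" for s t
  proof (rule antisym)
    obtain q :: rat where q: "t < of_rat q" "of_rat q < (0::real)" using of_rat_dense[OF \<open>t < 0\<close>] by auto
    show "H s t \<le> 0" using H_le[OF q(1), of s] gF(2)[OF s order.refl q(2)] by simp
    show "0 \<le> H s t" by (rule H_ge) (simp add: F_def)
  qed
  have H1: "H s t = 1" if s: "s \<in> G" and "1 \<le> t" for s t
  proof (rule antisym)
    obtain q :: rat where q: "t < of_rat q" using of_rat_dense[of t "t+1"] by auto
    have F1: "F q s = 1" if "t < of_rat q" for q
    proof (rule gF(3)[OF s order.refl])
      show "(1::real) \<le> of_rat q" using that \<open>1 \<le> t\<close> by linarith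
    qed
    show "H s t \<le> 1" using H_le[OF q, of s] unfolding F1[OF q] .
    show "1 \<le> H s t" by (rule H_ge) (simp add: F1)
  qed
  have H_right: "continuous (at_right a) (H s)" if s: "s \<in> G" for s a
  proof (subst continuous_at_right_real_increasing)
    show "\<And>x y. x \<le> y \<Longrightarrow> H s x \<le> H s y" by (rule H_mono)
    show "\<forall>e>0. \<exists>d>0. H s (a + d) - H s a < e"
    proof (intro allI impI)
      fix e :: real assume "0 < e"
      then have "H s a < H s a + e" by simp
      then have "\<exists>q\<in>{q. a < of_rat q}. F q s < H s a + e"
        unfolding H_def[of s a] by (subst (asm) cINF_less_iff[OF ne bdd])
      then obtain q where q: "a < of_rat q" "F q s < H s a + e" by auto
      have "H s (a + (of_rat q - a) / 2) \<le> F q s" proof (rule H_le)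
        show "a + (of_rat q - a) / 2 < of_rat q" using q(1) by argo
      qed
      then show "\<exists>d>0. H s (a + d) - H s a < e" using q by (intro exI[of _ "(of_rat q - a) / 2"]) auto
    qed
  qed
  have lims: "(H s \<longlongrightarrow> 0) at_bot" "(H s \<longlongrightarrow> 1) at_top" if s: "s \<in> G" for s
  proof -
    have "\<forall>\<^sub>F t in at_bot. H s t = 0"
      unfolding eventually_at_bot_dense by (intro exI[of _ 0]) (use H0[OF s] in auto)
    then show "(H s \<longlongrightarrow> 0) at_bot" by (rule tendsto_eventually)
    have "\<forall>\<^sub>F t in at_top. H s t = 1"
      using eventually_ge_at_top[of "1::real"] by eventually_elim (rule H1[OF s])
    then show "(H s \<longlongrightarrow> 1) at_top" by (rule tendsto_eventually)
  qed
  \<comment> \<open>Off the full-mass set \<open>G\<close> any law would do; the point mass at 0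
    keeps \<open>\<kappa>\<close> a probability kernel everywhere.\<close>
  define \<kappa> where "\<kappa> s = (if s \<in> G then interval_measure (H s) else return borel 0)" for s
  have \<kappa>_Iic: "emeasure (\<kappa> s) {..t} = (if s \<in> G then ennreal (H s t) else indicator {..t} 0)" for s t
    using emeasure_interval_measure_Iic[of "H s" t, OF H_mono H_right lims(1)] by (simp add: \<kappa>_def)
  have gen: "sets (borel :: real measure) = sigma_sets UNIV (range atMost)"
    by (simp add: borel_eq_atMost)
  have stab: "Int_stable (range (atMost :: real \<Rightarrow> _))" by (auto simp: Int_stable_def)
  have \<kappa>: "\<kappa> \<in> N \<rightarrow>\<^sub>M prob_algebra borel"
  proof (rule measurable_prob_algebra_generated[OF gen stab])
    show "prob_space (\<kappa> s)" for s
      using real_distribution.axioms(1)[OF real_distribution_interval_measure[of "H s", OF H_mono H_right lims]] prob_space_return[of "0::real" borel]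
      by (simp add: \<kappa>_def)
    show "sets (\<kappa> s) = sets borel" for s by (simp add: \<kappa>_def)
    fix X :: "real set" assume "X \<in> range atMost"
    then obtain t where "X = {..t}" by auto
    then show "(\<lambda>s. emeasure (\<kappa> s) X) \<in> borel_measurable N"
      using Hm[of t] G by (simp add: \<kappa>_Iic)
  qed auto
  have \<kappa>s: "\<kappa> \<in> N \<rightarrow>\<^sub>M subprob_algebra borel" by (rule measurable_prob_algebraD[OF \<kappa>])
  \<comment> \<open>Passing to right limits does not change the integrals: almost everywhere
    \<open>\<kappa> s {..t}\<close> lies between \<open>f t s\<close> and \<open>f q s\<close> for
    rational \<open>q\<close> above \<open>t\<close>, and the masses of
    \<open>A \<times> {..u}\<close> decrease to that of \<open>A \<times> {..t}\<close> as
    \<open>u\<close> decreases to \<open>t\<close>.\<close>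
  have intH: "(\<integral>\<^sup>+s. emeasure (\<kappa> s) {..t} * indicator A s \<partial>\<gamma>) = emeasure \<rho> (A \<times> {..t})" if A: "A \<in> sets N" for A t
  proof (rule antisym)
    have "AE s in \<gamma>. \<forall>q::rat. t < of_rat q \<longrightarrow> f t s \<le> f (of_rat q) s"
      unfolding AE_all_countable
    proof
      fix q :: rat
      show "AE s in \<gamma>. t < of_rat q \<longrightarrow> f t s \<le> f (of_rat q) s"
        using f_mono[of t "of_rat q"] by (cases "t < of_rat q") auto
    qed
    with AEgood have "AE s in \<gamma>. f t s \<le> emeasure (\<kappa> s) {..t}"
    proof eventually_elim
      case (elim s)
      obtain q :: rat where q: "t < of_rat q" using of_rat_dense[of t "t+1"] by auto
      have ft: "f t s \<le> ennreal (F q s)" if "t < of_rat q" for q using elim(2) that gF(5)[OF elim(1) order.refl, of q] by simp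
      have tt: "f t s < \<top>" by (rule le_less_trans[OF ft[OF q]]) simp
      have "enn2real (f t s) \<le> F q s" if "t < of_rat q" for q
        using enn2real_mono[OF ft[OF that]] gF(4)[OF elim(1) order.refl, of q] by simp
      then have "enn2real (f t s) \<le> H s t" by (rule H_ge)
      then have "ennreal (enn2real (f t s)) \<le> ennreal (H s t)" by (rule ennreal_leI)
      then show ?case using elim(1) tt by (simp add: \<kappa>_Iic)
    qed
    then have "AE s in \<gamma>. f t s * indicator A s \<le> emeasure (\<kappa> s) {..t} * indicator A s"
      by eventually_elim (rule mult_right_mono, assumption, simp)
    then have "(\<integral>\<^sup>+s. f t s * indicator A s \<partial>\<gamma>) \<le> (\<integral>\<^sup>+s. emeasure (\<kappa> s) {..t} * indicator A s \<partial>\<gamma>)"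
      by (rule nn_integral_mono_AE)
    then show "emeasure \<rho> (A \<times> {..t}) \<le> (\<integral>\<^sup>+s. emeasure (\<kappa> s) {..t} * indicator A s \<partial>\<gamma>)"
      unfolding intf[OF A] .
    have le: "(\<integral>\<^sup>+s. emeasure (\<kappa> s) {..t} * indicator A s \<partial>\<gamma>) \<le> emeasure \<rho> (A \<times> {..u})" if "t < u" for u
    proof -
      obtain q :: rat where q: "t < of_rat q" "of_rat q < u" using of_rat_dense[OF \<open>t < u\<close>] by auto
      have "AE s in \<gamma>. emeasure (\<kappa> s) {..t} * indicator A s \<le> f (of_rat q) s * indicator A s"
        using AEgood
      proof eventually_elim
        case (elim s)
        have "emeasure (\<kappa> s) {..t} \<le> f (of_rat q) s"
          using ennreal_leI[OF H_le[OF q(1), of s]] elim gF(5)[OF elim order.refl, of q] by (simp add: \<kappa>_Iic)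
        then show ?case by (rule mult_right_mono) simp
      qed
      then have "(\<integral>\<^sup>+s. emeasure (\<kappa> s) {..t} * indicator A s \<partial>\<gamma>) \<le> (\<integral>\<^sup>+s. f (of_rat q) s * indicator A s \<partial>\<gamma>)"
        by (rule nn_integral_mono_AE)
      also have "\<dots> \<le> emeasure \<rho> (A \<times> {..u})"
        unfolding intf[OF A] using q by (intro emeasure_mono rect A) auto
      finally show ?thesis .
    qed
    have "(\<lambda>n. emeasure \<rho> (A \<times> {..t + 1 / real (Suc n)})) \<longlonglongrightarrow> emeasure \<rho> (\<Inter>n. A \<times> {..t + 1 / real (Suc n)})"
    proof (rule Lim_emeasure_decseq)
      show "decseq (\<lambda>n. A \<times> {..t + 1 / real (Suc n)})"
        by (rule decseq_SucI) (auto intro: order.trans simp: field_simps)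
    qed (use rect A in auto)
    moreover have "(\<Inter>n. A \<times> {..t + 1 / real (Suc n)}) = A \<times> {..t}"
    proof (intro equalityI subsetI)
      fix p assume p: "p \<in> (\<Inter>n. A \<times> {..t + 1 / real (Suc n)})"
      have pn: "p \<in> A \<times> {..t + 1 / real (Suc n)}" for n using p by blast
      have sn: "snd p \<le> t + 1 / real (Suc n)" for n using pn[of n] by (simp only: mem_Times_iff atMost_iff)
      have "(\<lambda>n. t + 1 / real (Suc n)) \<longlonglongrightarrow> t + 0" by (intro tendsto_intros LIMSEQ_Suc[OF lim_1_over_n])
      then have "snd p \<le> t + 0" by (rule LIMSEQ_le_const) (use sn in blast)
      then show "p \<in> A \<times> {..t}" using pn[of 0] by (simp add: mem_Times_iff)
    qed (auto intro: order.trans)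
    ultimately have lim: "(\<lambda>n. emeasure \<rho> (A \<times> {..t + 1 / real (Suc n)})) \<longlonglongrightarrow> emeasure \<rho> (A \<times> {..t})" by simp
    have "t < t + 1 / real (Suc n)" for n by simp
    then show "(\<integral>\<^sup>+s. emeasure (\<kappa> s) {..t} * indicator A s \<partial>\<gamma>) \<le> emeasure \<rho> (A \<times> {..t})"
      using le by (intro LIMSEQ_le_const[OF lim]) blast
  qed
  have rects: "(\<integral>\<^sup>+s. emeasure (\<kappa> s) B * indicator A s \<partial>\<gamma>) = emeasure \<rho> (A \<times> B)"
    if A: "A \<in> sets N" and B: "B \<in> sets borel" and nonempty: "space N \<noteq> {}" for A B
  proof -
    have Am: "indicator A \<in> borel_measurable \<gamma>" using A s\<gamma> by simp
    have k': "\<kappa> \<in> density \<gamma> (indicator A) \<rightarrow>\<^sub>M subprob_algebra borel"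
    proof -
      have sd: "sets (density \<gamma> (indicator A)) = sets N" by (simp add: s\<gamma>)
      show ?thesis unfolding measurable_cong_sets[OF sd refl] by (rule \<kappa>s)
    qed
    have ek: "emeasure (density \<gamma> (indicator A) \<bind> \<kappa>) X = (\<integral>\<^sup>+s. emeasure (\<kappa> s) X * indicator A s \<partial>\<gamma>)" if X: "X \<in> sets borel" for X
    proof -
      have "(\<lambda>s. emeasure (\<kappa> s) X) \<in> borel_measurable \<gamma>"
        unfolding measurable_cong_sets[OF s\<gamma>(1) refl] by (rule measurable_compose[OF \<kappa>s measurable_emeasure_subprob_algebra[OF X]])
      then show ?thesis
        using nonempty s\<gamma> by (subst emeasure_bind[OF _ k' X]) (simp_all add: nn_integral_density[OF Am] mult.commute)
    qed
    have AU: "A \<times> UNIV \<in> sets \<rho>" by (rule rect[OF A]) simp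
    have smd: "snd \<in> density \<rho> (indicator (A \<times> UNIV)) \<rightarrow>\<^sub>M borel" using sm by simp
    have er: "emeasure (distr (density \<rho> (indicator (A \<times> UNIV))) borel snd) X = emeasure \<rho> (A \<times> X)" if X: "X \<in> sets borel" for X
    proof -
      have "emeasure (distr (density \<rho> (indicator (A \<times> UNIV))) borel snd) X = emeasure \<rho> ((A \<times> UNIV) \<inter> (snd -` X \<inter> space \<rho>))"
        unfolding emeasure_distr[OF smd X] using emeasure_restricted[OF AU measurable_sets[OF sm X]] by simp
      also have "(A \<times> UNIV) \<inter> (snd -` X \<inter> space \<rho>) = A \<times> X" using sets.sets_into_space[OF A] by (auto simp: sp\<rho>)
      finally show ?thesis .
    qed
    have "density \<gamma> (indicator A) \<bind> \<kappa> = distr (density \<rho> (indicator (A \<times> UNIV))) borel snd"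
    proof (rule measure_eqI_generator_eq[OF stab, where \<Omega>=UNIV and A="\<lambda>n::nat. {..real n}"])
      show "(\<Union>n::nat. {..real n}) = UNIV" using real_arch_simple by auto
      show "sets (density \<gamma> (indicator A) \<bind> \<kappa>) = sigma_sets UNIV (range atMost)"
        unfolding gen[symmetric] by (rule sets_bind_measurable[OF k']) (use nonempty s\<gamma> in simp)
      show "sets (distr (density \<rho> (indicator (A \<times> UNIV))) borel snd) = sigma_sets UNIV (range atMost)"
        unfolding gen[symmetric] by simp
      show "emeasure (density \<gamma> (indicator A) \<bind> \<kappa>) {..real n} \<noteq> \<infinity>" for n
        using intH[OF A, of "real n"] by (simp add: ek)
      fix X :: "real set" assume "X \<in> range atMost"
      then obtain t where X: "X = {..t}" by auto
      show "emeasure (density \<gamma> (indicator A) \<bind> \<kappa>) X = emeasure (distr (density \<rho> (indicator (A \<times> UNIV))) borel snd) X"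
        using intH[OF A, of t] by (simp add: X ek er)
    qed auto
    then have "emeasure (density \<gamma> (indicator A) \<bind> \<kappa>) B = emeasure (distr (density \<rho> (indicator (A \<times> UNIV))) borel snd) B" by simp
    then show ?thesis by (simp add: ek er B)
  qed
  show ?thesis
  proof (rule bexI[OF _ \<kappa>], rule ballI)
    fix C assume C: "C \<in> sets (N \<Otimes>\<^sub>M (borel :: real measure))"
    show "emeasure \<rho> C = (\<integral>\<^sup>+s. emeasure (\<kappa> s) (Pair s -` C) \<partial>distr \<rho> N fst)"
    proof (cases "space N = {}")
      case True
      then have "C = {}" using sets.sets_into_space[OF C] by (auto simp: space_pair_measure)
      then show ?thesis by simp
    next
      case False
      define L where "L s = distr (\<kappa> s) (N \<Otimes>\<^sub>M borel) (Pair s)" for s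
      have L: "L \<in> N \<rightarrow>\<^sub>M subprob_algebra (N \<Otimes>\<^sub>M borel)"
        unfolding L_def by (rule measurable_distr2[OF _ \<kappa>s]) simp
      have L': "L \<in> \<gamma> \<rightarrow>\<^sub>M subprob_algebra (N \<Otimes>\<^sub>M borel)"
        unfolding measurable_cong_sets[OF s\<gamma>(1) refl] by (rule L)
      have eL: "emeasure (\<gamma> \<bind> L) X = (\<integral>\<^sup>+s. emeasure (\<kappa> s) (Pair s -` X) \<partial>\<gamma>)" if X: "X \<in> sets (N \<Otimes>\<^sub>M borel)" for X
      proof -
        have "emeasure (L s) X = emeasure (\<kappa> s) (Pair s -` X)" if s: "s \<in> space N" for s
        proof -
          have "Pair s \<in> \<kappa> s \<rightarrow>\<^sub>M N \<Otimes>\<^sub>M borel"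
            unfolding measurable_cong_sets[OF kernel_props(2)[OF \<kappa> s] refl] by (rule measurable_Pair1'[OF s])
          from emeasure_distr[OF this X] show ?thesis unfolding L_def using kernel_props(3)[OF \<kappa> s] by simp
        qed
        then show ?thesis
          using False s\<gamma> by (subst emeasure_bind[OF _ L' X]) (auto intro!: nn_integral_cong)
      qed
      have "\<rho> = \<gamma> \<bind> L"
      proof (rule measure_eqI_generator_eq[OF Int_stable_pair_measure_generator[of N "borel :: real measure"]])
        show "{a \<times> b |a b. a \<in> sets N \<and> b \<in> sets (borel :: real measure)} \<subseteq> Pow (space N \<times> space (borel :: real measure))"
          by (rule pair_measure_closed)
        show "sets \<rho> = sigma_sets (space N \<times> space (borel :: real measure)) {a \<times> b |a b. a \<in> sets N \<and> b \<in> sets (borel :: real measure)}"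
          unfolding s\<rho> sets_pair_measure ..
        show "sets (\<gamma> \<bind> L) = sigma_sets (space N \<times> space (borel :: real measure)) {a \<times> b |a b. a \<in> sets N \<and> b \<in> sets (borel :: real measure)}"
          unfolding sets_pair_measure[symmetric] by (rule sets_bind_measurable[OF L']) (use False s\<gamma> in simp)
        show "range (\<lambda>_::nat. space N \<times> (UNIV::real set)) \<subseteq> {a \<times> b |a b. a \<in> sets N \<and> b \<in> sets (borel :: real measure)}"
          using sets.top[of N] by (auto intro!: exI[of _ "space N"] exI[of _ "UNIV :: real set"])
        fix X assume "X \<in> {a \<times> b |a b. a \<in> sets N \<and> b \<in> sets (borel :: real measure)}"
        then obtain A B where X: "X = A \<times> B" and A: "A \<in> sets N" and B: "B \<in> sets (borel :: real measure)" by auto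
        have "emeasure (\<gamma> \<bind> L) X = (\<integral>\<^sup>+s. emeasure (\<kappa> s) B * indicator A s \<partial>\<gamma>)"
          unfolding X eL[OF pair_measureI[OF A B]] by (intro nn_integral_cong) (auto simp: indicator_def)
        then show "emeasure \<rho> X = emeasure (\<gamma> \<bind> L) X" by (simp add: rects[OF A B False] X)
      qed auto
      then show ?thesis using eL[OF C] unfolding \<gamma>_def[symmetric] by simp
    qed
  qed
qed

section \<open>Coding paths over a Borel space by one real number\<close>

definition cantor_encode :: "(nat \<Rightarrow> bool) \<Rightarrow> real" where
  "cantor_encode b = (\<Sum>j. 2 * of_bool (b j) / 3 ^ Suc j)"

text \<open>Left shifts of ternary expansions. With digits 0 and 2 only, the first digit is decided
  by comparison with 2/3 without ambiguity, unlike in binary expansions, so the bits can be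
  recovered measurably.\<close>

primrec cantor_rest :: "nat \<Rightarrow> real \<Rightarrow> real" where
  "cantor_rest 0 y = y"
| "cantor_rest (Suc j) y = 3 * cantor_rest j y - (if 2/3 \<le> cantor_rest j y then 2 else 0)"

lemma cantor_sums:
  "summable (\<lambda>j. 2 * of_bool (b j) / 3 ^ Suc j :: real)" "0 \<le> cantor_encode b" "cantor_encode b \<le> 1"
proof -
  have geo: "(\<lambda>j. 2 / 3 ^ Suc j :: real) sums 1"
    using sums_mult[OF geometric_sums[of "1/3 :: real"], of "2/3"] by (simp add: power_one_over divide_simps)
  have le: "0 \<le> 2 * of_bool (b j) / (3::real) ^ Suc j" "2 * of_bool (b j) / (3::real) ^ Suc j \<le> 2 / 3 ^ Suc j" for j by auto
  show s: "summable (\<lambda>j. 2 * of_bool (b j) / 3 ^ Suc j :: real)"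
    using le by (intro summable_comparison_test'[OF sums_summable[OF geo]]) auto
  show "0 \<le> cantor_encode b" unfolding cantor_encode_def by (rule suminf_nonneg[OF s le(1)])
  show "cantor_encode b \<le> 1"
    using suminf_le[OF le(2) s sums_summable[OF geo]] sums_unique[OF geo] by (simp add: cantor_encode_def)
qed

lemma cantor_encode_Suc: "3 * cantor_encode b = 2 * of_bool (b 0) + cantor_encode (\<lambda>j. b (Suc j))"
proof -
  have "cantor_encode b = 2 * of_bool (b 0) / 3 + (\<Sum>j. 2 * of_bool (b (Suc j)) / 3 ^ Suc (Suc j))"
    unfolding cantor_encode_def using suminf_split_head[OF cantor_sums(1)[of b]] by simp
  also have "(\<Sum>j. 2 * of_bool (b (Suc j)) / (3::real) ^ Suc (Suc j)) = (\<Sum>j. 2 * of_bool (b (Suc j)) / 3 ^ Suc j / 3)"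
    by (simp add: field_simps)
  also have "\<dots> = cantor_encode (\<lambda>j. b (Suc j)) / 3"
    unfolding cantor_encode_def by (rule suminf_divide[OF cantor_sums(1)])
  finally show ?thesis by simp
qed

lemma cantor_encode_ge_iff: "2/3 \<le> cantor_encode b \<longleftrightarrow> b 0"
  using cantor_encode_Suc[of b] cantor_sums(2,3)[of "\<lambda>j. b (Suc j)"] by (cases "b 0") auto

lemma cantor_rest_encode: "cantor_rest n (cantor_encode b) = cantor_encode (\<lambda>j. b (j + n))"
proof (induction n)
  case (Suc n)
  show ?case
    using cantor_encode_Suc[of "\<lambda>j. b (j + n)"] cantor_encode_ge_iff[of "\<lambda>j. b (j + n)"]
    by (simp add: Suc)
qed simp

definition cantor_decode :: "real \<Rightarrow> nat \<Rightarrow> bool" where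
  "cantor_decode y j \<longleftrightarrow> 2/3 \<le> cantor_rest j y"

lemma cantor_decode_encode: "cantor_decode (cantor_encode b) j = b j"
  unfolding cantor_decode_def cantor_rest_encode cantor_encode_ge_iff by simp

lemma measurable_cantor_rest[measurable]: "cantor_rest j \<in> borel_measurable borel"
proof (induction j)
  case 0
  have "cantor_rest 0 = (\<lambda>y. y)" by (simp add: fun_eq_iff)
  then show ?case by simp
next
  case (Suc j)
  have "cantor_rest (Suc j) = (\<lambda>y. 3 * cantor_rest j y - (if 2/3 \<le> cantor_rest j y then 2 else 0))" by (simp add: fun_eq_iff)
  moreover have "(\<lambda>y. 3 * cantor_rest j y - (if 2/3 \<le> cantor_rest j y then 2 else 0)) \<in> borel_measurable borel"
    using Suc by (intro borel_measurable_diff borel_measurable_times measurable_If) auto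
  ultimately show ?case by simp
qed

definition rat_enum :: "nat \<Rightarrow> real" where
  "rat_enum k = of_rat (from_nat k)"

text \<open>A number in the unit interval is recovered from its rational cut; the truncation to the unit
  interval keeps the supremum bounded for bit sequences that are not cuts.\<close>

definition cut_value :: "(nat \<Rightarrow> bool) \<Rightarrow> real" where
  "cut_value b = (SUP k. if b k then max 0 (min 1 (rat_enum k)) else 0)"

lemma cut_value_cut:
  assumes "0 \<le> x" "x \<le> 1"
  shows "cut_value (\<lambda>k. rat_enum k < x) = x"
proof (rule antisym)
  show "cut_value (\<lambda>k. rat_enum k < x) \<le> x"
    unfolding cut_value_def by (rule cSUP_least) (use assms in auto)
  have bdd: "bdd_above (range (\<lambda>k. if rat_enum k < x then max 0 (min 1 (rat_enum k)) else 0))"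
    by (rule bdd_aboveI[of _ 1]) auto
  show "x \<le> cut_value (\<lambda>k. rat_enum k < x)"
  proof (rule ccontr)
    assume "\<not> x \<le> cut_value (\<lambda>k. rat_enum k < x)"
    then obtain q :: rat where q: "cut_value (\<lambda>k. rat_enum k < x) < of_rat q" "of_rat q < x"
      using of_rat_dense[of "cut_value (\<lambda>k. rat_enum k < x)" x] by auto
    have e: "rat_enum (to_nat q) = of_rat q" by (simp add: rat_enum_def)
    have "(if rat_enum (to_nat q) < x then max 0 (min 1 (rat_enum (to_nat q))) else 0) \<le> cut_value (\<lambda>k. rat_enum k < x)"
      unfolding cut_value_def by (rule cSUP_upper[OF _ bdd]) simp
    then have "max 0 (min 1 (of_rat q)) \<le> cut_value (\<lambda>k. rat_enum k < x)" using q(2) by (simp add: e)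
    then show False using q assms by linarith
  qed
qed

text \<open>Only a measurable retraction of the reals onto the path space is needed for the
  disintegration, not an isomorphism.\<close>

lemma borel_space_path_retract:
  assumes B: "borel_space M" and ne: "space M \<noteq> {}"
  shows "\<exists>\<Phi> \<Psi>. \<Phi> \<in> borel_measurable (PiM UNIV (\<lambda>_::nat. M)) \<and> \<Psi> \<in> borel \<rightarrow>\<^sub>M PiM UNIV (\<lambda>_::nat. M) \<and>
    (\<forall>\<omega>\<in>space (PiM UNIV (\<lambda>_::nat. M)). \<Psi> (\<Phi> \<omega>) = \<omega> \<and> 0 \<le> \<Phi> \<omega> \<and> \<Phi> \<omega> \<le> (1::real))"
proof -
  obtain B f g where B: "B \<in> sets borel" "B \<subseteq> {0..(1::real)}" and f: "f \<in> M \<rightarrow>\<^sub>M restrict_space borel B"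
    and g: "g \<in> restrict_space borel B \<rightarrow>\<^sub>M M" and gf: "\<And>x. x \<in> space M \<Longrightarrow> g (f x) = x"
    using assms(1) unfolding borel_space_def by auto
  obtain x0 where x0: "x0 \<in> space M" using ne by auto
  have f': "f \<in> borel_measurable M" using f by (rule measurable_restrict_space2_iff[THEN iffD1, THEN conjunct1])
  have fB: "f x \<in> B" if "x \<in> space M" for x using measurable_space[OF f that] by (simp add: space_restrict_space)
  \<comment> \<open>The default \<open>x0\<close> extends the inverse beyond \<open>B\<close>, so
    that decoding is total on the reals.\<close>
  define g' where "g' x = (if x \<in> B then g x else x0)" for x
  have g': "g' \<in> borel \<rightarrow>\<^sub>M M"
    using g unfolding g'_def by (subst (asm) measurable_restrict_space_iff[OF _ x0]) (use B in auto)
  have gf': "g' (f x) = x" if "x \<in> space M" for x using gf[OF that] fB[OF that] by (simp add: g'_def)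
  \<comment> \<open>The rational cuts of all coordinates are interleaved by the pairing function:
    the bit coding \<open>(n, k)\<close> records whether the \<open>k\<close>-th rational is below
    the code of coordinate \<open>n\<close>.\<close>
  define bit where "bit \<omega> j = (rat_enum (snd (prod_decode j)) < f (\<omega> (fst (prod_decode j))))" for \<omega> :: "nat \<Rightarrow> 'a" and j
  define \<Phi> where "\<Phi> \<omega> = cantor_encode (bit \<omega>)" for \<omega>
  define \<Psi> where "\<Psi> y n = g' (cut_value (\<lambda>k. cantor_decode y (prod_encode (n, k))))" for y n
  have comp: "(\<lambda>\<omega>. \<omega> n) \<in> PiM UNIV (\<lambda>_::nat. M) \<rightarrow>\<^sub>M M" for n
    by (rule measurable_component_singleton) simp
  have "\<Phi> \<in> borel_measurable (PiM UNIV (\<lambda>_::nat. M))"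
    unfolding \<Phi>_def cantor_encode_def
  proof (rule borel_measurable_suminf)
    fix j
    have "(\<lambda>\<omega>. f (\<omega> (fst (prod_decode j)))) \<in> borel_measurable (PiM UNIV (\<lambda>_::nat. M))"
      by (rule measurable_compose[OF comp f'])
    then have "Measurable.pred (PiM UNIV (\<lambda>_::nat. M)) (\<lambda>\<omega>. bit \<omega> j)"
      unfolding bit_def pred_def by (intro borel_measurable_less borel_measurable_const)
    then have "(\<lambda>\<omega>. if bit \<omega> j then 2 / 3 ^ Suc j else (0::real)) \<in> borel_measurable (PiM UNIV (\<lambda>_::nat. M))"
      by (intro measurable_If) (auto simp: pred_def)
    then show "(\<lambda>\<omega>. 2 * of_bool (bit \<omega> j) / 3 ^ Suc j :: real) \<in> borel_measurable (PiM UNIV (\<lambda>_::nat. M))"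
      by (rule measurable_cong[THEN iffD1, rotated]) simp
  qed
  moreover have "\<Psi> \<in> borel \<rightarrow>\<^sub>M PiM UNIV (\<lambda>_::nat. M)"
  proof -
    have \<Psi>n: "(\<lambda>y. \<Psi> y n) \<in> borel \<rightarrow>\<^sub>M M" for n
      unfolding \<Psi>_def
    proof (rule measurable_compose[OF _ g'])
      show "(\<lambda>y. cut_value (\<lambda>k. cantor_decode y (prod_encode (n, k)))) \<in> borel_measurable borel"
        unfolding cut_value_def cantor_decode_def
      proof (rule borel_measurable_cSUP)
        show "bdd_above (range (\<lambda>k. if 2/3 \<le> cantor_rest (prod_encode (n, k)) y then max 0 (min 1 (rat_enum k)) else 0))" for y
          by (rule bdd_aboveI[of _ 1]) auto
      qed auto
    qed
    then show ?thesis using measurable_space[OF \<Psi>n]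
      by (intro measurable_PiM_single') (auto simp: PiE_UNIV_domain)
  qed
  moreover have "\<Psi> (\<Phi> \<omega>) = \<omega> \<and> 0 \<le> \<Phi> \<omega> \<and> \<Phi> \<omega> \<le> 1" if w: "\<omega> \<in> space (PiM UNIV (\<lambda>_::nat. M))" for \<omega>
  proof -
    have wn: "\<omega> n \<in> space M" for n using w by (auto simp: space_PiM PiE_iff)
    have "\<Psi> (\<Phi> \<omega>) n = \<omega> n" for n
    proof -
      have "0 \<le> f (\<omega> n)" "f (\<omega> n) \<le> 1" using fB[OF wn[of n]] B(2) by auto
      then have "cut_value (\<lambda>k. cantor_decode (\<Phi> \<omega>) (prod_encode (n, k))) = f (\<omega> n)"
        unfolding \<Phi>_def cantor_decode_encode bit_def by (simp add: cut_value_cut)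
      then show ?thesis unfolding \<Psi>_def using gf'[OF wn] by simp
    qed
    then show ?thesis using cantor_sums(2,3) by (auto simp: \<Phi>_def)
  qed
  ultimately show ?thesis by blast
qed

text \<open>The kernel \<open>k\<close> is the conditional law given \<open>F\<close>. It is
  obtained for the real code \<Phi> and then mapped back by \<Psi>, for which the retraction
  identity suffices.\<close>

lemma disintegration_retract:
  assumes fin: "finite_measure a" and sa: "sets a = sets S" and F: "F \<in> S \<rightarrow>\<^sub>M N"
    and \<Phi>: "\<Phi> \<in> borel_measurable S" and \<Psi>: "\<Psi> \<in> borel \<rightarrow>\<^sub>M S"
    and inv: "\<And>\<omega>. \<omega> \<in> space S \<Longrightarrow> \<Psi> (\<Phi> \<omega>) = \<omega> \<and> 0 \<le> \<Phi> \<omega> \<and> \<Phi> \<omega> \<le> (1::real)"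
  shows "\<exists>k\<in>N \<rightarrow>\<^sub>M prob_algebra S. \<forall>B\<in>sets (N \<Otimes>\<^sub>M S).
    emeasure a {\<omega> \<in> space S. (F \<omega>, \<omega>) \<in> B} = (\<integral>\<^sup>+s. emeasure (k s) (Pair s -` B) \<partial>distr a N F)"
proof -
  interpret a: finite_measure a by fact
  have spa: "space a = space S" using sa by (rule sets_eq_imp_space_eq)
  have meas: "(\<lambda>\<omega>. (F \<omega>, \<Phi> \<omega>)) \<in> a \<rightarrow>\<^sub>M N \<Otimes>\<^sub>M borel"
    unfolding measurable_cong_sets[OF sa refl] by (intro measurable_Pair F \<Phi>)
  define \<rho> where "\<rho> = distr a (N \<Otimes>\<^sub>M borel) (\<lambda>\<omega>. (F \<omega>, \<Phi> \<omega>))"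
  have s\<rho>: "sets \<rho> = sets (N \<Otimes>\<^sub>M borel)" by (simp add: \<rho>_def)
  have fin\<rho>: "finite_measure \<rho>" unfolding \<rho>_def by (rule a.finite_measure_distr[OF meas])
  have "AE p in \<rho>. 0 \<le> snd p \<and> snd p \<le> (1::real)"
    unfolding \<rho>_def
  proof (subst AE_distr_iff[OF meas])
    show "{p \<in> space (N \<Otimes>\<^sub>M borel). 0 \<le> snd p \<and> snd p \<le> (1::real)} \<in> sets (N \<Otimes>\<^sub>M borel)" by measurable
    show "AE \<omega> in a. 0 \<le> snd (F \<omega>, \<Phi> \<omega>) \<and> snd (F \<omega>, \<Phi> \<omega>) \<le> 1"
      by (rule AE_I2) (use inv spa in simp)
  qed
  from disintegration_unit_interval[OF fin\<rho> s\<rho> this] obtain \<kappa> where \<kappa>: "\<kappa> \<in> N \<rightarrow>\<^sub>M prob_algebra (borel :: real measure)"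
    and e\<kappa>: "\<And>C. C \<in> sets (N \<Otimes>\<^sub>M borel) \<Longrightarrow> emeasure \<rho> C = (\<integral>\<^sup>+s. emeasure (\<kappa> s) (Pair s -` C) \<partial>distr \<rho> N fst)"
    by blast
  have F': "F \<in> a \<rightarrow>\<^sub>M N" unfolding measurable_cong_sets[OF sa refl] by (rule F)
  have d\<rho>: "distr \<rho> N fst = distr a N F"
    unfolding \<rho>_def by (subst distr_distr[OF measurable_fst meas]) (simp add: comp_def)
  define k where "k s = distr (\<kappa> s) S \<Psi>" for s
  have k: "k \<in> N \<rightarrow>\<^sub>M prob_algebra S"
    unfolding k_def by (rule measurable_compose[OF \<kappa> measurable_distr_prob_space[OF \<Psi>]])
  show ?thesis
  proof (rule bexI[OF _ k], rule ballI)
    fix B assume B: "B \<in> sets (N \<Otimes>\<^sub>M S)"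
    have m2: "(\<lambda>p. (fst p, \<Psi> (snd p))) \<in> N \<Otimes>\<^sub>M borel \<rightarrow>\<^sub>M N \<Otimes>\<^sub>M S"
      by (intro measurable_Pair measurable_fst measurable_compose[OF measurable_snd \<Psi>])
    define C where "C = (\<lambda>p. (fst p, \<Psi> (snd p))) -` B \<inter> space (N \<Otimes>\<^sub>M borel)"
    have C: "C \<in> sets (N \<Otimes>\<^sub>M borel)" unfolding C_def by (rule measurable_sets[OF m2 B])
    have "emeasure \<rho> C = emeasure a ((\<lambda>\<omega>. (F \<omega>, \<Phi> \<omega>)) -` C \<inter> space a)"
      unfolding \<rho>_def by (rule emeasure_distr[OF meas C])
    also have "(\<lambda>\<omega>. (F \<omega>, \<Phi> \<omega>)) -` C \<inter> space a = {\<omega> \<in> space S. (F \<omega>, \<omega>) \<in> B}"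
      using inv measurable_space[OF F] by (auto simp: C_def spa space_pair_measure)
    finally have "emeasure a {\<omega> \<in> space S. (F \<omega>, \<omega>) \<in> B} = (\<integral>\<^sup>+s. emeasure (\<kappa> s) (Pair s -` C) \<partial>distr a N F)"
      unfolding e\<kappa>[OF C] d\<rho> by simp
    also have "\<dots> = (\<integral>\<^sup>+s. emeasure (k s) (Pair s -` B) \<partial>distr a N F)"
    proof (rule nn_integral_cong)
      fix s assume "s \<in> space (distr a N F)"
      then have s: "s \<in> space N" by simp
      have "\<Psi> \<in> \<kappa> s \<rightarrow>\<^sub>M S" unfolding measurable_cong_sets[OF kernel_props(2)[OF \<kappa> s] refl] by (rule \<Psi>)
      then have "emeasure (k s) (Pair s -` B) = emeasure (\<kappa> s) (\<Psi> -` (Pair s -` B) \<inter> space (\<kappa> s))"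
        unfolding k_def by (rule emeasure_distr) (rule sets_Pair1[OF B])
      also have "\<Psi> -` (Pair s -` B) \<inter> space (\<kappa> s) = Pair s -` C"
        using s by (auto simp: C_def space_pair_measure kernel_props(3)[OF \<kappa> s])
      finally show "emeasure (\<kappa> s) (Pair s -` C) = emeasure (k s) (Pair s -` B)" by simp
    qed
    finally show "emeasure a {\<omega> \<in> space S. (F \<omega>, \<omega>) \<in> B} = (\<integral>\<^sup>+s. emeasure (k s) (Pair s -` B) \<partial>distr a N F)" .
  qed
qed

text \<open>Gluing along a common image: the two conditional laws given the image are taken independent.\<close>

lemma gluing:
  fixes S :: "'a measure" and N :: "'b measure"
  assumes fin: "finite_measure a" "finite_measure b" and sa: "sets a = sets S" and sb: "sets b = sets S"
    and F: "F \<in> S \<rightarrow>\<^sub>M N" and same: "distr a N F = distr b N F"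
    and \<Phi>: "\<Phi> \<in> borel_measurable S" and \<Psi>: "\<Psi> \<in> borel \<rightarrow>\<^sub>M S"
    and inv: "\<And>\<omega>. \<omega> \<in> space S \<Longrightarrow> \<Psi> (\<Phi> \<omega>) = \<omega> \<and> 0 \<le> \<Phi> \<omega> \<and> \<Phi> \<omega> \<le> (1::real)"
    and diag: "Id_on (space N) \<in> sets (N \<Otimes>\<^sub>M N)" and ne: "space S \<noteq> {}"
  shows "\<exists>c. sets c = sets (S \<Otimes>\<^sub>M S) \<and> (\<forall>A\<in>sets S. emeasure c (A \<times> space S) = emeasure a A \<and> emeasure c (space S \<times> A) = emeasure b A) \<and>
     emeasure c {p \<in> space (S \<Otimes>\<^sub>M S). F (fst p) \<noteq> F (snd p)} = 0"
proof -
  define \<gamma> where "\<gamma> = distr a N F"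
  have s\<gamma>: "sets \<gamma> = sets N" "space \<gamma> = space N" by (simp_all add: \<gamma>_def)
  have neN: "space N \<noteq> {}" using measurable_space[OF F] ne by auto
  have fin\<gamma>: "finite_measure \<gamma>" unfolding \<gamma>_def
    by (rule finite_measure.finite_measure_distr[OF fin(1)]) (unfold measurable_cong_sets[OF sa refl], rule F)
  have \<gamma>b: "\<gamma> = distr b N F" by (simp add: \<gamma>_def same)
  obtain k1 where k1: "k1 \<in> N \<rightarrow>\<^sub>M prob_algebra S" and e1: "\<And>B. B \<in> sets (N \<Otimes>\<^sub>M S) \<Longrightarrow> emeasure a {\<omega> \<in> space S. (F \<omega>, \<omega>) \<in> B} = (\<integral>\<^sup>+s. emeasure (k1 s) (Pair s -` B) \<partial>\<gamma>)"
    using disintegration_retract[OF fin(1) sa F \<Phi> \<Psi> inv] unfolding \<gamma>_def[symmetric] by blast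
  obtain k2 where k2: "k2 \<in> N \<rightarrow>\<^sub>M prob_algebra S" and e2: "\<And>B. B \<in> sets (N \<Otimes>\<^sub>M S) \<Longrightarrow> emeasure b {\<omega> \<in> space S. (F \<omega>, \<omega>) \<in> B} = (\<integral>\<^sup>+s. emeasure (k2 s) (Pair s -` B) \<partial>\<gamma>)"
    using disintegration_retract[OF fin(2) sb F \<Phi> \<Psi> inv] unfolding \<gamma>b[symmetric] by blast
  define K where "K s = k1 s \<Otimes>\<^sub>M k2 s" for s
  have K: "K \<in> N \<rightarrow>\<^sub>M prob_algebra (S \<Otimes>\<^sub>M S)" unfolding K_def by (rule measurable_pair_prob[OF k1 k2])
  have K': "K \<in> \<gamma> \<rightarrow>\<^sub>M subprob_algebra (S \<Otimes>\<^sub>M S)"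
    unfolding measurable_cong_sets[OF s\<gamma>(1) refl] by (rule measurable_prob_algebraD[OF K])
  define c where "c = \<gamma> \<bind> K"
  have sc: "sets c = sets (S \<Otimes>\<^sub>M S)" unfolding c_def by (rule sets_bind_measurable[OF K']) (use neN s\<gamma> in simp)
  have ec: "emeasure c X = (\<integral>\<^sup>+s. emeasure (K s) X \<partial>\<gamma>)" if "X \<in> sets (S \<Otimes>\<^sub>M S)" for X
    unfolding c_def by (rule emeasure_bind[OF _ K' that]) (use neN s\<gamma> in simp)
  have times: "emeasure (K s) (A \<times> B) = emeasure (k1 s) A * emeasure (k2 s) B" if "s \<in> space N" "A \<in> sets S" "B \<in> sets S" for s A B
  proof -
    interpret k2: prob_space "k2 s" by (rule kernel_props(1)[OF k2 that(1)])
    show ?thesis unfolding K_def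
      using that kernel_props(2)[OF k1 that(1)] kernel_props(2)[OF k2 that(1)] by (intro k2.emeasure_pair_measure_Times) auto
  qed
  have one: "emeasure (k1 s) (space S) = 1" "emeasure (k2 s) (space S) = 1" if s: "s \<in> space N" for s
    using prob_space.emeasure_space_1[OF kernel_props(1)[OF k1 s]] prob_space.emeasure_space_1[OF kernel_props(1)[OF k2 s]]
      kernel_props(3)[OF k1 s] kernel_props(3)[OF k2 s] by simp_all
  have marg: "emeasure c (A \<times> space S) = emeasure a A" "emeasure c (space S \<times> A) = emeasure b A" if A: "A \<in> sets S" for A
  proof -
    have NA: "space N \<times> A \<in> sets (N \<Otimes>\<^sub>M S)" using A by auto
    have eq: "{\<omega> \<in> space S. (F \<omega>, \<omega>) \<in> space N \<times> A} = A"
      using sets.sets_into_space[OF A] measurable_space[OF F] by auto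
    have "emeasure c (A \<times> space S) = (\<integral>\<^sup>+s. emeasure (k1 s) (Pair s -` (space N \<times> A)) \<partial>\<gamma>)"
      using A by (subst ec) (auto intro!: nn_integral_cong simp: times one s\<gamma>)
    then show "emeasure c (A \<times> space S) = emeasure a A" using e1[OF NA] by (simp only: eq)
    have "emeasure c (space S \<times> A) = (\<integral>\<^sup>+s. emeasure (k2 s) (Pair s -` (space N \<times> A)) \<partial>\<gamma>)"
      using A by (subst ec) (auto intro!: nn_integral_cong simp: times one s\<gamma>)
    then show "emeasure c (space S \<times> A) = emeasure b A" using e2[OF NA] by (simp only: eq)
  qed
  \<comment> \<open>\<open>G\<close> collects the pairs whose path does not have the prescribed
    image. Conditional laws do not charge its sections, so under almost every \<open>K s\<close>
    both coordinates have image \<open>s\<close> and agree after \<open>F\<close>.\<close>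
  define G where "G = {p \<in> space (N \<Otimes>\<^sub>M S). F (snd p) \<noteq> fst p}"
  have mG: "(\<lambda>p. (F (snd p), fst p)) \<in> N \<Otimes>\<^sub>M S \<rightarrow>\<^sub>M N \<Otimes>\<^sub>M N"
    by (intro measurable_Pair measurable_compose[OF measurable_snd F] measurable_fst)
  have "G = space (N \<Otimes>\<^sub>M S) - ((\<lambda>p. (F (snd p), fst p)) -` Id_on (space N) \<inter> space (N \<Otimes>\<^sub>M S))"
    using measurable_space[OF F] by (auto simp: G_def space_pair_measure)
  then have G: "G \<in> sets (N \<Otimes>\<^sub>M S)" using measurable_sets[OF mG diag] by auto
  have G0: "{\<omega> \<in> space S. (F \<omega>, \<omega>) \<in> G} = {}" by (auto simp: G_def)
  have Gm: "(\<lambda>s. emeasure (k s) (Pair s -` G)) \<in> borel_measurable \<gamma>" if k: "k \<in> N \<rightarrow>\<^sub>M prob_algebra S" for k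
  proof -
    have "(SIGMA s:space N. Pair s -` G) = G" by (auto simp: G_def space_pair_measure)
    then have "(\<lambda>s. emeasure (k s) (Pair s -` G)) \<in> borel_measurable N"
      using G by (intro emeasure_measurable_subprob_algebra2[OF _ measurable_prob_algebraD[OF k]]) simp
    then show ?thesis unfolding measurable_cong_sets[OF s\<gamma>(1) refl] .
  qed
  have z1: "AE s in \<gamma>. emeasure (k1 s) (Pair s -` G) = 0"
    using e1[OF G] unfolding G0 emeasure_empty by (simp only: nn_integral_0_iff_AE[OF Gm[OF k1], symmetric])
  have z2: "AE s in \<gamma>. emeasure (k2 s) (Pair s -` G) = 0"
    using e2[OF G] unfolding G0 emeasure_empty by (simp only: nn_integral_0_iff_AE[OF Gm[OF k2], symmetric])
  let ?E = "{p \<in> space (S \<Otimes>\<^sub>M S). F (fst p) \<noteq> F (snd p)}"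
  have mE: "(\<lambda>p. (F (fst p), F (snd p))) \<in> S \<Otimes>\<^sub>M S \<rightarrow>\<^sub>M N \<Otimes>\<^sub>M N"
    by (intro measurable_Pair measurable_compose[OF measurable_snd F] measurable_compose[OF measurable_fst F])
  have "?E = space (S \<Otimes>\<^sub>M S) - ((\<lambda>p. (F (fst p), F (snd p))) -` Id_on (space N) \<inter> space (S \<Otimes>\<^sub>M S))"
    using measurable_space[OF F] by (auto simp: space_pair_measure)
  then have E: "?E \<in> sets (S \<Otimes>\<^sub>M S)" using measurable_sets[OF mE diag] by auto
  have "AE s in \<gamma>. emeasure (K s) ?E = 0"
    using z1 z2 AE_space
  proof eventually_elim
    case (elim s)
    then have s: "s \<in> space N" by (simp only: s\<gamma>)
    define X where "X = Pair s -` G"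
    have X: "X \<in> sets S" unfolding X_def by (rule sets_Pair1[OF G])
    have "?E \<subseteq> (X \<times> space S) \<union> (space S \<times> X)"
      using s by (auto simp: X_def G_def space_pair_measure)
    then have "emeasure (K s) ?E \<le> emeasure (K s) ((X \<times> space S) \<union> (space S \<times> X))"
      using X kernel_props(2)[OF K s] by (intro emeasure_mono) auto
    also have "\<dots> \<le> emeasure (K s) (X \<times> space S) + emeasure (K s) (space S \<times> X)"
      using X kernel_props(2)[OF K s] by (intro emeasure_subadditive) auto
    also have "\<dots> = 0" using elim(1,2) X by (simp add: times[OF s] X_def[symmetric])
    finally show ?case by simp
  qed
  then have "emeasure c ?E = (\<integral>\<^sup>+s. 0 \<partial>\<gamma>)" unfolding ec[OF E] by (rule nn_integral_cong_AE)
  then show ?thesis using sc marg by (intro exI[of _ c]) auto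
qed

subsection \<open>Coalescing couplings\<close>

text \<open>A splitting of the image law lifts to the measure itself: the densities \<open>u\<close>
  and \<open>v\<close> of the two parts with respect to the image law add up to 1, and weighting by
  their values at \<open>F \<omega>\<close> splits \<open>a\<close> accordingly.\<close>

lemma thinning:
  assumes fin: "finite_measure a" and sa: "sets a = sets S" and F: "F \<in> S \<rightarrow>\<^sub>M N"
    and sc: "sets c = sets N" and sr: "sets r = sets N"
    and split: "\<And>A. A \<in> sets N \<Longrightarrow> emeasure (distr a N F) A = emeasure c A + emeasure r A"
  shows "\<exists>a1 a2. sets a1 = sets S \<and> sets a2 = sets S \<and> (\<forall>A\<in>sets S. emeasure a A = emeasure a1 A + emeasure a2 A) \<and>
    distr a1 N F = c \<and> distr a2 N F = r"
proof -
  interpret a: finite_measure a by fact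
  have F': "F \<in> a \<rightarrow>\<^sub>M N" unfolding measurable_cong_sets[OF sa refl] by (rule F)
  define \<nu> where "\<nu> = distr a N F"
  interpret \<nu>: finite_measure \<nu> unfolding \<nu>_def by (rule a.finite_measure_distr[OF F'])
  have s\<nu>: "sets \<nu> = sets N" by (simp add: \<nu>_def)
  have ac: "absolutely_continuous \<nu> c" "absolutely_continuous \<nu> r"
    unfolding absolutely_continuous_def
  proof safe
    fix X assume X: "X \<in> null_sets \<nu>"
    then have XN: "X \<in> sets N" using s\<nu> by auto
    have "emeasure c X + emeasure r X = 0" using split[OF XN] null_setsD1[OF X] by (simp add: \<nu>_def)
    then show "X \<in> null_sets c" "X \<in> null_sets r" using XN sc sr by (auto intro!: null_setsI)
  qed
  obtain u where u: "u \<in> borel_measurable \<nu>" "density \<nu> u = c"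
    using \<nu>.Radon_Nikodym[OF ac(1)] sc s\<nu> by auto
  obtain v where v: "v \<in> borel_measurable \<nu>" "density \<nu> v = r"
    using \<nu>.Radon_Nikodym[OF ac(2)] sr s\<nu> by auto
  have uN: "u \<in> borel_measurable N" and vN: "v \<in> borel_measurable N"
    using u(1) v(1) unfolding measurable_cong_sets[OF s\<nu> refl] by auto
  have "density \<nu> (\<lambda>s. u s + v s) = density \<nu> (\<lambda>_. 1)"
    unfolding density_1
  proof (rule measure_eqI)
    fix A assume "A \<in> sets (density \<nu> (\<lambda>s. u s + v s))"
    then have A: "A \<in> sets \<nu>" by simp
    have "emeasure (density \<nu> (\<lambda>s. u s + v s)) A = (\<integral>\<^sup>+s. u s * indicator A s + v s * indicator A s \<partial>\<nu>)"
      using u(1) v(1) A by (simp add: emeasure_density distrib_right)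
    also have "\<dots> = (\<integral>\<^sup>+s. u s * indicator A s \<partial>\<nu>) + (\<integral>\<^sup>+s. v s * indicator A s \<partial>\<nu>)"
      using u(1) v(1) A by (intro nn_integral_add) auto
    also have "\<dots> = emeasure c A + emeasure r A"
      unfolding u(2)[symmetric] v(2)[symmetric] using u(1) v(1) A by (simp add: emeasure_density)
    also have "\<dots> = emeasure \<nu> A" using split[of A] A s\<nu> by (simp add: \<nu>_def)
    finally show "emeasure (density \<nu> (\<lambda>s. u s + v s)) A = emeasure \<nu> A" .
  qed simp
  then have "AE s in \<nu>. u s + v s = 1"
    using u(1) v(1) by (subst (asm) \<nu>.density_unique_iff) auto
  from AE_distrD[OF F' this[unfolded \<nu>_def]] have uv: "AE \<omega> in a. u (F \<omega>) + v (F \<omega>) = 1" .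
  have um: "(\<lambda>\<omega>. u (F \<omega>)) \<in> borel_measurable a" by (rule measurable_compose[OF F' uN])
  have vm: "(\<lambda>\<omega>. v (F \<omega>)) \<in> borel_measurable a" by (rule measurable_compose[OF F' vN])
  have "emeasure a A = emeasure (density a (\<lambda>\<omega>. u (F \<omega>))) A + emeasure (density a (\<lambda>\<omega>. v (F \<omega>))) A" if "A \<in> sets S" for A
  proof -
    have A: "A \<in> sets a" using that sa by simp
    have "emeasure a A = (\<integral>\<^sup>+\<omega>. indicator A \<omega> \<partial>a)" using A by simp
    also have "\<dots> = (\<integral>\<^sup>+\<omega>. u (F \<omega>) * indicator A \<omega> + v (F \<omega>) * indicator A \<omega> \<partial>a)"
    proof (rule nn_integral_cong_AE)
      show "AE \<omega> in a. indicator A \<omega> = u (F \<omega>) * indicator A \<omega> + v (F \<omega>) * indicator A \<omega>"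
        using uv by eventually_elim (simp add: distrib_right[symmetric])
    qed
    also have "\<dots> = (\<integral>\<^sup>+\<omega>. u (F \<omega>) * indicator A \<omega> \<partial>a) + (\<integral>\<^sup>+\<omega>. v (F \<omega>) * indicator A \<omega> \<partial>a)"
      using um vm A by (intro nn_integral_add borel_measurable_times_ennreal borel_measurable_indicator)
    finally show ?thesis by (simp only: emeasure_density[OF um A] emeasure_density[OF vm A])
  qed
  moreover have "distr (density a (\<lambda>\<omega>. u (F \<omega>))) N F = c" "distr (density a (\<lambda>\<omega>. v (F \<omega>))) N F = r"
    unfolding density_distr[OF uN F', symmetric] density_distr[OF vN F', symmetric] \<nu>_def[symmetric] by (rule u v)+
  ultimately show ?thesis
    using sa by (intro exI[of _ "density a (\<lambda>\<omega>. u (F \<omega>))"] exI[of _ "density a (\<lambda>\<omega>. v (F \<omega>))"]) auto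
qed

text \<open>Only the common part of the two image laws is lifted and glued. The bound expresses the
  remaining mass by a set \<open>H\<close> carrying the residual of \<open>a\<close> and null for
  that of \<open>b\<close>; thus it involves only events determined by \<open>F\<close>, which suits
  an induction over tails.\<close>

lemma coupling_step:
  fixes S :: "'a measure" and N :: "'b measure"
  assumes fin: "finite_measure a" "finite_measure b" and sa: "sets a = sets S" and sb: "sets b = sets S"
    and F: "F \<in> S \<rightarrow>\<^sub>M N" and \<Phi>: "\<Phi> \<in> borel_measurable S" and \<Psi>: "\<Psi> \<in> borel \<rightarrow>\<^sub>M S"
    and inv: "\<And>\<omega>. \<omega> \<in> space S \<Longrightarrow> \<Psi> (\<Phi> \<omega>) = \<omega> \<and> 0 \<le> \<Phi> \<omega> \<and> \<Phi> \<omega> \<le> (1::real)"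
    and diag: "Id_on (space N) \<in> sets (N \<Otimes>\<^sub>M N)" and ne: "space S \<noteq> {}"
  shows "\<exists>c a' b' H. sets c = sets (S \<Otimes>\<^sub>M S) \<and> sets a' = sets S \<and> sets b' = sets S \<and>
    (\<forall>A\<in>sets S. emeasure a A = emeasure c (A \<times> space S) + emeasure a' A \<and> emeasure b A = emeasure c (space S \<times> A) + emeasure b' A) \<and>
    emeasure c {p \<in> space (S \<Otimes>\<^sub>M S). F (fst p) \<noteq> F (snd p)} = 0 \<and>
    H \<in> sets N \<and> measure a' (space S) \<le> measure a (F -` H \<inter> space S) - measure b (F -` H \<inter> space S)"
proof -
  interpret a: finite_measure a by fact
  interpret b: finite_measure b by fact
  have spa: "space a = space S" "space b = space S" using sa sb sets_eq_imp_space_eq by blast+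
  have Fa: "F \<in> a \<rightarrow>\<^sub>M N" unfolding measurable_cong_sets[OF sa refl] by (rule F)
  have Fb: "F \<in> b \<rightarrow>\<^sub>M N" unfolding measurable_cong_sets[OF sb refl] by (rule F)
  obtain g r1 r2 H where ging: "finite_measure g" "finite_measure r1" "finite_measure r2"
    and sets: "sets g = sets N" "sets r1 = sets N" "sets r2 = sets N" "H \<in> sets N"
    and e1: "\<And>A. A \<in> sets N \<Longrightarrow> emeasure (distr a N F) A = emeasure g A + emeasure r1 A"
    and e2: "\<And>A. A \<in> sets N \<Longrightarrow> emeasure (distr b N F) A = emeasure g A + emeasure r2 A"
    and H: "emeasure r1 (space N - H) = 0" "emeasure r2 H = 0"
    using common_part[OF a.finite_measure_distr[OF Fa] b.finite_measure_distr[OF Fb] sets_distr sets_distr] by metis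
  obtain a1 a' where a1: "sets a1 = sets S" "sets a' = sets S"
    "\<And>A. A \<in> sets S \<Longrightarrow> emeasure a A = emeasure a1 A + emeasure a' A" "distr a1 N F = g" "distr a' N F = r1"
    using thinning[OF fin(1) sa F sets(1,2) e1] by blast
  obtain b1 b' where b1: "sets b1 = sets S" "sets b' = sets S"
    "\<And>A. A \<in> sets S \<Longrightarrow> emeasure b A = emeasure b1 A + emeasure b' A" "distr b1 N F = g" "distr b' N F = r2"
    using thinning[OF fin(2) sb F sets(1,3) e2] by blast
  have "finite_measure a1" by (rule finite_measure_le[OF fin(1)]) (use a1 sa in auto)
  moreover have "finite_measure b1" by (rule finite_measure_le[OF fin(2)]) (use b1 sb in auto)
  ultimately obtain c where c: "sets c = sets (S \<Otimes>\<^sub>M S)"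
    "\<And>A. A \<in> sets S \<Longrightarrow> emeasure c (A \<times> space S) = emeasure a1 A \<and> emeasure c (space S \<times> A) = emeasure b1 A"
    "emeasure c {p \<in> space (S \<Otimes>\<^sub>M S). F (fst p) \<noteq> F (snd p)} = 0"
    using gluing[of a1 b1 S F N, OF _ _ a1(1) b1(1) F _ \<Phi> \<Psi> inv diag ne] a1(4) b1(4) by auto
  have "measure a' (space S) \<le> measure a (F -` H \<inter> space S) - measure b (F -` H \<inter> space S)"
  proof -
    interpret g: finite_measure g by fact
    interpret r1: finite_measure r1 by fact
    have spr: "space r1 = space N" using sets(2) sets_eq_imp_space_eq by blast
    have "measure r1 (space N) = measure r1 H + measure r1 (space N - H)"
      using sets r1.finite_measure_Diff[of "space N" H] spr sets.sets_into_space[OF sets(4)] by auto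
    moreover have "measure r1 (space N - H) = 0" using H(1) by (simp add: measure_def)
    moreover have "measure (distr a N F) H = measure g H + measure r1 H"
      unfolding measure_def e1[OF sets(4)] by (rule enn2real_plus) (simp_all add: less_top[symmetric])
    moreover have "measure (distr b N F) H = measure g H"
      unfolding measure_def e2[OF sets(4)] using H(2) by simp
    moreover have "measure (distr a N F) H = measure a (F -` H \<inter> space S)"
      using measure_distr[OF Fa sets(4)] by (simp add: spa)
    moreover have "measure (distr b N F) H = measure b (F -` H \<inter> space S)"
      using measure_distr[OF Fb sets(4)] by (simp add: spa)
    moreover have "measure a' (space S) = measure r1 (space N)"
    proof -
      have Fa': "F \<in> a' \<rightarrow>\<^sub>M N" unfolding measurable_cong_sets[OF a1(2) refl] by (rule F)
      have "F -` space N \<inter> space a' = space S"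
        using measurable_space[OF F] sets_eq_imp_space_eq[OF a1(2)] by auto
      then show ?thesis using measure_distr[OF Fa' sets.top[of N]] unfolding a1(5) by simp
    qed
    ultimately show ?thesis by linarith
  qed
  then show ?thesis
    using c a1 b1 sets(4) by (intro exI[of _ c] exI[of _ a'] exI[of _ b'] exI[of _ H]) auto
qed

context stationary_kernel
begin

lemma path_diagonal:
  assumes diag: "Id_on (space M) \<in> sets (M \<Otimes>\<^sub>M M)"
  shows "Id_on (space S) \<in> sets (S \<Otimes>\<^sub>M S)"
proof -
  have m: "(\<lambda>p. (fst p n, snd p n)) \<in> S \<Otimes>\<^sub>M S \<rightarrow>\<^sub>M M \<Otimes>\<^sub>M M" for n
    by (intro measurable_Pair measurable_compose[OF measurable_fst measurable_component_singleton[OF UNIV_I]]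
        measurable_compose[OF measurable_snd measurable_component_singleton[OF UNIV_I]])
  have "Id_on (space S) = (\<Inter>n. (\<lambda>p. (fst p n, snd p n)) -` Id_on (space M) \<inter> space (S \<Otimes>\<^sub>M S))"
    by (auto simp: space_pair_measure space_PiM PiE_iff Id_on_def fun_eq_iff)
  also have "\<dots> \<in> sets (S \<Otimes>\<^sub>M S)"
    by (rule sets.countable_INT') (auto intro: measurable_sets[OF m diag])
  finally show ?thesis .
qed

definition tails_differ :: "nat \<Rightarrow> ((nat \<Rightarrow> 'a) \<times> (nat \<Rightarrow> 'a)) set" where
  "tails_differ n = {p \<in> space (S \<Otimes>\<^sub>M S). (\<lambda>i. fst p (i + n)) \<noteq> (\<lambda>i. snd p (i + n))}"

lemma tails_differ_sets:
  assumes diag: "Id_on (space M) \<in> sets (M \<Otimes>\<^sub>M M)"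
  shows "tails_differ n \<in> sets (S \<Otimes>\<^sub>M S)"
proof -
  have m: "(\<lambda>p. (\<lambda>i. fst p (i + n), \<lambda>i. snd p (i + n))) \<in> S \<Otimes>\<^sub>M S \<rightarrow>\<^sub>M S \<Otimes>\<^sub>M S"
    by (intro measurable_Pair measurable_compose[OF measurable_fst measurable_shift]
        measurable_compose[OF measurable_snd measurable_shift])
  have "tails_differ n = space (S \<Otimes>\<^sub>M S) - ((\<lambda>p. (\<lambda>i. fst p (i + n), \<lambda>i. snd p (i + n))) -` Id_on (space S) \<inter> space (S \<Otimes>\<^sub>M S))"
    using measurable_space[OF measurable_shift] by (auto simp: tails_differ_def space_pair_measure)
  then show ?thesis using measurable_sets[OF m path_diagonal[OF diag]] by auto
qed

lemma tails_differ_antimono: "m \<le> n \<Longrightarrow> tails_differ n \<subseteq> tails_differ m"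
proof -
  assume "m \<le> n"
  then obtain k where n: "n = m + k" using le_Suc_ex by blast
  have "(\<lambda>i. \<omega> (i + n)) = (\<lambda>i. \<omega>' (i + n))" if "(\<lambda>i. \<omega> (i + m)) = (\<lambda>i. \<omega>' (i + m))" for \<omega> \<omega>' :: "nat \<Rightarrow> 'a"
  proof
    fix i
    from fun_cong[OF that, of "i + k"] show "\<omega> (i + n) = \<omega>' (i + n)" by (simp add: n ac_simps)
  qed
  then show ?thesis unfolding tails_differ_def by blast
qed

text \<open>As \<open>B\<close> varies these are the events determined by the path from time
  \<open>n\<close> on.\<close>

definition shift_preimage :: "nat \<Rightarrow> (nat \<Rightarrow> 'a) set \<Rightarrow> (nat \<Rightarrow> 'a) set" where
  "shift_preimage n B = (\<lambda>\<omega> i. \<omega> (i + n)) -` B \<inter> space S"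

lemma shift_preimage_sets: "B \<in> sets S \<Longrightarrow> shift_preimage n B \<in> sets S"
  unfolding shift_preimage_def by (rule measurable_sets[OF measurable_shift])

lemma shift_preimage_space: "shift_preimage n (space S) = space S"
  using measurable_space[OF measurable_shift] by (auto simp: shift_preimage_def)

text \<open>The tail laws are mixtures of \<open>path_law\<close> by the laws of time
  \<open>n\<close>, so the contraction property applies.\<close>

lemma path_law_shift_preimage_le:
  assumes x: "x \<in> space M" and y: "y \<in> space M" and B: "B \<in> sets S"
  shows "measure (path_law M P x) (shift_preimage n B) - measure (path_law M P y) (shift_preimage n B) \<le> dn n x y"
proof -
  have eq: "measure (path_law M P z) (shift_preimage n B) = measure (nstep M P n z \<bind> path_law M P) B" if z: "z \<in> space M" for z
  proof -
    have "(\<lambda>\<omega> i. \<omega> (i + n)) \<in> path_law M P z \<rightarrow>\<^sub>M S"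
      unfolding measurable_cong_sets[OF path_law_props(2)[OF z] refl] by (rule measurable_shift)
    from measure_distr[OF this B] show ?thesis
      unfolding path_law_shift[OF z] shift_preimage_def path_law_props(3)[OF z] ..
  qed
  have "\<bar>measure (nstep M P n x \<bind> path_law M P) B - measure (nstep M P n y \<bind> path_law M P) B\<bar>
    \<le> tv_dist S (nstep M P n x \<bind> path_law M P) (nstep M P n y \<bind> path_law M P)"
    using bind_props(1)[OF nstep_props(1,2)[OF y] measurable_path_law] bind_props(1)[OF nstep_props(1,2)[OF x] measurable_path_law]
    by (intro tv_dist_bound B)
  also have "\<dots> \<le> dn n x y"
    by (rule tv_dist_bind_contract[OF nstep_props(1)[OF x] nstep_props(1)[OF y] nstep_props(2)[OF x] nstep_props(2)[OF y] measurable_path_law])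
  finally show ?thesis unfolding eq[OF x] eq[OF y] by linarith
qed

text \<open>At time \<open>n\<close> the common part of the laws of the tails from \<open>n\<close> on is coupled.  What has been
  coupled before has equal tails, so the remaining measures differ on tail events exactly as the
  two path laws do; this is the third clause of the invariant.\<close>

definition residual_pair :: "'a \<Rightarrow> 'a \<Rightarrow> nat \<Rightarrow> (nat \<Rightarrow> 'a) measure \<times> (nat \<Rightarrow> 'a) measure \<Rightarrow> bool" where
  "residual_pair x y n ab \<longleftrightarrow> finite_measure (fst ab) \<and> finite_measure (snd ab) \<and>
     sets (fst ab) = sets S \<and> sets (snd ab) = sets S \<and>
     (\<forall>m B. n \<le> Suc m \<longrightarrow> B \<in> sets S \<longrightarrow>
        measure (fst ab) (shift_preimage m B) - measure (snd ab) (shift_preimage m B) =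
        measure (path_law M P x) (shift_preimage m B) - measure (path_law M P y) (shift_preimage m B)) \<and>
     (\<forall>k. n = Suc k \<longrightarrow> measure (fst ab) (space S) \<le> dn k x y)"

definition coupled_part :: "nat \<Rightarrow> (nat \<Rightarrow> 'a) measure \<times> (nat \<Rightarrow> 'a) measure \<Rightarrow> (nat \<Rightarrow> 'a) measure \<times> (nat \<Rightarrow> 'a) measure \<Rightarrow>
    ((nat \<Rightarrow> 'a) \<times> (nat \<Rightarrow> 'a)) measure \<Rightarrow> bool" where
  "coupled_part n ab ab' c \<longleftrightarrow> sets c = sets (S \<Otimes>\<^sub>M S) \<and>
     (\<forall>A\<in>sets S. emeasure (fst ab) A = emeasure c (A \<times> space S) + emeasure (fst ab') A \<and>
        emeasure (snd ab) A = emeasure c (space S \<times> A) + emeasure (snd ab') A) \<and>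
     emeasure c (tails_differ n) = 0"

lemma coupled_part_finite:
  assumes ab: "residual_pair x y n ab" and c: "coupled_part n ab ab' c"
  shows "finite_measure c"
proof (rule finite_measureI)
  have "space c = space S \<times> space S"
    using c sets_eq_imp_space_eq[of c "S \<Otimes>\<^sub>M S"] by (simp add: coupled_part_def space_pair_measure)
  moreover have "emeasure (fst ab) (space S) = emeasure c (space S \<times> space S) + emeasure (fst ab') (space S)"
    using c unfolding coupled_part_def by blast
  moreover have "emeasure (fst ab) (space S) \<noteq> \<infinity>"
    using ab by (simp add: residual_pair_def finite_measure.emeasure_finite)
  ultimately show "emeasure c (space c) \<noteq> \<infinity>" by simp
qed

lemma coupled_part_tail_eq:
  assumes c: "coupled_part n ab ab' c" and nm: "n \<le> m" and B: "B \<in> sets S"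
    and diag: "Id_on (space M) \<in> sets (M \<Otimes>\<^sub>M M)"
  shows "emeasure c (shift_preimage m B \<times> space S) = emeasure c (space S \<times> shift_preimage m B)"
proof (rule emeasure_eq_AE)
  have sc: "sets c = sets (S \<Otimes>\<^sub>M S)" and 0: "emeasure c (tails_differ n) = 0"
    using c by (auto simp: coupled_part_def)
  have spc: "space c = space S \<times> space S" using sets_eq_imp_space_eq[OF sc] by (simp add: space_pair_measure)
  have "tails_differ n \<in> null_sets c" using 0 tails_differ_sets[OF diag] sc by (intro null_setsI) auto
  from AE_not_in[OF this] AE_space
  show "AE p in c. p \<in> shift_preimage m B \<times> space S \<longleftrightarrow> p \<in> space S \<times> shift_preimage m B"
  proof eventually_elim
    case (elim p)
    have "p \<notin> tails_differ m" using elim(1) tails_differ_antimono[OF nm] by blast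
    then have "(\<lambda>i. fst p (i + m)) = (\<lambda>i. snd p (i + m))"
      using elim(2) by (simp add: tails_differ_def spc space_pair_measure)
    then show ?case using elim(2) by (auto simp: spc shift_preimage_def mem_Times_iff)
  qed
  show "shift_preimage m B \<times> space S \<in> sets c" "space S \<times> shift_preimage m B \<in> sets c"
    unfolding sc using shift_preimage_sets[OF B, of m] by auto
qed

text \<open>An index \<open>n\<close> means that the couplings at times below \<open>n\<close> have
  been done, so tail differences are preserved from time \<open>n - 1\<close> on, whence the bound
  \<open>n \<le> Suc m\<close>. The new residual mass is at most a difference on a tail event of
  time \<open>n\<close>; this equals the difference of the path laws there and is bounded by
  \<open>dn n x y\<close>.\<close>

lemma residual_pair_step:
  assumes diag: "Id_on (space M) \<in> sets (M \<Otimes>\<^sub>M M)" and B: "borel_space M"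
    and x: "x \<in> space M" and y: "y \<in> space M" and ab: "residual_pair x y n ab"
  shows "\<exists>ab'. residual_pair x y (Suc n) ab' \<and> (\<exists>c. coupled_part n ab ab' c)"
proof -
  have neM: "space M \<noteq> {}" using x by auto
  have neS: "space S \<noteq> {}" using x by (auto simp: space_PiM PiE_eq_empty_iff)
  obtain \<Phi> \<Psi> where \<Phi>: "\<Phi> \<in> borel_measurable S" and \<Psi>: "\<Psi> \<in> borel \<rightarrow>\<^sub>M S"
    and inv: "\<And>\<omega>. \<omega> \<in> space S \<Longrightarrow> \<Psi> (\<Phi> \<omega>) = \<omega> \<and> 0 \<le> \<Phi> \<omega> \<and> \<Phi> \<omega> \<le> (1::real)"
    using borel_space_path_retract[OF B neM] by blast
  define a b where "a = fst ab" and "b = snd ab"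
  have fin: "finite_measure a" "finite_measure b" and sab: "sets a = sets S" "sets b = sets S"
    and diff: "\<And>m B. n \<le> Suc m \<Longrightarrow> B \<in> sets S \<Longrightarrow>
        measure a (shift_preimage m B) - measure b (shift_preimage m B) =
        measure (path_law M P x) (shift_preimage m B) - measure (path_law M P y) (shift_preimage m B)"
    using ab by (auto simp: residual_pair_def a_def b_def)
  obtain c a' b' H where c: "sets c = sets (S \<Otimes>\<^sub>M S)" "sets a' = sets S" "sets b' = sets S"
    and split: "\<And>A. A \<in> sets S \<Longrightarrow> emeasure a A = emeasure c (A \<times> space S) + emeasure a' A"
      "\<And>A. A \<in> sets S \<Longrightarrow> emeasure b A = emeasure c (space S \<times> A) + emeasure b' A"
    and null: "emeasure c {p \<in> space (S \<Otimes>\<^sub>M S). (\<lambda>i. fst p (i + n)) \<noteq> (\<lambda>i. snd p (i + n))} = 0"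
    and H: "H \<in> sets S" "measure a' (space S) \<le> measure a ((\<lambda>\<omega> i. \<omega> (i + n)) -` H \<inter> space S) - measure b ((\<lambda>\<omega> i. \<omega> (i + n)) -` H \<inter> space S)"
    using coupling_step[OF fin sab measurable_shift[of n] \<Phi> \<Psi> inv path_diagonal[OF diag] neS] by blast
  have cp: "coupled_part n ab (a', b') c"
    using c(1) split null by (simp add: coupled_part_def a_def b_def tails_differ_def)
  have fin': "finite_measure a'" "finite_measure b'"
    by (rule finite_measure_le[OF fin(1)]; use c(2) sab(1) split(1) in simp)
       (rule finite_measure_le[OF fin(2)]; use c(3) sab(2) split(2) in simp)
  interpret a: finite_measure a by fact
  interpret b: finite_measure b by fact
  interpret a': finite_measure a' by fact
  interpret b': finite_measure b' by fact
  interpret c: finite_measure c by (rule coupled_part_finite[OF ab cp])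
  have ma: "measure a A = measure c (A \<times> space S) + measure a' A" if "A \<in> sets S" for A
    unfolding measure_def split(1)[OF that] by (rule enn2real_plus) (simp_all add: less_top[symmetric])
  have mb: "measure b A = measure c (space S \<times> A) + measure b' A" if "A \<in> sets S" for A
    unfolding measure_def split(2)[OF that] by (rule enn2real_plus) (simp_all add: less_top[symmetric])
  have "residual_pair x y (Suc n) (a', b')"
    unfolding residual_pair_def fst_conv snd_conv
  proof (intro conjI allI impI fin' c(2,3))
    fix m B assume m: "Suc n \<le> Suc m" and BS: "B \<in> sets S"
    have "measure c (shift_preimage m B \<times> space S) = measure c (space S \<times> shift_preimage m B)"
      unfolding measure_def using coupled_part_tail_eq[OF cp _ BS diag, of m] m by simp
    then show "measure a' (shift_preimage m B) - measure b' (shift_preimage m B) =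
        measure (path_law M P x) (shift_preimage m B) - measure (path_law M P y) (shift_preimage m B)"
      using diff[of m B] BS m ma[OF shift_preimage_sets[OF BS]] mb[OF shift_preimage_sets[OF BS]] by simp
  next
    fix k assume "Suc n = Suc k"
    then show "measure a' (space S) \<le> dn k x y"
      using H(2) diff[of n H] H(1) path_law_shift_preimage_le[OF x y H(1), of n]
      unfolding shift_preimage_def[symmetric] by simp
  qed
  then show ?thesis using cp by blast
qed

text \<open>The pieces \<open>c n\<close> add up to a full coupling because the uncoupled mass tends
  to 0. At time \<open>n\<close> the pieces coupled up to then have coalesced, so the probability of
  coalescence is at least 1 minus the uncoupled mass.\<close>

lemma coalescing_coupling:
  assumes diag: "Id_on (space M) \<in> sets (M \<Otimes>\<^sub>M M)" and B: "borel_space M"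
    and P': "cond_P M P \<mu>" and x: "x \<in> space M" and y: "y \<in> space M"
  shows "\<exists>\<xi>\<in>couplings (path_law M P x) (path_law M P y).
    (\<lambda>n. measure \<xi> {p \<in> space \<xi>. \<forall>k\<ge>n. fst p k = snd p k}) \<longlonglongrightarrow> 1"
proof -
  let ?Px = "path_law M P x" and ?Py = "path_law M P y"
  interpret Px: prob_space ?Px by (rule path_law_props(1)[OF x])
  interpret Py: prob_space ?Py by (rule path_law_props(1)[OF y])
  note sx = path_law_props(2)[OF x] and sy = path_law_props(2)[OF y]
  note spx = path_law_props(3)[OF x] and spy = path_law_props(3)[OF y]
  have "residual_pair x y 0 (?Px, ?Py)"
    by (simp add: residual_pair_def sx sy Px.finite_measure_axioms Py.finite_measure_axioms)
  have "\<exists>st. (\<forall>n. residual_pair x y n (st n) \<and> (n = 0 \<longrightarrow> st n = (?Px, ?Py))) \<and> (\<forall>n. \<exists>c. coupled_part n (st n) (st (Suc n)) c)"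
  \<comment> \<open>The clause for index 0 pins the start of the chosen sequence to the two path
    laws.\<close>
  proof (rule exE[OF dependent_nat_choice[of "\<lambda>n s. residual_pair x y n s \<and> (n = 0 \<longrightarrow> s = (?Px, ?Py))" "\<lambda>n s s'. \<exists>c. coupled_part n s s' c"]])
    show "\<exists>s. residual_pair x y 0 s \<and> (0 = 0 \<longrightarrow> s = (?Px, ?Py))"
      using \<open>residual_pair x y 0 (?Px, ?Py)\<close> by blast
    show "\<exists>s'. (residual_pair x y (Suc n) s' \<and> (Suc n = 0 \<longrightarrow> s' = (?Px, ?Py))) \<and> (\<exists>c. coupled_part n s s' c)"
      if "residual_pair x y n s \<and> (n = 0 \<longrightarrow> s = (?Px, ?Py))" for s n
      using residual_pair_step[OF diag B x y, of n s] that by auto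
  qed blast
  then obtain st where res: "\<And>n. residual_pair x y n (st n)" and st0: "st 0 = (?Px, ?Py)"
    and "\<And>n. \<exists>c. coupled_part n (st n) (st (Suc n)) c" by blast
  then obtain c where c: "\<And>n. coupled_part n (st n) (st (Suc n)) (c n)" by metis
  define a b where "a n = fst (st n)" and "b n = snd (st n)" for n
  have ab0: "a 0 = ?Px" "b 0 = ?Py" by (simp_all add: a_def b_def st0)
  have fin: "finite_measure (a n)" "finite_measure (b n)" and sab: "sets (a n) = sets S" "sets (b n) = sets S" for n
    using res[of n] by (auto simp: residual_pair_def a_def b_def)
  have spab: "space (a n) = space S" "space (b n) = space S" for n
    by (rule sets_eq_imp_space_eq[OF sab(1)], rule sets_eq_imp_space_eq[OF sab(2)])
  have finc: "finite_measure (c n)" for n by (rule coupled_part_finite[OF res c])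
  have sc: "sets (c n) = sets (S \<Otimes>\<^sub>M S)" for n using c[of n] by (simp add: coupled_part_def)
  have spc: "space (c n) = space S \<times> space S" for n using sets_eq_imp_space_eq[OF sc[of n]] by (simp add: space_pair_measure)
  have split: "emeasure (a n) A = emeasure (c n) (A \<times> space S) + emeasure (a (Suc n)) A"
    "emeasure (b n) A = emeasure (c n) (space S \<times> A) + emeasure (b (Suc n)) A" if "A \<in> sets S" for n A
    using c[of n] that by (simp_all add: coupled_part_def a_def b_def)
  have m1: "measure (c n) (A \<times> space S) = measure (a n) A - measure (a (Suc n)) A" if "A \<in> sets S" for n A
  proof -
    have "measure (a n) A = measure (c n) (A \<times> space S) + measure (a (Suc n)) A"
      unfolding measure_def split(1)[OF that, of n]
      by (rule enn2real_plus) (simp_all only: less_top[symmetric] finite_measure.emeasure_finite[OF finc]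
          finite_measure.emeasure_finite[OF fin(1)] finite_measure.emeasure_finite[OF fin(2)] not_False_eq_True)
    then show ?thesis by simp
  qed
  have m2: "measure (c n) (space S \<times> A) = measure (b n) A - measure (b (Suc n)) A" if "A \<in> sets S" for n A
  proof -
    have "measure (b n) A = measure (c n) (space S \<times> A) + measure (b (Suc n)) A"
      unfolding measure_def split(2)[OF that, of n]
      by (rule enn2real_plus) (simp_all only: less_top[symmetric] finite_measure.emeasure_finite[OF finc]
          finite_measure.emeasure_finite[OF fin(1)] finite_measure.emeasure_finite[OF fin(2)] not_False_eq_True)
    then show ?thesis by simp
  qed
  have dn0: "(\<lambda>n. dn n x y) \<longlonglongrightarrow> 0" using dn_tendsto[OF x y] cond_P_D_zero[OF P' x y] by simp
  have mass_le: "measure (a (Suc n)) (space S) \<le> dn n x y" for n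
    using res[of "Suc n"] by (simp add: residual_pair_def a_def)
  have "(\<lambda>n. measure (a (Suc n)) (space S)) \<longlonglongrightarrow> 0"
    using mass_le by (intro tendsto_sandwich[OF _ _ tendsto_const dn0]) auto
  then have amass: "(\<lambda>n. measure (a n) (space S)) \<longlonglongrightarrow> 0" by (rule LIMSEQ_imp_Suc)
  have same_mass: "measure (b n) (space S) = measure (a n) (space S)" for n
  proof -
    have "\<forall>m B. n \<le> Suc m \<longrightarrow> B \<in> sets S \<longrightarrow>
        measure (a n) (shift_preimage m B) - measure (b n) (shift_preimage m B) =
        measure ?Px (shift_preimage m B) - measure ?Py (shift_preimage m B)"
      using res[of n] by (simp add: residual_pair_def a_def b_def)
    \<comment> \<open>The whole space is a tail event for every time, so preservation of tail
      differences includes equality of the total masses.\<close>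
    then have "measure (a n) (space S) - measure (b n) (space S) = measure ?Px (space S) - measure ?Py (space S)"
      using shift_preimage_space[of n] sets.top[of S] by (metis le_Suc_eq order.refl)
    then show ?thesis using Px.prob_space Py.prob_space by (simp add: spx spy)
  qed
  have a_lim: "(\<lambda>n. measure (a n) A) \<longlonglongrightarrow> 0" "(\<lambda>n. measure (b n) A) \<longlonglongrightarrow> 0" for A
  proof -
    have "measure (a n) A \<le> measure (a n) (space S)" "measure (b n) A \<le> measure (a n) (space S)" for n
      using finite_measure.bounded_measure[OF fin(1), of n A] finite_measure.bounded_measure[OF fin(2), of n A] same_mass[of n]
      by (simp_all add: spab)
    then show "(\<lambda>n. measure (a n) A) \<longlonglongrightarrow> 0" "(\<lambda>n. measure (b n) A) \<longlonglongrightarrow> 0"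
      by (auto intro!: tendsto_sandwich[OF _ _ tendsto_const amass])
  qed
  define \<xi> where "\<xi> = sum_measure (S \<Otimes>\<^sub>M S) c"
  have s\<xi>: "sets \<xi> = sets (S \<Otimes>\<^sub>M S)" by (simp add: \<xi>_def)
  have sp\<xi>: "space \<xi> = space S \<times> space S" using sets_eq_imp_space_eq[OF s\<xi>] by (simp add: space_pair_measure)
  have e\<xi>: "emeasure \<xi> X = (\<Sum>n. emeasure (c n) X)" if "X \<in> sets (S \<Otimes>\<^sub>M S)" for X
    unfolding \<xi>_def by (rule emeasure_sum_measure[OF sc that])
  have emc: "emeasure (c n) X = ennreal (measure (c n) X)" for n X by (rule finite_measure.emeasure_eq_measure[OF finc])
  have marg1: "emeasure \<xi> (A \<times> space S) = emeasure ?Px A" if A: "A \<in> sets S" for A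
  proof -
    have "(\<lambda>n. measure (a n) A - measure (a (Suc n)) A) sums (measure (a 0) A - 0)"
      by (rule telescope_sums'[OF a_lim(1)])
    then have "(\<Sum>n. ennreal (measure (c n) (A \<times> space S))) = ennreal (measure (a 0) A)"
      by (intro suminf_ennreal_eq) (simp_all add: m1[OF A, symmetric])
    then show ?thesis using A by (simp add: e\<xi> emc ab0 Px.emeasure_eq_measure)
  qed
  have marg2: "emeasure \<xi> (space S \<times> A) = emeasure ?Py A" if A: "A \<in> sets S" for A
  proof -
    have "(\<lambda>n. measure (b n) A - measure (b (Suc n)) A) sums (measure (b 0) A - 0)"
      by (rule telescope_sums'[OF a_lim(2)])
    then have "(\<Sum>n. ennreal (measure (c n) (space S \<times> A))) = ennreal (measure (b 0) A)"
      by (intro suminf_ennreal_eq) (simp_all add: m2[OF A, symmetric])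
    then show ?thesis using A by (simp add: e\<xi> emc ab0 Py.emeasure_eq_measure)
  qed
  have "prob_space \<xi>"
    using marg1[OF sets.top] Px.emeasure_space_1 by (intro prob_spaceI) (simp add: sp\<xi> spx)
  then interpret \<xi>: prob_space \<xi> .
  have "\<xi> \<in> couplings ?Px ?Py"
    unfolding couplings_def mem_Collect_eq
  proof (intro conjI)
    show "prob_space \<xi>" by fact
    show "sets \<xi> = sets (?Px \<Otimes>\<^sub>M ?Py)" unfolding s\<xi> by (rule sets_pair_measure_cong[OF sx sy, symmetric])
    have fm: "fst \<in> \<xi> \<rightarrow>\<^sub>M ?Px" "snd \<in> \<xi> \<rightarrow>\<^sub>M ?Py"
      unfolding measurable_cong_sets[OF s\<xi> sx] measurable_cong_sets[OF s\<xi> sy] by (rule measurable_fst measurable_snd)+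
    show "distr \<xi> ?Px fst = ?Px"
    proof (rule measure_eqI)
      fix A assume "A \<in> sets (distr \<xi> ?Px fst)"
      then have A: "A \<in> sets ?Px" by simp
      then have AS: "A \<in> sets S" using sx by simp
      have "fst -` A \<inter> space \<xi> = A \<times> space S" using sets.sets_into_space[OF AS] by (auto simp: sp\<xi>)
      then show "emeasure (distr \<xi> ?Px fst) A = emeasure ?Px A" using emeasure_distr[OF fm(1) A] marg1[OF AS] by simp
    qed simp
    show "distr \<xi> ?Py snd = ?Py"
    proof (rule measure_eqI)
      fix A assume "A \<in> sets (distr \<xi> ?Py snd)"
      then have A: "A \<in> sets ?Py" by simp
      then have AS: "A \<in> sets S" using sy by simp
      have "snd -` A \<inter> space \<xi> = space S \<times> A" using sets.sets_into_space[OF AS] by (auto simp: sp\<xi>)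
      then show "emeasure (distr \<xi> ?Py snd) A = emeasure ?Py A" using emeasure_distr[OF fm(2) A] marg2[OF AS] by simp
    qed simp
  qed
  moreover have "(\<lambda>n. measure \<xi> {p \<in> space \<xi>. \<forall>k\<ge>n. fst p k = snd p k}) \<longlonglongrightarrow> 1"
  proof -
    define E where "E n = space S \<times> space S - tails_differ n" for n
    have spS: "space S \<times> space S \<in> sets (S \<Otimes>\<^sub>M S)" by auto
    have E: "E n \<in> sets (S \<Otimes>\<^sub>M S)" for n unfolding E_def using spS tails_differ_sets[OF diag] by (rule sets.Diff)
    have Eeq: "{p \<in> space \<xi>. \<forall>k\<ge>n. fst p k = snd p k} = E n" for n
    proof -
      have "(\<lambda>i. \<omega> (i + n)) = (\<lambda>i. \<omega>' (i + n)) \<longleftrightarrow> (\<forall>k\<ge>n. \<omega> k = \<omega>' k)" for \<omega> \<omega>' :: "nat \<Rightarrow> 'a"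
        unfolding fun_eq_iff by (metis le_add2 le_add_diff_inverse2)
      then show ?thesis by (auto simp: E_def tails_differ_def sp\<xi> space_pair_measure)
    qed
    \<comment> \<open>A piece coupled at time \<open>j\<close> has equal tails from \<open>j\<close>
      on, hence from every later time.\<close>
    have full: "measure (c j) (E n) = measure (c j) (space S \<times> space S)" if "j \<le> n" for j n
    proof -
      interpret cj: finite_measure "c j" by (rule finc)
      have "emeasure (c j) (tails_differ n) \<le> emeasure (c j) (tails_differ j)"
        using tails_differ_antimono[OF that] tails_differ_sets[OF diag, of j] by (intro emeasure_mono) (simp_all add: sc)
      also have "\<dots> = 0" using c[of j] by (simp add: coupled_part_def)
      finally have "measure (c j) (tails_differ n) = 0" by (simp add: measure_def)
      moreover have "measure (c j) (E n) = measure (c j) (space S \<times> space S) - measure (c j) (tails_differ n)"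
        unfolding E_def using spS tails_differ_sets[OF diag, of n] sc[of j]
        by (intro cj.finite_measure_Diff) (auto simp: tails_differ_def space_pair_measure)
      ultimately show ?thesis by simp
    qed
    have lower: "1 - measure (a (Suc n)) (space S) \<le> measure \<xi> (E n)" for n
    proof -
      have "1 - measure (a (Suc n)) (space S) = measure (a 0) (space S) - measure (a (Suc n)) (space S)"
        using Px.prob_space by (simp add: ab0 spx)
      also have "\<dots> = (\<Sum>j<Suc n. measure (a j) (space S) - measure (a (Suc j)) (space S))"
        by (rule sum_lessThan_telescope'[symmetric])
      also have "\<dots> = (\<Sum>j<Suc n. measure (c j) (E n))"
        by (intro sum.cong refl) (simp add: full m1[OF sets.top])
      finally have eq: "1 - measure (a (Suc n)) (space S) = (\<Sum>j<Suc n. measure (c j) (E n))" .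
      have "ennreal (1 - measure (a (Suc n)) (space S)) = (\<Sum>j<Suc n. emeasure (c j) (E n))"
        unfolding eq emc by (rule sum_ennreal[symmetric]) simp
      also have "\<dots> \<le> (\<Sum>j. emeasure (c j) (E n))" by (rule sum_le_suminf) auto
      also have "\<dots> = ennreal (measure \<xi> (E n))" using e\<xi>[OF E] by (simp add: \<xi>.emeasure_eq_measure)
      finally show ?thesis by (simp add: ennreal_le_iff)
    qed
    have "(\<lambda>n. 1 - measure (a (Suc n)) (space S)) \<longlonglongrightarrow> 1 - 0"
      by (intro tendsto_intros LIMSEQ_Suc[OF amass])
    then have lim: "(\<lambda>n. 1 - measure (a (Suc n)) (space S)) \<longlonglongrightarrow> 1" by (simp only: diff_zero)
    show ?thesis unfolding Eeq
      by (rule tendsto_sandwich[OF always_eventually[OF allI[OF lower]]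
            always_eventually[OF allI[OF \<xi>.prob_le_1]] lim tendsto_const])
  qed
  ultimately show ?thesis by blast
qed

text \<open>The pairs of paths themselves serve as sample points, with the coordinate processes
  under the coalescing coupling; this fixes the type argument.\<close>

lemma cond_P_imp_C':
  assumes diag: "Id_on (space M) \<in> sets (M \<Otimes>\<^sub>M M)" and B: "borel_space M" and P': "cond_P M P \<mu>"
  shows "cond_C' TYPE((nat \<Rightarrow> 'a) \<times> (nat \<Rightarrow> 'a)) M P"
  unfolding cond_C'_def
proof (intro ballI)
  fix x y assume x: "x \<in> space M" and y: "y \<in> space M"
  obtain \<xi> where \<xi>: "\<xi> \<in> couplings (path_law M P x) (path_law M P y)"
    and lim: "(\<lambda>n. measure \<xi> {p \<in> space \<xi>. \<forall>k\<ge>n. fst p k = snd p k}) \<longlonglongrightarrow> 1"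
    using coalescing_coupling[OF diag B P' x y] by blast
  have ps: "prob_space \<xi>" and s\<xi>: "sets \<xi> = sets (S \<Otimes>\<^sub>M S)"
    using \<xi> sets_pair_measure_cong[OF path_law_props(2)[OF x] path_law_props(2)[OF y]] by (auto simp: couplings_def)
  have m: "(\<lambda>p. fst p k) \<in> \<xi> \<rightarrow>\<^sub>M M" "(\<lambda>p. snd p k) \<in> \<xi> \<rightarrow>\<^sub>M M" for k
    unfolding measurable_cong_sets[OF s\<xi> refl]
    by (rule measurable_compose[OF measurable_fst measurable_component_singleton[OF UNIV_I]]
        measurable_compose[OF measurable_snd measurable_component_singleton[OF UNIV_I]])+
  have d: "distr \<xi> (S \<Otimes>\<^sub>M S) (\<lambda>p. (\<lambda>k. fst p k, \<lambda>k. snd p k)) = \<xi>"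
    by (simp add: distr_id2[OF s\<xi>[symmetric]])
  show "\<exists>(\<Omega> :: ((nat \<Rightarrow> 'a) \<times> (nat \<Rightarrow> 'a)) measure) X Y.
        prob_space \<Omega> \<and> (\<forall>k. X k \<in> \<Omega> \<rightarrow>\<^sub>M M) \<and> (\<forall>k. Y k \<in> \<Omega> \<rightarrow>\<^sub>M M) \<and>
        distr \<Omega> (S \<Otimes>\<^sub>M S) (\<lambda>\<omega>. (\<lambda>k. X k \<omega>, \<lambda>k. Y k \<omega>)) \<in> couplings (path_law M P x) (path_law M P y) \<and>
        (\<lambda>n. measure \<Omega> {\<omega> \<in> space \<Omega>. \<forall>k\<ge>n. X k \<omega> = Y k \<omega>}) \<longlonglongrightarrow> 1"
    by (rule exI[of _ \<xi>], rule exI[of _ "\<lambda>k p. fst p k"], rule exI[of _ "\<lambda>k p. snd p k"],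
        unfold d, intro conjI allI, rule ps, rule m, rule m, rule \<xi>, rule lim)
qed

end

theorem theorem2p16:
  fixes M \<mu> :: "'a measure" and P :: "'a \<Rightarrow> 'a measure"
  assumes "countably_generated M"
    and "Id_on (space M) \<in> sets (M \<Otimes>\<^sub>M M)"
    and "P \<in> M \<rightarrow>\<^sub>M prob_algebra M"
    and "invariant_prob M P \<mu>"
  shows "(cond_A M P \<longleftrightarrow> cond_P M P \<mu>) \<and> (cond_B M P \<mu> \<longleftrightarrow> cond_P M P \<mu>) \<and>
         (cond_C M P \<longleftrightarrow> cond_P M P \<mu>) \<and> (cond_C_hat M P \<longleftrightarrow> cond_P M P \<mu>) \<and>
         (cond_C' TYPE('w) M P \<longrightarrow> cond_C_ring M P) \<and>
         (cond_C_ring M P \<longrightarrow> cond_G M P) \<and>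
         (cond_G M P \<longrightarrow> cond_A M P) \<and>
         (borel_space M \<longrightarrow>
            (cond_A M P \<longleftrightarrow> cond_P M P \<mu>) \<and> (cond_B M P \<mu> \<longleftrightarrow> cond_P M P \<mu>) \<and>
            (cond_C M P \<longleftrightarrow> cond_P M P \<mu>) \<and> (cond_C_hat M P \<longleftrightarrow> cond_P M P \<mu>) \<and>
            (cond_C_ring M P \<longleftrightarrow> cond_P M P \<mu>) \<and>
            (cond_C' TYPE((nat \<Rightarrow> 'a) \<times> (nat \<Rightarrow> 'a)) M P \<longleftrightarrow> cond_P M P \<mu>) \<and>
            (cond_G M P \<longleftrightarrow> cond_P M P \<mu>))"
proof -
  interpret stationary_kernel M P \<mu>
    using assms(4) unfolding invariant_prob_def
    by (intro stationary_kernel.intro cg_markov_kernel.intro markov_kernel.intro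
        cg_markov_kernel_axioms.intro stationary_kernel_axioms.intro assms(1,3)) (elim conjE, assumption)+
  note diag = assms(2)
  have A: "cond_A M P \<longleftrightarrow> cond_P M P \<mu>" using cond_A_imp_P cond_P_imp_A by blast
  have B: "cond_B M P \<mu> \<longleftrightarrow> cond_P M P \<mu>"
    using cond_B_imp_P cond_P_imp_Harris cond_P_imp_aperiodic unfolding cond_B_def by blast
  have C: "cond_C M P \<longleftrightarrow> cond_P M P \<mu>" "cond_C_hat M P \<longleftrightarrow> cond_P M P \<mu>"
    using cond_C_imp_P[OF diag] cond_P_imp_C_hat[OF diag] cond_C_hat_imp_C by blast+
  have C': "cond_C' TYPE('w) M P \<longrightarrow> cond_C_ring M P" using cond_C'_imp_C_ring[OF diag] by blast
  have ring: "cond_C_ring M P \<longrightarrow> cond_G M P" using cond_C_ring_imp_G by blast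
  have G: "cond_G M P \<longrightarrow> cond_A M P" using cond_G_imp_A[OF diag] by blast
  have C'': "cond_C' TYPE((nat \<Rightarrow> 'a) \<times> (nat \<Rightarrow> 'a)) M P \<longrightarrow> cond_C_ring M P" using cond_C'_imp_C_ring[OF diag] by blast
  have "cond_C' TYPE((nat \<Rightarrow> 'a) \<times> (nat \<Rightarrow> 'a)) M P" if "borel_space M" "cond_P M P \<mu>"
    by (rule cond_P_imp_C'[OF diag that])
  then show ?thesis using A B C C' ring G C'' by blast
qed

end
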